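(* Let $n\ge 3$ be odd, let $\alpha\ge (1-n)/2$ be real, let $\lambda\ge 0$, let $\eta=n/2-1$, and let $f\in C^\infty(\mathbb{R}^n)$ be supported in the open unit ball $B=\{x\in\mathbb{R}^n:|x|<1\}$ (so that $\operatorname{supp} f$ is a compact subset of $B$). Let $u(x,t)$, $x\in\mathbb{R}^n$, $t\geq 0$, be the solution of the Cauchy problem $$\Delta_x u-u_{tt}-\frac{n+2\alpha-1}{t}\,u_t=\lambda^2u,\qquad u(x,0)=f(x),\qquad u_t(x,0)=0,$$ namely $u(x,t)=(M^\alpha_{t,\lambda}f)(x)$, and for $\theta\in S^{n-1}$ let $u_\theta(t)=u(\theta,t)$, $t>0$, be its trace on the cylinder $S^{n-1}\times(0,\infty)$. Then $f$ is recovered on $B$ from this trace by $$f(x)=\frac{(-1)^{(n-1)/2}\,\pi}{2\,\Gamma(n/2)\,\Gamma(\alpha+n/2)}\;\Delta\, P\big[D^{n-3}\,t^{n-2}\,I^{-\alpha}_{\eta+\alpha,\lambda}u_\theta\big](x),\qquad x\in B,$$ and consequently the solution $u$ is reconstructed from its trace by inserting this $f$ into $u(x,t)=(M^\alpha_{t,\lambda}f)(x)$.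
   Context: Notation. $D=\frac{1}{2t}\frac{d}{dt}$, and $D^{n-3}t^{n-2}\psi$ means $D$ applied $n-3$ times to the function $t^{n-2}\psi(t)$. $\Delta$ is the Laplacian in $x\in\mathbb{R}^n$. $S^{n-1}$ is the unit sphere in $\mathbb{R}^n$ with unnormalized surface measure $d\theta$ and total area $\sigma_{n-1}=2\pi^{n/2}/\Gamma(n/2)$. Back-projection operator: for a function $F(\theta,t)$ on $S^{n-1}\times(0,\infty)$, $$(PF)(x)=\frac{1}{\sigma_{n-1}}\int_{S^{n-1}}F(\theta,|x-\theta|)\,d\theta .$$ Generalized Erdélyi–Kober operators: for $\operatorname{Re}\beta>0$, $\lambda>0$, and $\psi$ infinitely differentiable on $(0,\infty)$ and vanishing near $0$, $$(I^\beta_\lambda\psi)(t)=2^\beta\lambda^{1-\beta}\int_0^t(t^2-r^2)^{(\beta-1)/2}\,I_{\beta-1}\big(\lambda\sqrt{t^2-r^2}\big)\,\psi(r)\,r\,dr,$$ where $I_\nu$ is the modified Bessel function of the first kind; for $\lambda=0$ the kernel is replaced by its limit as $\lambda\to0$, i.e. $(I^\beta_0\psi)(t)=\frac{2}{\Gamma(\beta)}\int_0^t(t^2-r^2)^{\beta-1}\psi(r)\,r\,dr$. For arbitrary complex $\beta$, $I^\beta_\lambda$ is defined by analytic continuation in $\beta$: $I^\beta_\lambda\psi=D^mI^{\beta+m}_\lambda\psi$ for any nonnegative integer $m$ with $\operatorname{Re}\beta+m>0$. Then $(I^\beta_{\mu,\lambda}\psi)(t)=t^{-2(\beta+\mu)}\,\big(I^\beta_\lambda[r^{2\mu}\psi(r)]\big)(t)$.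 In particular, for any integer $m\geq 0$ with $m>\alpha$, $$I^{-\alpha}_{\eta+\alpha,\lambda}u_\theta(t)=t^{-2\eta}\,D^m\,I^{m-\alpha}_\lambda\big[r^{2(\eta+\alpha)}u_\theta(r)\big](t).$$ The solution operator: for a Schwartz function $f$, $\operatorname{Re}\alpha>0$ and $\lambda>0$, $$(M^\alpha_{t,\lambda}f)(x)=\frac{(2/\lambda)^{\alpha-1}\Gamma(\alpha+n/2)}{\pi^{n/2}}\,t^{2-n-2\alpha}\int_{|y|<t}f(x-y)\,(t^2-|y|^2)^{(\alpha-1)/2}J_{\alpha-1}\big(\lambda\sqrt{t^2-|y|^2}\big)\,dy,$$ where $J_\nu$ is the Bessel function of the first kind; for $\lambda=0$ the kernel is replaced by its limit as $\lambda\to0$, i.e. $(M^\alpha_{t,0}f)(x)=\frac{\Gamma(\alpha+n/2)}{\pi^{n/2}\Gamma(\alpha)}\int_{|y|<1}(1-|y|^2)^{\alpha-1}f(x-ty)\,dy$. For other values of $\alpha$ it is defined by analytic (meromorphic) continuation in $\alpha$. It is a known fact that for $\alpha\ge(1-n)/2$, $\lambda\ge0$ and Schwartz $f$ the Cauchy problem $$\Delta_x u-u_{tt}-\frac{n+2\alpha-1}{t}\,u_t=\lambda^2u,\qquad u(x,0)=f(x),\qquad u_t(x,0)=0,$$ has the unique solution $u(x,t)=(M^\alpha_{t,\lambda}f)(x)$. *)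

theory Defs
  imports "HOL-Analysis.Analysis"
begin

section \<open>Smooth functions and differential operators\<close>

fun k_times_differentiable :: "nat \<Rightarrow> ('a::real_normed_vector \<Rightarrow> 'b::real_normed_vector) \<Rightarrow> bool" where
  "k_times_differentiable 0 f \<longleftrightarrow> continuous_on UNIV f"
| "k_times_differentiable (Suc k) f \<longleftrightarrow>
     f differentiable_on UNIV \<and>
     (\<forall>v. k_times_differentiable k (\<lambda>x. frechet_derivative f (at x) v))"

definition smooth :: "('a::real_normed_vector \<Rightarrow> 'b::real_normed_vector) \<Rightarrow> bool" where
  "smooth f \<longleftrightarrow> (\<forall>k. k_times_differentiable k f)"

definition partial_deriv :: "'n::finite \<Rightarrow> (real ^ 'n \<Rightarrow> complex) \<Rightarrow> real ^ 'n \<Rightarrow> complex" where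
  "partial_deriv i g x = vector_derivative (\<lambda>s. g (x + s *\<^sub>R axis i 1)) (at 0)"

definition laplacian :: "(real ^ 'n \<Rightarrow> complex) \<Rightarrow> real ^ 'n \<Rightarrow> complex" where
  "laplacian g x = (\<Sum>i\<in>UNIV. partial_deriv i (partial_deriv i g) x)"

definition D :: "(real \<Rightarrow> complex) \<Rightarrow> real \<Rightarrow> complex" where
  "D \<psi> t = vector_derivative \<psi> (at t) / of_real (2 * t)"

section \<open>Bessel functions\<close>

text \<open>\<^const>\<open>powr\<close> is the principal branch, and \<^const>\<open>rGamma\<close> is the entire function
  \<open>1 / \<Gamma>\<close>, so that the order may be any complex number.\<close>

definition bessel_J :: "complex \<Rightarrow> complex \<Rightarrow> complex" where
  "bessel_J \<nu> z =
     (z / 2) powr \<nu> * (\<Sum>k. (- 1) ^ k * rGamma (\<nu> + of_nat k + 1) / fact k * (z / 2) ^ (2 * k))"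

definition bessel_I :: "complex \<Rightarrow> complex \<Rightarrow> complex" where
  "bessel_I \<nu> z =
     (z / 2) powr \<nu> * (\<Sum>k. rGamma (\<nu> + of_nat k + 1) / fact k * (z / 2) ^ (2 * k))"

section \<open>Surface measure on the unit sphere and back-projection\<close>

text \<open>The unnormalized surface measure of \<open>A \<subseteq> S\<^sup>n\<^sup>-\<^sup>1\<close> is \<open>n\<close> times the volume of the cone
  \<open>{r\<theta> | \<theta> \<in> A, 0 < r < 1}\<close>, and \<^term>\<open>sgn y\<close> is \<open>y / \<bar>y\<bar>\<close>.\<close>

definition sphere_measure :: "(real ^ 'n) measure" where
  "sphere_measure =
     scale_measure (of_nat CARD('n))
       (distr (restrict_space lborel (ball 0 1 - {0})) (restrict_space borel (sphere 0 1)) sgn)"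

definition sphere_area :: "nat \<Rightarrow> real" where
  "sphere_area n = 2 * pi powr (real n / 2) / Gamma (real n / 2)"

definition back_projection ::
    "(real ^ 'n \<Rightarrow> real \<Rightarrow> complex) \<Rightarrow> real ^ 'n \<Rightarrow> complex" where
  "back_projection F x =
     (LINT \<theta>|sphere_measure. F \<theta> (norm (x - \<theta>))) / of_real (sphere_area CARD('n))"

section \<open>Generalized Erdelyi--Kober operators\<close>

definition EK_integral :: "complex \<Rightarrow> real \<Rightarrow> (real \<Rightarrow> complex) \<Rightarrow> real \<Rightarrow> complex" where
  "EK_integral \<beta> lam \<psi> t =
     (if lam = 0
      then 2 / Gamma \<beta> *
        (LINT r:{0<..<t}|lborel. of_real (t\<^sup>2 - r\<^sup>2) powr (\<beta> - 1) * \<psi> r * of_real r)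
      else 2 powr \<beta> * of_real lam powr (1 - \<beta>) *
        (LINT r:{0<..<t}|lborel. of_real (t\<^sup>2 - r\<^sup>2) powr ((\<beta> - 1) / 2) *
           bessel_I (\<beta> - 1) (of_real (lam * sqrt (t\<^sup>2 - r\<^sup>2))) * \<psi> r * of_real r))"

text \<open>The continuation \<open>I\<^sup>\<beta> = D\<^sup>m I\<^sup>\<beta>\<^sup>+\<^sup>m\<close> does not depend on the choice of \<open>m\<close> with
  \<open>Re \<beta> + m > 0\<close>; the least one is taken, which is \<open>0\<close> when \<open>Re \<beta> > 0\<close>.\<close>

definition EK :: "complex \<Rightarrow> real \<Rightarrow> (real \<Rightarrow> complex) \<Rightarrow> real \<Rightarrow> complex" where
  "EK \<beta> lam \<psi> =
     (let m = (LEAST m::nat. Re \<beta> + real m > 0)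
      in (D ^^ m) (EK_integral (\<beta> + of_nat m) lam \<psi>))"

definition EK_weighted ::
    "complex \<Rightarrow> complex \<Rightarrow> real \<Rightarrow> (real \<Rightarrow> complex) \<Rightarrow> real \<Rightarrow> complex" where
  "EK_weighted \<beta> \<mu> lam \<psi> t =
     of_real t powr (- 2 * (\<beta> + \<mu>)) * EK \<beta> lam (\<lambda>r. of_real r powr (2 * \<mu>) * \<psi> r) t"

section \<open>The solution operator of the Cauchy problem\<close>

text \<open>\<open>u(x,t) = solution_operator \<alpha> lam t f x\<close> is the solution, for \<open>t > 0\<close>, of
  \<open>\<Delta>u - u\<^sub>t\<^sub>t - ((n + 2\<alpha> - 1) / t) u\<^sub>t = lam\<^sup>2 u\<close>, \<open>u(x,0) = f(x)\<close>, \<open>u\<^sub>t(x,0) = 0\<close>.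
  The integral below represents it when \<open>Re \<alpha> > 0\<close>.\<close>

definition solution_integral ::
    "complex \<Rightarrow> real \<Rightarrow> real \<Rightarrow> (real ^ 'n \<Rightarrow> complex) \<Rightarrow> real ^ 'n \<Rightarrow> complex" where
  "solution_integral \<alpha> lam t f x =
     (let n = CARD('n) in
      if lam = 0
      then Gamma (\<alpha> + of_nat n / 2) / (of_real (pi powr (real n / 2)) * Gamma \<alpha>) *
        (LINT y:ball 0 1|lborel. of_real (1 - (norm y)\<^sup>2) powr (\<alpha> - 1) * f (x - t *\<^sub>R y))
      else of_real (2 / lam) powr (\<alpha> - 1) * Gamma (\<alpha> + of_nat n / 2) / of_real (pi powr (real n / 2)) *
        of_real t powr (2 - of_nat n - 2 * \<alpha>) *
        (LINT y:ball 0 t|lborel. f (x - y) * of_real (t\<^sup>2 - (norm y)\<^sup>2) powr ((\<alpha> - 1) / 2) *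
           bessel_J (\<alpha> - 1) (of_real (lam * sqrt (t\<^sup>2 - (norm y)\<^sup>2)))))"

definition analytic_continuation ::
    "complex set \<Rightarrow> complex set \<Rightarrow> (complex \<Rightarrow> complex) \<Rightarrow> complex \<Rightarrow> complex" where
  "analytic_continuation U V F z =
     (THE w. \<exists>g. g holomorphic_on V \<and> (\<forall>s\<in>U. g s = F s) \<and> g z = w)"

text \<open>For other \<open>\<alpha>\<close> the integral is continued to the complement of the poles of
  \<open>\<Gamma>(\<alpha> + n/2)\<close>. This is a connected open set, so the continuation is unique.\<close>

definition solution_operator ::
    "complex \<Rightarrow> real \<Rightarrow> real \<Rightarrow> (real ^ 'n \<Rightarrow> complex) \<Rightarrow> real ^ 'n \<Rightarrow> complex" where
  "solution_operator \<alpha> lam t f x =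
     (if Re \<alpha> > 0 then solution_integral \<alpha> lam t f x
      else analytic_continuation {s. Re s > 0} {s. s + of_nat CARD('n) / 2 \<notin> \<int>\<^sub>\<le>\<^sub>0}
             (\<lambda>s. solution_integral s lam t f x) \<alpha>)"

end

theory Submission
  imports Defs "HOL-Complex_Analysis.Complex_Analysis" "HOL-Real_Asymp.Real_Asymp"
begin

text \<open>In the variable \<open>s = r\<^sup>2\<close> the trace \<open>u\<^sub>\<theta>\<close> is, up to a power of \<open>t\<close>, a Riemann-Liouville type
  integral with Bessel kernel of the weighted spherical means of \<open>f\<close> about \<open>\<theta>\<close>. The Erdelyi-Kober operator
  with the opposite order and the modified Bessel kernel inverts it: the two kernels convolve to a pure power
  kernel, because the generating series of their coefficients are \<open>exp (- c I)\<close> and \<open>exp (c I)\<close>. Negative orders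
  are reached by repeated integration by parts, which also identifies the analytic continuation. For odd \<open>n\<close>
  the back-projection of the \<open>(n - 3)\<close>-fold derivative is a multiple of the Newtonian potential of \<open>f\<close>, whose
  Laplacian gives back \<open>f\<close>. To see this without distributions, the derivative is realised as the limit of
  \<open>(n - 1)\<close>-fold finite differences in \<open>b\<close> of the mean of \<open>f\<close> against the ramp
  \<open>max 0 (b + |x - \<theta>|\<^sup>2 - |y - \<theta>|\<^sup>2)\<close>; integrating the ramp over \<open>\<theta>\<close> first gives a moment of the
  projected surface measure \<open>(1 - v\<^sup>2)\<^bsup>(n-3)/2\<^esup> dv\<close>, a polynomial in \<open>b\<close> for small \<open>b\<close> exactly because \<open>n\<close> is odd.\<close>

text \<open>Let \<rho> < 1 bound the support of f. A sphere of radius below 1 - \<rho> about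
  \<theta>, |\<theta>| = 1, misses the support, so the weighted spherical mean vanishes near s = 0
  with all its derivatives. Hence no integration by parts leaves a boundary term at 0, and
  primitives of every order again vanish there. The ramp is the kernel of double integration in s,
  so the (n - 3)-fold D becomes an (n - 1)-fold derivative in b. The obstacle is to carry that
  derivative under the integral over y: the \<theta>-integral of the ramp is a polynomial in b only
  while |b + |x|^2 - |y|^2| <= 2 |x - y|. If |x|, |y| <= \<rho> (enlarge \<rho> to include x), then
  ||x|^2 - |y|^2| <= 2 \<rho> |x - y|, which leaves room 2 (1 - \<rho>) |x - y| around b = 0. This
  is where the open ball enters, and the room shrinks as y approaches x. Finite differences cope
  with that: once the step is small compared with |x - y| they equal the derivative, a constant
  times |x - y|^(2 - n), and before that they are bounded by the same power through scaling.\<close>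

section \<open>Differentiation and holomorphy under the integral sign\<close>

text \<open>Dominated convergence is sequential, so the remainder is tested along sequences. The
  mean value inequality on the ball bounds the increment of \<open>F\<close> by \<open>B w\<close>
  times the displacement, hence the normalised remainder by \<open>2 * B w\<close>.\<close>

lemma has_derivative_integral_dominated:
  fixes F :: "'a::real_normed_vector \<Rightarrow> 'b \<Rightarrow> 'c::{banach,second_countable_topology}"
  assumes e: "e > 0"
    and int: "\<And>x. x \<in> ball x0 e \<Longrightarrow> integrable M (F x)"
    and der: "\<And>x w. x \<in> ball x0 e \<Longrightarrow> w \<in> space M \<Longrightarrow> ((\<lambda>x. F x w) has_derivative F' x w) (at x)"
    and bd: "\<And>x w. x \<in> ball x0 e \<Longrightarrow> w \<in> space M \<Longrightarrow> onorm (F' x w) \<le> B w"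
    and B: "integrable M B"
    and lin: "bounded_linear (\<lambda>h. \<integral>w. F' x0 w h \<partial>M)"
    and meas: "\<And>h. (\<lambda>w. F' x0 w h) \<in> borel_measurable M"
  shows "((\<lambda>x. \<integral>w. F x w \<partial>M) has_derivative (\<lambda>h. \<integral>w. F' x0 w h \<partial>M)) (at x0)"
proof -
  have x0: "x0 \<in> ball x0 e" using e by simp
  have bl: "bounded_linear (F' x w)" if "x \<in> ball x0 e" "w \<in> space M" for x w
    using der[OF that] by (rule has_derivative_bounded_linear)
  have F'le: "norm (F' x0 w h) \<le> B w * norm h" if "w \<in> space M" for w h
  proof -
    have "norm (F' x0 w h) \<le> onorm (F' x0 w) * norm h"
      using bl[OF x0 that] by (rule onorm)
    also have "\<dots> \<le> B w * norm h"
      by (rule mult_right_mono) (use bd[OF x0 that] in auto)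
    finally show ?thesis .
  qed
  have F'int: "integrable M (\<lambda>w. F' x0 w h)" for h
    by (rule Bochner_Integration.integrable_bound[of M "\<lambda>w. B w * norm h"])
      (use B meas F'le in \<open>auto intro!: AE_I2 order_trans[OF F'le] abs_ge_self\<close>)
  have "((\<lambda>h. norm ((\<integral>w. F (x0 + h) w \<partial>M) - (\<integral>w. F x0 w \<partial>M) - (\<integral>w. F' x0 w h \<partial>M)) / norm h) \<longlongrightarrow> 0) (at 0)"
    unfolding tendsto_at_iff_sequentially o_def
  proof (intro allI impI)
    fix X :: "nat \<Rightarrow> 'a"
    assume X0: "\<forall>i. X i \<in> UNIV - {0}" and X: "X \<longlonglongrightarrow> 0"
    then have "eventually (\<lambda>i. dist (X i) 0 < e) sequentially"
      using e tendstoD by blast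
    then obtain N where N: "\<And>i. i \<ge> N \<Longrightarrow> norm (X i) < e"
      by (auto simp: eventually_sequentially)
    define Y where "Y i = X (i + N)" for i
    have Y0: "Y i \<noteq> 0" for i using X0 by (auto simp: Y_def)
    have Y: "Y \<longlonglongrightarrow> 0" unfolding Y_def using LIMSEQ_ignore_initial_segment[OF X] .
    have Yb: "x0 + Y i \<in> ball x0 e" for i
      using N[of "i + N"] by (simp add: Y_def dist_norm)
    define q where "q i w = (F (x0 + Y i) w - F x0 w - F' x0 w (Y i)) /\<^sub>R norm (Y i)" for i w
    have qint: "integrable M (q i)" for i
      unfolding q_def using int[OF Yb] int[OF x0] F'int by auto
    have lim: "(\<lambda>i. q i w) \<longlonglongrightarrow> 0" if w: "w \<in> space M" for w
    proof -
      have "((\<lambda>h. norm (F (x0 + h) w - F x0 w - F' x0 w h) / norm h) \<longlongrightarrow> 0) (at 0)"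
        using der[OF x0 w] unfolding has_derivative_at by blast
      then have "(\<lambda>i. norm (F (x0 + Y i) w - F x0 w - F' x0 w (Y i)) / norm (Y i)) \<longlonglongrightarrow> 0"
        unfolding tendsto_at_iff_sequentially o_def using Y Y0 by auto
      then have "(\<lambda>i. norm (q i w)) \<longlonglongrightarrow> 0"
        by (simp add: q_def divide_inverse mult.commute)
      then show ?thesis by (rule tendsto_norm_zero_cancel)
    qed
    have le: "norm (q i w) \<le> 2 * B w" if w: "w \<in> space M" for i w
    proof -
      have "norm (F (x0 + Y i) w - F x0 w) \<le> B w * norm (x0 + Y i - x0)"
        by (rule differentiable_bound[of "ball x0 e" _ "\<lambda>x. F' x w"])
          (use der[OF _ w] bd[OF _ w] x0 Yb in \<open>auto intro: has_derivative_at_withinI\<close>)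
      then have "norm (F (x0 + Y i) w - F x0 w - F' x0 w (Y i)) \<le> 2 * B w * norm (Y i)"
        using F'le[OF w, of "Y i"] norm_triangle_ineq4[of "F (x0 + Y i) w - F x0 w" "F' x0 w (Y i)"] by simp
      then have "norm (F (x0 + Y i) w - F x0 w - F' x0 w (Y i)) / norm (Y i) \<le> 2 * B w"
        using Y0[of i] by (simp add: pos_divide_le_eq)
      then show ?thesis by (simp add: q_def divide_inverse mult.commute)
    qed
    have "(\<lambda>i. \<integral>w. q i w \<partial>M) \<longlonglongrightarrow> (\<integral>w. 0 \<partial>M)"
      by (rule integral_dominated_convergence[where w="\<lambda>w. 2 * B w"])
        (use lim le qint B in \<open>auto intro!: AE_I2\<close>)
    moreover have "(\<integral>w. q i w \<partial>M) = ((\<integral>w. F (x0 + Y i) w \<partial>M) - (\<integral>w. F x0 w \<partial>M) - (\<integral>w. F' x0 w (Y i) \<partial>M)) /\<^sub>R norm (Y i)" for i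
      unfolding q_def using int[OF Yb] int[OF x0] F'int by (simp)
    ultimately have "(\<lambda>i. ((\<integral>w. F (x0 + Y i) w \<partial>M) - (\<integral>w. F x0 w \<partial>M) - (\<integral>w. F' x0 w (Y i) \<partial>M)) /\<^sub>R norm (Y i)) \<longlonglongrightarrow> 0"
      by simp
    from tendsto_norm[OF this]
    have "(\<lambda>i. norm ((\<integral>w. F (x0 + X (i+N)) w \<partial>M) - (\<integral>w. F x0 w \<partial>M) - (\<integral>w. F' x0 w (X (i+N)) \<partial>M)) / norm (X (i+N))) \<longlonglongrightarrow> 0"
      by (simp add: Y_def divide_inverse mult.commute)
    then show "(\<lambda>i. norm ((\<integral>w. F (x0 + X i) w \<partial>M) - (\<integral>w. F x0 w \<partial>M) - (\<integral>w. F' x0 w (X i) \<partial>M)) / norm (X i)) \<longlonglongrightarrow> 0"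
      by (rule LIMSEQ_offset)
  qed
  then show ?thesis using lin by (simp add: has_derivative_at)
qed

lemma has_vector_derivative_integral_dominated:
  fixes F :: "real \<Rightarrow> 'b \<Rightarrow> 'c::{banach,second_countable_topology}"
  assumes e: "e > 0"
    and int: "\<And>x. x \<in> ball x0 e \<Longrightarrow> integrable M (F x)"
    and der: "\<And>x w. x \<in> ball x0 e \<Longrightarrow> w \<in> space M \<Longrightarrow> ((\<lambda>x. F x w) has_vector_derivative F' x w) (at x)"
    and bd: "\<And>x w. x \<in> ball x0 e \<Longrightarrow> w \<in> space M \<Longrightarrow> norm (F' x w) \<le> B w"
    and B: "integrable M B"
    and meas: "F' x0 \<in> borel_measurable M"
  shows "((\<lambda>x. \<integral>w. F x w \<partial>M) has_vector_derivative (\<integral>w. F' x0 w \<partial>M)) (at x0)"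
proof -
  have on: "onorm (\<lambda>h. h *\<^sub>R v) \<le> norm v" for v :: 'c
    by (rule onorm_le) (simp add: mult.commute)
  have "((\<lambda>x. \<integral>w. F x w \<partial>M) has_derivative (\<lambda>h. \<integral>w. h *\<^sub>R F' x0 w \<partial>M)) (at x0)"
    by (rule has_derivative_integral_dominated[where e=e and B=B and F'="\<lambda>x w h. h *\<^sub>R F' x w"])
      (use assms in \<open>auto simp: has_vector_derivative_def intro: order_trans[OF on] bounded_linear_scaleR_left\<close>)
  then show ?thesis by (simp add: has_vector_derivative_def)
qed

text \<open>No bound on the derivative is assumed: Cauchy's estimate turns a local majorant
  \<open>B\<close> of \<open>F\<close> into the majorant \<open>B * 4 / e\<close> of its complex
  derivative, and differentiation under the integral applies.\<close>

lemma holomorphic_on_integral_dominated: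
  fixes F :: "complex \<Rightarrow> 'b \<Rightarrow> complex"
  assumes U: "open U"
    and int: "\<And>z. z \<in> U \<Longrightarrow> integrable M (F z)"
    and hol: "\<And>w. w \<in> space M \<Longrightarrow> (\<lambda>z. F z w) holomorphic_on U"
    and dom: "\<And>z. z \<in> U \<Longrightarrow> \<exists>e>0. \<exists>B. integrable M B \<and> (\<forall>y\<in>ball z e. \<forall>w\<in>space M. norm (F y w) \<le> B w)"
  shows "(\<lambda>z. \<integral>w. F z w \<partial>M) holomorphic_on U"
  unfolding holomorphic_on_def
proof
  fix z0 assume z0: "z0 \<in> U"
  obtain e1 B where e1: "e1 > 0" and B: "integrable M B"
    and Bb: "\<And>y w. y \<in> ball z0 e1 \<Longrightarrow> w \<in> space M \<Longrightarrow> norm (F y w) \<le> B w"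
    using dom[OF z0] by blast
  obtain e2 where e2: "e2 > 0" "ball z0 e2 \<subseteq> U" using U z0 open_contains_ball by blast
  define e where "e = min e1 e2"
  have e: "e > 0" and eU: "ball z0 e \<subseteq> U" and eb: "ball z0 e \<subseteq> ball z0 e1"
    using e1 e2 by (auto simp: e_def)
  have zz: "z \<in> ball z0 e" if "z \<in> ball z0 (e/2)" for z using that e by auto
  have der: "((\<lambda>z. F z w) has_field_derivative deriv (\<lambda>z. F z w) z) (at z)" if "z \<in> ball z0 e" "w \<in> space M" for z w
    using holomorphic_derivI[OF hol[OF that(2)] U] eU that by auto
  \<comment> \<open>For z within e/2 of the centre, the circle of radius e/4 about z stays inside
    the ball on which \<open>B\<close> is a majorant.\<close>
  have bd: "norm (deriv (\<lambda>z. F z w) z) \<le> B w * 4 / e" if z: "z \<in> ball z0 (e/2)" and w: "w \<in> space M" for z w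
  proof -
    have sub: "cball z (e/4) \<subseteq> ball z0 e"
    proof
      fix y assume "y \<in> cball z (e/4)"
      then show "y \<in> ball z0 e" using z e dist_triangle[of z0 y z] by auto
    qed
    have "norm ((deriv ^^ 1) (\<lambda>z. F z w) z) \<le> fact 1 * B w / (e/4)^1"
    proof (rule Cauchy_inequality)
      have h: "(\<lambda>z. F z w) holomorphic_on cball z (e/4)"
        using hol[OF w] sub eU by (meson holomorphic_on_subset order_trans)
      then show "(\<lambda>z. F z w) holomorphic_on ball z (e/4)"
        by (rule holomorphic_on_subset) auto
      show "continuous_on (cball z (e/4)) (\<lambda>z. F z w)" using h by (rule holomorphic_on_imp_continuous_on)
      show "e/4 > 0" using e by simp
      fix y assume "norm (z - y) = e/4"
      then have "y \<in> ball z0 e1" using sub eb by (auto simp: dist_norm subset_iff)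
      then show "norm (F y w) \<le> B w" using Bb w by blast
    qed
    then show ?thesis by (simp add: field_simps)
  qed
  \<comment> \<open>The derivative is a pointwise limit of difference quotients, which are
    measurable. The shift by 2 in \<open>e / (real i + 2)\<close> keeps every increment below
    \<open>e\<close>.\<close>
  have meas: "(\<lambda>w. deriv (\<lambda>z. F z w) z0) \<in> borel_measurable M"
  proof (rule borel_measurable_LIMSEQ_metric)
    define h where "h i = complex_of_real (e / (real i + 2))" for i
    have hU: "z0 + h i \<in> U" for i
    proof -
      have "e / (real i + 2) < e" using e by (simp add: divide_simps)
      then have "z0 + h i \<in> ball z0 e" using e by (simp add: h_def dist_norm del: of_real_divide)
      then show ?thesis using eU by blast
    qed
    show "(\<lambda>w. (F (z0 + h i) w - F z0 w) / h i) \<in> borel_measurable M" for i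
      using int[OF hU[of i]] int[OF z0] by (auto dest!: borel_measurable_integrable)
    fix w assume w: "w \<in> space M"
    have "((\<lambda>h. (F (z0 + h) w - F z0 w) / h) \<longlongrightarrow> deriv (\<lambda>z. F z w) z0) (at 0)"
      using der[of z0 w] e w unfolding DERIV_def by simp
    moreover have "h \<longlonglongrightarrow> 0"
    proof -
      have "(\<lambda>i. e / (real i + 2)) \<longlonglongrightarrow> 0" by real_asymp
      then show ?thesis unfolding h_def using tendsto_of_real[of _ 0] by (metis (full_types) of_real_0 tendsto_of_real)
    qed
    moreover have "h i \<noteq> 0" for i 
    proof -
      have "real i + 2 \<noteq> 0" by linarith
      then show ?thesis unfolding h_def using e by (simp del: of_real_divide)
    qed
    ultimately show "(\<lambda>i. (F (z0 + h i) w - F z0 w) / h i) \<longlonglongrightarrow> deriv (\<lambda>z. F z w) z0"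
      unfolding tendsto_at_iff_sequentially o_def by auto
  qed
  have on: "onorm (\<lambda>h. v * h) \<le> norm v" for v :: complex
    by (rule onorm_le) (simp add: norm_mult)
  have "((\<lambda>x. \<integral>w. F x w \<partial>M) has_derivative (\<lambda>h. \<integral>w. deriv (\<lambda>z. F z w) z0 * h \<partial>M)) (at z0)"
  proof (rule has_derivative_integral_dominated[where e="e/2" and B="\<lambda>w. B w * 4 / e" and F'="\<lambda>z w h. deriv (\<lambda>z. F z w) z * h"])
    show "integrable M (F x)" if "x \<in> ball z0 (e/2)" for x using that eU zz int by blast
    show "((\<lambda>x. F x w) has_derivative times (deriv (\<lambda>z. F z w) x)) (at x)"
      if "x \<in> ball z0 (e / 2)" "w \<in> space M" for x w
      using der[OF zz[OF that(1)] that(2)] by (simp add: has_field_derivative_def)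
    show "onorm (times (deriv (\<lambda>z. F z w) x)) \<le> B w * 4 / e"
      if "x \<in> ball z0 (e / 2)" "w \<in> space M" for x w
      using order_trans[OF on bd[OF that]] .
    show "bounded_linear (\<lambda>h. \<integral>w. deriv (\<lambda>z. F z w) z0 * h \<partial>M)"
      by (simp add: bounded_linear_mult_right)
  qed (use e B meas in auto)
  then show "(\<lambda>z. \<integral>w. F z w \<partial>M) field_differentiable at z0 within U"
    unfolding field_differentiable_def has_field_derivative_def 
    by (intro exI[of _ "\<integral>w. deriv (\<lambda>z. F z w) z0 \<partial>M"]) (simp add: has_derivative_at_withinI)
qed

text \<open>In the variable t^2 the operator \<open>D\<close> is plain differentiation. A chain in
  which each function has 2t times the next one as derivative therefore lists all powers of
  \<open>D\<close>; agreement on the open half-line is enough because differentiation is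
  local.\<close>

lemma D_funpow_eq:
  assumes chain: "\<And>j t. j < k \<Longrightarrow> t > 0 \<Longrightarrow> (\<phi> j has_vector_derivative of_real (2 * t) * \<phi> (Suc j) t) (at t)"
    and 0: "\<And>t. t > 0 \<Longrightarrow> \<psi> t = \<phi> 0 t" and t: "t > 0"
  shows "(D ^^ k) \<psi> t = \<phi> k t"
  using chain t
proof (induction k arbitrary: t)
  case 0
  then show ?case using assms(2) by simp
next
  case (Suc k)
  have IH: "(D ^^ k) \<psi> s = \<phi> k s" if "s > 0" for s using Suc that by simp
  have "((D ^^ k) \<psi> has_vector_derivative of_real (2 * t) * \<phi> (Suc k) t) (at t)"
    by (rule has_vector_derivative_transform_within_open[of "\<phi> k" _ _ "{0<..}"])
      (use Suc.prems IH in auto)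
  then have "vector_derivative ((D ^^ k) \<psi>) (at t) = of_real (2 * t) * \<phi> (Suc k) t"
    by (rule vector_derivative_at)
  then have "D ((D ^^ k) \<psi>) t = \<phi> (Suc k) t"
    using Suc.prems(2) by (simp add: D_def)
  then show ?case by simp
qed

lemma set_integrable_powr_diff:
  fixes a T :: real
  assumes a: "a > 0"
  shows "set_integrable lborel {0<..<T} (\<lambda>s. (T - s) powr (a - 1))"
    and "T \<ge> 0 \<Longrightarrow> (LINT s:{0<..<T}|lborel. (T - s) powr (a - 1)) = T powr a / a"
proof -
  have *: "set_integrable lborel {0<..<T} (\<lambda>s. (T - s) powr (a - 1)) \<and>
     (LINT s:{0<..<T}|lborel. (T - s) powr (a - 1)) = T powr a / a" if T: "T \<ge> 0"
  proof -
    have "((\<lambda>x. x powr (a - 1)) has_integral (T powr a / a)) {0..T}"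
      using has_integral_powr_from_0[of "a-1" T] a T by simp
    then have "(\<integral>\<^sup>+x. ennreal (indicator {0..T} x * x powr (a-1)) \<partial>lborel) = ennreal (T powr a / a)"
      by (intro nn_integral_has_integral_lebesgue) auto
    then have "(\<integral>\<^sup>+x. ennreal (indicator {0..T} (T - x) * (T - x) powr (a-1)) \<partial>lborel) = ennreal (T powr a / a)"
      by (subst (asm) nn_integral_real_affine[where c="-1" and t=T]) auto
    moreover have "(\<integral>\<^sup>+x. ennreal (indicator {0..T} (T - x) * (T - x) powr (a-1)) \<partial>lborel) 
        = (\<integral>\<^sup>+x. ennreal (indicator {0<..<T} x * (T - x) powr (a-1)) \<partial>lborel)"
      by (rule nn_integral_cong_AE) (use AE_lborel_singleton[of 0] AE_lborel_singleton[of T] in 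
         \<open>eventually_elim, auto simp: indicator_def\<close>)
    ultimately have "(\<integral>\<^sup>+x. ennreal (indicator {0<..<T} x * (T - x) powr (a-1)) \<partial>lborel) = ennreal (T powr a / a)"
      by simp
    then have "integrable lborel (\<lambda>x. indicator {0<..<T} x * (T - x) powr (a-1)) \<and>
        integral\<^sup>L lborel (\<lambda>x. indicator {0<..<T} x * (T - x) powr (a-1)) = T powr a / a"
      by (subst (asm) nn_integral_eq_integrable) (use a in auto)
    then show ?thesis by (simp add: set_integrable_def set_lebesgue_integral_def)
  qed
  show "set_integrable lborel {0<..<T} (\<lambda>s. (T - s) powr (a - 1))"
    using * by (cases "T \<ge> 0") (auto simp: set_integrable_def)
  show "T \<ge> 0 \<Longrightarrow> (LINT s:{0<..<T}|lborel. (T - s) powr (a - 1)) = T powr a / a"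
    using * by blast
qed

lemma norm_of_real_powr: "w > 0 \<Longrightarrow> norm (complex_of_real w powr z) = w powr Re z"
  by (simp add: norm_powr_real_powr)

section \<open>Fractional integrals with a Bessel kernel\<close>

text \<open>The Riemann-Liouville fractional integral I^q with base point 0. Writing the
  normalisation with the entire function \<open>rGamma\<close> makes holomorphy in \<open>q\<close>
  a matter of the integral alone.\<close>

definition RL :: "complex \<Rightarrow> (real \<Rightarrow> complex) \<Rightarrow> real \<Rightarrow> complex" where
  "RL q h T = rGamma q * (LINT s:{0<..<T}|lborel. of_real (T - s) powr (q - 1) * h s)"

lemma
  assumes q: "Re q > 0" and h: "h \<in> borel_measurable borel"
    and hB: "\<And>s. 0 < s \<Longrightarrow> s < T \<Longrightarrow> norm (h s) \<le> B" and T: "T > 0"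
  shows RL_integrable: "set_integrable lborel {0<..<T} (\<lambda>s. of_real (T - s) powr (q - 1) * h s)"
    and RL_norm_integral_le: "(LINT s:{0<..<T}|lborel. norm (of_real (T - s) powr (q - 1) * h s)) \<le> B * T powr Re q / Re q"
    and norm_RL_le: "norm (RL q h T) \<le> norm (rGamma q) * (B * T powr Re q / Re q)"
proof -
  have meas: "(\<lambda>s. indicator {0<..<T} s *\<^sub>R (of_real (T - s) powr (q - 1) * h s)) \<in> borel_measurable lborel"
    using h by measurable
  have i: "set_integrable lborel {0<..<T} (\<lambda>s. B * (T - s) powr (Re q - 1))"
    using set_integrable_powr_diff(1)[OF q] by simp
  have le: "norm (of_real (T - s) powr (q - 1) * h s) \<le> B * (T - s) powr (Re q - 1)" if "s \<in> {0<..<T}" for s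
    using that hB[of s] by (simp add: norm_mult norm_of_real_powr mult.commute mult_right_mono flip: of_real_diff)
  show 1: "set_integrable lborel {0<..<T} (\<lambda>s. of_real (T - s) powr (q - 1) * h s)"
    unfolding set_integrable_def
    by (rule Bochner_Integration.integrable_bound[OF i[unfolded set_integrable_def] meas])
      (use le in \<open>auto simp: indicator_def simp del: of_real_diff intro!: AE_I2 order_trans[OF le abs_ge_self]\<close>)
  have "(LINT s:{0<..<T}|lborel. norm (of_real (T - s) powr (q - 1) * h s)) \<le> (LINT s:{0<..<T}|lborel. B * (T - s) powr (Re q - 1))"
    by (rule set_integral_mono[OF set_integrable_norm[OF 1] i]) (use le in auto)
  also have "\<dots> = B * (T powr Re q / Re q)"
    using set_integrable_powr_diff(2)[OF q, of T] T by simp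
  finally show 2: "(LINT s:{0<..<T}|lborel. norm (of_real (T - s) powr (q - 1) * h s)) \<le> B * T powr Re q / Re q"
    by simp
  have "norm (LINT s:{0<..<T}|lborel. of_real (T - s) powr (q - 1) * h s) \<le> B * T powr Re q / Re q"
    using order_trans[OF set_integral_norm_bound[OF 1] 2] .
  then show "norm (RL q h T) \<le> norm (rGamma q) * (B * T powr Re q / Re q)"
    unfolding RL_def norm_mult by (rule mult_left_mono) simp
qed

text \<open>Since 1/Gamma(w) = w / Gamma(w + 1) and |w| >= 1 once Re w >= 1, the moduli decrease
  from k = 1 onwards; only the first step can increase them.\<close>

lemma norm_rGamma_add_nat_le:
  assumes p: "Re p > 0"
  shows "norm (rGamma (p + of_nat k)) \<le> max (norm (rGamma p)) (norm (rGamma (p + 1)))"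
proof (induction k)
  case (Suc k)
  show ?case
  proof (cases "k = 0")
    case False
    have "1 \<le> Re (p + of_nat k)" using False p by simp
    then have 1: "1 \<le> norm (p + of_nat k)" using complex_Re_le_cmod order_trans by blast
    have "norm (rGamma (p + of_nat k)) = norm (p + of_nat k) * norm (rGamma (p + of_nat k + 1))"
      by (metis norm_mult rGamma_plus1)
    then have "norm (rGamma (p + of_nat (Suc k))) \<le> norm (rGamma (p + of_nat k))"
      using mult_right_mono[OF 1, of "norm (rGamma (p + of_nat k + 1))"] by (simp add: ac_simps)
    then show ?thesis using Suc by linarith
  qed (simp)
qed simp

text \<open>The operator I^p exp(c I), with I the integration from 0, expanded in powers of
  I.\<close>

definition RL_exp :: "complex \<Rightarrow> real \<Rightarrow> (real \<Rightarrow> complex) \<Rightarrow> real \<Rightarrow> complex" where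
  "RL_exp p c h T = (\<Sum>k. of_real (c ^ k / fact k) * RL (p + of_nat k) h T)"

text \<open>The convolution kernel of \<open>RL_exp\<close>. Up to elementary factors it is a Bessel
  function of order p - 1: J when c is negative, I when c is positive.\<close>

definition RL_kernel :: "complex \<Rightarrow> real \<Rightarrow> real \<Rightarrow> complex" where
  "RL_kernel p c w = of_real w powr (p - 1) * (\<Sum>k. rGamma (p + of_nat k) / fact k * of_real (c * w) ^ k)"

lemma summable_exp_real: "summable (\<lambda>k. x ^ k / fact k :: real)"
  using summable_exp[of x] by (simp add: field_simps)

lemma powr_add_nat: "w > 0 \<Longrightarrow> of_real w powr (p + of_nat k - 1) = of_real w powr (p - 1) * (of_real w :: complex) ^ k"
  using powr_add[of "of_real w :: complex" "p - 1" "of_nat k"] by (simp add: algebra_simps)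

text \<open>One majorant serves all three claims: the k-th term is at most a constant times (|c|
  T)^k / k!, because the factors 1/Gamma(p + k) stay bounded and each further order contributes a
  factor T.\<close>

lemma
  assumes p: "Re p > 0" and h: "h \<in> borel_measurable borel"
    and hB: "\<And>s. 0 < s \<Longrightarrow> s < T \<Longrightarrow> norm (h s) \<le> B" and T: "T > 0"
  shows RL_exp_summable: "summable (\<lambda>k. norm (of_real (c ^ k / fact k) * RL (p + of_nat k) h T))"
    and RL_exp_eq_integral: "RL_exp p c h T = (LINT s:{0<..<T}|lborel. RL_kernel p c (T - s) * h s)"
    and RL_kernel_integrable: "set_integrable lborel {0<..<T} (\<lambda>s. RL_kernel p c (T - s) * h s)"
proof -
  define G where "G = max (norm (rGamma p)) (norm (rGamma (p + 1)))"
  have G: "norm (rGamma (p + of_nat k)) \<le> G" for k unfolding G_def by (rule norm_rGamma_add_nat_le[OF p])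
  have G0: "G \<ge> 0" using order_trans[OF norm_ge_zero G] .
  have B0: "B \<ge> 0" using order_trans[OF norm_ge_zero hB[of "T/2"]] T by simp
  have pk: "Re (p + of_nat k) > 0" for k using p by simp
  have r: "B * T powr Re (p + of_nat k) / Re (p + of_nat k) \<le> B * T powr Re p / Re p * T ^ k" for k
  proof -
    have "T powr Re (p + of_nat k) = T powr Re p * T ^ k" using T by (simp add: powr_add powr_realpow)
    moreover have "B * (T powr Re p * T ^ k) / Re (p + of_nat k) \<le> B * (T powr Re p * T ^ k) / Re p"
      using p B0 T by (intro divide_left_mono) auto
    ultimately show ?thesis by (simp add: mult.assoc)
  qed
  have bnd: "norm (rGamma (p + of_nat k)) * (B * T powr Re (p + of_nat k) / Re (p + of_nat k)) \<le> G * (B * T powr Re p / Re p * T ^ k)" for k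
    by (rule mult_mono[OF G r G0]) (use B0 p in auto)
  have sm: "summable (\<lambda>k. \<bar>c\<bar> ^ k / fact k * (G * (B * T powr Re p / Re p * T ^ k)))"
    using summable_mult[OF summable_exp_real[of "\<bar>c\<bar> * T"], of "G * (B * T powr Re p / Re p)"]
    by (simp add: power_mult_distrib mult_ac)
  show "summable (\<lambda>k. norm (of_real (c ^ k / fact k) * RL (p + of_nat k) h T))"
  proof (rule summable_comparison_test'[OF sm])
    fix k :: nat
    show "norm (norm (of_real (c ^ k / fact k) * RL (p + of_nat k) h T)) \<le> \<bar>c\<bar> ^ k / fact k * (G * (B * T powr Re p / Re p * T ^ k))"
      using mult_left_mono[OF order_trans[OF norm_RL_le[OF pk h hB T] bnd, of k], of "\<bar>c\<bar> ^ k / fact k"]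
      by (simp add: norm_mult power_abs norm_divide norm_power)
  qed
  define f where "f k s = indicator {0<..<T} s *\<^sub>R (of_real (c ^ k / fact k) * (rGamma (p + of_nat k) * (of_real (T - s) powr (p + of_nat k - 1) * h s)))" for k s
  have fi: "integrable lborel (f k)" for k
    using set_integrable_mult_right[OF RL_integrable[OF pk h hB T], of "of_real (c ^ k / fact k) * rGamma (p + of_nat k)"]
    unfolding f_def set_integrable_def by (simp add: mult.assoc)
  have f_int: "integral\<^sup>L lborel (f k) = of_real (c ^ k / fact k) * RL (p + of_nat k) h T" for k
    unfolding f_def RL_def set_lebesgue_integral_def by (simp add: mult_ac flip: integral_mult_right_zero)
  have fn: "(\<integral>s. norm (f k s) \<partial>lborel) \<le> \<bar>c\<bar> ^ k / fact k * (G * (B * T powr Re p / Re p * T ^ k))" for k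
  proof -
    have "(\<integral>s. norm (f k s) \<partial>lborel) = \<bar>c\<bar> ^ k / fact k * (norm (rGamma (p + of_nat k)) * (LINT s:{0<..<T}|lborel. norm (of_real (T - s) powr (p + of_nat k - 1) * h s)))"
      unfolding f_def set_lebesgue_integral_def
      by (simp add: norm_mult norm_divide norm_power power_abs mult_ac flip: integral_mult_right_zero)
    also have "\<dots> \<le> \<bar>c\<bar> ^ k / fact k * (norm (rGamma (p + of_nat k)) * (B * T powr Re (p + of_nat k) / Re (p + of_nat k)))"
      by (intro mult_left_mono RL_norm_integral_le[OF pk h hB T]) auto
    also have "\<dots> \<le> \<bar>c\<bar> ^ k / fact k * (G * (B * T powr Re p / Re p * T ^ k))"
      by (intro mult_left_mono bnd) auto
    finally show ?thesis .
  qed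
  have s2: "summable (\<lambda>k. \<integral>s. norm (f k s) \<partial>lborel)"
    by (rule summable_comparison_test'[OF sm]) (use fn in auto)
  have feq: "f k s = (indicator {0<..<T} s * (of_real (T - s) powr (p - 1) * h s)) * (rGamma (p + of_nat k) / fact k * of_real (c * (T - s)) ^ k)" for k s
    unfolding f_def using powr_add_nat[of "T - s" p k] 
    by (auto simp: indicator_def power_mult_distrib simp del: of_real_diff)
  have sk: "summable (\<lambda>k. norm (rGamma (p + of_nat k) / fact k * of_real w ^ k))" for w
  proof (rule summable_comparison_test'[OF summable_mult[OF summable_exp_real[of "\<bar>w\<bar>"], of G]])
    fix k :: nat
    show "norm (norm (rGamma (p + of_nat k) / fact k * of_real w ^ k)) \<le> G * (\<bar>w\<bar> ^ k / fact k)"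
      using G[of k] by (simp add: norm_mult norm_divide norm_power power_abs divide_right_mono mult_right_mono)
  qed
  have s1: "summable (\<lambda>k. norm (f k s))" for s
    unfolding feq norm_mult[of "_ * (_ * _)"] by (rule summable_mult[OF sk])
  have ker: "(\<Sum>k. f k s) = indicator {0<..<T} s *\<^sub>R (RL_kernel p c (T - s) * h s)" for s
    unfolding feq by (subst suminf_mult[OF summable_norm_cancel[OF sk]]) (auto simp: RL_kernel_def indicator_def)
  show "RL_exp p c h T = (LINT s:{0<..<T}|lborel. RL_kernel p c (T - s) * h s)"
    unfolding RL_exp_def set_lebesgue_integral_def ker[symmetric]
    by (subst integral_suminf[OF fi _ s2]) (use s1 in \<open>auto simp: f_int\<close>)
  show "set_integrable lborel {0<..<T} (\<lambda>s. RL_kernel p c (T - s) * h s)"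
    unfolding set_integrable_def ker[symmetric]
    by (rule integrable_suminf[OF fi _ s2]) (use s1 in auto)
qed

section \<open>The substitution s = r^2 and the Bessel kernels\<close>

text \<open>The substitution is proved as an identity of measures, so that it applies to complex
  integrands that are merely measurable and may be singular at the endpoint, as the fractional
  kernels are.\<close>

lemma distr_square:
  assumes t: "t > 0"
  shows "distr (density lborel (\<lambda>r. ennreal (indicator {0<..<t} r * (2 * r)))) borel (\<lambda>r. r\<^sup>2) = density lborel (indicator {0<..<t\<^sup>2})"
proof (rule measure_eqI)
  fix A assume "A \<in> sets (distr (density lborel (\<lambda>r. ennreal (indicator {0<..<t} r * (2 * r)))) borel (\<lambda>r. r\<^sup>2))"
  then have [measurable]: "A \<in> sets borel" by simp
  have "emeasure (distr (density lborel (\<lambda>r. ennreal (indicator {0<..<t} r * (2 * r)))) borel (\<lambda>r. r\<^sup>2)) A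
     = (\<integral>\<^sup>+r. ennreal (indicator {0<..<t} r * (2 * r)) * indicator ((\<lambda>r. r\<^sup>2) -` A) r \<partial>lborel)"
    by (subst emeasure_distr, simp, simp) (subst emeasure_density, auto intro!: measurable_sets_borel[of _ borel])
  also have "\<dots> = (\<integral>\<^sup>+r. ennreal (indicator A (r\<^sup>2) * (2 * r) * indicator {0..t} r) \<partial>lborel)"
    by (rule nn_integral_cong_AE) (use AE_lborel_singleton[of 0] AE_lborel_singleton[of t] in 
         \<open>eventually_elim, auto simp: indicator_def\<close>)
  also have "\<dots> = (\<integral>\<^sup>+r. ennreal (indicator A r * indicator {0\<^sup>2..t\<^sup>2} r) \<partial>lborel)"
    by (rule nn_integral_substitution[where g'="\<lambda>r. 2 * r", symmetric])
      (use t in \<open>auto intro!: derivative_eq_intros continuous_intros simp: set_borel_measurable_def\<close>)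
  also have "\<dots> = (\<integral>\<^sup>+r. indicator {0<..<t\<^sup>2} r * indicator A r \<partial>lborel)"
    by (rule nn_integral_cong_AE) (use AE_lborel_singleton[of 0] AE_lborel_singleton[of "t\<^sup>2"] in 
         \<open>eventually_elim, auto simp: indicator_def\<close>)
  also have "\<dots> = emeasure (density lborel (indicator {0<..<t\<^sup>2})) A"
    by (subst emeasure_density) auto
  finally show "emeasure (distr (density lborel (\<lambda>r. ennreal (indicator {0<..<t} r * (2 * r)))) borel (\<lambda>r. r\<^sup>2)) A = emeasure (density lborel (indicator {0<..<t\<^sup>2})) A" .
qed simp

lemma set_integral_square:
  fixes F :: "real \<Rightarrow> complex"
  assumes t: "t > 0" and F: "set_borel_measurable borel {0<..<t\<^sup>2} F"
  shows "(LINT r:{0<..<t}|lborel. F (r\<^sup>2) * of_real (2 * r)) = (LINT s:{0<..<t\<^sup>2}|lborel. F s)"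
proof -
  let ?F = "\<lambda>s. indicator {0<..<t\<^sup>2} s *\<^sub>R F s"
  have M[measurable]: "?F \<in> borel_measurable borel" using F by (simp add: set_borel_measurable_def)
  have "(LINT s:{0<..<t\<^sup>2}|lborel. F s) = (LINT s|density lborel (\<lambda>s. ennreal (indicator {0<..<t\<^sup>2} s)). ?F s)"
    by (subst integral_density) (auto simp: set_lebesgue_integral_def simp flip: indicator_inter_arith)
  also have "density lborel (\<lambda>s. ennreal (indicator {0<..<t\<^sup>2} s)) = density lborel (indicator {0<..<t\<^sup>2})"
    by (intro density_cong) (auto simp: indicator_def)
  also have "(LINT s|\<dots>. ?F s) = (LINT r|density lborel (\<lambda>r. ennreal (indicator {0<..<t} r * (2 * r))). ?F (r\<^sup>2))"
    unfolding distr_square[OF t, symmetric] by (rule integral_distr) (use M in auto)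
  also have "\<dots> = (LINT r|lborel. (indicator {0<..<t} r * (2 * r)) *\<^sub>R ?F (r\<^sup>2))"
  proof (rule integral_density)
    show "(\<lambda>r. ?F (r\<^sup>2)) \<in> borel_measurable lborel" by (rule measurable_compose[OF _ M]) simp
  qed (auto intro!: AE_I2 simp: indicator_def)
  also have "\<dots> = (LINT r:{0<..<t}|lborel. F (r\<^sup>2) * of_real (2 * r))"
    unfolding set_lebesgue_integral_def
    by (intro Bochner_Integration.integral_cong refl) (auto simp: indicator_def scaleR_conv_of_real power_strict_mono)
  finally show ?thesis by simp
qed

lemma of_real_powr_pos: "x > 0 \<Longrightarrow> of_real x powr (z::complex) = exp (z * of_real (ln x))"
  by (simp add: powr_def Ln_of_real)

text \<open>All bases are positive reals, so principal powers behave like real ones and the claim is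
  an identity between logarithms.\<close>

lemma bessel_factor:
  fixes z :: complex
  assumes l: "l > 0" and w: "w > 0"
  shows "of_real (2 / l) powr z * (of_real w powr (z / 2) * (of_real (l * sqrt w) / 2) powr z) = of_real w powr z"
proof -
  have 1: "of_real (l * sqrt w) / 2 = (of_real (l * sqrt w / 2) :: complex)" by simp
  have L1: "ln (l * sqrt w / 2) = ln l + ln w / 2 - ln 2"
    using l w by (simp add: ln_mult ln_div ln_sqrt)
  have L2: "ln (2 / l) = ln 2 - ln l" using l by (simp add: ln_div)
  have "z * of_real (ln (2 / l)) + (z / 2 * of_real (ln w) + z * of_real (ln (l * sqrt w / 2))) = z * of_real (ln w)"
    unfolding L1 L2 by (simp add: algebra_simps)
  then show ?thesis
    unfolding 1 using l w
    by (subst (1 2 3 4) of_real_powr_pos) (simp_all add: exp_add[symmetric])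
qed

text \<open>Because (l sqrt w / 2)^2 = l^2 w / 4, the Bessel series is a power series in w; its
  alternating signs go into the negative parameter -l^2 / 4.\<close>

lemma bessel_J_RL_kernel:
  assumes l: "l > 0" and w: "w > 0"
  shows "of_real (2 / l) powr (p - 1) * (of_real w powr ((p - 1) / 2) * bessel_J (p - 1) (of_real (l * sqrt w))) = RL_kernel p (- (l\<^sup>2 / 4)) w"
proof -
  have "(of_real (l * sqrt w) / 2 :: complex) ^ (2 * k) = of_real (l\<^sup>2 / 4 * w) ^ k" for k
    unfolding power_mult using w by (simp add: power_divide power_mult_distrib flip: of_real_power)
  then have "(\<lambda>k. (- 1) ^ k * rGamma (p - 1 + of_nat k + 1) / fact k * (of_real (l * sqrt w) / 2) ^ (2 * k))
     = (\<lambda>k. rGamma (p + of_nat k) / fact k * of_real (- (l\<^sup>2 / 4) * w) ^ k)"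
    by (intro ext) (simp add: power_minus[of "_ * _ / _"] power_minus[of "_ / _"] mult_ac)
  moreover have "X * (W * (L * S)) = Z * S" if "X * (W * L) = Z" for X W L S Z :: complex
    using that by (auto simp: mult_ac)
  ultimately show ?thesis
    unfolding bessel_J_def RL_kernel_def using bessel_factor[OF l w] by presburger
qed

text \<open>The same computation without signs. The factor 2 on the right is kept for the Jacobian 2
  r of s = r^2.\<close>

lemma bessel_I_RL_kernel:
  assumes l: "l > 0" and w: "w > 0"
  shows "2 powr p * of_real l powr (1 - p) * (of_real w powr ((p - 1) / 2) * bessel_I (p - 1) (of_real (l * sqrt w))) = 2 * RL_kernel p (l\<^sup>2 / 4) w"
proof -
  have "(of_real (l * sqrt w) / 2 :: complex) ^ (2 * k) = of_real (l\<^sup>2 / 4 * w) ^ k" for k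
    unfolding power_mult using w by (simp add: power_divide power_mult_distrib flip: of_real_power)
  then have 1: "(\<lambda>k. rGamma (p - 1 + of_nat k + 1) / fact k * (of_real (l * sqrt w) / 2) ^ (2 * k))
     = (\<lambda>k. rGamma (p + of_nat k) / fact k * of_real (l\<^sup>2 / 4 * w) ^ k)"
    by (intro ext) (simp add: algebra_simps)
  have L2: "ln (2 / l) = ln 2 - ln l" using l by (simp add: ln_div)
  have "p * of_real (ln 2) + (1 - p) * of_real (ln l) = of_real (ln 2) + (p - 1) * of_real (ln (2 / l))"
    unfolding L2 by (simp add: algebra_simps)
  moreover have "exp (of_real (ln 2)) = (2::complex)" by (subst exp_of_real) simp
  ultimately have 2: "2 powr p * of_real l powr (1 - p) = 2 * of_real (2 / l) powr (p - 1)"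
    using l of_real_powr_pos[of 2 p] of_real_powr_pos[of l "1 - p"] of_real_powr_pos[of "2/l" "p - 1"]
    by (metis divide_pos_pos exp_add of_real_numeral zero_less_numeral)
  have 3: "2 * X * (W * (L * S)) = 2 * (Z * S)" if "X * (W * L) = Z" for X W L S Z :: complex
    using that by (auto simp: mult_ac)
  show ?thesis
    unfolding 2 bessel_I_def RL_kernel_def 1 by (rule 3[OF bessel_factor[OF l w]])
qed

lemma RL_kernel_0: "RL_kernel p 0 w = of_real w powr (p - 1) * rGamma p"
proof -
  have "(\<Sum>k. rGamma (p + of_nat k) / fact k * 0 ^ k) = rGamma (p + of_nat 0) / fact 0 * 0 ^ 0"
    by (rule suminf_finite[of "{0}", simplified]) auto
  then show ?thesis by (simp add: RL_kernel_def)
qed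

text \<open>For \<open>lam = 0\<close> the parameter c is 0 and only the first term of the kernel
  series survives, so the separately defined limit case is an instance of the same formula.\<close>

lemma EK_integral_eq_RL_exp:
  assumes p: "Re p > 0" and h: "(\<lambda>s. \<psi> (sqrt s)) \<in> borel_measurable borel"
    and hB: "\<And>s. 0 < s \<Longrightarrow> s < t\<^sup>2 \<Longrightarrow> norm (\<psi> (sqrt s)) \<le> B" and t: "t > 0" and lam: "lam \<ge> 0"
  shows "EK_integral p lam \<psi> t = RL_exp p (lam\<^sup>2 / 4) (\<lambda>s. \<psi> (sqrt s)) (t\<^sup>2)"
proof -
  let ?c = "lam\<^sup>2 / 4"
  have t2: "t\<^sup>2 > 0" using t by simp
  have "RL_exp p ?c (\<lambda>s. \<psi> (sqrt s)) (t\<^sup>2) = (LINT s:{0<..<t\<^sup>2}|lborel. RL_kernel p ?c (t\<^sup>2 - s) * \<psi> (sqrt s))"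
    by (rule RL_exp_eq_integral[OF p h hB t2])
  also have "\<dots> = (LINT r:{0<..<t}|lborel. RL_kernel p ?c (t\<^sup>2 - r\<^sup>2) * \<psi> (sqrt (r\<^sup>2)) * of_real (2 * r))"
    by (rule set_integral_square[OF t, symmetric])
      (use RL_kernel_integrable[OF p h hB t2, of ?c] in \<open>auto simp: set_integrable_def set_borel_measurable_def dest!: borel_measurable_integrable\<close>)
  finally have R: "RL_exp p ?c (\<lambda>s. \<psi> (sqrt s)) (t\<^sup>2) = (LINT r:{0<..<t}|lborel. RL_kernel p ?c (t\<^sup>2 - r\<^sup>2) * \<psi> (sqrt (r\<^sup>2)) * of_real (2 * r))" .
  show ?thesis
  proof (cases "lam = 0")
    case True
    have "EK_integral p lam \<psi> t = (LINT r:{0<..<t}|lborel. 2 / Gamma p * (of_real (t\<^sup>2 - r\<^sup>2) powr (p - 1) * \<psi> r * of_real r))"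
      using True by (simp add: EK_integral_def)
    also have "\<dots> = (LINT r:{0<..<t}|lborel. RL_kernel p ?c (t\<^sup>2 - r\<^sup>2) * \<psi> (sqrt (r\<^sup>2)) * of_real (2 * r))"
      by (rule set_lebesgue_integral_cong) (auto simp: True RL_kernel_0 Gamma_def field_simps)
    finally show ?thesis using R by simp
  next
    case False
    then have l: "lam > 0" using lam by simp
    have "EK_integral p lam \<psi> t = (LINT r:{0<..<t}|lborel. 2 powr p * of_real lam powr (1 - p) * (of_real (t\<^sup>2 - r\<^sup>2) powr ((p - 1) / 2) *
           bessel_I (p - 1) (of_real (lam * sqrt (t\<^sup>2 - r\<^sup>2))) * \<psi> r * of_real r))"
      using False by (simp add: EK_integral_def)
    also have "\<dots> = (LINT r:{0<..<t}|lborel. RL_kernel p ?c (t\<^sup>2 - r\<^sup>2) * \<psi> (sqrt (r\<^sup>2)) * of_real (2 * r))"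
    proof (rule set_lebesgue_integral_cong)
      show "\<forall>r. r \<in> {0<..<t} \<longrightarrow> 2 powr p * of_real lam powr (1 - p) * (of_real (t\<^sup>2 - r\<^sup>2) powr ((p - 1) / 2) *
           bessel_I (p - 1) (of_real (lam * sqrt (t\<^sup>2 - r\<^sup>2))) * \<psi> r * of_real r) = RL_kernel p ?c (t\<^sup>2 - r\<^sup>2) * \<psi> (sqrt (r\<^sup>2)) * of_real (2 * r)"
      proof (intro allI impI)
        fix r assume r: "r \<in> {0<..<t}"
        then have w: "t\<^sup>2 - r\<^sup>2 > 0" by (simp add: power_strict_mono)
        from bessel_I_RL_kernel[OF l w, of p] r
        show "2 powr p * of_real lam powr (1 - p) * (of_real (t\<^sup>2 - r\<^sup>2) powr ((p - 1) / 2) *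
           bessel_I (p - 1) (of_real (lam * sqrt (t\<^sup>2 - r\<^sup>2))) * \<psi> r * of_real r) = RL_kernel p ?c (t\<^sup>2 - r\<^sup>2) * \<psi> (sqrt (r\<^sup>2)) * of_real (2 * r)"
          unfolding of_real_mult[of 2 r] by (simp add: mult.assoc[symmetric] del: of_real_diff of_real_mult of_real_power)
      qed
    qed simp
    finally show ?thesis using R by simp
  qed
qed

lemma continuous_on_Icc_bounded:
  fixes f :: "real \<Rightarrow> 'a::real_normed_vector"
  assumes "continuous_on {a..b} f"
  shows "\<exists>B. \<forall>s\<in>{a..b}. norm (f s) \<le> B"
  using compact_imp_bounded[OF compact_continuous_image[OF assms compact_Icc]] by (simp add: bounded_iff)

text \<open>Integration by parts; the factor q that appears is absorbed by 1/Gamma(q) = q / Gamma(q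
  + 1).\<close>

lemma RL_eq_RL_deriv:
  assumes q: "Re q > 0" and T: "T > 0"
    and h: "\<And>s. (h has_vector_derivative h' s) (at s)" and h': "continuous_on UNIV h'" and h0: "h 0 = 0"
  shows "RL q h T = RL (q + 1) h' T"
proof -
  have hc: "continuous_on UNIV h" using h by (meson continuous_at_imp_continuous_on has_vector_derivative_continuous)
  obtain B where B: "\<And>s. s \<in> {0..T} \<Longrightarrow> norm (h s) \<le> B"
    using continuous_on_Icc_bounded[OF continuous_on_subset[OF hc subset_UNIV]] by blast
  obtain B' where B': "\<And>s. s \<in> {0..T} \<Longrightarrow> norm (h' s) \<le> B'"
    using continuous_on_Icc_bounded[OF continuous_on_subset[OF h' subset_UNIV]] by blast
  have i1: "set_integrable lborel {0<..<T} (\<lambda>s. of_real (T - s) powr (q - 1) * h s)"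
    by (rule RL_integrable[OF q borel_measurable_continuous_onI[OF hc] B T]) auto
  have i2: "set_integrable lborel {0<..<T} (\<lambda>s. of_real (T - s) powr q * h' s)"
    using RL_integrable[OF _ borel_measurable_continuous_onI[OF h'] B' T, of "q+1"] q by auto
  \<comment> \<open>The boundary values of \<open>F\<close> vanish, at T because Re q > 0 and at 0
    because h(0) = 0. For small Re q the derivative \<open>F'\<close> can be singular at T, hence
    the fundamental theorem with differentiability only in the interior.\<close>
  define F where "F s = of_real (T - s) powr q * h s" for s
  define F' where "F' s = of_real (T - s) powr q * h' s - q * (of_real (T - s) powr (q - 1) * h s)" for s
  have der: "(F has_vector_derivative F' s) (at s)" if "s \<in> {0<..<T}" for s
  proof -
    have "((\<lambda>z. (of_real T - z) powr q) has_field_derivative (- q * (of_real T - of_real s) powr (q - 1))) (at (of_real s))"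
      using that by (auto intro!: derivative_eq_intros simp: complex_nonpos_Reals_iff simp flip: of_real_diff)
    from has_vector_derivative_real_field[OF this, of UNIV]
    have "((\<lambda>s. of_real (T - s) powr q) has_vector_derivative (- q * of_real (T - s) powr (q - 1))) (at s)"
      by simp
    from has_vector_derivative_mult[OF this h]
    show ?thesis unfolding F_def F'_def by (simp add: algebra_simps)
  qed
  have cont: "continuous_on {0..T} F"
    unfolding F_def by (intro continuous_intros continuous_on_subset[OF hc]) (use q in auto)
  have "(F' has_integral (F T - F 0)) {0..T}"
    by (rule fundamental_theorem_of_calculus_interior) (use T der cont in auto)
  moreover have "F T = 0" "F 0 = 0" using h0 q by (auto simp: F_def)
  ultimately have "integral {0<..<T} F' = 0" 
    using has_integral_Icc_iff_Ioo[of F' 0 0 T] by (auto simp: integral_unique)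
  moreover have F'i: "set_integrable lborel {0<..<T} F'"
    unfolding F'_def by (intro set_integral_diff i2 set_integrable_mult_right i1)
  ultimately have "(LINT s:{0<..<T}|lborel. F' s) = 0"
    using set_borel_integral_eq_integral(2)[OF F'i] by simp
  then have "(LINT s:{0<..<T}|lborel. of_real (T - s) powr q * h' s) = q * (LINT s:{0<..<T}|lborel. of_real (T - s) powr (q - 1) * h s)"
    unfolding F'_def by (subst (asm) set_integral_diff(2)[OF i2 set_integrable_mult_right[OF i1]]) auto
  then show ?thesis by (simp add: RL_def rGamma_plus1[of q, symmetric])
qed

lemma RL_1_deriv:
  assumes T: "T > 0"
    and h: "\<And>s. (h has_vector_derivative h' s) (at s)" and h': "continuous_on UNIV h'" and h0: "h 0 = 0"
  shows "RL 1 h' T = h T"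
proof -
  obtain B' where B': "\<And>s. s \<in> {0..T} \<Longrightarrow> norm (h' s) \<le> B'"
    using continuous_on_Icc_bounded[OF continuous_on_subset[OF h' subset_UNIV]] by blast
  have i2: "set_integrable lborel {0<..<T} (\<lambda>s. of_real (T - s) powr 0 * h' s)"
    using RL_integrable[OF _ borel_measurable_continuous_onI[OF h'] B' T, of 1] by auto
  then have i3: "set_integrable lborel {0<..<T} h'"
    by (rule set_integrable_cong[THEN iffD1, rotated -1]) auto
  have "(h' has_integral (h T - h 0)) {0..T}"
    by (rule fundamental_theorem_of_calculus) (use T h in \<open>auto intro: has_vector_derivative_at_within\<close>)
  then have "integral {0<..<T} h' = h T"
    using has_integral_Icc_iff_Ioo[of h' "h T - h 0" 0 T] h0 by (auto simp: integral_unique)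
  then have "(LINT s:{0<..<T}|lborel. h' s) = h T"
    using set_borel_integral_eq_integral(2)[OF i3] by simp
  moreover have "(LINT s:{0<..<T}|lborel. of_real (T - s) powr 0 * h' s) = (LINT s:{0<..<T}|lborel. h' s)"
    by (rule set_lebesgue_integral_cong) auto
  ultimately show ?thesis by (simp add: RL_def)
qed

lemma RL_holomorphic:
  assumes h: "h \<in> borel_measurable borel"
    and hB: "\<And>s. 0 < s \<Longrightarrow> s < T \<Longrightarrow> norm (h s) \<le> B" and T: "T > 0"
  shows "(\<lambda>q. RL q h T) holomorphic_on {q. Re q > 0}"
  unfolding RL_def set_lebesgue_integral_def
proof (rule holomorphic_on_mult[OF holomorphic_rGamma holomorphic_on_integral_dominated])
  show "open {q. Re q > 0}" by (simp add: open_halfspace_Re_gt)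
  show "integrable lborel (\<lambda>s. indicator {0<..<T} s *\<^sub>R (of_real (T - s) powr (q - 1) * h s))" if "q \<in> {q. Re q > 0}" for q
    using RL_integrable[OF _ h hB T, of q] that by (simp add: set_integrable_def)
  show "(\<lambda>q. indicator {0<..<T} s *\<^sub>R (of_real (T - s) powr (q - 1) * h s)) holomorphic_on {q. Re q > 0}" for s
    unfolding scaleR_conv_of_real by (cases "s \<in> {0<..<T}") (auto intro!: holomorphic_intros)
  fix q assume q: "q \<in> {q. Re q > 0}"
  \<comment> \<open>On the disc of radius Re q / 2 the real part of the order lies between a and 3a.
    A power with an exponent in between is at most the sum of the two extreme powers, whether its
    base is below or above 1.\<close>
  define a where "a = Re q / 2"
  have a: "a > 0" using q by (simp add: a_def)
  define D where "D s = indicator {0<..<T} s *\<^sub>R (((T - s) powr (a - 1) + (T - s) powr (3 * a - 1)) * B)" for s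
  have "integrable lborel D"
    unfolding D_def set_integrable_def[symmetric]
    by (intro set_integrable_mult_left set_integral_add set_integrable_powr_diff(1)) (use a in auto)
  moreover have "norm (indicator {0<..<T} s *\<^sub>R (of_real (T - s) powr (y - 1) * h s)) \<le> D s" if y: "y \<in> ball q a" for y s
  proof (cases "s \<in> {0<..<T}")
    case True
    have "\<bar>Re (q - y)\<bar> \<le> norm (q - y)" by (rule abs_Re_le_cmod)
    then have r: "a \<le> Re y" "Re y \<le> 3 * a" using y by (auto simp: dist_norm a_def)
    have w: "T - s > 0" using True by simp
    have "(T - s) powr (Re y - 1) \<le> (T - s) powr (a - 1) + (T - s) powr (3 * a - 1)"
    proof (cases "T - s \<le> 1")
      case True
      then have "(T - s) powr (Re y - 1) \<le> (T - s) powr (a - 1)" using r w by (intro powr_mono') auto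
      then show ?thesis by (simp add: add_increasing2)
    next
      case False
      then have "(T - s) powr (Re y - 1) \<le> (T - s) powr (3 * a - 1)" using r w by (intro powr_mono) auto
      then show ?thesis by (simp add: add_increasing)
    qed
    then have "(T - s) powr (Re y - 1) * norm (h s) \<le> ((T - s) powr (a - 1) + (T - s) powr (3 * a - 1)) * B"
      by (rule mult_mono) (use hB[of s] True in auto)
    then show ?thesis using True norm_of_real_powr[OF w, of "y - 1"] by (simp add: D_def norm_mult)
  qed (simp add: D_def)
  ultimately show "\<exists>e>0. \<exists>B. integrable lborel B \<and> (\<forall>y\<in>ball q e. \<forall>s\<in>space lborel. norm (indicator {0<..<T} s *\<^sub>R (of_real (T - s) powr (y - 1) * h s)) \<le> B s)"
    using a by (intro exI[of _ a] exI[of _ D] conjI) auto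
qed

lemma borel_measurable_RL [measurable]:
  assumes [measurable]: "h \<in> borel_measurable borel"
  shows "RL q h \<in> borel_measurable borel"
proof -
  have "RL q h = (\<lambda>T. rGamma q * (\<integral>s. (if 0 < s \<and> s < T then of_real (T - s) powr (q - 1) * h s else 0) \<partial>lborel))"
    unfolding RL_def set_lebesgue_integral_def
    by (intro ext arg_cong2[where f="times"] Bochner_Integration.integral_cong) (auto simp: indicator_def)
  moreover have "(\<lambda>T. rGamma q * (\<integral>s. (if 0 < s \<and> s < T then of_real (T - s) powr (q - 1) * h s else 0) \<partial>lborel)) \<in> borel_measurable borel"
    by measurable
  ultimately show ?thesis by simp
qed

lemma borel_measurable_RL_exp [measurable]:
  assumes [measurable]: "h \<in> borel_measurable borel"
  shows "RL_exp p c h \<in> borel_measurable borel"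
  unfolding RL_exp_def by measurable

lemma RL_cong: "(\<And>s. 0 < s \<Longrightarrow> s < T \<Longrightarrow> h s = h' s) \<Longrightarrow> RL q h T = RL q h' T"
  unfolding RL_def by (intro arg_cong2[where f="times"] set_lebesgue_integral_cong) auto

lemma RL_exp_cong: "(\<And>s. 0 < s \<Longrightarrow> s < T \<Longrightarrow> h s = h' s) \<Longrightarrow> RL_exp p c h T = RL_exp p c h' T"
  unfolding RL_exp_def using RL_cong[of T h h'] by simp

lemma RL_cmult: "RL q (\<lambda>s. C * h s) T = C * RL q h T"
  unfolding RL_def set_lebesgue_integral_def by (simp add: mult.left_commute flip: integral_mult_right_zero)

text \<open>The bound has the form K T^k uniformly in S <= T: after division by k! it is summable,
  and as a majorant on the whole interval it lets a further fractional integral pass through the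
  series.\<close>

lemma norm_RL_add_nat_le:
  assumes p: "Re p > 0" and h: "h \<in> borel_measurable borel"
    and hB: "\<And>s. 0 < s \<Longrightarrow> s < T \<Longrightarrow> norm (h s) \<le> B" and S: "0 < S" "S \<le> T"
  shows "norm (RL (p + of_nat k) h S) \<le> max (norm (rGamma p)) (norm (rGamma (p + 1))) * (B * T powr Re p / Re p) * T ^ k"
proof -
  have B0: "B \<ge> 0" using order_trans[OF norm_ge_zero hB[of "T/2"]] S by simp
  have pk: "Re (p + of_nat k) > 0" using p by simp
  have T: "T > 0" using S by simp
  have "S powr Re (p + of_nat k) = S powr Re p * S ^ k" using S by (simp add: powr_add powr_realpow)
  also have "\<dots> \<le> T powr Re p * T ^ k"
    using S p by (intro mult_mono powr_mono2 power_mono) auto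
  finally have "B * S powr Re (p + of_nat k) / Re (p + of_nat k) \<le> B * (T powr Re p * T ^ k) / Re p"
    using p B0 T by (intro frac_le mult_left_mono) auto
  then have 1: "B * S powr Re (p + of_nat k) / Re (p + of_nat k) \<le> B * T powr Re p / Re p * T ^ k"
    by (simp add: mult.assoc)
  have "norm (RL (p + of_nat k) h S) \<le> norm (rGamma (p + of_nat k)) * (B * S powr Re (p + of_nat k) / Re (p + of_nat k))"
    by (rule norm_RL_le[OF pk h _ S(1)]) (use hB S in auto)
  also have "\<dots> \<le> max (norm (rGamma p)) (norm (rGamma (p + 1))) * (B * T powr Re p / Re p * T ^ k)"
    by (rule mult_mono[OF norm_rGamma_add_nat_le[OF p] 1]) (use B0 p in \<open>auto simp: le_max_iff_disj\<close>)
  finally show ?thesis by (simp add: mult.assoc)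
qed

lemma RL_exp_cmult:
  assumes p: "Re p > 0" and h: "h \<in> borel_measurable borel"
    and hB: "\<And>s. 0 < s \<Longrightarrow> s < T \<Longrightarrow> norm (h s) \<le> B" and T: "T > 0"
  shows "RL_exp p c (\<lambda>s. C * h s) T = C * RL_exp p c h T"
  unfolding RL_exp_def RL_cmult
  using suminf_mult[OF summable_norm_cancel[OF RL_exp_summable[OF p h hB T, of c]], of C] by (simp add: mult.left_commute)

section \<open>The semigroup law and the inversion of exp(-c I)\<close>

text \<open>The affine map t to s + (T - s) t carries the Beta integral on the unit interval to this
  one; the two powers give (T - s)^(p + q - 2) and the Jacobian one more factor.\<close>

lemma has_bochner_integral_beta_convolution:
  fixes p q s T :: real
  assumes p: "p > 0" and q: "q > 0" and sT: "s < T"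
  shows "has_bochner_integral lborel (\<lambda>r. indicator {s<..<T} r * ((T - r) powr (p - 1) * (r - s) powr (q - 1)))
     ((T - s) powr (p + q - 1) * Beta p q)"
proof -
  define L where "L = T - s"
  have L: "L > 0" using sT by (simp add: L_def)
  have i: "set_integrable lborel {0..1} (\<lambda>t. t powr (q - 1) * (1 - t) powr (p - 1))"
    by (rule integrable_Beta[OF q p])
  have "(LINT t:{0..1}|lborel. t powr (q - 1) * (1 - t) powr (p - 1)) = Beta p q"
    using set_borel_integral_eq_integral(2)[OF i] has_integral_Beta_real[OF q p]
    by (simp add: integral_unique Beta_commute)
  with i have "has_bochner_integral lborel (\<lambda>t. indicator {0..1} t * (t powr (q - 1) * (1 - t) powr (p - 1))) (Beta p q)"
    by (simp add: has_bochner_integral_iff set_integrable_def set_lebesgue_integral_def)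
  from has_bochner_integral_mult_right[OF this, of "L powr (p + q - 2)"]
  have "has_bochner_integral lborel (\<lambda>t. L powr (p + q - 2) * (indicator {0..1} t * (t powr (q - 1) * (1 - t) powr (p - 1)))) (L powr (p + q - 2) * Beta p q)"
    by simp
  also have "(\<lambda>t. L powr (p + q - 2) * (indicator {0..1} t * (t powr (q - 1) * (1 - t) powr (p - 1))))
     = (\<lambda>t. indicator {s<..<T} (s + L * t) * ((T - (s + L * t)) powr (p - 1) * ((s + L * t) - s) powr (q - 1)))"
  proof
    fix t
    have e: "T - (s + L * t) = L * (1 - t)" by (simp add: L_def algebra_simps)
    have "L powr (p + q - 2) = L powr (p - 1) * L powr (q - 1)" by (simp flip: powr_add)
    moreover have "s + L * t < T \<longleftrightarrow> t < 1"
      using e L by (metis diff_gt_0_iff_gt zero_less_mult_iff less_asym)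
    moreover have "s < s + L * t \<longleftrightarrow> t > 0" using L by (simp add: zero_less_mult_iff)
    ultimately show "L powr (p + q - 2) * (indicator {0..1} t * (t powr (q - 1) * (1 - t) powr (p - 1)))
       = indicator {s<..<T} (s + L * t) * ((T - (s + L * t)) powr (p - 1) * ((s + L * t) - s) powr (q - 1))"
      unfolding e using L by (cases "t = 0 \<or> t = 1") (auto simp: indicator_def powr_mult)
  qed
  also have "L powr (p + q - 2) * Beta p q = (L powr (p + q - 1) * Beta p q) /\<^sub>R \<bar>L\<bar>"
    using L by (simp add: powr_diff field_simps power2_eq_square)
  finally show ?thesis
    using L by (subst lborel_has_bochner_integral_real_affine_iff[of L _ _ s]) (simp_all add: L_def)
qed

text \<open>Fubini on the triangle 0 < s < r < T: the integral over r is a Beta integral, and B(p,q)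
  = Gamma(p) Gamma(q) / Gamma(p + q) merges the two normalisations into one.\<close>

lemma RL_semigroup:
  fixes p q :: real
  assumes p: "p > 0" and q: "q > 0" and h[measurable]: "h \<in> borel_measurable borel"
    and hB: "\<And>s. 0 < s \<Longrightarrow> s < T \<Longrightarrow> norm (h s) \<le> B" and T: "T > 0"
  shows "RL (of_real p) (RL (of_real q) h) T = RL (of_real (p + q)) h T"
proof -
  define F :: "real \<Rightarrow> real \<Rightarrow> complex" where
    "F r s = (if 0 < s \<and> s < r \<and> r < T then of_real ((T - r) powr (p - 1) * (r - s) powr (q - 1)) * h s else 0)" for r s
  have B0: "B \<ge> 0" using order_trans[OF norm_ge_zero hB[of "T/2"]] T by simp
  have pw: "of_real w powr (of_real a - 1) = (of_real (w powr (a - 1)) :: complex)" if "w > 0" for w a :: real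
    using powr_of_real[of w "a - 1"] that by simp
  have F1: "F r s = indicator {0<..<T} r * of_real ((T - r) powr (p - 1)) * (indicator {0<..<r} s *\<^sub>R (of_real (r - s) powr (of_real q - 1) * h s))" for r s
    using pw[of "r - s" q] by (auto simp: F_def indicator_def simp del: of_real_diff)
  have int_s: "set_integrable lborel {0<..<r} (\<lambda>s. of_real (r - s) powr (of_real q - 1) * h s)" if "r \<in> {0<..<T}" for r
    by (rule RL_integrable[OF _ h, of _ _ B]) (use that hB q in auto)
  have Fs: "integrable lborel (F r)" for r
  proof (cases "r \<in> {0<..<T}")
    case True
    show ?thesis unfolding F1
      by (intro integrable_mult_right int_s[OF True, unfolded set_integrable_def])
  next
    case False
    then have "F r = (\<lambda>_. 0)" by (auto simp: F_def fun_eq_iff)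
    then show ?thesis by simp
  qed
  have [measurable]: "case_prod F \<in> borel_measurable (borel \<Otimes>\<^sub>M borel)"
    unfolding F_def by measurable
  have iF: "integrable (lborel \<Otimes>\<^sub>M lborel) (case_prod F)"
  proof (rule lborel_pair.Fubini_integrable)
    have "integrable lborel (\<lambda>r. indicator {0<..<T} r *\<^sub>R ((T - r) powr (p - 1) * (B * T powr q / q)))"
      using set_integrable_powr_diff(1)[OF p, of T] unfolding set_integrable_def[symmetric] by simp
    then show "integrable lborel (\<lambda>r. \<integral>s. norm (case (r, s) of (r, s) \<Rightarrow> F r s) \<partial>lborel)"
    proof (rule Bochner_Integration.integrable_bound)
      show "AE r in lborel. norm (\<integral>s. norm (case (r, s) of (r, s) \<Rightarrow> F r s) \<partial>lborel) \<le> norm (indicator {0<..<T} r *\<^sub>R ((T - r) powr (p - 1) * (B * T powr q / q)))"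
      proof (rule AE_I2)
        fix r
        show "norm (\<integral>s. norm (case (r, s) of (r, s) \<Rightarrow> F r s) \<partial>lborel) \<le> norm (indicator {0<..<T} r *\<^sub>R ((T - r) powr (p - 1) * (B * T powr q / q)))"
        proof (cases "r \<in> {0<..<T}")
          case True
          have "(\<integral>s. norm (F r s) \<partial>lborel) = (T - r) powr (p - 1) * (LINT s:{0<..<r}|lborel. norm (of_real (r - s) powr (of_real q - 1) * h s))"
            unfolding F1 set_lebesgue_integral_def using True
            by (simp add: norm_mult mult.assoc mult.left_commute[of "indicat_real _ _"] flip: integral_mult_right_zero)
          also have "\<dots> \<le> (T - r) powr (p - 1) * (B * r powr q / q)"
            using RL_norm_integral_le[of "of_real q" h r B] True hB q by (intro mult_left_mono) auto
          also have "\<dots> \<le> (T - r) powr (p - 1) * (B * T powr q / q)"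
            using True q B0 by (intro mult_left_mono divide_right_mono powr_mono2) auto
          finally show ?thesis using True B0 q by simp
        qed (simp add: F1)
      qed
    qed simp
  qed (use Fs in auto)
  have Fr: "(\<integral>s. F r s \<partial>lborel) = of_real ((T - r) powr (p - 1)) * (\<integral>s. indicator {0<..<r} s *\<^sub>R (of_real (r - s) powr (of_real q - 1) * h s) \<partial>lborel)" if "r \<in> {0<..<T}" for r
    unfolding F1 indicator_simps(1)[OF that] by (subst integral_mult_right_zero) simp
  have Fr0: "(\<integral>s. F r s \<partial>lborel) = 0" if "r \<notin> {0<..<T}" for r
    unfolding F1 indicator_simps(2)[OF that] by simp
  have "RL (of_real p) (RL (of_real q) h) T = rGamma (of_real p) * (\<integral>r. rGamma (of_real q) * (\<integral>s. F r s \<partial>lborel) \<partial>lborel)"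
    unfolding RL_def set_lebesgue_integral_def
  proof (intro arg_cong2[where f="times"] refl Bochner_Integration.integral_cong)
    fix r
    show "indicator {0<..<T} r *\<^sub>R (of_real (T - r) powr (of_real p - 1) * (rGamma (of_real q) * (\<integral>s. indicator {0<..<r} s *\<^sub>R (of_real (r - s) powr (of_real q - 1) * h s) \<partial>lborel))) = rGamma (of_real q) * (\<integral>s. F r s \<partial>lborel)"
      using pw[of "T - r" p] Fr[of r] Fr0[of r] by (cases "r \<in> {0<..<T}") (simp_all del: of_real_diff)
  qed
  also have "(\<integral>r. rGamma (of_real q) * (\<integral>s. F r s \<partial>lborel) \<partial>lborel) = rGamma (of_real q) * (\<integral>s. (\<integral>r. F r s \<partial>lborel) \<partial>lborel)"
    by (simp add: lborel_pair.Fubini_integral[OF iF])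
  also have "(\<integral>s. (\<integral>r. F r s \<partial>lborel) \<partial>lborel) = (\<integral>s. of_real (Beta p q) * (indicator {0<..<T} s *\<^sub>R (of_real (T - s) powr (of_real (p + q) - 1) * h s)) \<partial>lborel)"
  proof (rule Bochner_Integration.integral_cong[OF refl])
    fix s
    show "(\<integral>r. F r s \<partial>lborel) = of_real (Beta p q) * (indicator {0<..<T} s *\<^sub>R (of_real (T - s) powr (of_real (p + q) - 1) * h s))"
    proof (cases "s \<in> {0<..<T}")
      case True
      have "F r s = of_real (indicator {s<..<T} r * ((T - r) powr (p - 1) * (r - s) powr (q - 1))) * h s" for r
        using True by (auto simp: F_def indicator_def)
      then have "(\<integral>r. F r s \<partial>lborel) = of_real (\<integral>r. indicator {s<..<T} r * ((T - r) powr (p - 1) * (r - s) powr (q - 1)) \<partial>lborel) * h s"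
        by (simp del: of_real_mult)
      also have "(\<integral>r. indicator {s<..<T} r * ((T - r) powr (p - 1) * (r - s) powr (q - 1)) \<partial>lborel) = (T - s) powr (p + q - 1) * Beta p q"
        using has_bochner_integral_beta_convolution[OF p q, of s T] True by (simp add: has_bochner_integral_integral_eq)
      finally show ?thesis using True pw[of "T - s" "p + q"] by (simp add: mult_ac del: of_real_diff of_real_add)
    next
      case False
      then have "F r s = 0" for r by (auto simp: F_def)
      then show ?thesis using False by simp
    qed
  qed
  also have "rGamma (of_real p) * (rGamma (of_real q) * (\<integral>s. of_real (Beta p q) * (indicator {0<..<T} s *\<^sub>R (of_real (T - s) powr (of_real (p + q) - 1) * h s)) \<partial>lborel))
     = (rGamma (of_real p) * rGamma (of_real q) * of_real (Beta p q)) * (LINT s:{0<..<T}|lborel. of_real (T - s) powr (of_real (p + q) - 1) * h s)"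
    unfolding set_lebesgue_integral_def by (subst integral_mult_right_zero) (simp only: mult.assoc)
  also have "rGamma (of_real p) * rGamma (of_real q) * of_real (Beta p q) = (rGamma (of_real (p + q)) :: complex)"
  proof -
    have "rGamma p * rGamma q * Beta p q = rGamma (p + q)"
      using Gamma_real_pos[OF p, THEN less_imp_neq] Gamma_real_pos[OF q, THEN less_imp_neq]
      by (simp add: Beta_altdef rGamma_inverse_Gamma field_simps del: Gamma_eq_zero_iff)
    then show ?thesis by (simp only: rGamma_complex_of_real flip: of_real_mult)
  qed
  finally show ?thesis by (simp only: RL_def)
qed

text \<open>The Cauchy product behind exp(c) exp(-c) = 1, with \<rho> in the role of the powers of
  an operator: only j + k matters, and the coefficients of equal j + k cancel except for 0.\<close>

lemma exp_double_series:
  fixes \<rho> :: "nat \<Rightarrow> complex"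
  assumes \<rho>: "\<And>N. norm (\<rho> N) \<le> K * T ^ N" and T: "T > 0"
  shows "(\<Sum>j. of_real (c ^ j / fact j) * (\<Sum>k. of_real ((- c) ^ k / fact k) * \<rho> (j + k))) = \<rho> 0"
proof -
  define a where "a j = complex_of_real (c ^ j / fact j)" for j
  define b where "b j = complex_of_real ((- c) ^ j / fact j)" for j
  define e where "e j = (\<bar>c\<bar> * T) ^ j / fact j" for j
  have e: "summable e" "\<And>j. e j \<ge> 0" unfolding e_def using summable_exp_real T by auto
  have K0: "K \<ge> 0" using \<rho>[of 0] order_trans[OF norm_ge_zero] by fastforce
  have se: "(\<lambda>j. norm (e j)) summable_on UNIV" by (rule norm_summable_imp_summable_on) (use e in simp)
  have na: "norm (a j * b k * \<rho> (j + k)) \<le> K * (e j * e k)" for j k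
  proof -
    have "norm (a j * b k * \<rho> (j + k)) = (\<bar>c\<bar> ^ j / fact j) * (\<bar>c\<bar> ^ k / fact k) * norm (\<rho> (j + k))"
      by (simp add: a_def b_def norm_mult norm_divide norm_power power_abs)
    also have "\<dots> \<le> (\<bar>c\<bar> ^ j / fact j) * (\<bar>c\<bar> ^ k / fact k) * (K * T ^ (j + k))"
      by (intro mult_left_mono \<rho>) auto
    finally show ?thesis by (simp add: e_def power_mult_distrib power_add mult_ac)
  qed
  have "(\<lambda>x. norm (case x of (j, k) \<Rightarrow> a j * b k * \<rho> (j + k))) summable_on UNIV \<times> UNIV"
  proof (rule Infinite_Sum.abs_summable_on_comparison_test)
    show "(\<lambda>x. norm (case x of (j, k) \<Rightarrow> K * (e j * e k))) summable_on UNIV \<times> UNIV"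
      unfolding Infinite_Sum.abs_summable_on_Sigma_iff
    proof (intro conjI ballI)
      show "(\<lambda>k. norm (case (j, k) of (j, k) \<Rightarrow> K * (e j * e k))) summable_on UNIV" for j
        using summable_on_cmult_right[OF se, of "\<bar>K * e j\<bar>"] by (simp add: abs_mult mult.assoc)
      have "(\<Sum>\<^sub>\<infinity>k. norm (K * (e j * e k))) = norm (e j) * (\<bar>K\<bar> * (\<Sum>\<^sub>\<infinity>k. norm (e k)))" for j
        by (simp add: abs_mult mult_ac flip: infsum_cmult_right')
      then show "(\<lambda>j. norm (\<Sum>\<^sub>\<infinity>k. norm (case (j, k) of (j, k) \<Rightarrow> K * (e j * e k)))) summable_on UNIV"
        using summable_on_cmult_left[OF se, of "norm (\<bar>K\<bar> * (\<Sum>\<^sub>\<infinity>k. norm (e k)))"] by (simp add: abs_mult)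
    qed
    fix x :: "nat \<times> nat"
    show "norm (case x of (j, k) \<Rightarrow> a j * b k * \<rho> (j + k)) \<le> norm (case x of (j, k) \<Rightarrow> K * (e j * e k))"
      using na order_trans[OF na abs_ge_self] by (cases x) (simp only: prod.case real_norm_def)
  qed
  then have sm: "(\<lambda>(j, k). a j * b k * \<rho> (j + k)) summable_on UNIV \<times> UNIV"
    by (rule abs_summable_summable)
  have in_sum: "(\<lambda>k. a j * b k * \<rho> (j + k)) summable_on UNIV" for j
    using summable_on_SigmaD1[OF sm, of j] by simp
  have inner: "(\<Sum>\<^sub>\<infinity>k. a j * b k * \<rho> (j + k)) = a j * (\<Sum>k. b k * \<rho> (j + k))" for j
  proof -
    have "summable (\<lambda>k. norm (b k * \<rho> (j + k)))"
    proof (rule summable_comparison_test'[OF summable_mult[OF e(1), of "K * T ^ j"]])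
      fix k :: nat
      have "norm (b k * \<rho> (j + k)) \<le> (\<bar>c\<bar> ^ k / fact k) * (K * T ^ (j + k))"
        unfolding norm_mult b_def using \<rho> by (intro mult_mono) (auto simp: norm_divide norm_power)
      then show "norm (norm (b k * \<rho> (j + k))) \<le> K * T ^ j * e k"
        by (simp add: e_def power_mult_distrib power_add mult_ac)
    qed
    from norm_summable_imp_has_sum[OF this summable_sums[OF summable_norm_cancel[OF this]]]
    have "((\<lambda>k. b k * \<rho> (j + k)) has_sum (\<Sum>k. b k * \<rho> (j + k))) UNIV" .
    from has_sum_cmult_right[OF this, of "a j"] show ?thesis
      by (simp add: infsumI mult.assoc)
  qed
  have outer: "(\<lambda>j. a j * (\<Sum>k. b k * \<rho> (j + k))) sums (\<Sum>\<^sub>\<infinity>(j, k)\<in>UNIV \<times> UNIV. a j * b k * \<rho> (j + k))"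
    using has_sum_imp_sums[OF has_sum_SigmaD[OF has_sum_infsum[OF sm], of "\<lambda>j. \<Sum>\<^sub>\<infinity>k. a j * b k * \<rho> (j + k)"]]
      has_sum_infsum[OF in_sum] unfolding inner by simp
  \<comment> \<open>Reindexing by N = j + k and j collects the terms with the same \<rho> N;
    absolute summability allows the rearrangement.\<close>
  have bij: "bij_betw (\<lambda>(N, j). (j, N - j)) (SIGMA N:UNIV. {..N}) (UNIV \<times> UNIV :: (nat \<times> nat) set)"
    by (rule bij_betw_byWitness[where f'="\<lambda>(j, k). (j + k, j)"]) auto
  have "(\<Sum>\<^sub>\<infinity>(j, k)\<in>UNIV \<times> UNIV. a j * b k * \<rho> (j + k)) = (\<Sum>\<^sub>\<infinity>(N, j)\<in>(SIGMA N:UNIV. {..N}). a j * b (N - j) * \<rho> (j + (N - j)))"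
    by (subst infsum_reindex_bij_betw[OF bij, symmetric]) (simp add: case_prod_unfold)
  also have "\<dots> = (\<Sum>\<^sub>\<infinity>N. \<Sum>\<^sub>\<infinity>j\<in>{..N}. a j * b (N - j) * \<rho> (j + (N - j)))"
  proof (rule infsum_Sigma'_banach[symmetric])
    have "(\<lambda>x. (\<lambda>(j, k). a j * b k * \<rho> (j + k)) ((\<lambda>(N, j). (j, N - j)) x)) summable_on (SIGMA N:UNIV. {..N})"
      using summable_on_reindex_bij_betw[OF bij] sm by blast
    then show "(\<lambda>(N, j). a j * b (N - j) * \<rho> (j + (N - j))) summable_on (SIGMA N:UNIV. {..N})"
      by (simp add: case_prod_unfold)
  qed
  \<comment> \<open>By the binomial theorem the coefficient of \<rho> N is (c + (-c))^N / N!, and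
    0^0 = 1 leaves the term N = 0.\<close>
  also have "(\<lambda>N. \<Sum>\<^sub>\<infinity>j\<in>{..N}. a j * b (N - j) * \<rho> (j + (N - j))) = (\<lambda>N. if N = 0 then \<rho> 0 else 0)"
  proof
    fix N :: nat
    have "(\<Sum>\<^sub>\<infinity>j\<in>{..N}. a j * b (N - j) * \<rho> (j + (N - j))) = (\<Sum>j\<le>N. a j * b (N - j)) * \<rho> N"
      by (simp add: sum_distrib_right)
    also have "(\<Sum>j\<le>N. a j * b (N - j)) = of_real ((\<Sum>j\<le>N. of_nat (N choose j) * c ^ j * (- c) ^ (N - j)) / fact N)"
      unfolding sum_divide_distrib of_real_sum
      by (intro sum.cong refl) (simp add: a_def b_def binomial_fact)
    also have "(\<Sum>j\<le>N. of_nat (N choose j) * c ^ j * (- c) ^ (N - j)) = (c + (- c)) ^ N"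
      by (rule binomial_ring[symmetric])
    finally show "(\<Sum>\<^sub>\<infinity>j\<in>{..N}. a j * b (N - j) * \<rho> (j + (N - j))) = (if N = 0 then \<rho> 0 else 0)"
      by (simp add: power_0_left)
  qed
  also have "(\<Sum>\<^sub>\<infinity>N. if N = 0 then \<rho> 0 else 0) = \<rho> 0"
    by (subst infsum_cong_neutral[where T="{0}" and g="\<lambda>_. \<rho> 0"]) auto
  finally show ?thesis using sums_unique[OF outer] by (simp add: a_def b_def)
qed

lemma RL_suminf:
  assumes q: "Re q > 0" and v: "\<And>k. v k \<in> borel_measurable borel"
    and vM: "\<And>k s. 0 < s \<Longrightarrow> s < T \<Longrightarrow> norm (v k s) \<le> M k" and M: "summable M" and T: "T > 0"
  shows "RL q (\<lambda>s. \<Sum>k. v k s) T = (\<Sum>k. RL q (v k) T)" and "summable (\<lambda>k. RL q (v k) T)"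
proof -
  define f where "f k s = indicator {0<..<T} s *\<^sub>R (of_real (T - s) powr (q - 1) * v k s)" for k s
  have fi: "integrable lborel (f k)" for k
    using RL_integrable[OF q v vM T] unfolding f_def set_integrable_def .
  have "(\<integral>s. norm (f k s) \<partial>lborel) \<le> M k * T powr Re q / Re q" for k
    using RL_norm_integral_le[OF q v vM T, of k] by (simp add: f_def set_lebesgue_integral_def)
  then have s2: "summable (\<lambda>k. \<integral>s. norm (f k s) \<partial>lborel)"
    by (intro summable_comparison_test'[OF summable_mult2[OF M, of "T powr Re q / Re q"]]) simp
  have sv: "summable (\<lambda>k. norm (v k s))" if "s \<in> {0<..<T}" for s
    by (rule summable_comparison_test'[OF M]) (use vM that in auto)
  have s1: "summable (\<lambda>k. norm (f k s))" for s
    using summable_mult[OF sv, of s "norm (complex_of_real (T - s) powr (q - 1))"] 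
    by (cases "s \<in> {0<..<T}") (simp_all add: f_def norm_mult del: of_real_diff)
  have sf: "(\<Sum>k. f k s) = indicator {0<..<T} s *\<^sub>R (of_real (T - s) powr (q - 1) * (\<Sum>k. v k s))" for s
    using suminf_mult[OF summable_norm_cancel[OF sv], of s "of_real (T - s) powr (q - 1)"]
    by (cases "s \<in> {0<..<T}") (simp_all add: f_def del: of_real_diff)
  have sI: "(\<lambda>k. integral\<^sup>L lborel (f k)) sums (\<integral>s. (\<Sum>k. f k s) \<partial>lborel)"
    by (rule sums_integral[OF fi _ s2]) (use s1 in auto)
  have "(\<lambda>k. RL q (v k) T) sums RL q (\<lambda>s. \<Sum>k. v k s) T"
    unfolding RL_def set_lebesgue_integral_def f_def[symmetric] sf[symmetric] by (rule sums_mult[OF sI])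
  then show "RL q (\<lambda>s. \<Sum>k. v k s) T = (\<Sum>k. RL q (v k) T)" "summable (\<lambda>k. RL q (v k) T)"
    by (auto simp: sums_iff)
qed

text \<open>Formally I^p exp(cI) I^q exp(-cI) = I^(p+q). By the semigroup law a pair of terms with
  indices j and k contributes a fractional integral whose order depends on j + k alone, which is the
  shape \<open>exp_double_series\<close> needs.\<close>

lemma RL_exp_comp:
  fixes p q :: real
  assumes p: "p > 0" and q: "q > 0" and h[measurable]: "h \<in> borel_measurable borel"
    and hB: "\<And>s. 0 < s \<Longrightarrow> s < T \<Longrightarrow> norm (h s) \<le> B" and T: "T > 0"
  shows "RL_exp (of_real p) c (RL_exp (of_real q) (- c) h) T = RL (of_real (p + q)) h T"
proof -
  define K where "K q = max (norm (rGamma (complex_of_real q))) (norm (rGamma (complex_of_real q + 1))) * (B * T powr q / q)" for q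
  have bd: "norm (RL (of_real q + of_nat k) h S) \<le> K q * T ^ k" if "0 < S" "S \<le> T" "q > 0" for k S and q :: real
    unfolding K_def using norm_RL_add_nat_le[of "of_real q" h T B S k] h hB that by simp
  define b where "b k = complex_of_real ((- c) ^ k / fact k)" for k
  have sM: "summable (\<lambda>k. \<bar>c\<bar> ^ k / fact k * (K q * T ^ k))"
    using summable_mult[OF summable_exp_real[of "\<bar>c\<bar> * T"], of "K q"] by (simp add: power_mult_distrib mult_ac)
  have "RL (of_real p + of_nat j) (RL_exp (of_real q) (- c) h) T = (\<Sum>k. b k * RL (of_real (p + q) + of_nat (j + k)) h T)" for j
  proof -
    have e0: "RL_exp (of_real q) (- c) h = (\<lambda>s. \<Sum>k. b k * RL (of_real q + of_nat k) h s)"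
      by (simp add: RL_exp_def fun_eq_iff b_def)
    have e1: "RL (of_real p + of_nat j) (\<lambda>s. \<Sum>k. b k * RL (of_real q + of_nat k) h s) T = (\<Sum>k. RL (of_real p + of_nat j) (\<lambda>s. b k * RL (of_real q + of_nat k) h s) T)"
    proof (rule RL_suminf[OF _ _ _ sM T])
      show "norm (b k * RL (of_real q + of_nat k) h s) \<le> \<bar>c\<bar> ^ k / fact k * (K q * T ^ k)" if "0 < s" "s < T" for k s
        unfolding norm_mult using bd[of s q k] that q
        by (intro mult_mono) (auto simp: b_def norm_divide norm_power)
    qed (use p in auto)
    have e2: "RL (of_real p + of_nat j) (\<lambda>s. b k * RL (of_real q + of_nat k) h s) T = b k * RL (of_real (p + q) + of_nat (j + k)) h T" for k
      using RL_semigroup[of "p + real j" "q + real k" h T B] p q h hB T by (simp add: RL_cmult algebra_simps)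
    show ?thesis unfolding e0 e1 e2 ..
  qed
  then have "RL_exp (of_real p) c (RL_exp (of_real q) (- c) h) T = (\<Sum>j. of_real (c ^ j / fact j) * (\<Sum>k. b k * RL (of_real (p + q) + of_nat (j + k)) h T))"
    by (simp add: RL_exp_def)
  also have "\<dots> = RL (of_real (p + q) + of_nat 0) h T"
    unfolding b_def by (rule exp_double_series[of _ "K (p + q)" T]) (use bd[of T "p + q"] T p q in auto)
  finally show ?thesis by simp
qed

lemma RL_exp_holomorphic:
  assumes h: "h \<in> borel_measurable borel"
    and hB: "\<And>s. 0 < s \<Longrightarrow> s < T \<Longrightarrow> norm (h s) \<le> B" and T: "T > 0"
  shows "(\<lambda>z. RL_exp z c h T) holomorphic_on {z. Re z > 0}"
  unfolding RL_exp_def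
proof (rule holomorphic_uniform_sequence)
  show "open {z. Re z > 0}" by (simp add: open_halfspace_Re_gt)
  have "(\<lambda>z. RL (z + of_nat k) h T) holomorphic_on {z. Re z > 0}" for k
    using holomorphic_on_compose_gen[OF _ RL_holomorphic[OF h hB T], of "\<lambda>z. z + of_nat k" "{z. Re z > 0}"]
    by (force simp: o_def intro!: holomorphic_intros)
  then show "(\<lambda>z. \<Sum>k<n. of_real (c ^ k / fact k) * RL (z + of_nat k) h T) holomorphic_on {z. Re z > 0}" for n
    by (intro holomorphic_intros)
  fix z assume z: "z \<in> {z. Re z > 0}"
  define d where "d = Re z / 2"
  have d: "d > 0" using z by (simp add: d_def)
  have sub: "Re y > 0" if "y \<in> cball z d" for y
  proof -
    have "\<bar>Re (z - y)\<bar> \<le> norm (z - y)" by (rule abs_Re_le_cmod)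
    then show ?thesis using that d by (auto simp: dist_norm d_def)
  qed
  \<comment> \<open>The part of the bound that depends on the order y. It is continuous on the
    closed disc, hence bounded there, which makes the majorant of the M-test independent of
    y.\<close>
  define \<phi> where "\<phi> y = max (norm (rGamma y)) (norm (rGamma (y + 1))) * (B * T powr Re y / Re y)" for y
  have rc: "continuous_on S (\<lambda>y. rGamma (f y))" if "continuous_on S f" for f :: "complex \<Rightarrow> complex" and S
    using continuous_on_compose2[OF holomorphic_on_imp_continuous_on[OF holomorphic_rGamma] that] by auto
  have "continuous_on (cball z d) \<phi>"
    unfolding \<phi>_def using sub T by (intro continuous_intros rc) force+
  then have "bounded (\<phi> ` cball z d)"
    by (intro compact_imp_bounded compact_continuous_image) auto
  then obtain G where "\<forall>y\<in>cball z d. \<bar>\<phi> y\<bar> \<le> G" unfolding bounded_iff by auto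
  then have G: "\<And>y. y \<in> cball z d \<Longrightarrow> \<bar>\<phi> y\<bar> \<le> G" by blast
  have "uniform_limit (cball z d) (\<lambda>n x. \<Sum>k<n. of_real (c ^ k / fact k) * RL (x + of_nat k) h T)
       (\<lambda>x. \<Sum>k. of_real (c ^ k / fact k) * RL (x + of_nat k) h T) sequentially"
  proof (rule Weierstrass_m_test)
    show "summable (\<lambda>k. \<bar>c\<bar> ^ k / fact k * (G * T ^ k))"
      using summable_mult[OF summable_exp_real[of "\<bar>c\<bar> * T"], of G] by (simp add: power_mult_distrib mult_ac)
    fix k y assume y: "y \<in> cball z d"
    have "norm (RL (y + of_nat k) h T) \<le> \<phi> y * T ^ k"
      unfolding \<phi>_def by (rule norm_RL_add_nat_le[OF sub[OF y] h hB T order_refl])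
    also have "\<dots> \<le> G * T ^ k" using G[OF y] T by (intro mult_right_mono) auto
    finally show "norm (of_real (c ^ k / fact k) * RL (y + of_nat k) h T) \<le> \<bar>c\<bar> ^ k / fact k * (G * T ^ k)"
      unfolding norm_mult by (intro mult_mono) (auto simp: norm_divide norm_power)
  qed
  then show "\<exists>d>0. cball z d \<subseteq> {z. Re z > 0} \<and> uniform_limit (cball z d) (\<lambda>n x. \<Sum>k<n. of_real (c ^ k / fact k) * RL (x + of_nat k) h T)
       (\<lambda>x. \<Sum>k. of_real (c ^ k / fact k) * RL (x + of_nat k) h T) sequentially"
    using d sub by (intro exI[of _ d]) auto
qed

section \<open>Analytic continuation by integration by parts\<close>

text \<open>A smooth function given together with all its derivatives as data, so that
  differentiating is shifting the index. Vanishing on s <= 0 removes every boundary term at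
  0.\<close>

definition deriv_chain :: "(nat \<Rightarrow> real \<Rightarrow> complex) \<Rightarrow> bool" where
  "deriv_chain g \<longleftrightarrow> (\<forall>k s. (g k has_vector_derivative g (Suc k) s) (at s)) \<and> (\<forall>k s. s \<le> 0 \<longrightarrow> g k s = 0)"

lemma deriv_chain_continuous: "deriv_chain g \<Longrightarrow> continuous_on UNIV (g k)"
  by (meson continuous_at_imp_continuous_on deriv_chain_def has_vector_derivative_continuous)

lemma deriv_chain_measurable: "deriv_chain g \<Longrightarrow> g k \<in> borel_measurable borel"
  by (intro borel_measurable_continuous_onI deriv_chain_continuous)

lemma deriv_chain_bounded:
  assumes "deriv_chain g"
  obtains B where "\<And>s. 0 < s \<Longrightarrow> s < T \<Longrightarrow> norm (g k s) \<le> B"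
  using continuous_on_Icc_bounded[OF continuous_on_subset[OF deriv_chain_continuous[OF assms] subset_UNIV], of 0 T k]
  by (meson atLeastAtMost_iff less_imp_le)

text \<open>Each term of the series is integrated by parts; all orders rise by one together, so the
  coefficients, and with them c, stay the same.\<close>

lemma RL_exp_deriv_chain:
  assumes g: "deriv_chain g" and q: "Re q > 0" and T: "T > 0"
  shows "RL_exp q c (g k) T = RL_exp (q + of_nat m) c (g (k + m)) T"
proof (induction m)
  case (Suc m)
  have "RL (q + of_nat m + of_nat j) (g (k + m)) T = RL (q + of_nat m + of_nat j + 1) (g (Suc (k + m))) T" for j
    by (rule RL_eq_RL_deriv[OF _ T]) (use q g deriv_chain_continuous[OF g] in \<open>auto simp: deriv_chain_def\<close>)
  then have "RL_exp (q + of_nat m) c (g (k + m)) T = RL_exp (q + of_nat (Suc m)) c (g (k + Suc m)) T"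
    unfolding RL_exp_def by (simp add: ac_simps)
  then show ?case using Suc by simp
qed simp

text \<open>Taylor's formula with zero initial data. It starts at order 1: \<open>rGamma 0\<close>
  is 0, so \<open>RL 0\<close> is the zero operator and not the identity.\<close>

lemma RL_deriv_chain:
  assumes g: "deriv_chain g" and T: "T > 0"
  shows "RL (of_nat (Suc m)) (g (Suc m)) T = g 0 T"
proof (induction m)
  case 0
  show ?case using RL_1_deriv[OF T, of "g 0" "g 1"] g deriv_chain_continuous[OF g] by (auto simp: deriv_chain_def)
next
  case (Suc m)
  have "RL (of_nat (Suc m)) (g (Suc m)) T = RL (of_nat (Suc m) + 1) (g (Suc (Suc m))) T"
    by (rule RL_eq_RL_deriv[OF _ T]) (use g deriv_chain_continuous[OF g] in \<open>auto simp: deriv_chain_def\<close>)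
  then show ?case using Suc by (simp add: add.commute)
qed

text \<open>Negative indices for a chain: g becomes the m-th derivative of a new chain. The
  inversion uses this to write a derivative of an integral as a mere shift, and the ramp uses it
  with m = 2.\<close>

lemma deriv_chain_primitive:
  assumes g: "deriv_chain g"
  obtains h where "deriv_chain h" "\<And>k. h (m + k) = g k"
proof -
  have "\<exists>h. deriv_chain h \<and> (\<forall>k. h (m + k) = g k)"
  proof (induction m)
    case 0
    show ?case using g by (intro exI[of _ g]) simp
  next
    case (Suc m)
    then obtain h where h: "deriv_chain h" "\<And>k. h (m + k) = g k" by blast
    \<comment> \<open>Integrating from -1 makes 0 an interior point, so that H has a two-sided
      derivative there; the integrand vanishes on s <= 0, so for positive s the value is that of the
      integral from 0.\<close>
    define H where "H s = integral {-1..s} (h 0)" for s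
    have c: "continuous_on UNIV (h 0)" by (rule deriv_chain_continuous[OF h(1)])
    have z: "h 0 s = 0" if "s \<le> 0" for s using h(1) that by (auto simp: deriv_chain_def)
    have H0: "H s = 0" if "s \<le> 0" for s
    proof -
      have "H s = integral {-1..s} (\<lambda>_. 0)"
        unfolding H_def by (rule integral_cong) (use z that in auto)
      then show ?thesis by simp
    qed
    have "(H has_vector_derivative h 0 s) (at s)" for s
    proof (cases "s < 0")
      case True
      have "((\<lambda>_. 0) has_vector_derivative h 0 s) (at s)" using z[of s] True by simp
      then show ?thesis
        by (rule has_vector_derivative_transform_within_open[of _ _ _ "{..<0}"]) (use True H0 in auto)
    next
      case False
      have "(H has_vector_derivative h 0 s) (at s within {-1..s+1})"
        unfolding H_def by (rule integral_has_vector_derivative) (use False continuous_on_subset[OF c] in auto)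
      moreover have "at s within {-1..s+1} = at s"
        by (rule at_within_interior) (use False in simp)
      ultimately show ?thesis by simp
    qed
    then have "((case k of 0 \<Rightarrow> H | Suc k \<Rightarrow> h k) has_vector_derivative h k s) (at s)" for k s
      using h(1) by (cases k) (simp_all add: deriv_chain_def)
    moreover have "(case k of 0 \<Rightarrow> H | Suc k \<Rightarrow> h k) s = 0" if "s \<le> 0" for k s
      using h(1) H0[OF that] that by (cases k) (simp_all add: deriv_chain_def)
    ultimately have "deriv_chain (\<lambda>k. case k of 0 \<Rightarrow> H | Suc k \<Rightarrow> h k)"
      by (simp add: deriv_chain_def)
    then show ?case using h(2) by (intro exI[of _ "\<lambda>k. case k of 0 \<Rightarrow> H | Suc k \<Rightarrow> h k"]) simp
  qed
  then show ?thesis using that by blast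
qed

text \<open>The definite description is resolved by the identity theorem on the connected set
  \<open>V\<close>: any one holomorphic extension determines the value.\<close>

lemma analytic_continuation_eq:
  assumes "open U" "U \<noteq> {}" "U \<subseteq> V" "open V" "connected V" "g holomorphic_on V"
    and "\<And>s. s \<in> U \<Longrightarrow> g s = F s" and "z \<in> V"
  shows "analytic_continuation U V F z = g z"
  unfolding analytic_continuation_def
proof (rule the_equality)
  show "\<exists>g'. g' holomorphic_on V \<and> (\<forall>s\<in>U. g' s = F s) \<and> g' z = g z" using assms by blast
  fix w assume "\<exists>g'. g' holomorphic_on V \<and> (\<forall>s\<in>U. g' s = F s) \<and> g' z = w"
  then obtain g' where g': "g' holomorphic_on V" "\<And>s. s \<in> U \<Longrightarrow> g' s = F s" "g' z = w" by blast
  have "g' z = g z"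
    by (rule analytic_continuation_open[of U V]) (use assms g' in auto)
  then show "w = g z" using g' by simp
qed

text \<open>Raising the order by m and differentiating the function m times gives an expression that
  is holomorphic on Re z > -m. Integration by parts makes the expressions for different m agree, so
  they glue to one entire function.\<close>

lemma RL_exp_deriv_chain_entire:
  assumes g: "deriv_chain g" and T: "T > 0"
  obtains E where "E holomorphic_on UNIV"
    and "\<And>z m. Re z + real m > 0 \<Longrightarrow> E z = RL_exp (z + of_nat m) c (g m) T"
proof -
  \<comment> \<open>This choice of m guarantees Re z + m >= 1. It jumps as z varies, so holomorphy
    is checked near each point with m frozen.\<close>
  define E where "E z = (let m = nat \<lceil>1 - Re z\<rceil> in RL_exp (z + of_nat m) c (g m) T)" for z
  have le: "RL_exp (z + of_nat m) c (g m) T = RL_exp (z + of_nat m') c (g m') T"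
    if "Re z + real m > 0" "m \<le> m'" for z m m'
    using RL_exp_deriv_chain[OF g _ T, of "z + of_nat m" c m "m' - m"] that by (simp add: of_nat_diff)
  have eq: "E z = RL_exp (z + of_nat m) c (g m) T" if m: "Re z + real m > 0" for z m
  proof -
    have "Re z + real (nat \<lceil>1 - Re z\<rceil>) > 0" by linarith
    then show ?thesis using le[of z] m by (metis E_def nle_le)
  qed
  have "E field_differentiable at z0" for z0
  proof -
    define m where "m = nat \<lceil>1 - Re z0\<rceil>"
    define W where "W = {z. Re (z + of_nat m) > 0}"
    have "W = {z. - real m < Re z}" by (auto simp: W_def)
    then have W: "open W" using open_halfspace_Re_gt[of "- real m"] by simp
    obtain B where B: "\<And>s. 0 < s \<Longrightarrow> s < T \<Longrightarrow> norm (g m s) \<le> B" using deriv_chain_bounded[OF g] by blast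
    have "(\<lambda>z. RL_exp (z + of_nat m) c (g m) T) holomorphic_on W"
      using holomorphic_on_compose_gen[OF _ RL_exp_holomorphic[OF deriv_chain_measurable[OF g] B T], of "\<lambda>z. z + of_nat m" W]
      by (force simp: o_def W_def intro!: holomorphic_intros)
    then have "E holomorphic_on W"
      by (rule holomorphic_transform) (simp add: W_def eq)
    moreover have "z0 \<in> W" unfolding W_def m_def by simp linarith
    ultimately show ?thesis using W holomorphic_on_imp_differentiable_at by blast
  qed
  then have "E holomorphic_on UNIV" by (simp add: holomorphic_on_def)
  then show ?thesis using that eq by blast
qed

text \<open>All poles sit in the factor \<open>C\<close>; the product of \<open>C\<close> with the
  entire continuation of \<open>RL_exp\<close> is thus the continuation on the whole domain of
  \<open>C\<close>.\<close>

lemma analytic_continuation_RL_exp: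
  assumes g: "deriv_chain g" and T: "T > 0"
    and C: "C holomorphic_on {s. s + \<nu> \<notin> \<int>\<^sub>\<le>\<^sub>0}" and \<nu>: "Re \<nu> > 0"
    and F: "\<And>s. Re s > 0 \<Longrightarrow> F s = C s * RL_exp s c (g 0) T"
    and \<alpha>: "\<alpha> + \<nu> \<notin> \<int>\<^sub>\<le>\<^sub>0" and m: "Re \<alpha> + real m > 0"
  shows "analytic_continuation {s. Re s > 0} {s. s + \<nu> \<notin> \<int>\<^sub>\<le>\<^sub>0} F \<alpha> = C \<alpha> * RL_exp (\<alpha> + of_nat m) c (g m) T"
proof -
  let ?V = "{s. s + \<nu> \<notin> \<int>\<^sub>\<le>\<^sub>0}"
  obtain E where E: "E holomorphic_on UNIV"
    "\<And>z m. Re z + real m > 0 \<Longrightarrow> E z = RL_exp (z + of_nat m) c (g m) T"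
    using RL_exp_deriv_chain_entire[OF g T, of c] by blast
  \<comment> \<open>The domain is the plane with a countable set removed, hence path
    connected.\<close>
  have V: "?V = - ((\<lambda>z. z - \<nu>) ` \<int>\<^sub>\<le>\<^sub>0)"
    by (auto simp: image_iff) (metis add_diff_cancel_right')
  have "countable (\<int>\<^sub>\<le>\<^sub>0 :: complex set)"
    by (rule countable_subset[OF nonpos_Ints_subset_Ints]) (simp add: Ints_def)
  then have "connected ?V" unfolding V
    by (intro path_connected_imp_connected path_connected_complement_countable) auto
  moreover have "open ?V"
  proof -
    have "open (- \<int>\<^sub>\<le>\<^sub>0 :: complex set)" by (simp add: open_Compl)
    then show ?thesis
      using continuous_open_vimage[of "- \<int>\<^sub>\<le>\<^sub>0" "\<lambda>s. s + \<nu>"] by (simp add: vimage_def continuous_intros)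
  qed
  moreover have "{s. Re s > 0} \<subseteq> ?V"
  proof
    fix s :: complex assume s: "s \<in> {s. Re s > 0}"
    have "s + \<nu> \<notin> \<int>\<^sub>\<le>\<^sub>0"
    proof
      assume "s + \<nu> \<in> \<int>\<^sub>\<le>\<^sub>0"
      then obtain i where "s + \<nu> = of_int i" "i \<le> 0" by (auto elim: nonpos_Ints_cases)
      then have "Re (s + \<nu>) \<le> 0" by simp
      then show False using s \<nu> by simp
    qed
    then show "s \<in> ?V" by simp
  qed
  ultimately have "analytic_continuation {s. Re s > 0} ?V F \<alpha> = C \<alpha> * E \<alpha>"
    by (intro analytic_continuation_eq[where g="\<lambda>s. C s * E s"])
      (use F E(2)[where m=0] \<alpha> in \<open>auto intro!: holomorphic_intros C holomorphic_on_subset[OF E(1)] open_halfspace_Re_gt exI[of _ 1]\<close>)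
  then show ?thesis using E(2)[OF m] by simp
qed

lemma deriv_chain_square_has_vector_derivative:
  assumes "deriv_chain h"
  shows "((\<lambda>s. C * h j (s\<^sup>2)) has_vector_derivative of_real (2 * s) * (C * h (Suc j) (s\<^sup>2))) (at s)"
proof -
  have "((\<lambda>s. s\<^sup>2) has_vector_derivative 2 * s) (at s)"
    by (auto intro!: derivative_eq_intros simp flip: has_real_derivative_iff_has_vector_derivative)
  from vector_diff_chain_at[OF this, of "h j" "h (Suc j) (s\<^sup>2)"]
  have "((\<lambda>s. h j (s\<^sup>2)) has_vector_derivative (2 * s) *\<^sub>R h (Suc j) (s\<^sup>2)) (at s)"
    using assms by (simp add: deriv_chain_def o_def)
  from has_vector_derivative_mult_right[OF this, of C]
  show ?thesis by (simp add: scaleR_conv_of_real mult_ac)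
qed

text \<open>In operator form \<psi> is C I^(\<alpha>+m) exp(-cI) applied to the m-th derivative of
  g, and the Erdelyi-Kober integral of order m' - \<alpha> is I^(m'-\<alpha>) exp(cI). Their
  composite is I^(m'+m), which undoes the m derivatives and leaves an m'-fold primitive of g; the m'
  applications of \<open>D\<close> return g.\<close>

lemma EK_inversion:
  assumes g: "deriv_chain g" and lam: "lam \<ge> 0" and m: "\<alpha> + real m > 0" and t: "t > 0"
    and \<psi>: "\<And>r. r > 0 \<Longrightarrow> \<psi> r = C * RL_exp (of_real \<alpha> + of_nat m) (- (lam\<^sup>2 / 4)) (g m) (r\<^sup>2)"
  shows "EK (- of_real \<alpha>) lam \<psi> t = C * g 0 (t\<^sup>2)"
proof -
  define c where "c = lam\<^sup>2 / 4"
  define m' where "m' = (LEAST m'::nat. Re (- of_real \<alpha>) + real m' > 0)"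
  obtain k0 :: nat where "real k0 > \<alpha>" using reals_Archimedean2 by blast
  then have m': "real m' - \<alpha> > 0"
    using LeastI[of "\<lambda>m'::nat. Re (- of_real \<alpha>) + real m' > 0" k0] by (simp add: m'_def)
  \<comment> \<open>The m'-fold primitive of g, so that the final application of
    \<open>D ^^ m'\<close> is a shift of index.\<close>
  obtain h where h: "deriv_chain h" "\<And>k. h (m' + k) = g k" using deriv_chain_primitive[OF g] by blast
  \<comment> \<open>Nothing is known about \<psi> on r <= 0, while measurability is required on the
    whole line; cutting off at 0 leaves the integral over (0,s) unchanged.\<close>
  define \<psi>' where "\<psi>' r = (if r > 0 then \<psi> r else 0)" for r
  let ?q = "complex_of_real (\<alpha> + real m)"
  let ?p = "complex_of_real (real m' - \<alpha>)"
  have q: "?q = of_real \<alpha> + of_nat m" and p: "?p = - of_real \<alpha> + of_nat m'" by simp_all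
  have gm[measurable]: "g m \<in> borel_measurable borel" by (rule deriv_chain_measurable[OF g])
  have s\<psi>': "(\<lambda>s. \<psi>' (sqrt s)) = (\<lambda>s. if s > 0 then C * RL_exp ?q (- c) (g m) s else 0)"
    by (auto simp: \<psi>'_def \<psi> c_def)
  have EKI: "EK_integral ?p lam \<psi> s = C * h 0 (s\<^sup>2)" if s: "s > 0" for s
  proof -
    define T where "T = s\<^sup>2"
    have T: "T > 0" using s by (simp add: T_def)
    obtain B where B: "\<And>s. 0 < s \<Longrightarrow> s < T \<Longrightarrow> norm (g m s) \<le> B" using deriv_chain_bounded[OF g] by blast
    define K where "K = max (norm (rGamma ?q)) (norm (rGamma (?q + 1))) * (B * T powr Re ?q / Re ?q)"
    have sM: "summable (\<lambda>k. \<bar>c\<bar> ^ k / fact k * (K * T ^ k))"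
      using summable_mult[OF summable_exp_real[of "\<bar>c\<bar> * T"], of K] by (simp add: power_mult_distrib mult_ac)
    have bd: "norm (RL_exp ?q (- c) (g m) S) \<le> (\<Sum>k. \<bar>c\<bar> ^ k / fact k * (K * T ^ k))" if "0 < S" "S < T" for S
      unfolding RL_exp_def
    proof (rule norm_suminf_le[OF _ sM])
      fix k
      have "norm (RL (?q + of_nat k) (g m) S) \<le> K * T ^ k"
        unfolding K_def by (rule norm_RL_add_nat_le[OF _ gm B]) (use that m in auto)
      then show "norm (of_real ((- c) ^ k / fact k) * RL (?q + of_nat k) (g m) S) \<le> \<bar>c\<bar> ^ k / fact k * (K * T ^ k)"
        unfolding norm_mult by (intro mult_mono) (auto simp: norm_divide norm_power)
    qed
    have "EK_integral ?p lam \<psi> s = EK_integral ?p lam \<psi>' s"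
      unfolding EK_integral_def
      by (intro if_cong refl arg_cong2[where f="times"] set_lebesgue_integral_cong) (auto simp: \<psi>'_def)
    also have "\<dots> = RL_exp ?p c (\<lambda>s. \<psi>' (sqrt s)) T"
      unfolding c_def T_def
    proof (rule EK_integral_eq_RL_exp[OF _ _ _ s lam])
      show "norm (\<psi>' (sqrt r)) \<le> norm C * (\<Sum>k. \<bar>c\<bar> ^ k / fact k * (K * T ^ k))" if "0 < r" "r < s\<^sup>2" for r
        using fun_cong[OF s\<psi>', of r] bd[of r] that by (simp add: norm_mult mult_left_mono T_def)
      show "(\<lambda>s. \<psi>' (sqrt s)) \<in> borel_measurable borel" unfolding s\<psi>' by measurable
    qed (use m' in simp)
    also have "\<dots> = RL_exp ?p c (\<lambda>s. C * RL_exp ?q (- c) (g m) s) T"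
      unfolding s\<psi>' by (rule RL_exp_cong) simp
    also have "\<dots> = C * RL_exp ?p c (RL_exp ?q (- c) (g m)) T"
      by (rule RL_exp_cmult[OF _ _ bd T]) (use m' in auto)
    also have "RL_exp ?p c (RL_exp ?q (- c) (g m)) T = RL (of_real ((real m' - \<alpha>) + (\<alpha> + real m))) (g m) T"
      by (rule RL_exp_comp[OF m' m gm B T])
    also have "\<dots> = RL (of_nat (m' + m)) (h (m' + m)) T" by (simp add: h(2))
    \<comment> \<open>The total order m' + m is positive because m' > \<alpha> > -m, so
      \<open>RL_deriv_chain\<close> applies with predecessor m' + m - 1.\<close>
    also have "\<dots> = h 0 T"
      using RL_deriv_chain[OF h(1) T, of "m' + m - 1"] m m' by (cases "m' + m") auto
    finally show ?thesis by (simp add: T_def)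
  qed
  have "(D ^^ m') (EK_integral ?p lam \<psi>) t = C * h m' (t\<^sup>2)"
    by (rule D_funpow_eq[where \<phi>="\<lambda>j t. C * h j (t\<^sup>2)"])
      (use deriv_chain_square_has_vector_derivative[OF h(1)] EKI t in auto)
  then show ?thesis
    using h(2)[of 0] unfolding EK_def Let_def m'_def[symmetric] p by simp
qed

section \<open>Surface measure on the unit sphere\<close>

lemma measurable_sgn_sphere:
  "sgn \<in> measurable (restrict_space lborel (ball 0 1 - {0::'a::euclidean_space})) (restrict_space borel (sphere 0 1))"
proof (rule measurable_restrict_space2)
  show "sgn \<in> space (restrict_space lborel (ball 0 1 - {0::'a})) \<rightarrow> sphere 0 1"
    by (auto simp: space_restrict_space norm_sgn)
  have "(\<lambda>x::'a. x /\<^sub>R norm x) \<in> borel_measurable borel" by measurable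
  then show "sgn \<in> borel_measurable (restrict_space lborel (ball 0 1 - {0::'a}))"
    by (intro measurable_restrict_space1) (simp add: sgn_div_norm[abs_def])
qed

lemma space_sphere_measure [simp]: "space (sphere_measure :: (real ^ 'n) measure) = sphere 0 1"
  by (simp add: sphere_measure_def space_restrict_space space_scale_measure)

lemma sets_sphere_measure [measurable_cong]: "sets (sphere_measure :: (real ^ 'n) measure) = sets (restrict_space borel (sphere 0 1))"
  by (simp add: sphere_measure_def)

lemma borel_measurable_sphere_measureI:
  "f \<in> borel_measurable borel \<Longrightarrow> f \<in> borel_measurable (sphere_measure :: (real ^ 'n) measure)"
  by (subst measurable_cong_sets[OF sets_sphere_measure refl]) (rule measurable_restrict_space1)

lemma measurable_ident_sphere_measure [measurable]: "(\<lambda>x. x) \<in> measurable (sphere_measure :: (real ^ 'n) measure) borel"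
  by (rule borel_measurable_sphere_measureI) simp

lemma nn_integral_sphere_measure:
  fixes h :: "real ^ 'n \<Rightarrow> ennreal"
  assumes [measurable]: "h \<in> borel_measurable borel"
  shows "(\<integral>\<^sup>+\<theta>. h \<theta> \<partial>sphere_measure) = of_nat CARD('n) * (\<integral>\<^sup>+y. h (sgn y) * indicator (ball 0 1 - {0}) y \<partial>lborel)"
proof -
  have "(\<integral>\<^sup>+\<theta>. h \<theta> \<partial>sphere_measure) = of_nat CARD('n) *
     (\<integral>\<^sup>+\<theta>. h \<theta> \<partial>distr (restrict_space lborel (ball 0 1 - {0::real^'n})) (restrict_space borel (sphere 0 1)) sgn)"
    unfolding sphere_measure_def by (rule nn_integral_scale_measure) (auto intro: measurable_restrict_space1)
  also have "(\<integral>\<^sup>+\<theta>. h \<theta> \<partial>distr (restrict_space lborel (ball 0 1 - {0::real^'n})) (restrict_space borel (sphere 0 1)) sgn)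
     = (\<integral>\<^sup>+y. h (sgn y) \<partial>restrict_space lborel (ball 0 1 - {0}))"
    by (rule nn_integral_distr[OF measurable_sgn_sphere]) (auto intro: measurable_restrict_space1)
  also have "\<dots> = (\<integral>\<^sup>+y. h (sgn y) * indicator (ball 0 1 - {0}) y \<partial>lborel)"
    by (rule nn_integral_restrict_space) auto
  finally show ?thesis .
qed

lemma emeasure_sphere_measure_space:
  "emeasure (sphere_measure :: (real ^ 'n) measure) (sphere 0 1) = ennreal (sphere_area CARD('n))"
proof -
  have "emeasure (sphere_measure :: (real ^ 'n) measure) (sphere 0 1) = (\<integral>\<^sup>+\<theta>. 1 \<partial>(sphere_measure :: (real ^ 'n) measure))"
    by (simp flip: space_sphere_measure)
  also have "\<dots> = of_nat CARD('n) * (\<integral>\<^sup>+y. indicator (ball 0 1 - {0::real^'n}) y \<partial>lborel)"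
    by (subst nn_integral_sphere_measure) auto
  also have "(\<integral>\<^sup>+y. indicator (ball 0 1 - {0::real^'n}) y \<partial>lborel) = (\<integral>\<^sup>+y. indicator (ball 0 1 :: (real^'n) set) y \<partial>lborel)"
    by (rule nn_integral_cong_AE) (use AE_lborel_singleton[of "0::real^'n"] in \<open>eventually_elim, auto simp: indicator_def\<close>)
  also have "\<dots> = ennreal (unit_ball_vol (real CARD('n)))"
    using emeasure_ball[of 1 "0::real^'n"] by simp
  also have "of_nat CARD('n) * ennreal (unit_ball_vol (real CARD('n))) = ennreal (real CARD('n) * unit_ball_vol (real CARD('n)))"
    by (simp add: ennreal_mult ennreal_of_nat_eq_real_of_nat)
  \<comment> \<open>Gamma(n/2 + 1) = (n/2) Gamma(n/2) turns n times the ball volume into 2 pi^(n/2)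
    / Gamma(n/2).\<close>
  also have "real CARD('n) * unit_ball_vol (real CARD('n)) = sphere_area CARD('n)"
  proof -
    have h: "real CARD('n) / 2 > 0" by simp
    then have "real CARD('n) / 2 \<notin> \<int>\<^sub>\<le>\<^sub>0" using nonpos_Ints_nonpos[of "real CARD('n) / 2"] by linarith
    then have g: "Gamma (real CARD('n) / 2 + 1) = real CARD('n) / 2 * Gamma (real CARD('n) / 2)"
      by (rule Gamma_plus1)
    show ?thesis
      unfolding unit_ball_vol_def sphere_area_def g by simp
  qed
  finally show ?thesis .
qed

lemma finite_measure_sphere_measure: "finite_measure (sphere_measure :: (real ^ 'n) measure)"
  by (rule finite_measureI) (simp add: emeasure_sphere_measure_space)

interpretation sphere: finite_measure "sphere_measure :: (real ^ 'n) measure"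
  by (rule finite_measure_sphere_measure)

lemma sphere_area_pos: "n > 0 \<Longrightarrow> sphere_area n > 0"
  by (simp add: sphere_area_def Gamma_real_pos)

lemma measure_sphere_measure_space: "measure (sphere_measure :: (real ^ 'n) measure) (sphere 0 1) = sphere_area CARD('n)"
  using emeasure_sphere_measure_space[where 'n='n] sphere_area_pos[of "CARD('n)"] by (simp add: measure_def)

lemma nn_integral_lborel_scaleR:
  fixes h :: "'a::euclidean_space \<Rightarrow> ennreal"
  assumes [measurable]: "h \<in> borel_measurable borel" and c: "c > 0"
  shows "(\<integral>\<^sup>+y. h (c *\<^sub>R y) \<partial>lborel) = ennreal (inverse c ^ DIM('a)) * (\<integral>\<^sup>+y. h y \<partial>lborel)"
proof -
  have "(\<integral>\<^sup>+y. h y \<partial>lborel) = ennreal (c ^ DIM('a)) * (\<integral>\<^sup>+y. h (c *\<^sub>R y) \<partial>lborel)"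
    using c by (subst lborel_affine[of c 0]) (simp_all add: nn_integral_density nn_integral_distr nn_integral_cmult)
  then have "ennreal (inverse c ^ DIM('a)) * (\<integral>\<^sup>+y. h y \<partial>lborel) = (ennreal (inverse c ^ DIM('a)) * ennreal (c ^ DIM('a))) * (\<integral>\<^sup>+y. h (c *\<^sub>R y) \<partial>lborel)"
    by (simp add: mult.assoc)
  also have "ennreal (inverse c ^ DIM('a)) * ennreal (c ^ DIM('a)) = 1"
    using c by (simp flip: ennreal_mult power_mult_distrib)
  finally show ?thesis by simp
qed

section \<open>Polar coordinates and moments of the sphere\<close>

text \<open>The radial density r^(n-1) dr written in s = r^2, the coordinate in which
  \<open>D\<close> is d/ds.\<close>

definition polar_weight :: "nat \<Rightarrow> real \<Rightarrow> real" where
  "polar_weight n s = (if s > 0 then s powr (real n / 2 - 1) / 2 else 0)"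

lemma polar_weight_nonneg [simp]: "polar_weight n s \<ge> 0"
  by (simp add: polar_weight_def)

lemma borel_measurable_polar_weight [measurable]: "polar_weight n \<in> borel_measurable borel"
  unfolding polar_weight_def by measurable

text \<open>The surface measure is given by cones, so the right side is an integral over s and over
  y in the unit ball. Replacing s by |y|^2 s removes the normalisation of y, replacing y by z / sqrt
  s brings out F(z), and Tonelli leaves a radial integral equal to 1.\<close>

lemma nn_integral_polar:
  fixes F :: "real ^ 'n \<Rightarrow> ennreal"
  assumes [measurable]: "F \<in> borel_measurable borel"
  shows "(\<integral>\<^sup>+y. F y \<partial>lborel) = (\<integral>\<^sup>+s. ennreal (polar_weight CARD('n) s) * (\<integral>\<^sup>+\<omega>. F (sqrt s *\<^sub>R \<omega>) \<partial>sphere_measure) \<partial>lborel)"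
proof -
  define n where "n = CARD('n)"
  have n: "n > 0" by (simp add: n_def)
  let ?w = "polar_weight n"
  let ?B = "ball 0 1 - {0} :: (real ^ 'n) set"
  have [measurable]: "(\<lambda>x::real^'n. sgn x) \<in> borel_measurable borel"
    unfolding sgn_div_norm[abs_def] by measurable
  have [measurable]: "?B \<in> sets borel" by simp
  have s1: "(\<integral>\<^sup>+s. ennreal (?w s) * F (sqrt s *\<^sub>R sgn y) \<partial>lborel) = ennreal (norm y ^ n) * (\<integral>\<^sup>+s. ennreal (?w s) * F (sqrt s *\<^sub>R y) \<partial>lborel)"
    if y: "y \<in> ?B" for y
  proof -
    have ny: "norm y > 0" using y by simp
    then have "(\<integral>\<^sup>+s. ennreal (?w s) * F (sqrt s *\<^sub>R sgn y) \<partial>lborel) = ennreal ((norm y)\<^sup>2) * (\<integral>\<^sup>+s. ennreal (?w ((norm y)\<^sup>2 * s)) * F (sqrt ((norm y)\<^sup>2 * s) *\<^sub>R sgn y) \<partial>lborel)"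
      using y by (subst nn_integral_real_affine[where c="(norm y)\<^sup>2" and t=0]) auto
    also have "\<dots> = (\<integral>\<^sup>+s. ennreal ((norm y)\<^sup>2) * (ennreal (?w ((norm y)\<^sup>2 * s)) * F (sqrt ((norm y)\<^sup>2 * s) *\<^sub>R sgn y)) \<partial>lborel)"
      by (rule nn_integral_cmult[symmetric]) measurable
    also have "\<dots> = (\<integral>\<^sup>+s. ennreal (norm y ^ n) * (ennreal (?w s) * F (sqrt s *\<^sub>R y)) \<partial>lborel)"
    proof (rule nn_integral_cong)
      fix s
      have "(norm y)\<^sup>2 * ?w ((norm y)\<^sup>2 * s) = norm y ^ n * ?w s"
      proof (cases "s > 0")
        case True
        have "(norm y)\<^sup>2 * ((norm y)\<^sup>2 * s) powr (real n / 2 - 1) = (norm y)\<^sup>2 * (norm y) powr (real n - 2) * s powr (real n / 2 - 1)"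
          using ny True powr_powr[of "norm y" 2 "real n / 2 - 1"] by (simp add: powr_mult algebra_simps)
        also have "(norm y)\<^sup>2 * (norm y) powr (real n - 2) = norm y ^ n"
          using ny by (simp add: powr_diff powr_realpow)
        finally show ?thesis using True ny by (simp add: polar_weight_def)
      qed (use ny in \<open>simp add: polar_weight_def zero_less_mult_iff\<close>)
      moreover have "sqrt ((norm y)\<^sup>2 * s) *\<^sub>R sgn y = sqrt s *\<^sub>R y"
        using ny by (simp add: real_sqrt_mult sgn_div_norm)
      ultimately show "ennreal ((norm y)\<^sup>2) * (ennreal (?w ((norm y)\<^sup>2 * s)) * F (sqrt ((norm y)\<^sup>2 * s) *\<^sub>R sgn y)) = ennreal (norm y ^ n) * (ennreal (?w s) * F (sqrt s *\<^sub>R y))"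
        by (simp add: ennreal_mult[symmetric] mult.assoc[symmetric])
    qed
    also have "\<dots> = ennreal (norm y ^ n) * (\<integral>\<^sup>+s. ennreal (?w s) * F (sqrt s *\<^sub>R y) \<partial>lborel)"
      by (rule nn_integral_cmult) measurable
    finally show ?thesis .
  qed
  have s2: "ennreal (?w s) * (\<integral>\<^sup>+y. ennreal (norm y ^ n) * F (sqrt s *\<^sub>R y) * indicator ?B y \<partial>lborel)
     = (\<integral>\<^sup>+z. F z * (ennreal (norm z ^ n) * (indicator {z. z \<noteq> 0 \<and> (norm z)\<^sup>2 < s} z * ennreal (s powr (- real n / 2 - 1) / 2))) \<partial>lborel)" for s
  proof (cases "s > 0")
    case True
    have "(\<integral>\<^sup>+y. ennreal (norm y ^ n) * F (sqrt s *\<^sub>R y) * indicator ?B y \<partial>lborel)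
      = (\<integral>\<^sup>+y. (\<lambda>z. ennreal (norm z ^ n) * ennreal (s powr (- real n / 2)) * F z * indicator {z. z \<noteq> 0 \<and> (norm z)\<^sup>2 < s} z) (sqrt s *\<^sub>R y) \<partial>lborel)"
    proof (rule nn_integral_cong)
      fix y :: "real ^ 'n"
      have "norm (sqrt s *\<^sub>R y) ^ n * s powr (- real n / 2) = norm y ^ n"
        using True by (simp add: power_mult_distrib powr_realpow[symmetric] powr_half_sqrt[symmetric] powr_powr powr_minus field_simps)
      then have "ennreal (norm (sqrt s *\<^sub>R y) ^ n) * ennreal (s powr (- real n / 2)) = ennreal (norm y ^ n)"
        by (simp flip: ennreal_mult)
      moreover have "(norm (sqrt s *\<^sub>R y))\<^sup>2 < s \<longleftrightarrow> norm y < 1"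
        using True by (simp add: power_mult_distrib abs_square_less_1)
      ultimately show "ennreal (norm y ^ n) * F (sqrt s *\<^sub>R y) * indicator ?B y = (\<lambda>z. ennreal (norm z ^ n) * ennreal (s powr (- real n / 2)) * F z * indicator {z. z \<noteq> 0 \<and> (norm z)\<^sup>2 < s} z) (sqrt s *\<^sub>R y)"
        using True by (auto simp: indicator_def)
    qed
    also have "\<dots> = ennreal (inverse (sqrt s) ^ n) * (\<integral>\<^sup>+z. ennreal (norm z ^ n) * ennreal (s powr (- real n / 2)) * F z * indicator {z. z \<noteq> 0 \<and> (norm z)\<^sup>2 < s} z \<partial>lborel)"
      using True by (subst nn_integral_lborel_scaleR) (simp_all add: n_def)
    finally have "ennreal (?w s) * (\<integral>\<^sup>+y. ennreal (norm y ^ n) * F (sqrt s *\<^sub>R y) * indicator ?B y \<partial>lborel)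
       = (\<integral>\<^sup>+z. ennreal (?w s) * ennreal (inverse (sqrt s) ^ n) * (ennreal (norm z ^ n) * ennreal (s powr (- real n / 2)) * F z * indicator {z. z \<noteq> 0 \<and> (norm z)\<^sup>2 < s} z) \<partial>lborel)"
      by (subst nn_integral_cmult) (simp_all add: mult.assoc)
    also have "\<dots> = (\<integral>\<^sup>+z. F z * (ennreal (norm z ^ n) * (indicator {z. z \<noteq> 0 \<and> (norm z)\<^sup>2 < s} z * ennreal (s powr (- real n / 2 - 1) / 2))) \<partial>lborel)"
    proof (rule nn_integral_cong)
      fix z :: "real ^ 'n"
      have "inverse (sqrt s) ^ n = s powr (- real n / 2)"
        using True by (simp add: powr_realpow[symmetric] powr_half_sqrt[symmetric] powr_powr powr_minus power_inverse)
      then have "?w s * inverse (sqrt s) ^ n * s powr (- real n / 2) = s powr (- real n / 2 - 1) / 2"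
        using True by (simp add: polar_weight_def powr_diff flip: powr_add)
      then have "ennreal (?w s) * ennreal (inverse (sqrt s) ^ n) * ennreal (s powr (- real n / 2)) = ennreal (s powr (- real n / 2 - 1) / 2)"
        using True by (simp flip: ennreal_mult)
      moreover have "A * B * (X * C * G * I) = G * (X * (I * E))" if "A * B * C = E" for A B C E G I X :: ennreal
        unfolding that[symmetric] by (simp only: mult_ac)
      ultimately show "ennreal (?w s) * ennreal (inverse (sqrt s) ^ n) * (ennreal (norm z ^ n) * ennreal (s powr (- real n / 2)) * F z * indicator {z. z \<noteq> 0 \<and> (norm z)\<^sup>2 < s} z)
        = F z * (ennreal (norm z ^ n) * (indicator {z. z \<noteq> 0 \<and> (norm z)\<^sup>2 < s} z * ennreal (s powr (- real n / 2 - 1) / 2)))"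
        by blast
    qed
    finally show ?thesis .
  next
    case False
    then have "\<not> (norm z)\<^sup>2 < s" for z :: "real^'n" by (meson not_less order_less_le_trans zero_le_power2 le_less_trans)
    then show ?thesis using False by (simp add: polar_weight_def)
  qed
  \<comment> \<open>For fixed z the remaining s ranges over s > |z|^2, and the integral of
    s^(-n/2-1) / 2 there is |z|^(-n) / n.\<close>
  have s3: "ennreal (norm z ^ n) * (\<integral>\<^sup>+s. indicator {z. z \<noteq> 0 \<and> (norm z)\<^sup>2 < s} z * ennreal (s powr (- real n / 2 - 1) / 2) \<partial>lborel) * of_nat n = 1"
    if z: "z \<noteq> 0" for z :: "real ^ 'n"
  proof -
    let ?a = "(norm z)\<^sup>2"
    have a: "?a > 0" using z by simp
    have "((\<lambda>x. x powr (- real n / 2 - 1)) has_integral -(?a powr ((- real n / 2 - 1) + 1)) / ((- real n / 2 - 1) + 1)) {?a..}"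
      by (rule has_integral_powr_to_inf) (use n a in auto)
    from has_integral_mult_left[OF this, of "1/2"]
    have "((\<lambda>x. x powr (- real n / 2 - 1) / 2) has_integral (?a powr (- real n / 2) / n)) {?a..}"
      using n by (simp add: field_simps)
    then have "(\<integral>\<^sup>+s. ennreal (indicator {?a..} s * (s powr (- real n / 2 - 1) / 2)) \<partial>lborel) = ennreal (?a powr (- real n / 2) / n)"
      by (intro nn_integral_has_integral_lebesgue) auto
    moreover have "(\<integral>\<^sup>+s. indicator {z. z \<noteq> 0 \<and> (norm z)\<^sup>2 < s} z * ennreal (s powr (- real n / 2 - 1) / 2) \<partial>lborel) = (\<integral>\<^sup>+s. ennreal (indicator {?a..} s * (s powr (- real n / 2 - 1) / 2)) \<partial>lborel)"
      by (rule nn_integral_cong_AE, rule AE_mp[OF AE_lborel_singleton[of ?a]]) (use z in \<open>auto simp: indicator_def intro!: AE_I2\<close>)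
    moreover have "norm z ^ n * (?a powr (- real n / 2) / n) * n = 1"
      using z n powr_powr[of "norm z" 2 "- real n / 2"] by (simp add: powr_minus powr_realpow)
    ultimately show ?thesis
      by (simp add: ennreal_of_nat_eq_real_of_nat flip: ennreal_mult)
  qed
  have "(\<integral>\<^sup>+s. ennreal (?w s) * (\<integral>\<^sup>+\<omega>. F (sqrt s *\<^sub>R \<omega>) \<partial>sphere_measure) \<partial>lborel)
     = (\<integral>\<^sup>+s. (\<integral>\<^sup>+y. of_nat n * (ennreal (?w s) * F (sqrt s *\<^sub>R sgn y) * indicator ?B y) \<partial>lborel) \<partial>lborel)"
  proof (rule nn_integral_cong)
    fix s
    have "(\<integral>\<^sup>+y. of_nat n * (ennreal (?w s) * F (sqrt s *\<^sub>R sgn y) * indicator ?B y) \<partial>lborel)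
      = (\<integral>\<^sup>+y. (of_nat n * ennreal (?w s)) * (F (sqrt s *\<^sub>R sgn y) * indicator ?B y) \<partial>lborel)"
      by (simp only: mult.assoc)
    also have "\<dots> = (of_nat n * ennreal (?w s)) * (\<integral>\<^sup>+y. F (sqrt s *\<^sub>R sgn y) * indicator ?B y \<partial>lborel)"
      by (rule nn_integral_cmult) (intro borel_measurable_times_ennreal measurable_compose[OF _ assms] borel_measurable_indicator; simp)
    also have "\<dots> = ennreal (?w s) * (\<integral>\<^sup>+\<omega>. F (sqrt s *\<^sub>R \<omega>) \<partial>sphere_measure)"
      by (subst nn_integral_sphere_measure) (simp_all add: n_def mult_ac)
    finally show "ennreal (?w s) * (\<integral>\<^sup>+\<omega>. F (sqrt s *\<^sub>R \<omega>) \<partial>sphere_measure) = (\<integral>\<^sup>+y. of_nat n * (ennreal (?w s) * F (sqrt s *\<^sub>R sgn y) * indicator ?B y) \<partial>lborel)" ..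
  qed
  also have "\<dots> = (\<integral>\<^sup>+y. (\<integral>\<^sup>+s. of_nat n * (ennreal (?w s) * F (sqrt s *\<^sub>R sgn y) * indicator ?B y) \<partial>lborel) \<partial>lborel)"
    by (rule lborel_pair.Fubini') measurable
  also have "\<dots> = (\<integral>\<^sup>+y. (\<integral>\<^sup>+s. of_nat n * (ennreal (?w s) * (ennreal (norm y ^ n) * F (sqrt s *\<^sub>R y) * indicator ?B y)) \<partial>lborel) \<partial>lborel)"
  proof (rule nn_integral_cong)
    fix y :: "real ^ 'n"
    show "(\<integral>\<^sup>+s. of_nat n * (ennreal (?w s) * F (sqrt s *\<^sub>R sgn y) * indicator ?B y) \<partial>lborel) = (\<integral>\<^sup>+s. of_nat n * (ennreal (?w s) * (ennreal (norm y ^ n) * F (sqrt s *\<^sub>R y) * indicator ?B y)) \<partial>lborel)"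
      using s1[of y] by (cases "y \<in> ?B") (simp_all add: nn_integral_cmult mult.left_commute[of _ "ennreal (norm y ^ n)"])
  qed
  also have "\<dots> = (\<integral>\<^sup>+s. (\<integral>\<^sup>+y. of_nat n * (ennreal (?w s) * (ennreal (norm y ^ n) * F (sqrt s *\<^sub>R y) * indicator ?B y)) \<partial>lborel) \<partial>lborel)"
    by (rule lborel_pair.Fubini'[symmetric]) measurable
  also have "\<dots> = (\<integral>\<^sup>+s. (\<integral>\<^sup>+z. of_nat n * (F z * (ennreal (norm z ^ n) * (indicator {z. z \<noteq> 0 \<and> (norm z)\<^sup>2 < s} z * ennreal (s powr (- real n / 2 - 1) / 2)))) \<partial>lborel) \<partial>lborel)"
    using s2 by (simp add: nn_integral_cmult)
  also have "\<dots> = (\<integral>\<^sup>+z. (\<integral>\<^sup>+s. of_nat n * (F z * (ennreal (norm z ^ n) * (indicator {z. z \<noteq> 0 \<and> (norm z)\<^sup>2 < s} z * ennreal (s powr (- real n / 2 - 1) / 2)))) \<partial>lborel) \<partial>lborel)"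
    by (rule lborel_pair.Fubini') (unfold indicator_def, measurable)
  also have "\<dots> = (\<integral>\<^sup>+z. F z \<partial>lborel)"
  proof (rule nn_integral_cong_AE)
    show "AE z in lborel. (\<integral>\<^sup>+s. of_nat n * (F z * (ennreal (norm z ^ n) * (indicator {z. z \<noteq> 0 \<and> (norm z)\<^sup>2 < s} z * ennreal (s powr (- real n / 2 - 1) / 2)))) \<partial>lborel) = F z"
      using AE_lborel_singleton[of "0::real^'n"]
    proof eventually_elim
      fix z :: "real ^ 'n" assume z: "z \<noteq> 0"
      have [measurable]: "(\<lambda>s. indicator {z. z \<noteq> 0 \<and> (norm z)\<^sup>2 < s} z :: ennreal) \<in> borel_measurable borel"
        unfolding indicator_def by measurable
      show "(\<integral>\<^sup>+s. of_nat n * (F z * (ennreal (norm z ^ n) * (indicator {z. z \<noteq> 0 \<and> (norm z)\<^sup>2 < s} z * ennreal (s powr (- real n / 2 - 1) / 2)))) \<partial>lborel) = F z"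
      proof -
        have "of_nat n * (F z * (N * I)) = F z" if "N * I * of_nat n = 1" for N I :: ennreal
        proof -
          have "of_nat n * (F z * (N * I)) = F z * (N * I * of_nat n)" by (simp only: mult_ac)
          then show ?thesis unfolding that by simp
        qed
        then show ?thesis using s3[OF z] by (simp add: nn_integral_cmult)
      qed
    qed
  qed
  finally show ?thesis by (simp add: n_def)
qed

definition polar_measure :: "nat \<Rightarrow> real measure" where
  "polar_measure n = density lborel (\<lambda>s. ennreal (polar_weight n s))"

lemma sets_polar_measure [measurable_cong, simp]: "sets (polar_measure n) = sets borel"
  by (simp add: polar_measure_def)

lemma sigma_finite_polar_measure: "sigma_finite_measure (polar_measure n)"
  unfolding polar_measure_def by (subst sigma_finite_measure.sigma_finite_iff_density_finite[OF sigma_finite_lborel]) auto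

lemma pair_sigma_finite_polar: "pair_sigma_finite (polar_measure n) (sphere_measure :: (real ^ 'n) measure)"
  by (intro pair_sigma_finite.intro sigma_finite_polar_measure) (rule sphere.sigma_finite_measure_axioms)

lemma measurable_polar_map [measurable]:
  "(\<lambda>(s, \<omega>). sqrt s *\<^sub>R \<omega>) \<in> borel_measurable (polar_measure n \<Otimes>\<^sub>M (sphere_measure :: (real ^ 'n) measure))"
  by measurable

text \<open>Polar coordinates as a push-forward identity: Bochner integrals of vector-valued
  functions then follow from Fubini on the product measure.\<close>

lemma lborel_eq_polar:
  "(lborel :: (real ^ 'n) measure) = distr (polar_measure CARD('n) \<Otimes>\<^sub>M sphere_measure) borel (\<lambda>(s, \<omega>). sqrt s *\<^sub>R \<omega>)"
proof (rule measure_eqI)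
  interpret pair_sigma_finite "polar_measure CARD('n)" "sphere_measure :: (real ^ 'n) measure"
    by (rule pair_sigma_finite_polar)
  fix A :: "(real ^ 'n) set" assume "A \<in> sets lborel"
  then have [measurable]: "A \<in> sets borel" by simp
  have "emeasure (distr (polar_measure CARD('n) \<Otimes>\<^sub>M sphere_measure) borel (\<lambda>(s, \<omega>). sqrt s *\<^sub>R \<omega>)) A
     = (\<integral>\<^sup>+y. indicator A y \<partial>distr (polar_measure CARD('n) \<Otimes>\<^sub>M sphere_measure) borel (\<lambda>(s, \<omega>). sqrt s *\<^sub>R \<omega>))"
    by simp
  also have "\<dots> = (\<integral>\<^sup>+x. indicator A (case x of (s, \<omega>) \<Rightarrow> sqrt s *\<^sub>R \<omega>) \<partial>(polar_measure CARD('n) \<Otimes>\<^sub>M sphere_measure))"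
    by (rule nn_integral_distr[OF measurable_polar_map]) simp
  also have "\<dots> = (\<integral>\<^sup>+s. (\<integral>\<^sup>+\<omega>. indicator A (sqrt s *\<^sub>R \<omega>) \<partial>sphere_measure) \<partial>polar_measure CARD('n))"
    by (subst sigma_finite_measure.nn_integral_fst[OF sphere.sigma_finite_measure_axioms, symmetric]) simp_all
  also have "\<dots> = (\<integral>\<^sup>+s. ennreal (polar_weight CARD('n) s) * (\<integral>\<^sup>+\<omega>. indicator A (sqrt s *\<^sub>R \<omega>) \<partial>sphere_measure) \<partial>lborel)"
    unfolding polar_measure_def by (rule nn_integral_density) measurable
  also have "\<dots> = emeasure lborel A"
    by (subst nn_integral_polar[symmetric]) simp_all
  finally show "emeasure lborel A = emeasure (distr (polar_measure CARD('n) \<Otimes>\<^sub>M sphere_measure) borel (\<lambda>(s, \<omega>). sqrt s *\<^sub>R \<omega>)) A" ..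
qed simp

lemma
  fixes F :: "real ^ 'n \<Rightarrow> 'a::{banach, second_countable_topology}"
  assumes F: "integrable lborel F"
  shows integral_polar: "(\<integral>y. F y \<partial>lborel) = (\<integral>s. polar_weight CARD('n) s *\<^sub>R (\<integral>\<omega>. F (sqrt s *\<^sub>R \<omega>) \<partial>sphere_measure) \<partial>lborel)"
    and integrable_polar: "integrable lborel (\<lambda>s. polar_weight CARD('n) s *\<^sub>R (\<integral>\<omega>. F (sqrt s *\<^sub>R \<omega>) \<partial>sphere_measure))"
proof -
  interpret pair_sigma_finite "polar_measure CARD('n)" "sphere_measure :: (real ^ 'n) measure"
    by (rule pair_sigma_finite_polar)
  have [measurable]: "F \<in> borel_measurable borel" using F by simp
  have "integrable (distr (polar_measure CARD('n) \<Otimes>\<^sub>M sphere_measure) borel (\<lambda>(s, \<omega>). sqrt s *\<^sub>R \<omega>)) F"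
    using F by (subst lborel_eq_polar[symmetric])
  then have i: "integrable (polar_measure CARD('n) \<Otimes>\<^sub>M (sphere_measure :: (real ^ 'n) measure)) (\<lambda>(s, \<omega>). F (sqrt s *\<^sub>R \<omega>))"
    by (subst (asm) integrable_distr_eq) (auto simp: case_prod_unfold)
  have "(\<integral>y. F y \<partial>lborel) = (\<integral>y. F y \<partial>distr (polar_measure CARD('n) \<Otimes>\<^sub>M sphere_measure) borel (\<lambda>(s, \<omega>). sqrt s *\<^sub>R \<omega>))"
    by (subst lborel_eq_polar[symmetric]) simp
  also have "\<dots> = (\<integral>x. (case x of (s, \<omega>) \<Rightarrow> F (sqrt s *\<^sub>R \<omega>)) \<partial>(polar_measure CARD('n) \<Otimes>\<^sub>M sphere_measure))"
    by (subst integral_distr) (auto simp: case_prod_unfold)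
  also have "\<dots> = (\<integral>s. (\<integral>\<omega>. F (sqrt s *\<^sub>R \<omega>) \<partial>sphere_measure) \<partial>polar_measure CARD('n))"
    using integral_fst'[OF i] by simp
  also have "\<dots> = (\<integral>s. polar_weight CARD('n) s *\<^sub>R (\<integral>\<omega>. F (sqrt s *\<^sub>R \<omega>) \<partial>sphere_measure) \<partial>lborel)"
    unfolding polar_measure_def by (rule integral_density) auto
  finally show "(\<integral>y. F y \<partial>lborel) = (\<integral>s. polar_weight CARD('n) s *\<^sub>R (\<integral>\<omega>. F (sqrt s *\<^sub>R \<omega>) \<partial>sphere_measure) \<partial>lborel)" .
  have "integrable (polar_measure CARD('n)) (\<lambda>s. \<integral>\<omega>. F (sqrt s *\<^sub>R \<omega>) \<partial>sphere_measure)"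
    using integrable_fst'[OF i] by simp
  then show "integrable lborel (\<lambda>s. polar_weight CARD('n) s *\<^sub>R (\<integral>\<omega>. F (sqrt s *\<^sub>R \<omega>) \<partial>sphere_measure))"
    unfolding polar_measure_def by (subst (asm) integrable_density) auto
qed

lemma sphere_integrable_bounded:
  fixes h :: "real ^ 'n \<Rightarrow> 'a::{banach, second_countable_topology}"
  assumes "h \<in> borel_measurable borel" and "\<And>\<theta>. norm \<theta> = 1 \<Longrightarrow> norm (h \<theta>) \<le> B"
  shows "integrable sphere_measure h"
  by (rule sphere.integrable_const_bound[of _ B]) (use assms in \<open>auto intro!: AE_I2\<close>)

lemma sphere_integrable_continuous:
  fixes h :: "real ^ 'n \<Rightarrow> 'a::{banach, second_countable_topology}"
  assumes h: "continuous_on UNIV h"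
  shows "integrable sphere_measure h"
proof -
  have "bounded (h ` sphere 0 1)"
    by (intro compact_imp_bounded compact_continuous_image continuous_on_subset[OF h]) auto
  then obtain B where "\<forall>\<theta>\<in>sphere 0 1. norm (h \<theta>) \<le> B" unfolding bounded_iff by auto
  then show ?thesis
    by (intro sphere_integrable_bounded[of h B] borel_measurable_continuous_onI[OF h]) auto
qed

lemma sphere_integral_const [simp]: "(\<integral>\<theta>. (c::'a::{banach, second_countable_topology}) \<partial>(sphere_measure :: (real ^ 'n) measure)) = sphere_area CARD('n) *\<^sub>R c"
  by (simp add: measure_sphere_measure_space)

lemma norm_sphere_integral_le:
  fixes h :: "real ^ 'n \<Rightarrow> 'a::{banach, second_countable_topology}"
  assumes "\<And>\<theta>. norm \<theta> = 1 \<Longrightarrow> norm (h \<theta>) \<le> B" and "integrable sphere_measure h"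
  shows "norm (\<integral>\<theta>. h \<theta> \<partial>sphere_measure) \<le> sphere_area CARD('n) * B"
proof -
  have "norm (\<integral>\<theta>. h \<theta> \<partial>sphere_measure) \<le> (\<integral>\<theta>. norm (h \<theta>) \<partial>sphere_measure)" by (rule integral_norm_bound)
  also have "\<dots> \<le> (\<integral>\<theta>. B \<partial>(sphere_measure :: (real ^ 'n) measure))"
    by (rule integral_mono) (use assms in auto)
  finally show ?thesis by (simp add: measure_sphere_measure_space)
qed

lemma continuous_on_sphere_integral:
  fixes G :: "'a::metric_space \<Rightarrow> real ^ 'n \<Rightarrow> 'b::{banach, second_countable_topology}"
  assumes G: "continuous_on UNIV (\<lambda>(x, \<omega>). G x \<omega>)"
    and bd: "\<And>x \<omega>. norm \<omega> = 1 \<Longrightarrow> norm (G x \<omega>) \<le> B"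
  shows "continuous_on UNIV (\<lambda>x. \<integral>\<omega>. G x \<omega> \<partial>sphere_measure)"
  unfolding continuous_on_sequentially
proof (intro allI impI ballI)
  fix X :: "nat \<Rightarrow> 'a" and x assume X: "(\<forall>n. X n \<in> UNIV) \<and> X \<longlonglongrightarrow> x"
  have c: "continuous_on UNIV (G y)" for y
    using continuous_on_compose2[OF G, of UNIV "\<lambda>\<omega>. (y, \<omega>)"] by (simp add: continuous_intros)
  show "((\<lambda>x. \<integral>\<omega>. G x \<omega> \<partial>sphere_measure) \<circ> X) \<longlonglongrightarrow> (\<integral>\<omega>. G x \<omega> \<partial>sphere_measure)"
    unfolding o_def
  proof (rule integral_dominated_convergence[where w="\<lambda>_. B"])
    show "AE \<omega> in sphere_measure. (\<lambda>i. G (X i) \<omega>) \<longlonglongrightarrow> G x \<omega>"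
    proof (rule AE_I2)
      fix \<omega>
      have "continuous_on UNIV (\<lambda>x. G x \<omega>)"
        using continuous_on_compose2[OF G, of UNIV "\<lambda>x. (x, \<omega>)"] by (simp add: continuous_intros)
      then show "(\<lambda>i. G (X i) \<omega>) \<longlonglongrightarrow> G x \<omega>"
        using X unfolding continuous_on_sequentially o_def by auto
    qed
  qed (use bd c in \<open>auto intro!: AE_I2 borel_measurable_sphere_measureI borel_measurable_continuous_onI\<close>)
qed

lemma integrable_continuous_bounded_support:
  fixes f :: "'a::euclidean_space \<Rightarrow> 'b::{banach, second_countable_topology}"
  assumes f: "continuous_on UNIV f" and R: "\<And>x. norm x > R \<Longrightarrow> f x = 0"
  shows "integrable lborel f"
proof -
  have "integrable lborel (\<lambda>x. indicator (cball 0 R) x *\<^sub>R f x)"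
    by (rule borel_integrable_compact) (auto intro: continuous_on_subset[OF f])
  also have "(\<lambda>x. indicator (cball 0 R) x *\<^sub>R f x) = f"
    using R by (auto simp: indicator_def fun_eq_iff not_le)
  finally show ?thesis .
qed

lemma continuous_bounded_support_bounded:
  fixes f :: "'a::euclidean_space \<Rightarrow> 'b::real_normed_vector"
  assumes f: "continuous_on UNIV f" and R: "\<And>x. norm x > R \<Longrightarrow> f x = 0"
  obtains C where "C \<ge> 0" "\<And>x. norm (f x) \<le> C"
proof -
  have "bounded (f ` cball 0 R)"
    by (intro compact_imp_bounded compact_continuous_image continuous_on_subset[OF f]) auto
  then obtain C where C: "\<forall>x\<in>cball 0 R. norm (f x) \<le> C" unfolding bounded_iff by auto
  have "norm (f x) \<le> max C 0" for x
    using C R[of x] by (cases "norm x \<le> R") (auto simp: le_max_iff_disj)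
  then show ?thesis using that[of "max C 0"] by simp
qed

lemma lborel_integral_translate:
  fixes f :: "'a::euclidean_space \<Rightarrow> 'b::{banach, second_countable_topology}"
  assumes "f \<in> borel_measurable borel"
  shows "(\<integral>x. f (c + x) \<partial>lborel) = (\<integral>x. f x \<partial>lborel)"
proof -
  have "(\<integral>x. f x \<partial>lborel) = (\<integral>x. f x \<partial>distr lborel borel ((+) c))"
    unfolding lborel_distr_plus ..
  also have "\<dots> = (\<integral>x. f (c + x) \<partial>lborel)"
    by (rule integral_distr) (use assms in auto)
  finally show ?thesis ..
qed

text \<open>Translation invariance makes the integral of G(y + s a) constant in s; its derivative at
  s = 0, taken under the integral, is the integral of G'.\<close>

lemma integral_directional_derivative_eq_0:
  fixes G :: "'a::euclidean_space \<Rightarrow> 'b::{banach, second_countable_topology}"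
  assumes G: "continuous_on UNIV G" and G': "continuous_on UNIV G'"
    and der: "\<And>y. ((\<lambda>s. G (y + s *\<^sub>R a)) has_vector_derivative G' y) (at 0)"
    and R: "\<And>x. norm x > R \<Longrightarrow> G x = 0" "\<And>x. norm x > R \<Longrightarrow> G' x = 0"
  shows "(\<integral>y. G' y \<partial>lborel) = 0"
proof -
  obtain C where C: "C \<ge> 0" "\<And>x. norm (G' x) \<le> C"
    using continuous_bounded_support_bounded[OF G' R(2)] by blast
  have der': "((\<lambda>s. G (y + s *\<^sub>R a)) has_vector_derivative G' (y + s *\<^sub>R a)) (at s)" for y s
  proof -
    have "((\<lambda>u. u - s) has_vector_derivative 1) (at s)"
      by (auto intro!: derivative_eq_intros)
    from vector_diff_chain_at[OF this, of "\<lambda>u. G ((y + s *\<^sub>R a) + u *\<^sub>R a)" "G' (y + s *\<^sub>R a)"] der[of "y + s *\<^sub>R a"]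
    show ?thesis by (simp add: o_def algebra_simps)
  qed
  have c: "continuous_on UNIV (\<lambda>y. f (y + s *\<^sub>R a))" if "continuous_on UNIV f" for f :: "'a \<Rightarrow> 'b" and s
    using continuous_on_compose2[OF that, of UNIV "\<lambda>y. y + s *\<^sub>R a"] by (simp add: continuous_intros)
  have out: "norm (y + s *\<^sub>R a) > R" if "norm y > R + \<bar>s\<bar> * norm a" for y s
    using norm_triangle_ineq2[of y "- s *\<^sub>R a"] that by simp
  have "((\<lambda>s. \<integral>y. G (y + s *\<^sub>R a) \<partial>lborel) has_vector_derivative (\<integral>y. G' (y + 0 *\<^sub>R a) \<partial>lborel)) (at 0)"
  proof (rule has_vector_derivative_integral_dominated[where e=1 and B="\<lambda>y. indicator (cball 0 (R + norm a)) y *\<^sub>R C"])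
    show "integrable lborel (\<lambda>y. G (y + s *\<^sub>R a))" for s
      by (rule integrable_continuous_bounded_support[OF c[OF G], of "R + \<bar>s\<bar> * norm a"]) (use out R in blast)
    show "norm (G' (y + s *\<^sub>R a)) \<le> indicator (cball 0 (R + norm a)) y *\<^sub>R C" if "s \<in> ball 0 1" for s y
    proof (cases "norm y \<le> R + norm a")
      case False
      have "\<bar>s\<bar> * norm a \<le> 1 * norm a" using that by (intro mult_right_mono) auto
      then have "G' (y + s *\<^sub>R a) = 0" using False out[of s y] R by auto
      then show ?thesis using C by simp
    qed (use C in simp)
    show "integrable lborel (\<lambda>y::'a. indicator (cball 0 (R + norm a)) y *\<^sub>R C)"
      by (rule borel_integrable_compact) auto
  qed (use der' borel_measurable_continuous_onI[OF G'] in auto)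
  moreover have "(\<integral>y. G (y + s *\<^sub>R a) \<partial>lborel) = (\<integral>y. G y \<partial>lborel)" for s
    using lborel_integral_translate[OF borel_measurable_continuous_onI[OF G], of "s *\<^sub>R a"] by (simp add: add.commute)
  ultimately have "((\<lambda>s::real. (\<integral>y. G y \<partial>lborel)) has_vector_derivative (\<integral>y. G' y \<partial>lborel)) (at 0)"
    by simp
  moreover have "((\<lambda>s::real. (\<integral>y. G y \<partial>lborel)) has_vector_derivative 0) (at 0)"
    by (rule has_vector_derivative_const)
  ultimately show ?thesis by (rule vector_derivative_unique_at)
qed

lemma set_integrable_powr_unit:
  fixes A :: real
  assumes A: "A > 0"
  shows "set_integrable lborel {0<..<1} (\<lambda>s. s powr (A - 1))"
    and "(LINT s:{0<..<1}|lborel. s powr (A - 1)) = 1 / A"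
proof -
  have i: "has_bochner_integral lborel (\<lambda>s. indicator {0<..<1} s * (1 - s) powr (A - 1)) (1 / A)"
    using set_integrable_powr_diff[OF A, of 1] by (simp add: has_bochner_integral_iff set_integrable_def set_lebesgue_integral_def)
  have "has_bochner_integral lborel (\<lambda>s. indicator {0<..<1} s * s powr (A - 1)) (1 / A)"
    by (subst lborel_has_bochner_integral_real_affine_iff[of "-1" _ _ 1], simp)
       (use i in \<open>simp add: indicator_def conj_commute\<close>)
  then show "set_integrable lborel {0<..<1} (\<lambda>s. s powr (A - 1))"
    "(LINT s:{0<..<1}|lborel. s powr (A - 1)) = 1 / A"
    by (auto simp: has_bochner_integral_iff set_integrable_def set_lebesgue_integral_def)
qed

lemma integral_powr_times_one_minus:
  fixes A :: real
  assumes A: "A > 0"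
  shows "(LINT s:{0<..<1}|lborel. s powr (A - 1) * (1 - s) ^ 1) = 1 / (A * (A + 1))"
proof -
  have "(LINT s:{0<..<1}|lborel. s powr (A - 1) * (1 - s) ^ 1) = (LINT s:{0<..<1}|lborel. s powr (A - 1) - s powr ((A + 1) - 1))"
    by (rule set_lebesgue_integral_cong) (auto simp: powr_diff field_simps)
  also have "\<dots> = 1 / A - 1 / (A + 1)"
    using A set_integrable_powr_unit[of A] set_integrable_powr_unit[of "A+1"]
    by (subst set_integral_diff(2); simp)
  also have "\<dots> = 1 / (A * (A + 1))"
    using A by (simp add: divide_simps)
  finally show ?thesis .
qed

definition sphere_moment :: "real ^ 'n \<Rightarrow> nat \<Rightarrow> real" where
  "sphere_moment a j = (\<integral>\<theta>. (\<theta> \<bullet> a) ^ j \<partial>sphere_measure)"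

lemma sphere_moment_0: "sphere_moment (a :: real ^ 'n) 0 = sphere_area CARD('n)"
  by (simp add: sphere_moment_def measure_sphere_measure_space)

text \<open>A compactly supported radial weight turns a moment of the sphere into a volume integral,
  where integration by parts is available. The exponent A - 1 collects n/2 - 1 from the polar weight
  and j/2 from the homogeneity of (y . a)^j.\<close>

lemma integral_radial_moment:
  fixes a :: "real ^ 'n" and m :: nat
  assumes A: "A = (real CARD('n) + real j) / 2" and m: "m > 0"
  shows "(\<integral>y. (y \<bullet> a) ^ j * (max 0 (1 - (norm y)\<^sup>2)) ^ m \<partial>lborel) 
     = (LINT s:{0<..<1}|lborel. s powr (A - 1) * (1 - s) ^ m) / 2 * sphere_moment a j"
proof -
  have "continuous_on UNIV (\<lambda>y. (y \<bullet> a) ^ j * (max 0 (1 - (norm y)\<^sup>2)) ^ m)"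
    by (intro continuous_intros)
  moreover have "(y \<bullet> a) ^ j * (max 0 (1 - (norm y)\<^sup>2)) ^ m = 0" if "norm y > 1" for y
  proof -
    have "1 < (norm y)\<^sup>2" using that by (simp add: one_less_power)
    then show ?thesis using m by simp
  qed
  ultimately have "integrable lborel (\<lambda>y. (y \<bullet> a) ^ j * (max 0 (1 - (norm y)\<^sup>2)) ^ m)"
    by (rule integrable_continuous_bounded_support)
  from integral_polar[OF this]
  have "(\<integral>y. (y \<bullet> a) ^ j * (max 0 (1 - (norm y)\<^sup>2)) ^ m \<partial>lborel)
     = (\<integral>s. polar_weight CARD('n) s * (\<integral>\<omega>. ((sqrt s *\<^sub>R \<omega>) \<bullet> a) ^ j * (max 0 (1 - (norm (sqrt s *\<^sub>R \<omega>))\<^sup>2)) ^ m \<partial>sphere_measure) \<partial>lborel)"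
    by simp
  also have "\<dots> = (\<integral>s. (indicator {0<..<1} s * (s powr (A - 1) * (1 - s) ^ m)) * (sphere_moment a j / 2) \<partial>lborel)"
  proof (rule Bochner_Integration.integral_cong[OF refl])
    fix s :: real
    show "polar_weight CARD('n) s * (\<integral>\<omega>. ((sqrt s *\<^sub>R \<omega>) \<bullet> a) ^ j * (max 0 (1 - (norm (sqrt s *\<^sub>R \<omega>))\<^sup>2)) ^ m \<partial>sphere_measure)
       = (indicator {0<..<1} s * (s powr (A - 1) * (1 - s) ^ m)) * (sphere_moment a j / 2)"
    proof (cases "s > 0")
      case True
      have "(\<integral>\<omega>. ((sqrt s *\<^sub>R \<omega>) \<bullet> a) ^ j * (max 0 (1 - (norm (sqrt s *\<^sub>R \<omega>))\<^sup>2)) ^ m \<partial>sphere_measure)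
        = (\<integral>\<omega>. sqrt s ^ j * (max 0 (1 - s)) ^ m * (\<omega> \<bullet> a) ^ j \<partial>sphere_measure)"
        by (rule Bochner_Integration.integral_cong[OF refl]) (use True in \<open>simp add: power_mult_distrib\<close>)
      also have "\<dots> = sqrt s ^ j * (max 0 (1 - s)) ^ m * sphere_moment a j"
        by (simp add: sphere_moment_def)
      finally have 1: "(\<integral>\<omega>. ((sqrt s *\<^sub>R \<omega>) \<bullet> a) ^ j * (max 0 (1 - (norm (sqrt s *\<^sub>R \<omega>))\<^sup>2)) ^ m \<partial>sphere_measure) = sqrt s ^ j * (max 0 (1 - s)) ^ m * sphere_moment a j" .
      have "s powr (real CARD('n) / 2 - 1) * sqrt s ^ j = s powr (A - 1)"
        using True by (simp add: A powr_half_sqrt[symmetric] powr_realpow[symmetric] powr_powr powr_add[symmetric] add_divide_distrib algebra_simps)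
      then show ?thesis
        unfolding 1 using True m by (auto simp: polar_weight_def indicator_def max_def mult.assoc[symmetric])
    qed (simp add: polar_weight_def)
  qed
  also have "\<dots> = (LINT s:{0<..<1}|lborel. s powr (A - 1) * (1 - s) ^ m) / 2 * sphere_moment a j"
    by (simp add: set_lebesgue_integral_def)
  finally show ?thesis .
qed

text \<open>The positive part of 1 - u has a corner at u = 1 but its square has none, so this
  truncated weight can be differentiated across the unit sphere.\<close>

lemma max_sq_derivative: "((\<lambda>u::real. (max 0 (1 - u))\<^sup>2) has_real_derivative - 2 * max 0 (1 - u)) (at u)"
proof -
  consider "u < 1" | "u > 1" | "u = 1" by linarith
  then show ?thesis
  proof cases
    case 1
    show ?thesis
      by (rule has_field_derivative_transform_within_open[of "\<lambda>u. (1 - u)\<^sup>2" _ _ "{..<1}"])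
        (use 1 in \<open>auto intro!: derivative_eq_intros\<close>)
  next
    case 2
    show ?thesis
      by (rule has_field_derivative_transform_within_open[of "\<lambda>u. 0" _ _ "{1<..}"])
        (use 2 in \<open>auto intro!: derivative_eq_intros\<close>)
  next
    case 3
    have "((\<lambda>h. ((max 0 (1 - (1 + h)))\<^sup>2 - (max 0 (1 - 1))\<^sup>2) / h) \<longlongrightarrow> (0::real)) (at 0)"
    proof (rule Lim_null_comparison[of _ "\<lambda>h. \<bar>h\<bar>"])
      show "\<forall>\<^sub>F h in at 0. norm (((max 0 (1 - (1 + h)))\<^sup>2 - (max 0 (1 - 1))\<^sup>2) / h) \<le> \<bar>h :: real\<bar>"
        by (rule always_eventually) (auto simp: max_def power2_eq_square)
      show "((\<lambda>h::real. \<bar>h\<bar>) \<longlongrightarrow> 0) (at 0)" by (auto intro!: tendsto_eq_intros)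
    qed
    then show ?thesis unfolding DERIV_def 3 by simp
  qed
qed

text \<open>Integrating a derivative in direction a to zero relates the moments j and j + 2; the
  factor n + j is the ratio of the two radial integrals.\<close>

lemma sphere_moment_rec:
  fixes a :: "real ^ 'n"
  shows "(real CARD('n) + real j) * sphere_moment a (j + 2) = (real j + 1) * (norm a)\<^sup>2 * sphere_moment a j"
proof -
  define A where "A = (real CARD('n) + real j) / 2"
  have A: "A > 0" by (simp add: A_def add_pos_nonneg)
  define N where "N y = (norm y)\<^sup>2" for y :: "real ^ 'n"
  have N: "N y = y \<bullet> y" for y by (simp add: N_def power2_norm_eq_inner)
  have out: "max 0 (1 - N y) = 0" if "norm y > 1" for y
  proof -
    have "1 < (norm y)\<^sup>2" using that by (simp add: one_less_power)
    then show ?thesis by (simp add: N_def)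
  qed
  \<comment> \<open>Along a, the power of y . a differentiates to (j + 1) |a|^2 times a lower power,
    and the squared weight yields -4 (y . a) times the weight. These two terms are \<open>G1\<close>
    and \<open>G2\<close>.\<close>
  define G where "G y = (y \<bullet> a) ^ (j + 1) * (max 0 (1 - N y))\<^sup>2" for y
  define G1 where "G1 y = (y \<bullet> a) ^ j * (max 0 (1 - N y))\<^sup>2" for y
  define G2 where "G2 y = (y \<bullet> a) ^ (j + 2) * (max 0 (1 - N y)) ^ 1" for y
  have cN: "continuous_on UNIV N" unfolding N_def by (intro continuous_intros)
  have c: "continuous_on UNIV G" "continuous_on UNIV G1" "continuous_on UNIV G2"
    unfolding G_def G1_def G2_def by (intro continuous_intros cN)+
  have i1: "integrable lborel G1" by (rule integrable_continuous_bounded_support[OF c(2), of 1]) (simp add: G1_def out)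
  have i2: "integrable lborel G2" by (rule integrable_continuous_bounded_support[OF c(3), of 1]) (simp add: G2_def out)
  have "(\<integral>y. (real j + 1) * (norm a)\<^sup>2 * G1 y - 4 * G2 y \<partial>lborel) = 0"
  proof (rule integral_directional_derivative_eq_0[OF c(1), where R=1 and a=a])
    show "continuous_on UNIV (\<lambda>y. (real j + 1) * (norm a)\<^sup>2 * G1 y - 4 * G2 y)"
      by (intro continuous_intros c)
    fix y
    have "((\<lambda>s. (y + s *\<^sub>R a) \<bullet> a) has_real_derivative (norm a)\<^sup>2) (at 0)"
      by (auto intro!: derivative_eq_intros simp: inner_add_left power2_norm_eq_inner)
    from DERIV_power_Suc[OF this, of j]
    have d1: "((\<lambda>s. ((y + s *\<^sub>R a) \<bullet> a) ^ (j + 1)) has_real_derivative (real j + 1) * (norm a)\<^sup>2 * (y \<bullet> a) ^ j) (at 0)"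
      by (simp add: algebra_simps)
    have "((\<lambda>s. N (y + s *\<^sub>R a)) has_real_derivative 2 * (y \<bullet> a)) (at 0)"
      unfolding N by (auto intro!: derivative_eq_intros simp: inner_add_left inner_add_right inner_commute)
    from DERIV_chain2[OF max_sq_derivative this]
    have d2: "((\<lambda>s. (max 0 (1 - N (y + s *\<^sub>R a)))\<^sup>2) has_real_derivative - 2 * max 0 (1 - N y) * (2 * (y \<bullet> a))) (at 0)"
      by simp
    from DERIV_mult[OF d1 d2]
    show "((\<lambda>s. G (y + s *\<^sub>R a)) has_vector_derivative (real j + 1) * (norm a)\<^sup>2 * G1 y - 4 * G2 y) (at 0)"
      unfolding G_def G1_def G2_def by (simp add: has_real_derivative_iff_has_vector_derivative[symmetric] algebra_simps)
  qed (use out in \<open>auto simp: G_def G1_def G2_def\<close>)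
  then have eq: "(real j + 1) * (norm a)\<^sup>2 * (\<integral>y. G1 y \<partial>lborel) = 4 * (\<integral>y. G2 y \<partial>lborel)"
    using i1 i2 by simp
  have I1: "(\<integral>y. G1 y \<partial>lborel) = (LINT s:{0<..<1}|lborel. s powr (A - 1) * (1 - s) ^ 2) / 2 * sphere_moment a j"
    unfolding G1_def N_def by (rule integral_radial_moment) (simp_all add: A_def)
  have I2: "(\<integral>y. G2 y \<partial>lborel) = (LINT s:{0<..<1}|lborel. s powr ((A + 1) - 1) * (1 - s) ^ 1) / 2 * sphere_moment a (j + 2)"
    unfolding G2_def N_def by (rule integral_radial_moment) (simp_all add: A_def field_simps)
  have "(LINT s:{0<..<1}|lborel. s powr (A - 1) * (1 - s) ^ 2) = (LINT s:{0<..<1}|lborel. s powr (A - 1) - 2 * s powr ((A + 1) - 1) + s powr ((A + 2) - 1))"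
    by (rule set_lebesgue_integral_cong) (auto simp: powr_diff powr_add power2_eq_square field_simps)
  also have "\<dots> = 1 / A - 2 * (1 / (A + 1)) + 1 / (A + 2)"
    using A set_integrable_powr_unit[of A] set_integrable_powr_unit[of "A+1"] set_integrable_powr_unit[of "A+2"]
    by (subst set_integral_add(2) set_integral_diff(2) set_integral_mult_right; (intro set_integral_diff set_integrable_mult_right)?; simp)+
  finally have J1: "(LINT s:{0<..<1}|lborel. s powr (A - 1) * (1 - s) ^ 2) = 1 / A - 2 * (1 / (A + 1)) + 1 / (A + 2)" .
  have J2: "(LINT s:{0<..<1}|lborel. s powr ((A + 1) - 1) * (1 - s) ^ 1) = 1 / ((A + 1) * (A + 2))"
    using integral_powr_times_one_minus[of "A + 1"] A by (simp add: add.assoc)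
  have K1: "1 / A - 2 * (1 / (A + 1)) + 1 / (A + 2) = 2 / (A * (A + 1) * (A + 2))"
    using A by (simp add: divide_simps) (simp add: algebra_simps)
  have "(real j + 1) * (norm a)\<^sup>2 * (2 / (A * (A + 1) * (A + 2)) / 2 * sphere_moment a j) = 4 * (1 / ((A + 1) * (A + 2)) / 2 * sphere_moment a (j + 2))"
    using eq unfolding I1 I2 J1 J2 K1 .
  moreover have "X * Z = 2 * A * Y" if *: "X * (2 / (A * (A + 1) * (A + 2)) / 2 * Z) = 4 * (1 / ((A + 1) * (A + 2)) / 2 * Y)" for X Y Z
  proof -
    define P where "P = (A + 1) * (A + 2)"
    have P: "P > 0" using A by (simp add: P_def)
    have "X * (2 / (A * P) / 2 * Z) = 4 * (1 / P / 2 * Y)" using * by (simp add: P_def mult.assoc)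
    then show ?thesis using A P by (simp add: field_simps)
  qed
  ultimately have "(real j + 1) * (norm a)\<^sup>2 * sphere_moment a j = 2 * A * sphere_moment a (j + 2)"
    by blast
  moreover have "2 * A = real CARD('n) + real j" by (simp add: A_def)
  ultimately show ?thesis by simp
qed

text \<open>The same device with no power of y . a in front of the weight; together with the
  recursion it makes all odd moments vanish.\<close>

lemma sphere_moment_1: "sphere_moment (a :: real ^ 'n) 1 = 0"
proof -
  define N where "N y = (norm y)\<^sup>2" for y :: "real ^ 'n"
  have N: "N y = y \<bullet> y" for y by (simp add: N_def power2_norm_eq_inner)
  have out: "max 0 (1 - N y) = 0" if "norm y > 1" for y
  proof -
    have "1 < (norm y)\<^sup>2" using that by (simp add: one_less_power)
    then show ?thesis by (simp add: N_def)
  qed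
  have cN: "continuous_on UNIV N" unfolding N_def by (intro continuous_intros)
  have "(\<integral>y. - 4 * ((y \<bullet> a) ^ 1 * (max 0 (1 - N y)) ^ 1) \<partial>lborel) = 0"
  proof (rule integral_directional_derivative_eq_0[where R=1 and a=a and G="\<lambda>y. (max 0 (1 - N y))\<^sup>2"])
    fix y
    have "((\<lambda>s. N (y + s *\<^sub>R a)) has_real_derivative 2 * (y \<bullet> a)) (at 0)"
      unfolding N by (auto intro!: derivative_eq_intros simp: inner_add_left inner_add_right inner_commute)
    from DERIV_chain2[OF max_sq_derivative this]
    show "((\<lambda>s. (max 0 (1 - N (y + s *\<^sub>R a)))\<^sup>2) has_vector_derivative - 4 * ((y \<bullet> a) ^ 1 * (max 0 (1 - N y)) ^ 1)) (at 0)"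
      by (simp add: has_real_derivative_iff_has_vector_derivative[symmetric] algebra_simps)
  qed (use out in \<open>auto intro!: continuous_intros cN\<close>)
  then have "(\<integral>y. (y \<bullet> a) ^ 1 * (max 0 (1 - (norm y)\<^sup>2)) ^ 1 \<partial>lborel) = 0"
    unfolding integral_mult_right_zero N_def by simp
  then show ?thesis
    unfolding integral_radial_moment[OF refl zero_less_one] using integral_powr_times_one_minus[of "(real CARD('n) + real 1) / 2"]
    by (simp add: add_nonneg_eq_0_iff)
qed

text \<open>With k = (n - 3)/2 the weight is, up to a constant, the density of the surface measure
  projected to an axis.\<close>

definition interval_moment :: "nat \<Rightarrow> nat \<Rightarrow> real" where
  "interval_moment k j = integral {-1..1} (\<lambda>v. v ^ j * (1 - v\<^sup>2) ^ k)"

text \<open>The derivative of v^(j+1) (1 - v^2)^(k+1) integrates to zero. The result is the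
  recursion of \<open>sphere_moment_rec\<close> for |a| = 1 and n = 2k + 3.\<close>

lemma interval_moment_rec:
  "(2 * real k + 3 + real j) * interval_moment k (j + 2) = (real j + 1) * interval_moment k j"
proof -
  let ?w = "\<lambda>v::real. (1 - v\<^sup>2) ^ k"
  have i: "(\<lambda>v. C * (v ^ i * ?w v)) integrable_on {-1..1}" for C i
    by (intro integrable_continuous_real continuous_intros)
  have "((\<lambda>v. (real j + 1) * (v ^ j * ?w v) - (2 * real k + 3 + real j) * (v ^ (j + 2) * ?w v)) has_integral
     (1 ^ (j + 1) * (1 - 1\<^sup>2) ^ (k + 1) - (- 1) ^ (j + 1) * (1 - (- 1)\<^sup>2) ^ (k + 1))) {-1..1::real}"
  proof (rule fundamental_theorem_of_calculus)
    fix v :: real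
    have d1: "((\<lambda>v. v ^ (j + 1)) has_real_derivative (real j + 1) * v ^ j) (at v)"
      unfolding Suc_eq_plus1[symmetric] by (rule DERIV_cong[OF DERIV_power_Suc[OF DERIV_ident]]) simp
    have "((\<lambda>v. 1 - v\<^sup>2) has_real_derivative - 2 * v) (at v)"
      by (auto intro!: derivative_eq_intros)
    then have d2: "((\<lambda>v. (1 - v\<^sup>2) ^ (k + 1)) has_real_derivative (real k + 1) * (- 2 * v * ?w v)) (at v)"
      unfolding Suc_eq_plus1[symmetric] by (rule DERIV_cong[OF DERIV_power_Suc]) simp
    from DERIV_mult[OF d1 d2]
    have "((\<lambda>v. v ^ (j + 1) * (1 - v\<^sup>2) ^ (k + 1)) has_real_derivative (real j + 1) * v ^ j * (1 - v\<^sup>2) ^ (k + 1) + (real k + 1) * (- 2 * v * ?w v) * v ^ (j + 1)) (at v)"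
      by simp
    also have "(real j + 1) * v ^ j * (1 - v\<^sup>2) ^ (k + 1) + (real k + 1) * (- 2 * v * ?w v) * v ^ (j + 1)
       = (real j + 1) * (v ^ j * ?w v) - (2 * real k + 3 + real j) * (v ^ (j + 2) * ?w v)"
      by (simp add: algebra_simps power2_eq_square)
    finally show "((\<lambda>v. v ^ (j + 1) * (1 - v\<^sup>2) ^ (k + 1)) has_vector_derivative (real j + 1) * (v ^ j * ?w v) - (2 * real k + 3 + real j) * (v ^ (j + 2) * ?w v)) (at v within {-1..1})"
      by (simp add: has_real_derivative_iff_has_vector_derivative has_vector_derivative_at_within)
  qed simp
  then have "integral {-1..1} (\<lambda>v. (real j + 1) * (v ^ j * ?w v) - (2 * real k + 3 + real j) * (v ^ (j + 2) * ?w v)) = 0"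
    by (simp add: integral_unique)
  then show ?thesis
    unfolding Henstock_Kurzweil_Integration.integral_diff[OF i i] Henstock_Kurzweil_Integration.integral_mult_right interval_moment_def by simp
qed

lemma interval_moment_1: "interval_moment k 1 = 0"
proof -
  have "((\<lambda>v. - 2 * (real k + 1) * (v ^ 1 * (1 - v\<^sup>2) ^ k)) has_integral
     ((1 - 1\<^sup>2) ^ (k + 1) - (1 - (- 1)\<^sup>2) ^ (k + 1))) {-1..1::real}"
  proof (rule fundamental_theorem_of_calculus)
    fix v :: real
    have "((\<lambda>v. 1 - v\<^sup>2) has_real_derivative - 2 * v) (at v)"
      by (auto intro!: derivative_eq_intros)
    then have "((\<lambda>v. (1 - v\<^sup>2) ^ (k + 1)) has_real_derivative (real k + 1) * (- 2 * v * (1 - v\<^sup>2) ^ k)) (at v)"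
      unfolding Suc_eq_plus1[symmetric] by (rule DERIV_cong[OF DERIV_power_Suc]) simp
    moreover have e: "r * (- 2 * v * w) = - 2 * r * (v ^ 1 * w)" for r w :: real
      by simp
    ultimately have "((\<lambda>v. (1 - v\<^sup>2) ^ (k + 1)) has_real_derivative - 2 * (real k + 1) * (v ^ 1 * (1 - v\<^sup>2) ^ k)) (at v)"
      by (simp only: e)
    then show "((\<lambda>v. (1 - v\<^sup>2) ^ (k + 1)) has_vector_derivative - 2 * (real k + 1) * (v ^ 1 * (1 - v\<^sup>2) ^ k)) (at v within {-1..1})"
      unfolding has_real_derivative_iff_has_vector_derivative by (rule has_vector_derivative_at_within)
  qed simp
  from integral_unique[OF this] show ?thesis by (simp add: interval_moment_def)
qed

lemma interval_moment_0_pos: "interval_moment k 0 > 0"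
proof -
  have c: "continuous_on {-1..1} (\<lambda>v::real. (1 - v\<^sup>2) ^ k)" by (intro continuous_intros)
  have nn: "(1 - v\<^sup>2) ^ k \<ge> 0" if "v \<in> {-1..1}" for v :: real
    using that abs_square_le_1[of v] by (intro zero_le_power) auto
  have "interval_moment k 0 \<ge> 0"
    unfolding interval_moment_def using nn by (intro integral_nonneg integrable_continuous_real continuous_intros) auto
  moreover have "interval_moment k 0 \<noteq> 0"
  proof
    assume "interval_moment k 0 = 0"
    then have "integral {-1..1} (\<lambda>v::real. (1 - v\<^sup>2) ^ k) = 0" by (simp add: interval_moment_def)
    then have "\<forall>v\<in>{-1..1}. (1 - v\<^sup>2) ^ k = (0::real)"
      using integral_eq_0_iff[OF c _ nn] by simp
    then show False by (auto dest: bspec[of _ _ 0])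
  qed
  ultimately show ?thesis by simp
qed

text \<open>Both sides satisfy the same two-step recursion in j, so only j = 0 and j = 1 have to be
  compared; the constant is fixed by j = 0.\<close>

lemma sphere_moment_eq_interval_moment:
  fixes a :: "real ^ 'n"
  assumes n: "CARD('n) = 2 * k + 3"
  shows "sphere_moment a j = sphere_area CARD('n) / interval_moment k 0 * norm a ^ j * interval_moment k j"
proof (induction j rule: less_induct)
  case (less j)
  consider "j = 0" | "j = 1" | i where "j = i + 2"
    by (metis One_nat_def add_2_eq_Suc' less_2_cases not_less_iff_gr_or_eq numeral_2_eq_2 old.nat.exhaust)
  then show ?case
  proof cases
    case 1
    then show ?thesis using interval_moment_0_pos[of k] by (simp add: sphere_moment_0)
  next
    case 2
    then show ?thesis using sphere_moment_1[of a] interval_moment_1[of k] by simp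
  next
    case 3
    have p: "2 * real k + 3 + real i > 0" by linarith
    have IH: "sphere_moment a i = sphere_area CARD('n) / interval_moment k 0 * norm a ^ i * interval_moment k i"
      using less 3 by simp
    have "(2 * real k + 3 + real i) * sphere_moment a (i + 2) = (real i + 1) * (norm a)\<^sup>2 * sphere_moment a i"
      using sphere_moment_rec[of i a] n by simp
    also have "\<dots> = sphere_area CARD('n) / interval_moment k 0 * norm a ^ (i + 2) * ((real i + 1) * interval_moment k i)"
      unfolding IH by (simp add: power2_eq_square)
    also have "\<dots> = (2 * real k + 3 + real i) * (sphere_area CARD('n) / interval_moment k 0 * norm a ^ (i + 2) * interval_moment k (i + 2))"
      unfolding interval_moment_rec[symmetric] by simp
    finally show ?thesis using p unfolding 3 by (simp only: mult_cancel_left) linarith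
  qed
qed

text \<open>Moments give the formula for polynomials, and Weierstrass approximation extends it to
  continuous F. The extension is essential: the ramp to which it is applied has a corner.\<close>

lemma sphere_integral_ridge:
  fixes a :: "real ^ 'n" and F :: "real \<Rightarrow> real"
  assumes n: "CARD('n) = 2 * k + 3" and F: "continuous_on UNIV F"
  shows "(\<integral>\<theta>. F (\<theta> \<bullet> a) \<partial>sphere_measure)
     = sphere_area CARD('n) / interval_moment k 0 * integral {-1..1} (\<lambda>v. F (norm a * v) * (1 - v\<^sup>2) ^ k)"
proof -
  define c where "c = sphere_area CARD('n) / interval_moment k 0"
  define W where "W = interval_moment k 0"
  have W: "W > 0" using interval_moment_0_pos by (simp add: W_def)
  have c0: "c > 0" using W sphere_area_pos[of "CARD('n)"] by (simp add: c_def W_def)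
  have wi: "(\<lambda>v. G (norm a * v) * (1 - v\<^sup>2) ^ k) integrable_on {-1..1}" if "continuous_on UNIV G" for G :: "real \<Rightarrow> real"
    by (intro integrable_continuous_real continuous_intros continuous_on_compose2[OF that]) auto
  have si: "integrable sphere_measure (\<lambda>\<theta>::real^'n. G (\<theta> \<bullet> a))" if "continuous_on UNIV G" for G :: "real \<Rightarrow> real"
    by (intro sphere_integrable_continuous continuous_on_compose2[OF that]) (auto intro!: continuous_intros)
  have poly: "(\<integral>\<theta>. g (\<theta> \<bullet> a) \<partial>sphere_measure) = c * integral {-1..1} (\<lambda>v. g (norm a * v) * (1 - v\<^sup>2) ^ k)"
    if "real_polynomial_function g" for g
  proof -
    obtain b N where g: "g = (\<lambda>x. \<Sum>i\<le>N. b i * x ^ i)"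
      using \<open>real_polynomial_function g\<close> unfolding real_polynomial_function_iff_sum by blast
    have ci: "continuous_on UNIV (\<lambda>x::real. x ^ i)" for i by (intro continuous_intros)
    have "(\<integral>\<theta>. g (\<theta> \<bullet> a) \<partial>sphere_measure) = (\<Sum>i\<le>N. b i * sphere_moment a i)"
      unfolding g sphere_moment_def using si[OF ci] by (simp)
    also have "\<dots> = c * (\<Sum>i\<le>N. b i * (norm a ^ i * interval_moment k i))"
      unfolding sphere_moment_eq_interval_moment[OF n] c_def by (simp add: sum_distrib_left mult_ac)
    also have "(\<Sum>i\<le>N. b i * (norm a ^ i * interval_moment k i)) = (\<Sum>i\<le>N. integral {-1..1} (\<lambda>v. b i * ((norm a * v) ^ i * (1 - v\<^sup>2) ^ k)))"
      unfolding interval_moment_def by (simp add: power_mult_distrib mult.assoc)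
    also have "\<dots> = integral {-1..1} (\<lambda>v. \<Sum>i\<le>N. b i * ((norm a * v) ^ i * (1 - v\<^sup>2) ^ k))"
      by (rule integral_sum[symmetric]) (auto intro!: integrable_continuous_real continuous_intros)
    also have "\<dots> = integral {-1..1} (\<lambda>v. g (norm a * v) * (1 - v\<^sup>2) ^ k)"
      unfolding g by (simp add: sum_distrib_right mult.assoc)
    finally show ?thesis .
  qed
  have "\<bar>(\<integral>\<theta>. F (\<theta> \<bullet> a) \<partial>sphere_measure) - c * integral {-1..1} (\<lambda>v. F (norm a * v) * (1 - v\<^sup>2) ^ k)\<bar> \<le> e * (sphere_area CARD('n) + c * W)"
    if e: "e > 0" for e
  proof -
    \<comment> \<open>Approximation on [-|a|, |a|] is enough, since by Cauchy-Schwarz \<theta> . a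
      lies there, as does |a| v.\<close>
    obtain g where g: "real_polynomial_function g" "\<And>x. x \<in> {- norm a..norm a} \<Longrightarrow> \<bar>F x - g x\<bar> < e"
      using Stone_Weierstrass_real_polynomial_function[OF compact_Icc continuous_on_subset[OF F subset_UNIV] e] by blast
    have cg: "continuous_on UNIV g" using g(1) by (simp add: continuous_on_polymonial_function real_polynomial_function_eq)
    have "(\<integral>\<theta>. F (\<theta> \<bullet> a) \<partial>sphere_measure) - (\<integral>\<theta>. g (\<theta> \<bullet> a) \<partial>sphere_measure) = (\<integral>\<theta>. F (\<theta> \<bullet> a) - g (\<theta> \<bullet> a) \<partial>sphere_measure)"
      using si[OF F] si[OF cg] by simp
    also have "\<bar>\<dots>\<bar> \<le> sphere_area CARD('n) * e"
    proof -
      have "norm (F (\<theta> \<bullet> a) - g (\<theta> \<bullet> a)) \<le> e" if "norm \<theta> = 1" for \<theta>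
        using g(2)[of "\<theta> \<bullet> a"] Cauchy_Schwarz_ineq2[of \<theta> a] that by (simp add: abs_le_iff less_imp_le)
      then show ?thesis using norm_sphere_integral_le[of "\<lambda>\<theta>. F (\<theta> \<bullet> a) - g (\<theta> \<bullet> a)" e] si[OF F] si[OF cg] by simp
    qed
    finally have 1: "\<bar>(\<integral>\<theta>. F (\<theta> \<bullet> a) \<partial>sphere_measure) - (\<integral>\<theta>. g (\<theta> \<bullet> a) \<partial>sphere_measure)\<bar> \<le> sphere_area CARD('n) * e" .
    have "integral {-1..1} (\<lambda>v. F (norm a * v) * (1 - v\<^sup>2) ^ k) - integral {-1..1} (\<lambda>v. g (norm a * v) * (1 - v\<^sup>2) ^ k)
       = integral {-1..1} (\<lambda>v. F (norm a * v) * (1 - v\<^sup>2) ^ k - g (norm a * v) * (1 - v\<^sup>2) ^ k)"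
      using wi[OF F] wi[OF cg] by (simp add: Henstock_Kurzweil_Integration.integral_diff)
    also have "norm \<dots> \<le> integral {-1..1} (\<lambda>v. e * (v ^ 0 * (1 - v\<^sup>2) ^ k))"
    proof (rule integral_norm_bound_integral)
      show "(\<lambda>v. F (norm a * v) * (1 - v\<^sup>2) ^ k - g (norm a * v) * (1 - v\<^sup>2) ^ k) integrable_on {-1..1}"
        using wi[OF F] wi[OF cg] by (rule integrable_diff)
      show "(\<lambda>v. e * (v ^ 0 * (1 - v\<^sup>2) ^ k)) integrable_on {-1..1}"
        by (intro integrable_continuous_real continuous_intros)
      fix v :: real assume v: "v \<in> {-1..1}"
      have w: "(1 - v\<^sup>2) ^ k \<ge> 0" using v abs_square_le_1[of v] by (intro zero_le_power) auto
      have "\<bar>norm a * v\<bar> \<le> norm a * 1" unfolding abs_mult using v by (intro mult_mono) auto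
      then have "\<bar>F (norm a * v) - g (norm a * v)\<bar> \<le> e" using g(2)[of "norm a * v"] by (simp add: abs_le_iff less_imp_le)
      from mult_right_mono[OF this w] show "norm (F (norm a * v) * (1 - v\<^sup>2) ^ k - g (norm a * v) * (1 - v\<^sup>2) ^ k) \<le> e * (v ^ 0 * (1 - v\<^sup>2) ^ k)"
        using w by (simp add: abs_mult flip: left_diff_distrib)
    qed
    also have "\<dots> = e * W" by (simp add: W_def interval_moment_def)
    finally have 2: "\<bar>integral {-1..1} (\<lambda>v. F (norm a * v) * (1 - v\<^sup>2) ^ k) - integral {-1..1} (\<lambda>v. g (norm a * v) * (1 - v\<^sup>2) ^ k)\<bar> \<le> e * W" by simp
    have "\<bar>c * integral {-1..1} (\<lambda>v. F (norm a * v) * (1 - v\<^sup>2) ^ k) - c * integral {-1..1} (\<lambda>v. g (norm a * v) * (1 - v\<^sup>2) ^ k)\<bar> \<le> c * (e * W)"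
      using mult_left_mono[OF 2, of c] c0 by (simp add: abs_mult flip: right_diff_distrib)
    then show ?thesis using 1 unfolding poly[OF g(1)] by (simp add: algebra_simps)
  qed
  then have "\<bar>(\<integral>\<theta>. F (\<theta> \<bullet> a) \<partial>sphere_measure) - c * integral {-1..1} (\<lambda>v. F (norm a * v) * (1 - v\<^sup>2) ^ k)\<bar> \<le> 0"
  proof -
    define S where "S = sphere_area CARD('n) + c * W"
    have S: "S > 0" using c0 W sphere_area_pos[of "CARD('n)"] by (simp add: S_def add_pos_pos)
    assume *: "\<And>e. e > 0 \<Longrightarrow> \<bar>(\<integral>\<theta>. F (\<theta> \<bullet> a) \<partial>sphere_measure) - c * integral {-1..1} (\<lambda>v. F (norm a * v) * (1 - v\<^sup>2) ^ k)\<bar> \<le> e * (sphere_area CARD('n) + c * W)"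
    show ?thesis
    proof (rule field_le_epsilon)
      fix e :: real assume "e > 0"
      with *[of "e / S"] S show "\<bar>(\<integral>\<theta>. F (\<theta> \<bullet> a) \<partial>sphere_measure) - c * integral {-1..1} (\<lambda>v. F (norm a * v) * (1 - v\<^sup>2) ^ k)\<bar> \<le> 0 + e"
        by (simp add: S_def[symmetric])
    qed
  qed
  then show ?thesis by (simp add: c_def)
qed

section \<open>Spherical means of a smooth function\<close>

text \<open>The direction comes first, so that \<open>dird v ^^ k\<close> is the k-fold derivative
  along v.\<close>

definition dird :: "'a \<Rightarrow> ('a::real_normed_vector \<Rightarrow> 'b::real_normed_vector) \<Rightarrow> 'a \<Rightarrow> 'b" where
  "dird v f x = frechet_derivative f (at x) v"

lemma smooth_differentiable: "smooth f \<Longrightarrow> f differentiable (at x)"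
proof -
  assume "smooth f"
  then have "k_times_differentiable (Suc 0) f" by (simp only: smooth_def)
  then show ?thesis by (simp add: differentiable_on_def)
qed

lemma smooth_continuous: "smooth f \<Longrightarrow> continuous_on UNIV f"
  unfolding smooth_def by (metis k_times_differentiable.simps(1))

lemma smooth_dird: "smooth f \<Longrightarrow> smooth (dird v f)"
  unfolding smooth_def dird_def[abs_def] by (metis k_times_differentiable.simps(2))

lemma smooth_dird_funpow: "smooth f \<Longrightarrow> smooth ((dird v ^^ k) f)"
  by (induction k) (auto intro: smooth_dird)

lemma smooth_has_derivative: "smooth f \<Longrightarrow> (f has_derivative (\<lambda>v. dird v f x)) (at x)"
  unfolding dird_def using smooth_differentiable frechet_derivative_works by blast

lemma smooth_has_vector_derivative_line:
  assumes "smooth f"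
  shows "((\<lambda>s. f (x + s *\<^sub>R v)) has_vector_derivative dird v f (x + s *\<^sub>R v)) (at s)"
proof -
  have d: "((\<lambda>s. x + s *\<^sub>R v) has_derivative (\<lambda>h. h *\<^sub>R v)) (at s)"
    by (auto intro!: derivative_eq_intros)
  have f: "(f has_derivative (\<lambda>w. dird w f (x + s *\<^sub>R v))) (at (x + s *\<^sub>R v))"
    by (rule smooth_has_derivative[OF assms])
  have "((\<lambda>s. f (x + s *\<^sub>R v)) has_derivative (\<lambda>h. dird (h *\<^sub>R v) f (x + s *\<^sub>R v))) (at s)"
    using has_derivative_compose[OF d f] .
  moreover have "dird (h *\<^sub>R v) f (x + s *\<^sub>R v) = h *\<^sub>R dird v f (x + s *\<^sub>R v)" for h
    using linear_cmul[OF has_derivative_linear[OF f]] .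
  ultimately show ?thesis by (simp add: has_vector_derivative_def)
qed

lemma dird_sum:
  assumes "\<And>i. i \<in> I \<Longrightarrow> smooth (g i)"
  shows "dird v (\<lambda>x. \<Sum>i\<in>I. c i *\<^sub>R g i x) = (\<lambda>x. \<Sum>i\<in>I. c i *\<^sub>R dird v (g i) x)"
proof
  fix x
  have "((\<lambda>x. \<Sum>i\<in>I. c i *\<^sub>R g i x) has_derivative (\<lambda>v. \<Sum>i\<in>I. c i *\<^sub>R dird v (g i) x)) (at x)"
    by (intro has_derivative_sum has_derivative_scaleR_right smooth_has_derivative assms)
  from fun_cong[OF frechet_derivative_at[OF this], of v]
  show "dird v (\<lambda>x. \<Sum>i\<in>I. c i *\<^sub>R g i x) x = (\<Sum>i\<in>I. c i *\<^sub>R dird v (g i) x)"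
    by (simp add: dird_def)
qed

lemma dird_funpow_sum:
  assumes "\<And>i. i \<in> I \<Longrightarrow> smooth (g i)"
  shows "(dird v ^^ k) (\<lambda>x. \<Sum>i\<in>I. c i *\<^sub>R g i x) = (\<lambda>x. \<Sum>i\<in>I. c i *\<^sub>R (dird v ^^ k) (g i) x)"
proof (induction k)
  case (Suc k)
  then show ?case using dird_sum[of I "\<lambda>i. (dird v ^^ k) (g i)" v c] assms smooth_dird_funpow by auto
qed simp

lemma dird_eq_sum_axis:
  fixes f :: "real ^ 'n \<Rightarrow> 'b::real_normed_vector"
  assumes "smooth f"
  shows "dird v f = (\<lambda>x. \<Sum>i\<in>UNIV. (v $ i) *\<^sub>R dird (axis i 1) f x)"
proof
  fix x
  have l: "linear (\<lambda>v. dird v f x)" using has_derivative_linear[OF smooth_has_derivative[OF assms]] .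
  have "v = (\<Sum>i\<in>UNIV. (v $ i) *\<^sub>R axis i 1)"
    using basis_expansion[of v] by (simp add: scalar_mult_eq_scaleR)
  then have "dird v f x = dird (\<Sum>i\<in>UNIV. (v $ i) *\<^sub>R axis i 1) f x" by simp
  also have "\<dots> = (\<Sum>i\<in>UNIV. (v $ i) *\<^sub>R dird (axis i 1) f x)"
    using linear_sum[OF l, of "\<lambda>i. (v $ i) *\<^sub>R axis i 1" UNIV] linear_cmul[OF l] by simp
  finally show "dird v f x = (\<Sum>i\<in>UNIV. (v $ i) *\<^sub>R dird (axis i 1) f x)" .
qed

text \<open>Smoothness speaks of fixed directions, but the directions will be integration variables,
  so joint continuity is needed. Expanding the innermost derivative in coordinates moves the
  dependence on v into coefficients v_i, and the induction runs over all smooth functions.\<close>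

lemma continuous_on_dird_funpow:
  fixes f :: "real ^ 'n \<Rightarrow> 'b::real_normed_vector"
  assumes "smooth f"
  shows "continuous_on UNIV (\<lambda>p. (dird (snd p) ^^ k) f (fst p))"
  using assms
proof (induction k arbitrary: f)
  case 0
  then show ?case
    using continuous_on_compose2[OF smooth_continuous[OF 0] continuous_on_fst[OF continuous_on_id]] by simp
next
  case (Suc k)
  have "(\<lambda>p. (dird (snd p) ^^ Suc k) f (fst p)) = (\<lambda>p. \<Sum>i\<in>UNIV. (snd p $ i) *\<^sub>R (dird (snd p) ^^ k) (dird (axis i 1) f) (fst p))"
  proof
    fix p
    have "(dird (snd p) ^^ Suc k) f (fst p) = (dird (snd p) ^^ k) (\<lambda>x. \<Sum>i\<in>UNIV. (snd p $ i) *\<^sub>R dird (axis i 1) f x) (fst p)"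
      unfolding funpow_Suc_right o_def by (subst dird_eq_sum_axis[OF Suc.prems, of "snd p"]) simp
    also have "\<dots> = (\<Sum>i\<in>UNIV. (snd p $ i) *\<^sub>R (dird (snd p) ^^ k) (dird (axis i 1) f) (fst p))"
      by (subst dird_funpow_sum) (auto intro: smooth_dird Suc.prems)
    finally show "(dird (snd p) ^^ Suc k) f (fst p) = (\<Sum>i\<in>UNIV. (snd p $ i) *\<^sub>R (dird (snd p) ^^ k) (dird (axis i 1) f) (fst p))" .
  qed
  moreover have "continuous_on UNIV (\<lambda>p. \<Sum>i\<in>UNIV. (snd p $ i) *\<^sub>R (dird (snd p) ^^ k) (dird (axis i 1) f) (fst p))"
    by (intro continuous_intros Suc.IH smooth_dird Suc.prems)
  ultimately show ?case by (simp only:)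
qed

lemma dird_eq_0:
  assumes "open U" "\<And>y. y \<in> U \<Longrightarrow> f y = 0" "x \<in> U"
  shows "dird v f x = 0"
proof -
  have "(f has_derivative (\<lambda>_. 0)) (at x)"
    by (rule has_derivative_transform_within_open[of "\<lambda>_. 0" _ _ _ U]) (use assms in auto)
  from fun_cong[OF frechet_derivative_at[OF this], of v] show ?thesis by (simp add: dird_def)
qed

lemma dird_funpow_eq_0:
  assumes "open U" "\<And>y. y \<in> U \<Longrightarrow> f y = 0" "x \<in> U"
  shows "(dird v ^^ k) f x = 0"
  using assms(3)
proof (induction k arbitrary: x)
  case (Suc k)
  then show ?case using dird_eq_0[OF assms(1), of "(dird v ^^ k) f"] by simp
qed (simp add: assms)

text \<open>The k-th derivative in r of the unnormalised spherical mean about \<theta>; r may be any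
  real number, so r = 0 is not an endpoint.\<close>

definition sph_deriv :: "(real ^ 'n \<Rightarrow> complex) \<Rightarrow> real ^ 'n \<Rightarrow> nat \<Rightarrow> real \<Rightarrow> complex" where
  "sph_deriv f \<theta> k r = (\<integral>\<omega>. (dird (- \<omega>) ^^ k) f (\<theta> - r *\<^sub>R \<omega>) \<partial>sphere_measure)"

context
  fixes f :: "real ^ 'n \<Rightarrow> complex" and \<rho> :: real
  assumes f: "smooth f" and \<rho>: "\<And>x. \<rho> < norm x \<Longrightarrow> f x = 0"
begin

lemma dird_funpow_outside: "\<rho> < norm x \<Longrightarrow> (dird v ^^ k) f x = 0"
proof (rule dird_funpow_eq_0)
  have "{x::real^'n. \<rho> < norm x} = - cball 0 \<rho>" by auto
  then show "open {x::real^'n. \<rho> < norm x}" by (simp add: open_Compl)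
qed (use \<rho> in auto)

lemma dird_funpow_bounded:
  obtains C where "C \<ge> 0" "\<And>x \<omega>. norm \<omega> = 1 \<Longrightarrow> norm ((dird (- \<omega>) ^^ k) f x) \<le> C"
proof -
  have "bounded ((\<lambda>p. (dird (snd p) ^^ k) f (fst p)) ` (cball 0 \<rho> \<times> sphere 0 1))"
    by (intro compact_imp_bounded compact_continuous_image continuous_on_subset[OF continuous_on_dird_funpow[OF f]] compact_Times) auto
  then obtain C where C: "\<forall>p \<in> cball 0 \<rho> \<times> sphere 0 1. norm ((dird (snd p) ^^ k) f (fst p)) \<le> C" unfolding bounded_iff by auto
  have "norm ((dird (- \<omega>) ^^ k) f x) \<le> max C 0" if "norm \<omega> = 1" for x \<omega>
  proof (cases "norm x \<le> \<rho>")
    case True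
    then show ?thesis using C[rule_format, of "(x, - \<omega>)"] that by (simp add: le_max_iff_disj)
  next
    case False
    then show ?thesis using dird_funpow_outside[of x k] by simp
  qed
  then show ?thesis using that[of "max C 0"] by simp
qed

lemma continuous_on_dird_funpow_compose:
  fixes X :: "'c::topological_space \<Rightarrow> real ^ 'n"
  assumes "continuous_on UNIV X" "continuous_on UNIV V"
  shows "continuous_on UNIV (\<lambda>x. (dird (V x) ^^ k) f (X x))"
  using continuous_on_compose2[OF continuous_on_dird_funpow[OF f, of k] continuous_on_Pair[OF assms]] by simp

lemma sph_deriv_integrable:
  "integrable sphere_measure (\<lambda>\<omega>. (dird (- \<omega>) ^^ k) f (\<theta> - r *\<^sub>R \<omega>))"
  by (intro sphere_integrable_continuous continuous_on_dird_funpow_compose continuous_intros)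

lemma continuous_on_sph_deriv: "continuous_on UNIV (\<lambda>p. sph_deriv f (fst p) k (snd p))"
proof -
  obtain C where C: "C \<ge> 0" "\<And>x \<omega>. norm \<omega> = 1 \<Longrightarrow> norm ((dird (- \<omega>) ^^ k) f x) \<le> C"
    using dird_funpow_bounded by blast
  show ?thesis
    unfolding sph_deriv_def
    by (rule continuous_on_sphere_integral[where B=C])
      (use C(2) in \<open>auto simp: case_prod_unfold intro!: continuous_on_dird_funpow_compose continuous_intros\<close>)
qed

lemma sph_deriv_bounded:
  obtains C where "C \<ge> 0" "\<And>\<theta> r. norm (sph_deriv f \<theta> k r) \<le> C"
proof -
  obtain C where C: "C \<ge> 0" "\<And>x \<omega>. norm \<omega> = 1 \<Longrightarrow> norm ((dird (- \<omega>) ^^ k) f x) \<le> C"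
    using dird_funpow_bounded by blast
  have "norm (sph_deriv f \<theta> k r) \<le> sphere_area CARD('n) * C" for \<theta> r
    unfolding sph_deriv_def by (rule norm_sphere_integral_le[OF C(2) sph_deriv_integrable])
  then show ?thesis using that[of "sphere_area CARD('n) * C"] C sphere_area_pos[of "CARD('n)"] by simp
qed

lemma sph_deriv_has_vector_derivative:
  "(sph_deriv f \<theta> k has_vector_derivative sph_deriv f \<theta> (Suc k) r) (at r)"
proof -
  obtain C where C: "C \<ge> 0" "\<And>x \<omega>. norm \<omega> = 1 \<Longrightarrow> norm ((dird (- \<omega>) ^^ Suc k) f x) \<le> C"
    using dird_funpow_bounded[of "Suc k"] by blast
  have "((\<lambda>r. \<integral>\<omega>. (dird (- \<omega>) ^^ k) f (\<theta> - r *\<^sub>R \<omega>) \<partial>sphere_measure) has_vector_derivative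
     (\<integral>\<omega>. (dird (- \<omega>) ^^ Suc k) f (\<theta> - r *\<^sub>R \<omega>) \<partial>sphere_measure)) (at r)"
  proof (rule has_vector_derivative_integral_dominated[where e=1 and B="\<lambda>_. C"])
    show "((\<lambda>r. (dird (- \<omega>) ^^ k) f (\<theta> - r *\<^sub>R \<omega>)) has_vector_derivative (dird (- \<omega>) ^^ Suc k) f (\<theta> - x *\<^sub>R \<omega>)) (at x)" for x \<omega>
      using smooth_has_vector_derivative_line[where f="(dird (- \<omega>) ^^ k) f" and x=\<theta> and v="- \<omega>" and s=x, OF smooth_dird_funpow[OF f]] by simp
    show "norm ((dird (- \<omega>) ^^ Suc k) f (\<theta> - x *\<^sub>R \<omega>)) \<le> C" if "\<omega> \<in> space sphere_measure" for x \<omega>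
      using C(2)[of \<omega>] that by simp
  qed (use borel_measurable_integrable[OF sph_deriv_integrable[of "Suc k"]] sph_deriv_integrable in simp_all)
  then show ?thesis unfolding sph_deriv_def[abs_def] .
qed

text \<open>The triangle inequality gives |\<theta> - r \<omega>| >= 1 - |r| > \<rho>: small spheres
  about points of the unit sphere miss the support.\<close>

lemma sph_deriv_eq_0:
  assumes "norm \<theta> = 1" "\<bar>r\<bar> < 1 - \<rho>"
  shows "sph_deriv f \<theta> k r = 0"
proof -
  have "(dird (- \<omega>) ^^ k) f (\<theta> - r *\<^sub>R \<omega>) = 0" if "norm \<omega> = 1" for \<omega>
    by (rule dird_funpow_outside) (use norm_triangle_ineq2[of \<theta> "r *\<^sub>R \<omega>"] assms that in simp)
  then have "sph_deriv f \<theta> k r = (\<integral>\<omega>. 0 \<partial>(sphere_measure :: (real^'n) measure))"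
    unfolding sph_deriv_def by (intro Bochner_Integration.integral_cong) auto
  then show ?thesis by simp
qed

end

text \<open>\<open>radial_chain S k p j\<close> is \<open>D\<^sup>k (r\<^sup>p S\<^sub>j)\<close> when \<open>S\<^sub>j\<^sub>+\<^sub>1\<close> is the derivative of \<open>S\<^sub>j\<close>.\<close>

fun radial_chain :: "(nat \<Rightarrow> real \<Rightarrow> complex) \<Rightarrow> nat \<Rightarrow> real \<Rightarrow> nat \<Rightarrow> real \<Rightarrow> complex" where
  "radial_chain S 0 p j r = (r powr p) *\<^sub>R S j r"
| "radial_chain S (Suc k) p j r = (p / 2) *\<^sub>R radial_chain S k (p - 2) j r + (1 / 2) *\<^sub>R radial_chain S k (p - 1) (Suc j) r"

text \<open>The product rule gives D(r^p S_j) = (p/2) r^(p-2) S_j + (1/2) r^(p-1) S_(j+1). The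
  recursion of \<open>radial_chain\<close> applies this identity first and the other k copies of D
  afterwards, so the induction varies p and j.\<close>

lemma radial_chain_has_vector_derivative:
  assumes S: "\<And>j r. (S j has_vector_derivative S (Suc j) r) (at r)" and r: "r > 0"
  shows "(radial_chain S k p j has_vector_derivative (2 * r) *\<^sub>R radial_chain S (Suc k) p j r) (at r)"
proof (induction k arbitrary: p j)
  case 0
  have "((\<lambda>r. r powr p) has_vector_derivative p * r powr (p - 1)) (at r)"
    unfolding has_real_derivative_iff_has_vector_derivative[symmetric] using r by (rule has_real_derivative_powr)
  from has_vector_derivative_scaleR[OF this[unfolded has_real_derivative_iff_has_vector_derivative[symmetric]] S[of j]]
  have "((\<lambda>r. (r powr p) *\<^sub>R S j r) has_vector_derivative (r powr p) *\<^sub>R S (Suc j) r + (p * r powr (p - 1)) *\<^sub>R S j r) (at r)"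
    by simp
  moreover have "r * r powr (p - 2) = r powr (p - 1)" "r * r powr (p - 1) = r powr p"
    using r by (simp_all add: powr_diff power2_eq_square)
  ultimately show ?case using r by (simp add: algebra_simps)
next
  case (Suc k)
  have "((\<lambda>r. (p / 2) *\<^sub>R radial_chain S k (p - 2) j r + (1 / 2) *\<^sub>R radial_chain S k (p - 1) (Suc j) r) has_vector_derivative
     (p / 2) *\<^sub>R ((2 * r) *\<^sub>R radial_chain S (Suc k) (p - 2) j r) + (1 / 2) *\<^sub>R ((2 * r) *\<^sub>R radial_chain S (Suc k) (p - 1) (Suc j) r)) (at r)"
    by (intro derivative_intros bounded_linear.has_vector_derivative[OF bounded_linear_scaleR_right] Suc)
  then show ?case
    unfolding radial_chain.simps(2)[of S "Suc k" p j] by (simp add: radial_chain.simps(2)[abs_def] scaleR_add_right mult.commute del: radial_chain.simps)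
qed

lemma radial_chain_eq_0:
  "(\<And>j. S j r = 0) \<Longrightarrow> radial_chain S k p j r = 0"
  by (induction k arbitrary: p j) auto

text \<open>Exponents can become negative along the recursion, so r is kept away from 0; the values
  of r^p at both ends of the interval cover either sign of p. Uniformity in \<theta> is for
  dominated convergence on the sphere.\<close>

lemma radial_chain_bounded:
  assumes "\<And>j. \<exists>C. \<forall>\<theta>. \<forall>r. norm (S \<theta> j r) \<le> C" and \<delta>: "0 < \<delta>"
  shows "\<exists>C. \<forall>\<theta>. \<forall>r\<in>{\<delta>..R}. norm (radial_chain (S \<theta>) k p j r) \<le> C"
proof (induction k arbitrary: p j)
  case 0
  obtain C where C: "\<And>\<theta> r. norm (S \<theta> j r) \<le> C" using assms(1) by blast
  have "norm (radial_chain (S \<theta>) 0 p j r) \<le> (\<delta> powr p + R powr p) * C" if r: "r \<in> {\<delta>..R}" for \<theta> r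
  proof -
    have "r powr p \<le> \<delta> powr p + R powr p"
    proof (cases "p \<ge> 0")
      case True
      then have "r powr p \<le> R powr p" using r \<delta> by (intro powr_mono2) auto
      then show ?thesis by (simp add: add_increasing)
    next
      case False
      then have "r powr p \<le> \<delta> powr p" using r \<delta> by (intro powr_mono2') auto
      then show ?thesis by (simp add: add_increasing2)
    qed
    then show ?thesis using C[of \<theta> r] by (auto intro!: mult_mono)
  qed
  then show ?case by blast
next
  case (Suc k)
  obtain C1 C2 where C: "\<And>\<theta> r. r \<in> {\<delta>..R} \<Longrightarrow> norm (radial_chain (S \<theta>) k (p - 2) j r) \<le> C1"
     "\<And>\<theta> r. r \<in> {\<delta>..R} \<Longrightarrow> norm (radial_chain (S \<theta>) k (p - 1) (Suc j) r) \<le> C2"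
    using Suc by meson
  have "norm (radial_chain (S \<theta>) (Suc k) p j r) \<le> \<bar>p / 2\<bar> * C1 + (1 / 2) * C2" if "r \<in> {\<delta>..R}" for \<theta> r
    using norm_triangle_ineq[of "(p / 2) *\<^sub>R radial_chain (S \<theta>) k (p - 2) j r" "(1 / 2) *\<^sub>R radial_chain (S \<theta>) k (p - 1) (Suc j) r"]
      mult_left_mono[OF C(1)[OF that, of \<theta>], of "\<bar>p/2\<bar>"] C(2)[OF that, of \<theta>] by simp
  then show ?case by blast
qed

lemma radial_chain_measurable:
  assumes "\<And>j. (\<lambda>\<theta>. S \<theta> j (r \<theta>)) \<in> borel_measurable M" "r \<in> borel_measurable M"
  shows "(\<lambda>\<theta>. radial_chain (S \<theta>) k p j (r \<theta>)) \<in> borel_measurable M"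
  using assms(2) by (induction k arbitrary: p j) (use assms(1) in simp_all)

text \<open>The k-th derivative in s of s^(n/2-1) times the unnormalised spherical mean of radius
  sqrt s. At index 0 it carries twice the polar weight, whence the factors 1/2 in the later
  formulas.\<close>

definition sph_chain :: "(real ^ 'n \<Rightarrow> complex) \<Rightarrow> real ^ 'n \<Rightarrow> nat \<Rightarrow> real \<Rightarrow> complex" where
  "sph_chain f \<theta> k s = (if s > 0 then radial_chain (sph_deriv f \<theta>) k (real CARD('n) - 2) 0 (sqrt s) else 0)"

lemma sph_chain_0: "sph_chain f \<theta> 0 s = (2 * polar_weight CARD('n) s) *\<^sub>R (\<integral>\<omega>. f (\<theta> - sqrt s *\<^sub>R \<omega>) \<partial>sphere_measure)"
  for f :: "real ^ 'n \<Rightarrow> complex"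
  by (simp add: sph_chain_def polar_weight_def sph_deriv_def powr_half_sqrt[symmetric] powr_powr diff_divide_distrib)

context
  fixes f :: "real ^ 'n \<Rightarrow> complex" and \<rho> :: real
  assumes f: "smooth f" and \<rho>: "\<And>x. \<rho> < norm x \<Longrightarrow> f x = 0" and \<rho>1: "\<rho> < 1"
begin

lemma sph_chain_eq_0:
  assumes "norm \<theta> = 1" "s < (1 - \<rho>)\<^sup>2"
  shows "sph_chain f \<theta> k s = 0"
proof (cases "s > 0")
  case True
  have "sqrt s < 1 - \<rho>" using assms \<rho>1 real_sqrt_less_mono[OF assms(2)] by simp
  then show ?thesis using True sph_deriv_eq_0[OF f \<rho> assms(1)] by (simp add: sph_chain_def radial_chain_eq_0)
qed (simp add: sph_chain_def)

lemma deriv_chain_sph_chain: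
  assumes \<theta>: "norm \<theta> = 1"
  shows "deriv_chain (sph_chain f \<theta>)"
  unfolding deriv_chain_def
proof (intro conjI allI impI)
  fix k s
  show "(sph_chain f \<theta> k has_vector_derivative sph_chain f \<theta> (Suc k) s) (at s)"
  proof (cases "s > 0")
    case True
    have "(sqrt has_vector_derivative inverse (sqrt s) / 2) (at s)"
      unfolding has_real_derivative_iff_has_vector_derivative[symmetric] using True by (rule DERIV_real_sqrt)
    moreover have "(sph_deriv f \<theta> j has_vector_derivative sph_deriv f \<theta> (Suc j) r) (at r)" for j r
      by (rule sph_deriv_has_vector_derivative[OF f \<rho>])
    ultimately have "(radial_chain (sph_deriv f \<theta>) k (real CARD('n) - 2) 0 \<circ> sqrt has_vector_derivative
       (inverse (sqrt s) / 2) *\<^sub>R ((2 * sqrt s) *\<^sub>R radial_chain (sph_deriv f \<theta>) (Suc k) (real CARD('n) - 2) 0 (sqrt s))) (at s)"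
      by (intro vector_diff_chain_at radial_chain_has_vector_derivative) (use True in auto)
    with True
    have "((\<lambda>s. radial_chain (sph_deriv f \<theta>) k (real CARD('n) - 2) 0 (sqrt s)) has_vector_derivative radial_chain (sph_deriv f \<theta>) (Suc k) (real CARD('n) - 2) 0 (sqrt s)) (at s)"
      by (simp add: o_def del: radial_chain.simps)
    then have "((\<lambda>s. radial_chain (sph_deriv f \<theta>) k (real CARD('n) - 2) 0 (sqrt s)) has_vector_derivative sph_chain f \<theta> (Suc k) s) (at s)"
      using True by (simp add: sph_chain_def del: radial_chain.simps)
    then show ?thesis
      by (rule has_vector_derivative_transform_within_open[of _ _ _ "{0<..}"]) (use True in \<open>auto simp: sph_chain_def\<close>)
  next
    case False
    \<comment> \<open>A point s <= 0 has a neighbourhood on which the whole chain vanishes, so the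
      singularity of the square root at 0 is never met.\<close>
    have \<delta>: "(1 - \<rho>)\<^sup>2 > 0" using \<rho>1 by simp
    have s: "s < (1 - \<rho>)\<^sup>2" using \<delta> False by linarith
    have z: "sph_chain f \<theta> (Suc k) s = 0" by (rule sph_chain_eq_0[OF \<theta> s])
    show ?thesis unfolding z
      by (rule has_vector_derivative_transform_within_open[of "\<lambda>_. 0" _ _ "{..<(1 - \<rho>)\<^sup>2}"]) (use s sph_chain_eq_0[OF \<theta>] in auto)
  qed
qed (simp add: sph_chain_def)

lemma sph_chain_bounded:
  obtains C where "C \<ge> 0" "\<And>\<theta> s. norm \<theta> = 1 \<Longrightarrow> s \<le> R \<Longrightarrow> norm (sph_chain f \<theta> k s) \<le> C"
proof -
  have "\<exists>C. \<forall>\<theta> r. norm (sph_deriv f \<theta> j r) \<le> C" for j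
    using sph_deriv_bounded[where k=j, OF f \<rho>] by metis
  from radial_chain_bounded[where S="sph_deriv f" and \<delta>="1 - \<rho>" and R="sqrt R" and k=k and p="real CARD('n) - 2" and j=0, OF this] \<rho>1
  obtain C where "\<forall>\<theta>. \<forall>r\<in>{1 - \<rho>..sqrt R}. norm (radial_chain (sph_deriv f \<theta>) k (real CARD('n) - 2) 0 r) \<le> C"
    by (simp only: diff_gt_0_iff_gt) blast
  then have C: "\<And>\<theta> r. r \<in> {1 - \<rho>..sqrt R} \<Longrightarrow> norm (radial_chain (sph_deriv f \<theta>) k (real CARD('n) - 2) 0 r) \<le> C"
    by blast
  have "norm (sph_chain f \<theta> k s) \<le> max C 0" if "norm \<theta> = 1" "s \<le> R" for \<theta> s
  proof (cases "s < (1 - \<rho>)\<^sup>2")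
    case True
    then show ?thesis using sph_chain_eq_0[OF that(1)] by simp
  next
    case False
    then have "1 - \<rho> \<le> sqrt s" using \<rho>1 by (simp add: real_le_rsqrt)
    moreover have "s > 0" using False \<rho>1 by (smt (verit) zero_less_power)
    ultimately show ?thesis using C[of "sqrt s" \<theta>] that(2) by (simp add: sph_chain_def le_max_iff_disj)
  qed
  then show ?thesis using that[of "max C 0"] by simp
qed

lemma sph_chain_measurable:
  assumes "continuous_on UNIV r"
  shows "(\<lambda>\<theta>. sph_chain f \<theta> k (r \<theta>)) \<in> borel_measurable borel"
proof -
  have [measurable]: "r \<in> borel_measurable borel" by (rule borel_measurable_continuous_onI[OF assms])
  have "(\<lambda>\<theta>. radial_chain (sph_deriv f \<theta>) k (real CARD('n) - 2) 0 (sqrt (r \<theta>))) \<in> borel_measurable borel"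
  proof (rule radial_chain_measurable)
    show "(\<lambda>\<theta>. sph_deriv f \<theta> j (sqrt (r \<theta>))) \<in> borel_measurable borel" for j
      using continuous_on_compose2[OF continuous_on_sph_deriv[where k=j, OF f \<rho>], where s=UNIV and f="\<lambda>\<theta>. (\<theta>, sqrt (r \<theta>))"]
      by (intro borel_measurable_continuous_onI) (simp add: continuous_intros assms)
  qed measurable
  then show ?thesis unfolding sph_chain_def by measurable
qed

end

section \<open>Radial integrals\<close>

lemma nn_integral_radial:
  fixes h :: "real \<Rightarrow> real"
  assumes [measurable]: "h \<in> borel_measurable borel"
  shows "(\<integral>\<^sup>+y. ennreal (h ((norm (y :: real ^ 'n))\<^sup>2)) \<partial>lborel) = ennreal (sphere_area CARD('n)) * (\<integral>\<^sup>+s. ennreal (polar_weight CARD('n) s * h s) \<partial>lborel)"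
proof -
  have "(\<integral>\<^sup>+y. ennreal (h ((norm (y :: real ^ 'n))\<^sup>2)) \<partial>lborel)
      = (\<integral>\<^sup>+s. ennreal (polar_weight CARD('n) s) * (\<integral>\<^sup>+\<omega>. ennreal (h ((norm (sqrt s *\<^sub>R (\<omega> :: real ^ 'n)))\<^sup>2)) \<partial>sphere_measure) \<partial>lborel)"
    by (rule nn_integral_polar) measurable
  also have "\<dots> = (\<integral>\<^sup>+s. ennreal (sphere_area CARD('n)) * ennreal (polar_weight CARD('n) s * h s) \<partial>lborel)"
  proof (rule nn_integral_cong)
    fix s
    show "ennreal (polar_weight CARD('n) s) * (\<integral>\<^sup>+\<omega>. ennreal (h ((norm (sqrt s *\<^sub>R (\<omega> :: real ^ 'n)))\<^sup>2)) \<partial>sphere_measure) = ennreal (sphere_area CARD('n)) * ennreal (polar_weight CARD('n) s * h s)"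
    proof (cases "s > 0")
      case True
      have "(\<integral>\<^sup>+\<omega>. ennreal (h ((norm (sqrt s *\<^sub>R (\<omega> :: real ^ 'n)))\<^sup>2)) \<partial>sphere_measure) = (\<integral>\<^sup>+\<omega>. ennreal (h s) \<partial>(sphere_measure :: (real ^ 'n) measure))"
        by (rule nn_integral_cong) (use True in \<open>simp add: power_mult_distrib\<close>)
      then show ?thesis
        unfolding ennreal_mult'[OF polar_weight_nonneg] by (simp add: emeasure_sphere_measure_space mult_ac)
    qed (simp add: polar_weight_def)
  qed
  also have "\<dots> = ennreal (sphere_area CARD('n)) * (\<integral>\<^sup>+s. ennreal (polar_weight CARD('n) s * h s) \<partial>lborel)"
    by (rule nn_integral_cmult) measurable
  finally show ?thesis .
qed

text \<open>In s = |z|^2 the kernel |z|^(2-n) is s^(1-n/2), which cancels the polar weight up to the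
  factor 1/2.\<close>

lemma integrable_norm_powr_cball:
  "integrable lborel (\<lambda>z::real^'n. indicator (cball 0 R) z * norm z powr (2 - real CARD('n)))"
proof (rule integrableI_nonneg)
  define h where "h s = indicator {..R\<^sup>2} s * s powr (1 - real CARD('n) / 2)" for s :: real
  have [measurable]: "h \<in> borel_measurable borel" unfolding h_def by measurable
  have "(\<integral>\<^sup>+z. ennreal (indicator (cball 0 R) z * norm (z::real^'n) powr (2 - real CARD('n))) \<partial>lborel) \<le> (\<integral>\<^sup>+z. ennreal (h ((norm (z::real^'n))\<^sup>2)) \<partial>lborel)"
  proof (rule nn_integral_mono, rule ennreal_leI)
    fix z :: "real ^ 'n"
    have "((norm z)\<^sup>2) powr (1 - real CARD('n) / 2) = norm z powr (2 - real CARD('n))"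
      using powr_powr[of "norm z" 2 "1 - real CARD('n) / 2"] by (simp add: algebra_simps)
    moreover have "norm z \<le> R \<Longrightarrow> (norm z)\<^sup>2 \<le> R\<^sup>2" by (intro power_mono) auto
    ultimately show "indicator (cball 0 R) z * norm z powr (2 - real CARD('n)) \<le> h ((norm z)\<^sup>2)"
      by (auto simp: h_def indicator_def)
  qed
  also have "\<dots> = ennreal (sphere_area CARD('n)) * (\<integral>\<^sup>+s. ennreal (polar_weight CARD('n) s * h s) \<partial>lborel)"
    by (rule nn_integral_radial) measurable
  also have "(\<integral>\<^sup>+s. ennreal (polar_weight CARD('n) s * h s) \<partial>lborel) \<le> (\<integral>\<^sup>+s. indicator {0..R\<^sup>2} s \<partial>lborel)"
  proof (rule nn_integral_mono)
    fix s
    have "s powr (real CARD('n) / 2 - 1) * s powr (1 - real CARD('n) / 2) = 1" if "s > 0"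
      using that by (simp add: powr_add[symmetric])
    then have "polar_weight CARD('n) s * h s \<le> indicator {0..R\<^sup>2} s"
      by (auto simp: polar_weight_def h_def indicator_def)
    then show "ennreal (polar_weight CARD('n) s * h s) \<le> indicator {0..R\<^sup>2} s"
      by (metis ennreal_indicator ennreal_leI)
  qed
  also have "\<dots> = ennreal (R\<^sup>2)" by simp
  finally show "(\<integral>\<^sup>+z. ennreal (indicator (cball 0 R) z * norm (z::real^'n) powr (2 - real CARD('n))) \<partial>lborel) < \<infinity>"
    using ennreal_mult_less_top by (simp add: mult_left_mono order_le_less_trans ennreal_mult_less_top)
  show "(\<lambda>z::real^'n. indicator (cball 0 R) z * norm z powr (2 - real CARD('n))) \<in> borel_measurable lborel"
    by (intro borel_measurable_times borel_measurable_indicator powr_real_measurable borel_measurable_norm borel_measurable_const) auto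
qed (auto intro!: AE_I2)

text \<open>The total mass of the approximate identity that appears when the Newtonian kernel is
  regularised.\<close>

lemma poisson_kernel_integral:
  assumes n: "CARD('n) \<ge> 3"
  shows "integrable lborel (\<lambda>w::real^'n. (1 + (norm w)\<^sup>2) powr (- real CARD('n) / 2 - 1))"
    and "(\<integral>w. (1 + (norm (w::real^'n))\<^sup>2) powr (- real CARD('n) / 2 - 1) \<partial>lborel) = sphere_area CARD('n) / real CARD('n)"
proof -
  define N where "N = real CARD('n)"
  have N: "N \<ge> 3" using n by (simp add: N_def)
  define h where "h s = (if s > 0 then (1 + s) powr (- N / 2 - 1) else 0)" for s :: real
  have [measurable]: "h \<in> borel_measurable borel" unfolding h_def by measurable
  \<comment> \<open>An explicit primitive of the radial density; it tends to 0 at 0 and to 1/n at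
    infinity.\<close>
  define F where "F s = (s / (1 + s)) powr (N / 2) / N" for s :: real
  have int: "set_integrable lborel (einterval 0 \<infinity>) (\<lambda>s. polar_weight CARD('n) s * h s)"
    "(LBINT s=0..\<infinity>. polar_weight CARD('n) s * h s) = 1 / N - 0"
  proof -
    have D: "(F has_real_derivative polar_weight CARD('n) s * h s) (at s)" if "s > 0" for s
    proof -
      have "((\<lambda>s. s / (1 + s)) has_real_derivative 1 / (1 + s)\<^sup>2) (at s)"
        using that by (auto intro!: derivative_eq_intros simp: power2_eq_square field_simps)
      then have "((\<lambda>s. (s / (1 + s)) powr (N / 2)) has_real_derivative (N / 2) * (s / (1 + s)) powr (N / 2 - 1) * (1 / (1 + s)\<^sup>2)) (at s)"
        by (rule DERIV_chain2[OF has_real_derivative_powr, rotated]) (use that in simp)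
      then have "(F has_real_derivative (N / 2) * (s / (1 + s)) powr (N / 2 - 1) * (1 / (1 + s)\<^sup>2) / N) (at s)"
        unfolding F_def by (rule DERIV_cdivide)
      also have "(N / 2) * (s / (1 + s)) powr (N / 2 - 1) * (1 / (1 + s)\<^sup>2) / N = polar_weight CARD('n) s * h s"
      proof -
        have "(s / (1 + s)) powr (N / 2 - 1) = s powr (N / 2 - 1) * (1 + s) powr (1 - N / 2)"
          using that powr_divide[of s "1 + s" "N / 2 - 1"] powr_minus_divide[of "1 + s" "N / 2 - 1"] by simp
        moreover have "(1 + s) powr (1 - N / 2) / (1 + s)\<^sup>2 = (1 + s) powr (- N / 2 - 1)"
        proof -
          have "- N / 2 - 1 = (1 - N / 2) - 2" by simp
          then show ?thesis using that by (simp only: powr_diff) simp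
        qed
        ultimately show ?thesis
          using that N by (simp add: polar_weight_def h_def N_def[symmetric] field_simps)
      qed
      finally show ?thesis .
    qed
    have cont: "isCont (\<lambda>s. polar_weight CARD('n) s * h s) s" if "s > 0" for s
    proof -
      have "isCont (\<lambda>s. s powr (N / 2 - 1) / 2 * (1 + s) powr (- N / 2 - 1)) s"
        using that by (intro continuous_intros) auto
      moreover have "\<forall>\<^sub>F s in nhds s. s powr (N / 2 - 1) / 2 * (1 + s) powr (- N / 2 - 1) = polar_weight CARD('n) s * h s"
        by (rule eventually_mono[OF eventually_nhds_in_open[of "{0<..}" s]]) (use that in \<open>auto simp: polar_weight_def h_def N_def\<close>)
      ultimately show ?thesis using isCont_cong by fast
    qed
    have l0: "(F \<longlongrightarrow> 0) (at_right 0)" unfolding F_def using N by real_asymp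
    have "(F \<longlongrightarrow> inverse N) at_top" unfolding F_def using N by real_asymp
    then have l1: "(F \<longlongrightarrow> 1 / N) at_top" by (simp add: inverse_eq_divide)
    have l0': "((F \<circ> real_of_ereal) \<longlongrightarrow> 0) (at_right (0::ereal))"
      using l0 unfolding zero_ereal_def by (simp add: ereal_tendsto_simps)
    have l1': "((F \<circ> real_of_ereal) \<longlongrightarrow> 1 / N) (at_left (\<infinity>::ereal))"
      using l1 by (simp add: ereal_tendsto_simps)
    have nn: "AE s in lborel. 0 < ereal s \<longrightarrow> ereal s < \<infinity> \<longrightarrow> 0 \<le> polar_weight CARD('n) s * h s"
      by (intro AE_I2 impI mult_nonneg_nonneg) (simp_all add: h_def)
    have D': "0 < ereal s \<Longrightarrow> ereal s < \<infinity> \<Longrightarrow> (F has_real_derivative polar_weight CARD('n) s * h s) (at s)"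
      and c': "0 < ereal s \<Longrightarrow> ereal s < \<infinity> \<Longrightarrow> isCont (\<lambda>s. polar_weight CARD('n) s * h s) s" for s
      using D cont by simp_all
    show "set_integrable lborel (einterval 0 \<infinity>) (\<lambda>s. polar_weight CARD('n) s * h s)"
      by (rule interval_integral_FTC_nonneg(1)[OF _ D' c' nn l0' l1']) auto
    show "(LBINT s=0..\<infinity>. polar_weight CARD('n) s * h s) = 1 / N - 0"
      by (rule interval_integral_FTC_nonneg(2)[OF _ D' c' nn l0' l1']) auto
  qed
  have "has_bochner_integral lborel (\<lambda>s. polar_weight CARD('n) s * h s) (1 / N)"
  proof -
    have e: "indicator (einterval 0 \<infinity>) s *\<^sub>R (polar_weight CARD('n) s * h s) = polar_weight CARD('n) s * h s" for s
      by (auto simp: indicator_def einterval_def h_def)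
    show ?thesis using int
      unfolding set_integrable_def interval_lebesgue_integral_def set_lebesgue_integral_def e
      by (simp add: has_bochner_integral_iff)
  qed
  then have "(\<integral>\<^sup>+s. ennreal (polar_weight CARD('n) s * h s) \<partial>lborel) = ennreal (1 / N)"
    by (subst nn_integral_eq_integral) (auto simp: has_bochner_integral_iff h_def)
  then have "(\<integral>\<^sup>+y. ennreal (h ((norm (y :: real ^ 'n))\<^sup>2)) \<partial>lborel) = ennreal (sphere_area CARD('n)) * ennreal (1 / N)"
    by (subst nn_integral_radial) simp_all
  also have "\<dots> = ennreal (sphere_area CARD('n) / N)"
    using N sphere_area_pos[of "CARD('n)"] by (simp flip: ennreal_mult)
  also have "(\<integral>\<^sup>+y. ennreal (h ((norm (y :: real ^ 'n))\<^sup>2)) \<partial>lborel) = (\<integral>\<^sup>+y. ennreal ((1 + (norm (y :: real ^ 'n))\<^sup>2) powr (- N / 2 - 1)) \<partial>lborel)"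
    by (rule nn_integral_cong_AE, rule AE_mp[OF AE_lborel_singleton[of 0]]) (auto simp: h_def intro!: AE_I2)
  finally have "(\<integral>\<^sup>+y. ennreal ((1 + (norm (y :: real ^ 'n))\<^sup>2) powr (- N / 2 - 1)) \<partial>lborel) = ennreal (sphere_area CARD('n) / N)" .
  then show "integrable lborel (\<lambda>w::real^'n. (1 + (norm w)\<^sup>2) powr (- real CARD('n) / 2 - 1))"
    "(\<integral>w. (1 + (norm (w::real^'n))\<^sup>2) powr (- real CARD('n) / 2 - 1) \<partial>lborel) = sphere_area CARD('n) / real CARD('n)"
    using N sphere_area_pos[of "CARD('n)"]
    by (subst (asm) nn_integral_eq_integrable; simp add: N_def)+
qed

section \<open>The Newtonian potential\<close>

text \<open>The potential without its normalising constant. In the form f(x - z) all derivatives in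
  x fall on f, and the singular kernel is not differentiated.\<close>

definition newton_potential :: "(real ^ 'n \<Rightarrow> complex) \<Rightarrow> real ^ 'n \<Rightarrow> complex" where
  "newton_potential f x = (\<integral>z. f (x - z) * of_real (norm z powr (2 - real CARD('n))) \<partial>lborel)"

lemma newton_potential_integrand_bound:
  fixes f :: "real ^ 'n \<Rightarrow> complex"
  assumes C: "\<And>x. norm (f x) \<le> C" and \<rho>: "\<And>x. \<rho> < norm x \<Longrightarrow> f x = 0" and x: "norm x \<le> X"
  shows "norm (f (x - z) * of_real (norm z powr p)) \<le> C * (indicator (cball 0 (X + \<rho>)) z * norm z powr p)"
proof (cases "norm z \<le> X + \<rho>")
  case True
  then show ?thesis using C[of "x - z"] by (simp add: norm_mult mult_right_mono)
next
  case False
  have "\<rho> < norm (x - z)" using norm_triangle_ineq2[of z x] False x by (simp add: norm_minus_commute)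
  then show ?thesis using \<rho> False by simp
qed

lemma newton_potential_integrable:
  fixes f :: "real ^ 'n \<Rightarrow> complex"
  assumes f: "continuous_on UNIV f" and \<rho>: "\<And>x. \<rho> < norm x \<Longrightarrow> f x = 0"
  shows "integrable lborel (\<lambda>z. f (x - z) * of_real (norm z powr (2 - real CARD('n))))"
proof -
  obtain C where C: "C \<ge> 0" "\<And>x. norm (f x) \<le> C"
    using continuous_bounded_support_bounded[OF f \<rho>] by blast
  have [measurable]: "f \<in> borel_measurable borel" by (rule borel_measurable_continuous_onI[OF f])
  show ?thesis
    by (rule Bochner_Integration.integrable_bound[OF integrable_mult_right[OF integrable_norm_powr_cball, of C "norm x + \<rho>"]])
      (use newton_potential_integrand_bound[OF C(2) \<rho> order_refl, where x=x and p="2 - real CARD('n)"] in \<open>auto intro!: AE_I2 order_trans[OF _ abs_ge_self]\<close>)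
qed

lemma newton_potential_has_vector_derivative:
  fixes f :: "real ^ 'n \<Rightarrow> complex"
  assumes f: "smooth f" and \<rho>: "\<And>x. \<rho> < norm x \<Longrightarrow> f x = 0"
  shows "((\<lambda>s. newton_potential f (x + s *\<^sub>R v)) has_vector_derivative newton_potential (dird v f) (x + s *\<^sub>R v)) (at s)"
proof -
  have \<rho>': "dird v f x = 0" if "\<rho> < norm x" for x
    using dird_funpow_outside[where k=1 and f=f and \<rho>=\<rho> and v=v and x=x, OF f \<rho> that] by simp
  have c: "continuous_on UNIV (dird v f)" by (rule smooth_continuous[OF smooth_dird[OF f]])
  obtain C where C: "C \<ge> 0" "\<And>x. norm (dird v f x) \<le> C"
    using continuous_bounded_support_bounded[OF c \<rho>'] by blast
  \<comment> \<open>A bound for |x + t v| over |t - s| < 1, so that all integrands live in one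
    ball.\<close>
  define X where "X = norm x + (\<bar>s\<bar> + 1) * norm v"
  show ?thesis
    unfolding newton_potential_def
  proof (rule has_vector_derivative_integral_dominated[where e=1 and B="\<lambda>z. C * (indicator (cball 0 (X + \<rho>)) z * norm z powr (2 - real CARD('n)))"])
    show "integrable lborel (\<lambda>z. f (x + t *\<^sub>R v - z) * of_real (norm z powr (2 - real CARD('n))))" for t
      by (rule newton_potential_integrable[OF smooth_continuous[OF f] \<rho>])
    show "((\<lambda>t. f (x + t *\<^sub>R v - z) * of_real (norm z powr (2 - real CARD('n)))) has_vector_derivative dird v f (x + t *\<^sub>R v - z) * of_real (norm z powr (2 - real CARD('n)))) (at t)" for t z
      using has_vector_derivative_mult_left[OF smooth_has_vector_derivative_line[where x="x - z" and v=v and s=t, OF f], of "of_real (norm z powr (2 - real CARD('n)))"]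
      by (simp add: diff_add_eq)
    show "norm (dird v f (x + t *\<^sub>R v - z) * of_real (norm z powr (2 - real CARD('n)))) \<le> C * (indicator (cball 0 (X + \<rho>)) z * norm z powr (2 - real CARD('n)))"
      if t: "t \<in> ball s 1" for t z
    proof (rule newton_potential_integrand_bound[OF C(2) \<rho>'])
      have "\<bar>t\<bar> \<le> \<bar>s\<bar> + 1" using t by (simp add: dist_real_def)
      then have "\<bar>t\<bar> * norm v \<le> (\<bar>s\<bar> + 1) * norm v" by (rule mult_right_mono) simp
      then show "norm (x + t *\<^sub>R v) \<le> X"
        using norm_triangle_ineq[of x "t *\<^sub>R v"] by (simp add: X_def)
    qed
    show "(\<lambda>z. dird v f (x + s *\<^sub>R v - z) * of_real (norm z powr (2 - real CARD('n)))) \<in> borel_measurable lborel"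
      using newton_potential_integrable[OF c \<rho>'] by simp
  qed (use integrable_norm_powr_cball in auto)
qed

lemma partial_deriv_eq:
  assumes "((\<lambda>s. g (x + s *\<^sub>R axis i 1)) has_vector_derivative d) (at 0)"
  shows "partial_deriv i g x = d"
  unfolding partial_deriv_def by (rule vector_derivative_at[OF assms])

lemma laplacian_newton_potential_eq:
  fixes f :: "real ^ 'n \<Rightarrow> complex"
  assumes f: "smooth f" and \<rho>: "\<And>x. \<rho> < norm x \<Longrightarrow> f x = 0"
  shows "laplacian (newton_potential f) x = (\<Sum>i\<in>UNIV. newton_potential (dird (axis i 1) (dird (axis i 1) f)) x)"
proof -
  have \<rho>': "dird v f x = 0" if "\<rho> < norm x" for x v
    using dird_funpow_outside[where k=1 and f=f and \<rho>=\<rho> and v=v and x=x, OF f \<rho> that] by simp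
  have "partial_deriv i (newton_potential f) = newton_potential (dird (axis i 1) f)" for i
    by (rule ext, rule partial_deriv_eq) (use newton_potential_has_vector_derivative[OF f \<rho>, where s=0] in force)
  moreover have "partial_deriv i (newton_potential (dird (axis i 1) f)) = newton_potential (dird (axis i 1) (dird (axis i 1) f))" for i
    by (rule ext, rule partial_deriv_eq) (use newton_potential_has_vector_derivative[OF smooth_dird[OF f] \<rho>', where s=0] in force)
  ultimately show ?thesis by (simp add: laplacian_def)
qed

text \<open>Differentiating g(x - z) in z carries a minus sign that cancels the one from integration
  by parts, so the derivative moves to the kernel without a sign.\<close>

lemma integral_by_parts_convolution:
  fixes g :: "real ^ 'n \<Rightarrow> complex"
  assumes g: "smooth g" and \<rho>: "\<And>x. \<rho> < norm x \<Longrightarrow> g x = 0"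
    and k: "continuous_on UNIV k" and k': "continuous_on UNIV k'"
    and der: "\<And>z. ((\<lambda>s. k (z + s *\<^sub>R v)) has_vector_derivative k' z) (at 0)"
  shows "(\<integral>z. dird v g (x - z) * k z \<partial>lborel) = (\<integral>z. g (x - z) * k' z \<partial>lborel)"
proof -
  have \<rho>': "dird v g x = 0" if "\<rho> < norm x" for x v
    using dird_funpow_outside[where k=1 and f=g and \<rho>=\<rho> and v=v and x=x, OF g \<rho> that] by simp
  have out: "\<rho> < norm (x - z)" if "norm x + \<rho> < norm z" for z
    using norm_triangle_ineq2[of z x] that by (simp add: norm_minus_commute)
  have cx: "continuous_on UNIV (\<lambda>z. h (x - z))" if "continuous_on UNIV h" for h :: "real ^ 'n \<Rightarrow> complex"
    by (rule continuous_on_compose2[OF that]) (auto intro!: continuous_intros)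
  have c1: "continuous_on UNIV (\<lambda>z. dird v g (x - z) * k z)" and c2: "continuous_on UNIV (\<lambda>z. g (x - z) * k' z)"
    by (intro continuous_intros cx k k' smooth_continuous smooth_dird g)+
  have i1: "integrable lborel (\<lambda>z. dird v g (x - z) * k z)"
    by (rule integrable_continuous_bounded_support[OF c1, of "norm x + \<rho>"]) (use out \<rho>' in auto)
  have i2: "integrable lborel (\<lambda>z. g (x - z) * k' z)"
    by (rule integrable_continuous_bounded_support[OF c2, of "norm x + \<rho>"]) (use out \<rho> in auto)
  have "(\<integral>z. g (x - z) * k' z - dird v g (x - z) * k z \<partial>lborel) = 0"
  proof (rule integral_directional_derivative_eq_0[where G="\<lambda>z. g (x - z) * k z" and a=v and R="norm x + \<rho>"])
    fix z
    have d: "((\<lambda>s. g ((x - z) + s *\<^sub>R (- v))) has_vector_derivative dird (- v) g ((x - z) + 0 *\<^sub>R (- v))) (at 0)"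
      by (rule smooth_has_vector_derivative_line[OF g])
    have "dird (- v) g y = - dird v g y" for y
      using linear_neg[OF has_derivative_linear[OF smooth_has_derivative[OF g]]] .
    with has_vector_derivative_mult[OF d der[of z]]
    show "((\<lambda>s. g (x - (z + s *\<^sub>R v)) * k (z + s *\<^sub>R v)) has_vector_derivative g (x - z) * k' z - dird v g (x - z) * k z) (at 0)"
      by (simp add: algebra_simps)
    show "continuous_on UNIV (\<lambda>z. g (x - z) * k z)" by (intro continuous_intros cx k smooth_continuous[OF g])
    show "continuous_on UNIV (\<lambda>z. g (x - z) * k' z - dird v g (x - z) * k z)" by (rule continuous_on_diff[OF c2 c1])
  qed (use out \<rho> \<rho>' in auto)
  then show ?thesis using i1 i2 by simp
qed

text \<open>The kernel (|z|^2 + \<epsilon>)^(1-n/2) is smooth, so both derivatives can be moved onto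
  it. Its Laplacian is -n (n - 2) \<epsilon> (|z|^2 + \<epsilon>)^(-n/2-1).\<close>

lemma integral_laplacian_convolution:
  fixes f :: "real ^ 'n \<Rightarrow> complex"
  assumes f: "smooth f" and \<rho>: "\<And>x. \<rho> < norm x \<Longrightarrow> f x = 0" and \<epsilon>: "\<epsilon> > 0"
  shows "(\<Sum>i\<in>UNIV. \<integral>z. dird (axis i 1) (dird (axis i 1) f) (x - z) * of_real (((norm z)\<^sup>2 + \<epsilon>) powr (1 - real CARD('n) / 2)) \<partial>lborel)
     = of_real (- real CARD('n) * (real CARD('n) - 2) * \<epsilon>) * (\<integral>z. f (x - z) * of_real (((norm z)\<^sup>2 + \<epsilon>) powr (- real CARD('n) / 2 - 1)) \<partial>lborel)"
proof -
  define N where "N = real CARD('n)"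
  define Q where "Q z = (norm z)\<^sup>2 + \<epsilon>" for z :: "real ^ 'n"
  have Q: "Q z > 0" for z using \<epsilon> by (simp add: Q_def add_nonneg_pos)
  have cQ: "continuous_on UNIV Q" unfolding Q_def by (intro continuous_intros)
  have cQp: "continuous_on UNIV (\<lambda>z. Q z powr p)" for p
    using Q by (intro continuous_intros cQ) (auto simp: less_imp_neq[symmetric])
  have dQ: "((\<lambda>s. Q (z + s *\<^sub>R axis i 1)) has_real_derivative 2 * z $ i) (at 0)" for z i
  proof -
    have "Q (z + s *\<^sub>R axis i 1) = Q z + 2 * s * z $ i + s\<^sup>2" for s
      unfolding Q_def power2_norm_eq_inner by (simp add: inner_add_left inner_add_right inner_axis inner_axis' power2_eq_square algebra_simps)
    then show ?thesis by (auto intro!: derivative_eq_intros)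
  qed
  have dQp: "((\<lambda>s. Q (z + s *\<^sub>R axis i 1) powr p) has_real_derivative p * Q z powr (p - 1) * (2 * z $ i)) (at 0)" for z i p
  proof -
    have "((\<lambda>u. u powr p) has_real_derivative p * Q (z + 0 *\<^sub>R axis i 1) powr (p - 1)) (at (Q (z + 0 *\<^sub>R axis i 1)))"
      by (rule has_real_derivative_powr) (rule Q)
    from DERIV_chain2[OF this dQ] show ?thesis by simp
  qed
  \<comment> \<open>\<open>k1 i\<close> and \<open>k2 i\<close> are the first and second partial
    derivatives of the regularised kernel in direction i.\<close>
  define k1 where "k1 i z = (2 - N) * z $ i * Q z powr (- N / 2)" for i z
  define k2 where "k2 i z = (2 - N) * Q z powr (- N / 2) - (2 - N) * N * (z $ i)\<^sup>2 * Q z powr (- N / 2 - 1)" for i z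
  have ck1: "continuous_on UNIV (k1 i)" for i unfolding k1_def[abs_def] by (intro continuous_intros cQp)
  have ck2: "continuous_on UNIV (k2 i)" for i unfolding k2_def[abs_def] by (intro continuous_intros cQp)
  have d1: "((\<lambda>s. Q (z + s *\<^sub>R axis i 1) powr (1 - N / 2)) has_real_derivative k1 i z) (at 0)" for i z
    using dQp[of z i "1 - N / 2"] by (simp add: k1_def algebra_simps)
  have d2: "((\<lambda>s. k1 i (z + s *\<^sub>R axis i 1)) has_real_derivative k2 i z) (at 0)" for i z
  proof -
    have "((\<lambda>s. (2 - N) * ((z + s *\<^sub>R axis i 1) $ i)) has_real_derivative (2 - N)) (at 0)"
      by (auto intro!: derivative_eq_intros)
    from DERIV_mult[OF this dQp[of z i "- N / 2"]]
    show ?thesis by (simp add: k1_def[abs_def] k2_def algebra_simps power2_eq_square)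
  qed
  have cr: "((\<lambda>s. complex_of_real (u s)) has_vector_derivative of_real d) (at 0)" if "(u has_real_derivative d) (at 0)" for u d
    using that by (intro has_vector_derivative_of_real) (simp add: has_real_derivative_iff_has_vector_derivative)
  have \<rho>': "dird v f x = 0" if "\<rho> < norm x" for x v
    using dird_funpow_outside[where k=1 and f=f and \<rho>=\<rho> and v=v and x=x, OF f \<rho> that] by simp
  have "(\<integral>z. dird (axis i 1) (dird (axis i 1) f) (x - z) * of_real (Q z powr (1 - N / 2)) \<partial>lborel) = (\<integral>z. f (x - z) * of_real (k2 i z) \<partial>lborel)" for i
  proof -
    have "(\<integral>z. dird (axis i 1) (dird (axis i 1) f) (x - z) * of_real (Q z powr (1 - N / 2)) \<partial>lborel) = (\<integral>z. dird (axis i 1) f (x - z) * of_real (k1 i z) \<partial>lborel)"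
      by (rule integral_by_parts_convolution[OF smooth_dird[OF f] \<rho>' _ _ cr[OF d1]]) (auto intro!: continuous_intros cQp ck1)
    also have "\<dots> = (\<integral>z. f (x - z) * of_real (k2 i z) \<partial>lborel)"
      by (rule integral_by_parts_convolution[OF f \<rho> _ _ cr[OF d2]]) (auto intro!: continuous_intros ck1 ck2)
    finally show ?thesis .
  qed
  then have "(\<Sum>i\<in>UNIV. \<integral>z. dird (axis i 1) (dird (axis i 1) f) (x - z) * of_real (Q z powr (1 - N / 2)) \<partial>lborel)
     = (\<Sum>i\<in>UNIV. \<integral>z. f (x - z) * of_real (k2 i z) \<partial>lborel)" by simp
  also have "\<dots> = (\<integral>z. (\<Sum>i\<in>UNIV. f (x - z) * of_real (k2 i z)) \<partial>lborel)"
  proof (rule Bochner_Integration.integral_sum[symmetric])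
    fix i :: 'n
    have out: "\<rho> < norm (x - z)" if "norm x + \<rho> < norm z" for z
      using norm_triangle_ineq2[of z x] that by (simp add: norm_minus_commute)
    have "continuous_on UNIV (\<lambda>z. f (x - z) * of_real (k2 i z))"
      by (intro continuous_intros ck2 continuous_on_compose2[OF smooth_continuous[OF f]]) auto
    then show "integrable lborel (\<lambda>z. f (x - z) * of_real (k2 i z))"
      by (rule integrable_continuous_bounded_support[of _ "norm x + \<rho>"]) (use out \<rho> in auto)
  qed
  also have "\<dots> = (\<integral>z. of_real (- N * (N - 2) * \<epsilon>) * (f (x - z) * of_real (Q z powr (- N / 2 - 1))) \<partial>lborel)"
  proof (rule Bochner_Integration.integral_cong[OF refl])
    fix z :: "real ^ 'n"
    \<comment> \<open>Since the squares of the coordinates sum to Q - \<epsilon>, the terms in Q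
      cancel and only the one with \<epsilon> remains.\<close>
    have nz: "(\<Sum>i\<in>UNIV. (z $ i)\<^sup>2) = Q z - \<epsilon>"
      by (simp add: Q_def norm_vec_def L2_set_def sum_nonneg)
    have "Q z powr (- N / 2) = Q z * Q z powr (- N / 2 - 1)"
      using Q[of z] by (simp add: powr_diff)
    then have "(\<Sum>i\<in>UNIV. k2 i z) = (2 - N) * N * (Q z * Q z powr (- N / 2 - 1)) - (2 - N) * N * (\<Sum>i\<in>UNIV. (z $ i)\<^sup>2) * Q z powr (- N / 2 - 1)"
      by (simp add: k2_def sum_subtractf N_def sum_distrib_left sum_distrib_right)
    also have "\<dots> = - N * (N - 2) * \<epsilon> * Q z powr (- N / 2 - 1)"
      unfolding nz by (simp add: algebra_simps)
    finally have "(\<Sum>i\<in>UNIV. k2 i z) = - N * (N - 2) * \<epsilon> * Q z powr (- N / 2 - 1)" .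
    moreover have "(\<Sum>i\<in>UNIV. f (x - z) * of_real (k2 i z)) = f (x - z) * of_real (\<Sum>i\<in>UNIV. k2 i z)"
      by (simp add: sum_distrib_left)
    ultimately show "(\<Sum>i\<in>UNIV. f (x - z) * of_real (k2 i z)) = of_real (- N * (N - 2) * \<epsilon>) * (f (x - z) * of_real (Q z powr (- N / 2 - 1)))"
      by simp
  qed
  finally show ?thesis by (simp add: Q_def N_def)
qed

lemma lborel_integral_scaleR:
  fixes h :: "'a::euclidean_space \<Rightarrow> 'b::{banach, second_countable_topology}"
  assumes "h \<in> borel_measurable borel" and c: "c > 0"
  shows "(\<integral>y. h y \<partial>lborel) = (c ^ DIM('a)) *\<^sub>R (\<integral>y. h (c *\<^sub>R y) \<partial>lborel)"
proof -
  have "(\<integral>y. h y \<partial>lborel) = (\<integral>y. h y \<partial>density (distr lborel borel (\<lambda>x. 0 + c *\<^sub>R x)) (\<lambda>_. ennreal (\<bar>c\<bar> ^ DIM('a))))"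
    using c by (subst lborel_affine[of c 0]) simp_all
  also have "\<dots> = (c ^ DIM('a)) *\<^sub>R (\<integral>y. h (c *\<^sub>R y) \<partial>lborel)"
    using assms by (subst integral_density) (auto simp: integral_distr)
  finally show ?thesis .
qed

text \<open>The regularised potentials have two limits: by domination with the singular kernel they
  tend to the potential of the Laplacian of f, and after rescaling they are f averaged against an
  approximate identity.\<close>

lemma laplacian_newton_potential:
  fixes f :: "real ^ 'n \<Rightarrow> complex"
  assumes n: "CARD('n) \<ge> 3" and f: "smooth f" and \<rho>: "\<And>x. \<rho> < norm x \<Longrightarrow> f x = 0"
  shows "laplacian (newton_potential f) x = - of_real ((real CARD('n) - 2) * sphere_area CARD('n)) * f x"
proof -
  define N where "N = real CARD('n)"
  have N: "N \<ge> 3" using n by (simp add: N_def)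
  define e where "e j = 1 / real (Suc j)" for j
  have e: "e j > 0" for j by (simp add: e_def)
  have e0: "e \<longlonglongrightarrow> 0" unfolding e_def by real_asymp
  have \<rho>': "dird v f x = 0" if "\<rho> < norm x" for x v
    using dird_funpow_outside[where k=1 and f=f and \<rho>=\<rho> and v=v and x=x, OF f \<rho> that] by simp
  define L where "L j = (\<Sum>i\<in>UNIV. \<integral>z. dird (axis i 1) (dird (axis i 1) f) (x - z) * of_real (((norm z)\<^sup>2 + (e j)\<^sup>2) powr (1 - N / 2)) \<partial>lborel)" for j
  have lim1: "L \<longlonglongrightarrow> (\<Sum>i\<in>UNIV. newton_potential (dird (axis i 1) (dird (axis i 1) f)) x)"
    unfolding L_def[abs_def] newton_potential_def
  proof (rule tendsto_sum, rule integral_dominated_convergence)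
    fix i :: 'n
    let ?g = "dird (axis i 1) (dird (axis i 1) f)"
    have gs: "smooth ?g" by (intro smooth_dird f)
    have g0: "?g y = 0" if "\<rho> < norm y" for y
      using dird_funpow_outside[where k=2 and f=f and \<rho>=\<rho> and v="axis i 1" and x=y, OF f \<rho> that] by (simp add: numeral_2_eq_2)
    have [measurable]: "?g \<in> borel_measurable borel"
      by (rule borel_measurable_continuous_onI[OF smooth_continuous[OF gs]])
    show "(\<lambda>z. ?g (x - z) * of_real (norm z powr (2 - real CARD('n)))) \<in> borel_measurable lborel"
      by (rule borel_measurable_integrable[OF newton_potential_integrable[OF smooth_continuous[OF gs] g0]])
    show "(\<lambda>z. ?g (x - z) * of_real (((norm z)\<^sup>2 + (e j)\<^sup>2) powr (1 - N / 2))) \<in> borel_measurable lborel" for j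
    proof -
      have "(norm z)\<^sup>2 + (e j)\<^sup>2 \<noteq> 0" for z :: "real ^ 'n" using e[of j] by (simp add: sum_power2_eq_zero_iff)
      then have "continuous_on UNIV (\<lambda>z. ?g (x - z) * of_real (((norm z)\<^sup>2 + (e j)\<^sup>2) powr (1 - N / 2)))"
        by (intro continuous_intros continuous_on_compose2[OF smooth_continuous[OF gs]]) auto
      then show ?thesis by (simp add: borel_measurable_continuous_onI)
    qed
    show "integrable lborel (\<lambda>z. norm (?g (x - z) * of_real (norm z powr (2 - real CARD('n)))))"
      by (intro integrable_norm newton_potential_integrable[OF smooth_continuous[OF gs] g0])
    show "AE z in lborel. norm (?g (x - z) * of_real (((norm z)\<^sup>2 + (e j)\<^sup>2) powr (1 - N / 2))) \<le> norm (?g (x - z) * of_real (norm z powr (2 - real CARD('n))))" for j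
      using AE_lborel_singleton[of 0]
    proof eventually_elim
      fix z :: "real ^ 'n" assume z: "z \<noteq> 0"
      have "((norm z)\<^sup>2 + (e j)\<^sup>2) powr (1 - N / 2) \<le> ((norm z)\<^sup>2) powr (1 - N / 2)"
        using z N by (intro powr_mono2') auto
      also have "\<dots> = norm z powr (2 - real CARD('n))"
        using powr_powr[of "norm z" 2 "1 - N / 2"] by (simp add: N_def algebra_simps)
      finally show "norm (?g (x - z) * of_real (((norm z)\<^sup>2 + (e j)\<^sup>2) powr (1 - N / 2))) \<le> norm (?g (x - z) * of_real (norm z powr (2 - real CARD('n))))"
        by (simp add: norm_mult mult_left_mono)
    qed
    show "AE z in lborel. (\<lambda>j. ?g (x - z) * of_real (((norm z)\<^sup>2 + (e j)\<^sup>2) powr (1 - N / 2))) \<longlonglongrightarrow> ?g (x - z) * of_real (norm z powr (2 - real CARD('n)))"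
      using AE_lborel_singleton[of 0]
    proof eventually_elim
      fix z :: "real ^ 'n" assume z: "z \<noteq> 0"
      have "(\<lambda>j. ((norm z)\<^sup>2 + (e j)\<^sup>2) powr (1 - N / 2)) \<longlonglongrightarrow> ((norm z)\<^sup>2 + 0\<^sup>2) powr (1 - N / 2)"
        using z by (intro tendsto_intros e0) auto
      moreover have "((norm z)\<^sup>2 + 0\<^sup>2) powr (1 - N / 2) = norm z powr (2 - real CARD('n))"
        using powr_powr[of "norm z" 2 "1 - N / 2"] by (simp add: N_def algebra_simps)
      ultimately have "(\<lambda>j. ((norm z)\<^sup>2 + (e j)\<^sup>2) powr (1 - N / 2)) \<longlonglongrightarrow> norm z powr (2 - real CARD('n))"
        by (simp only:)
      then show "(\<lambda>j. ?g (x - z) * of_real (((norm z)\<^sup>2 + (e j)\<^sup>2) powr (1 - N / 2))) \<longlonglongrightarrow> ?g (x - z) * of_real (norm z powr (2 - real CARD('n)))"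
        by (intro tendsto_mult tendsto_const tendsto_of_real)
    qed
  qed
  have [measurable]: "f \<in> borel_measurable borel"
    by (rule borel_measurable_continuous_onI[OF smooth_continuous[OF f]])
  \<comment> \<open>Substituting z = e_j w, the powers e_j^2, e_j^n and e_j^(-n-2) cancel, and the
    parameter survives only in the argument of f.\<close>
  have L: "L j = of_real (- N * (N - 2)) * (\<integral>w. f (x - e j *\<^sub>R w) * of_real ((1 + (norm w)\<^sup>2) powr (- N / 2 - 1)) \<partial>lborel)" for j
  proof -
    have "L j = of_real (- N * (N - 2) * (e j)\<^sup>2) * (\<integral>z. f (x - z) * of_real (((norm z)\<^sup>2 + (e j)\<^sup>2) powr (- N / 2 - 1)) \<partial>lborel)"
      unfolding L_def N_def using e[of j] by (intro integral_laplacian_convolution[OF f \<rho>]) auto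
    also have "(\<integral>z. f (x - z) * of_real (((norm z)\<^sup>2 + (e j)\<^sup>2) powr (- N / 2 - 1)) \<partial>lborel)
       = (e j ^ CARD('n)) *\<^sub>R (\<integral>w. f (x - e j *\<^sub>R w) * of_real (((norm (e j *\<^sub>R w))\<^sup>2 + (e j)\<^sup>2) powr (- N / 2 - 1)) \<partial>lborel)"
      using lborel_integral_scaleR[OF _ e[of j], of "\<lambda>z. f (x - z) * of_real (((norm z)\<^sup>2 + (e j)\<^sup>2) powr (- N / 2 - 1))"] by simp
    also have "(\<integral>w. f (x - e j *\<^sub>R w) * of_real (((norm (e j *\<^sub>R w))\<^sup>2 + (e j)\<^sup>2) powr (- N / 2 - 1)) \<partial>lborel)
       = (\<integral>w. of_real (e j powr (- N - 2)) * (f (x - e j *\<^sub>R w) * of_real ((1 + (norm w)\<^sup>2) powr (- N / 2 - 1))) \<partial>lborel)"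
    proof (rule Bochner_Integration.integral_cong[OF refl])
      fix w :: "real ^ 'n"
      have "(norm (e j *\<^sub>R w))\<^sup>2 + (e j)\<^sup>2 = (e j)\<^sup>2 * (1 + (norm w)\<^sup>2)"
        by (simp add: power_mult_distrib algebra_simps)
      then have "((norm (e j *\<^sub>R w))\<^sup>2 + (e j)\<^sup>2) powr (- N / 2 - 1) = ((e j)\<^sup>2) powr (- N / 2 - 1) * (1 + (norm w)\<^sup>2) powr (- N / 2 - 1)"
        by (simp only: powr_mult)
      also have "((e j)\<^sup>2) powr (- N / 2 - 1) = e j powr (- N - 2)"
        using powr_powr[of "e j" 2 "- N / 2 - 1"] e[of j] by (simp add: algebra_simps)
      finally show "f (x - e j *\<^sub>R w) * of_real (((norm (e j *\<^sub>R w))\<^sup>2 + (e j)\<^sup>2) powr (- N / 2 - 1)) = of_real (e j powr (- N - 2)) * (f (x - e j *\<^sub>R w) * of_real ((1 + (norm w)\<^sup>2) powr (- N / 2 - 1)))"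
        by simp
    qed
    also have "\<dots> = of_real (e j powr (- N - 2)) * (\<integral>w. f (x - e j *\<^sub>R w) * of_real ((1 + (norm w)\<^sup>2) powr (- N / 2 - 1)) \<partial>lborel)"
      by simp
    finally have "L j = of_real (- N * (N - 2) * ((e j)\<^sup>2 * e j ^ CARD('n) * e j powr (- N - 2))) * (\<integral>w. f (x - e j *\<^sub>R w) * of_real ((1 + (norm w)\<^sup>2) powr (- N / 2 - 1)) \<partial>lborel)"
      by (simp add: scaleR_conv_of_real mult_ac)
    also have "(e j)\<^sup>2 * e j ^ CARD('n) * e j powr (- N - 2) = 1"
    proof -
      have "e j powr 2 * e j powr N * e j powr (- N - 2) = 1"
        using e[of j] by (simp only: powr_add[symmetric]) simp
      moreover have "e j powr 2 = (e j)\<^sup>2" "e j powr N = e j ^ CARD('n)"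
        using e[of j] powr_realpow[of "e j" "CARD('n)"] by (simp_all add: N_def)
      ultimately show ?thesis by simp
    qed
    finally show ?thesis by simp
  qed
  obtain C where C: "C \<ge> 0" "\<And>x. norm (f x) \<le> C"
    using continuous_bounded_support_bounded[OF smooth_continuous[OF f] \<rho>] by blast
  have "(\<lambda>j. \<integral>w. f (x - e j *\<^sub>R w) * of_real ((1 + (norm w)\<^sup>2) powr (- N / 2 - 1)) \<partial>lborel) \<longlonglongrightarrow> (\<integral>w. f x * of_real ((1 + (norm w)\<^sup>2) powr (- N / 2 - 1)) \<partial>(lborel :: (real^'n) measure))"
  proof (rule integral_dominated_convergence[where w="\<lambda>w. C * (1 + (norm w)\<^sup>2) powr (- N / 2 - 1)"])
    show "AE w in lborel. (\<lambda>j. f (x - e j *\<^sub>R w) * of_real ((1 + (norm w)\<^sup>2) powr (- N / 2 - 1))) \<longlonglongrightarrow> f x * of_real ((1 + (norm w)\<^sup>2) powr (- N / 2 - 1))"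
    proof (rule AE_I2)
      fix w :: "real ^ 'n"
      have "(\<lambda>j. x - e j *\<^sub>R w) \<longlonglongrightarrow> x - 0 *\<^sub>R w" by (intro tendsto_intros e0)
      then have "(\<lambda>j. f (x - e j *\<^sub>R w)) \<longlonglongrightarrow> f (x - 0 *\<^sub>R w)"
        using continuous_on_tendsto_compose[OF smooth_continuous[OF f]] by simp
      then show "(\<lambda>j. f (x - e j *\<^sub>R w) * of_real ((1 + (norm w)\<^sup>2) powr (- N / 2 - 1))) \<longlonglongrightarrow> f x * of_real ((1 + (norm w)\<^sup>2) powr (- N / 2 - 1))"
        by (intro tendsto_mult tendsto_const) simp
    qed
    show "integrable lborel (\<lambda>w::real^'n. C * (1 + (norm w)\<^sup>2) powr (- N / 2 - 1))"
      unfolding N_def by (intro integrable_mult_right poisson_kernel_integral(1)[OF n])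
  qed (use C in \<open>auto simp: norm_mult mult_right_mono intro!: AE_I2\<close>)
  \<comment> \<open>The mass \<open>sphere_area\<close> / n times -n (n - 2) gives the constant of
    the claim.\<close>
  also have "(\<integral>w. f x * of_real ((1 + (norm w)\<^sup>2) powr (- N / 2 - 1)) \<partial>(lborel :: (real^'n) measure)) = f x * of_real (sphere_area CARD('n) / N)"
    unfolding integral_mult_right_zero integral_complex_of_real N_def poisson_kernel_integral(2)[OF n] ..
  finally have "L \<longlonglongrightarrow> of_real (- N * (N - 2)) * (f x * of_real (sphere_area CARD('n) / N))"
    unfolding L[abs_def] by (intro tendsto_intros)
  from LIMSEQ_unique[OF lim1 this]
  have "(\<Sum>i\<in>UNIV. newton_potential (dird (axis i 1) (dird (axis i 1) f)) x) = - of_real ((N - 2) * sphere_area CARD('n)) * f x"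
    using N by simp
  moreover have "laplacian (newton_potential f) x = (\<Sum>i\<in>UNIV. newton_potential (dird (axis i 1) (dird (axis i 1) f)) x)"
    by (rule laplacian_newton_potential_eq[OF f \<rho>])
  ultimately show ?thesis by (simp add: N_def)
qed

section \<open>Back-projection as a limit of finite differences\<close>

fun fdiff :: "real \<Rightarrow> nat \<Rightarrow> (real \<Rightarrow> 'a::real_normed_vector) \<Rightarrow> real \<Rightarrow> 'a" where
  "fdiff \<tau> 0 H a = H a"
| "fdiff \<tau> (Suc N) H a = fdiff \<tau> N H (a + \<tau>) - fdiff \<tau> N H a"

lemma fdiff_cong:
  "(\<And>i. i \<le> N \<Longrightarrow> G (a + real i * \<tau>) = H (a + real i * \<tau>)) \<Longrightarrow> fdiff \<tau> N G a = fdiff \<tau> N H a"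
proof (induction N arbitrary: a)
  case (Suc N)
  have "fdiff \<tau> N G (a + \<tau>) = fdiff \<tau> N H (a + \<tau>)"
    by (rule Suc.IH) (use Suc.prems[of "Suc _"] in \<open>simp add: algebra_simps\<close>)
  moreover have "fdiff \<tau> N G a = fdiff \<tau> N H a"
    by (rule Suc.IH) (use Suc.prems in simp)
  ultimately show ?case by simp
qed (use less_eq_nat.simps in fastforce)

lemma norm_fdiff_le:
  "(\<And>i. i \<le> N \<Longrightarrow> norm (G (a + real i * \<tau>)) \<le> B) \<Longrightarrow> norm (fdiff \<tau> N G a) \<le> 2 ^ N * B"
proof (induction N arbitrary: a)
  case 0
  then show ?case using 0[of 0] by simp
next
  case (Suc N)
  have "norm (fdiff \<tau> N G (a + \<tau>)) \<le> 2 ^ N * B"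
    by (rule Suc.IH) (use Suc.prems[of "Suc _"] in \<open>simp add: algebra_simps\<close>)
  moreover have "norm (fdiff \<tau> N G a) \<le> 2 ^ N * B"
    by (rule Suc.IH) (use Suc.prems in simp)
  ultimately show ?case using norm_triangle_ineq4[of "fdiff \<tau> N G (a + \<tau>)" "fdiff \<tau> N G a"] by simp
qed

lemma fdiff_bounded_linear:
  assumes "bounded_linear L"
  shows "fdiff \<tau> N (\<lambda>b. L (G b)) a = L (fdiff \<tau> N G a)"
proof -
  interpret bounded_linear L by fact
  show ?thesis by (induction N arbitrary: a) (simp_all add: diff)
qed

lemma fdiff_integral:
  fixes F :: "'b \<Rightarrow> real \<Rightarrow> 'a::{banach, second_countable_topology}"
  assumes "\<And>b. integrable M (\<lambda>w. F w b)"
  shows "integrable M (\<lambda>w. fdiff \<tau> N (F w) a)"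
    and "fdiff \<tau> N (\<lambda>b. \<integral>w. F w b \<partial>M) a = (\<integral>w. fdiff \<tau> N (F w) a \<partial>M)"
proof (induction N arbitrary: a)
  case (Suc N)
  { case 1 show ?case using Suc by simp }
  { case 2 show ?case using Suc by simp }
qed (use assms in auto)

lemma fdiff_has_vector_derivative:
  assumes "\<And>s. (G has_vector_derivative G' s) (at s)"
  shows "(fdiff \<tau> N G has_vector_derivative fdiff \<tau> N G' t) (at t)"
proof (induction N arbitrary: t)
  case 0
  then show ?case using assms by simp
next
  case (Suc N)
  have "((\<lambda>t. t + \<tau>) has_vector_derivative 1) (at t)" by (auto intro!: derivative_eq_intros)
  from vector_diff_chain_at[OF this Suc[of "t + \<tau>"]]
  have "((\<lambda>t. fdiff \<tau> N G (t + \<tau>)) has_vector_derivative fdiff \<tau> N G' (t + \<tau>)) (at t)" by (simp add: o_def)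
  from has_vector_derivative_diff[OF this Suc[of t]] show ?case by simp
qed

text \<open>The mean value inequality, iterated: if the N-th derivative stays within \<epsilon> of c
  over the sampled range, the N-th difference stays within \<epsilon> \<tau>^N of \<tau>^N c. With
  \<epsilon> = 0 it is exact for polynomials of degree at most N.\<close>

lemma fdiff_approx:
  fixes H :: "nat \<Rightarrow> real \<Rightarrow> 'a::real_normed_vector"
  assumes "\<And>j s. (H j has_vector_derivative H (Suc j) s) (at s)" and \<tau>: "\<tau> \<ge> 0"
    and "\<And>s. a \<le> s \<Longrightarrow> s \<le> a + real N * \<tau> \<Longrightarrow> norm (H N s - c) \<le> \<epsilon>"
  shows "norm (fdiff \<tau> N (H 0) a - \<tau> ^ N *\<^sub>R c) \<le> \<epsilon> * \<tau> ^ N"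
  using assms(1,3)
proof (induction N arbitrary: H a)
  case 0
  then show ?case by simp
next
  case (Suc N)
  \<comment> \<open>Subtracting t \<tau>^N c makes the increment of K over one step the quantity to
    be bounded, while its derivative \<open>K'\<close> is covered by the induction hypothesis for
    the shifted chain.\<close>
  define K where "K t = fdiff \<tau> N (H 0) t - (t * \<tau> ^ N) *\<^sub>R c" for t
  define K' where "K' t = fdiff \<tau> N (H 1) t - \<tau> ^ N *\<^sub>R c" for t
  have d: "(K has_vector_derivative K' t) (at t)" for t
  proof -
    have 1: "(fdiff \<tau> N (H 0) has_vector_derivative fdiff \<tau> N (H 1) t) (at t)"
      by (rule fdiff_has_vector_derivative) (use Suc.prems(1)[of 0] in simp)
    have "((\<lambda>t. t * \<tau> ^ N) has_real_derivative \<tau> ^ N) (at t)"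
      by (auto intro!: derivative_eq_intros)
    from has_vector_derivative_scaleR[OF this has_vector_derivative_const[of c]]
    have 2: "((\<lambda>t. (t * \<tau> ^ N) *\<^sub>R c) has_vector_derivative \<tau> ^ N *\<^sub>R c) (at t)" by simp
    show ?thesis unfolding K_def[abs_def] K'_def by (rule has_vector_derivative_diff[OF 1 2])
  qed
  have b: "norm (K' t) \<le> \<epsilon> * \<tau> ^ N" if "t \<in> {a..a + \<tau>}" for t
    unfolding K'_def using Suc.IH[of "\<lambda>j. H (Suc j)" t] Suc.prems that by (simp add: algebra_simps)
  have "norm (K (a + \<tau>) - K a) \<le> (\<epsilon> * \<tau> ^ N) * norm (a + \<tau> - a)"
  proof (rule differentiable_bound[of "{a..a + \<tau>}" K "\<lambda>t h. h *\<^sub>R K' t"])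
    show "(K has_derivative (\<lambda>h. h *\<^sub>R K' t)) (at t within {a..a + \<tau>})" for t
      using has_vector_derivative_at_within[OF d] by (simp add: has_vector_derivative_def)
    show "onorm (\<lambda>h. h *\<^sub>R K' t) \<le> \<epsilon> * \<tau> ^ N" if "t \<in> {a..a + \<tau>}" for t
    proof (rule order_trans[OF _ b[OF that]])
      show "onorm (\<lambda>h. h *\<^sub>R K' t) \<le> norm (K' t)" by (rule onorm_le) (simp add: mult.commute)
    qed
  qed (use \<tau> in auto)
  moreover have "K (a + \<tau>) - K a = fdiff \<tau> (Suc N) (H 0) a - \<tau> ^ Suc N *\<^sub>R c"
    by (simp add: K_def algebra_simps)
  ultimately show ?case using \<tau> by (simp add: mult_ac)
qed

lemma exists_poly_antiderivative:
  fixes q :: "real poly"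
  shows "\<exists>p. pderiv p = q"
proof
  have "pderiv (\<Sum>i\<le>degree q. monom (coeff q i / real (Suc i)) (Suc i)) = (\<Sum>i\<le>degree q. monom (coeff q i) i)"
    using higher_pderiv_sum[of 1 "\<lambda>i. monom (coeff q i / real (Suc i)) (Suc i)" "{..degree q}"] by (simp add: pderiv_monom)
  also have "\<dots> = q" by (rule poly_as_sum_of_monoms)
  finally show "pderiv (\<Sum>i\<le>degree q. monom (coeff q i / real (Suc i)) (Suc i)) = q" .
qed

text \<open>R is the double primitive of (1 - v^2)^k with zero value and slope at -1. It is a
  polynomial because k is a natural number, and its degree 2k + 2 equals n - 1, the number of
  differences taken.\<close>

lemma exists_cap_poly:
  obtains R :: "real poly" where
    "\<And>u. u \<in> {-1..1} \<Longrightarrow> ((\<lambda>v. (u - v) * (1 - v\<^sup>2) ^ k) has_integral poly R u) {-1..u}"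
    and "(pderiv ^^ (2 * k + 2)) R = [:(- 1) ^ k * fact (2 * k):]"
proof -
  define w :: "real poly" where "w = [:1, 0, -1:] ^ k"
  have w: "poly w v = (1 - v\<^sup>2) ^ k" for v by (simp add: w_def poly_power power2_eq_square)
  obtain q where q: "pderiv q = w" using exists_poly_antiderivative by blast
  define q' where "q' = q - [:poly q (-1):]"
  have q': "pderiv q' = w" "poly q' (-1) = 0" by (simp_all add: q'_def pderiv_diff q pderiv_pCons)
  obtain p where p: "pderiv p = q'" using exists_poly_antiderivative by blast
  define R where "R = p - [:poly p (-1):]"
  have R: "pderiv R = q'" "poly R (-1) = 0" by (simp_all add: R_def pderiv_diff p pderiv_pCons)
  have "((\<lambda>v. (u - v) * (1 - v\<^sup>2) ^ k) has_integral poly R u) {-1..u}" if u: "u \<in> {-1..1}" for u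
  proof -
    have "((\<lambda>v. (u - v) * (1 - v\<^sup>2) ^ k) has_integral ((u - u) * poly q' u + poly R u) - ((u - (-1)) * poly q' (-1) + poly R (-1))) {-1..u}"
    proof (rule fundamental_theorem_of_calculus)
      fix v
      have "((\<lambda>v. (u - v) * poly q' v + poly R v) has_real_derivative (u - v) * (1 - v\<^sup>2) ^ k) (at v)"
        by (rule derivative_eq_intros poly_DERIV refl)+ (simp add: q' R w)
      then show "((\<lambda>v. (u - v) * poly q' v + poly R v) has_vector_derivative (u - v) * (1 - v\<^sup>2) ^ k) (at v within {-1..u})"
        unfolding has_real_derivative_iff_has_vector_derivative by (rule has_vector_derivative_at_within)
    qed (use u in simp)
    then show ?thesis by (simp add: q' R)
  qed
  moreover have "(pderiv ^^ (2 * k + 2)) R = [:(- 1) ^ k * fact (2 * k):]"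
  proof -
    have dw: "degree w = 2 * k" by (simp add: w_def degree_power_eq)
    have lw: "coeff w (2 * k) = (- 1) ^ k"
      using lead_coeff_power[of "[:1, 0, -1::real:]" k] dw by (simp add: w_def)
    have "(pderiv ^^ (2 * k + 2)) R = (pderiv ^^ (2 * k)) (pderiv (pderiv R))"
      by (simp add: funpow_swap1)
    also have "\<dots> = (pderiv ^^ (2 * k)) w" by (simp add: R q')
    also have "\<dots> = [:(- 1) ^ k * fact (2 * k):]"
    proof (rule poly_eqI)
      fix i
      show "coeff ((pderiv ^^ (2 * k)) w) i = coeff [:(- 1) ^ k * fact (2 * k):] i"
      proof (cases "i = 0")
        case True
        then show ?thesis using lw by (simp add: coeff_higher_pderiv pochhammer_fact[symmetric])
      next
        case False
        then have "coeff w (i + 2 * k) = 0" using dw by (intro coeff_eq_0) simp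
        then show ?thesis using False by (simp add: coeff_higher_pderiv coeff_pCons split: nat.split)
      qed
    qed
    finally show ?thesis .
  qed
  ultimately show ?thesis using that by blast
qed

text \<open>The condition |\<beta>| <= l places the corner u = \<beta> / l of the ramp inside
  [-1,1]; to the right of it the integrand is zero.\<close>

lemma integral_ramp:
  fixes R :: "real poly"
  assumes R: "\<And>u. u \<in> {-1..1} \<Longrightarrow> ((\<lambda>v. (u - v) * (1 - v\<^sup>2) ^ k) has_integral poly R u) {-1..u}"
    and l: "l > 0" and \<beta>: "\<bar>\<beta>\<bar> \<le> l"
  shows "integral {-1..1} (\<lambda>v. max 0 (\<beta> - l * v) * (1 - v\<^sup>2) ^ k) = l * poly R (\<beta> / l)"
proof -
  define u where "u = \<beta> / l"
  have \<beta>u: "\<beta> = l * u" using l by (simp add: u_def)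
  have u: "u \<in> {-1..1}" using l \<beta> by (auto simp: u_def divide_simps abs_le_iff)
  have "((\<lambda>v. max 0 (\<beta> - l * v) * (1 - v\<^sup>2) ^ k) has_integral l * poly R u) {-1..u}"
  proof (rule has_integral_eq[rotated, OF has_integral_mult_right[OF R[OF u], of l]])
    fix v assume "v \<in> {-1..u}"
    then have "l * v \<le> l * u" using l by (intro mult_left_mono) auto
    then show "l * ((u - v) * (1 - v\<^sup>2) ^ k) = max 0 (\<beta> - l * v) * (1 - v\<^sup>2) ^ k"
      by (simp add: \<beta>u right_diff_distrib[symmetric] mult.assoc) (simp add: algebra_simps)
  qed
  moreover have "((\<lambda>v. max 0 (\<beta> - l * v) * (1 - v\<^sup>2) ^ k) has_integral 0) {u..1}"
  proof (rule has_integral_eq[rotated, OF has_integral_0])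
    fix v assume "v \<in> {u..1}"
    then have "l * u \<le> l * v" using l by (intro mult_left_mono) auto
    then show "0 = max 0 (\<beta> - l * v) * (1 - v\<^sup>2) ^ k" by (simp add: \<beta>u)
  qed
  ultimately have "((\<lambda>v. max 0 (\<beta> - l * v) * (1 - v\<^sup>2) ^ k) has_integral l * poly R u + 0) {-1..1}"
    using u by (intro has_integral_combine[of "-1" u 1]) auto
  then show ?thesis by (simp add: u_def integral_unique)
qed

definition ramp_integral :: "real ^ 'n \<Rightarrow> real ^ 'n \<Rightarrow> real \<Rightarrow> real" where
  "ramp_integral x y b = (\<integral>\<theta>. max 0 (b + (norm (x - \<theta>))\<^sup>2 - (norm (y - \<theta>))\<^sup>2) \<partial>sphere_measure)"

text \<open>The ridge normalisation times the top derivative of the polynomial of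
  \<open>exists_cap_poly\<close>; the power of 2 comes from l = 2 |x - y| raised to -(2k + 1) = 2 -
  n.\<close>

definition ramp_const :: "nat \<Rightarrow> real" where
  "ramp_const k = sphere_area (2 * k + 3) / interval_moment k 0 * ((- 1) ^ k * fact (2 * k)) / 2 ^ (2 * k + 1)"

text \<open>The terms |\<theta>|^2 cancel in |x - \<theta>|^2 - |y - \<theta>|^2, which makes the
  argument of the ramp affine in \<theta>, with slope vector -2 (x - y).\<close>

lemma ramp_integral_eq:
  fixes x y :: "real ^ 'n"
  assumes n: "CARD('n) = 2 * k + 3"
  shows "ramp_integral x y b = sphere_area CARD('n) / interval_moment k 0
     * integral {-1..1} (\<lambda>v. max 0 (b + ((norm x)\<^sup>2 - (norm y)\<^sup>2) - 2 * norm (x - y) * v) * (1 - v\<^sup>2) ^ k)"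
proof -
  define \<beta> where "\<beta> = b + ((norm x)\<^sup>2 - (norm y)\<^sup>2)"
  have e: "b + (norm (x - \<theta>))\<^sup>2 - (norm (y - \<theta>))\<^sup>2 = \<beta> - \<theta> \<bullet> (2 *\<^sub>R (x - y))" for \<theta>
    unfolding \<beta>_def power2_norm_eq_inner by (simp add: inner_diff_left inner_diff_right inner_commute algebra_simps)
  have "ramp_integral x y b = (\<integral>\<theta>. (\<lambda>v. max 0 (\<beta> - v)) (\<theta> \<bullet> (2 *\<^sub>R (x - y))) \<partial>sphere_measure)"
    unfolding ramp_integral_def e ..
  also have "\<dots> = sphere_area CARD('n) / interval_moment k 0 * integral {-1..1} (\<lambda>v. max 0 (\<beta> - norm (2 *\<^sub>R (x - y)) * v) * (1 - v\<^sup>2) ^ k)"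
    by (rule sphere_integral_ridge[OF n]) (intro continuous_intros)
  finally show ?thesis by (simp add: \<beta>_def)
qed

text \<open>With \<rho> < 1 this stays below 2 |x - y| by a fixed fraction, the margin in which b
  may move without pushing the corner of the ramp out of [-1,1].\<close>

lemma abs_norm_sq_diff_le:
  fixes x y :: "'a::real_inner"
  assumes "norm x \<le> \<rho>" "norm y \<le> \<rho>"
  shows "\<bar>(norm x)\<^sup>2 - (norm y)\<^sup>2\<bar> \<le> 2 * \<rho> * norm (x - y)"
proof -
  have "\<bar>(norm x)\<^sup>2 - (norm y)\<^sup>2\<bar> = \<bar>norm x - norm y\<bar> * (norm x + norm y)"
    by (simp add: square_diff_square_factored power2_eq_square abs_mult mult.commute)
  also have "\<dots> \<le> norm (x - y) * (2 * \<rho>)"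
    using assms norm_triangle_ineq3[of x y] by (intro mult_mono) auto
  finally show ?thesis by (simp add: mult.commute)
qed

text \<open>While all samples keep the corner of the ramp in the range of v, they lie on one
  polynomial of degree 2k + 2, whose top difference is exact.\<close>

lemma fdiff_ramp_integral_exact:
  fixes x y :: "real ^ 'n"
  assumes n: "CARD('n) = 2 * k + 3" and x: "norm x \<le> \<rho>" and y: "norm y \<le> \<rho>" and xy: "x \<noteq> y"
    and \<tau>: "\<tau> \<ge> 0" "real (2 * k + 2) * \<tau> \<le> 2 * (1 - \<rho>) * norm (x - y)"
  shows "fdiff \<tau> (2 * k + 2) (ramp_integral x y) 0 = \<tau> ^ (2 * k + 2) * (ramp_const k * norm (x - y) powr (2 - real CARD('n)))"
proof -
  obtain R :: "real poly" where R: "\<And>u. u \<in> {-1..1} \<Longrightarrow> ((\<lambda>v. (u - v) * (1 - v\<^sup>2) ^ k) has_integral poly R u) {-1..u}"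
    "(pderiv ^^ (2 * k + 2)) R = [:(- 1) ^ k * fact (2 * k):]" using exists_cap_poly[of k] by blast
  define l where "l = 2 * norm (x - y)"
  have l: "l > 0" using xy by (simp add: l_def)
  define \<beta> where "\<beta> = (norm x)\<^sup>2 - (norm y)\<^sup>2"
  define c where "c = sphere_area CARD('n) / interval_moment k 0"
  \<comment> \<open>The j-th derivative in b of c l R((b + \<beta>) / l); each differentiation
    brings out one factor 1/l.\<close>
  define H where "H j b = c * l * inverse l ^ j * poly ((pderiv ^^ j) R) ((b + \<beta>) / l)" for j b
  have HN: "H (2 * k + 2) b = ramp_const k * norm (x - y) powr (2 - real CARD('n))" for b
  proof -
    have "l * inverse l ^ (2 * k + 2) = inverse (l ^ (2 * k + 1))"
      using l by (simp add: field_simps)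
    also have "\<dots> = norm (x - y) powr (2 - real CARD('n)) / 2 ^ (2 * k + 1)"
    proof -
      have "norm (x - y) powr (2 - real CARD('n)) = inverse (norm (x - y) powr real (2 * k + 1))"
        unfolding powr_minus[symmetric] n by simp
      also have "norm (x - y) powr real (2 * k + 1) = norm (x - y) ^ (2 * k + 1)"
        using xy by (intro powr_realpow) simp
      finally show ?thesis by (simp add: l_def power_mult_distrib field_simps)
    qed
    finally have e: "l * inverse l ^ (2 * k + 2) = norm (x - y) powr (2 - real CARD('n)) / 2 ^ (2 * k + 1)" .
    have "H (2 * k + 2) b = c * (l * inverse l ^ (2 * k + 2)) * ((- 1) ^ k * fact (2 * k))"
      unfolding H_def R(2) by (simp add: mult.assoc)
    then show ?thesis
      unfolding e by (simp add: ramp_const_def c_def n)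
  qed
  have "(H j has_real_derivative H (Suc j) b) (at b)" for j b
  proof -
    have "((\<lambda>b. (b + \<beta>) / l) has_real_derivative inverse l) (at b)"
      by (auto intro!: derivative_eq_intros simp: divide_inverse)
    from DERIV_cmult[OF DERIV_chain2[OF poly_DERIV this], of "c * l * inverse l ^ j" "(pderiv ^^ j) R"]
    show ?thesis unfolding H_def[abs_def] by (simp add: mult_ac)
  qed
  then have "(H j has_vector_derivative H (Suc j) b) (at b)" for j b
    by (simp add: has_real_derivative_iff_has_vector_derivative)
  \<comment> \<open>The top derivative is constant, so the approximation holds with error 0.\<close>
  from fdiff_approx[of H \<tau> 0 "2 * k + 2" "ramp_const k * norm (x - y) powr (2 - real CARD('n))" 0, OF this \<tau>(1)] HN
  have "fdiff \<tau> (2 * k + 2) (H 0) 0 = \<tau> ^ (2 * k + 2) * (ramp_const k * norm (x - y) powr (2 - real CARD('n)))"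
    by (simp del: fdiff.simps)
  moreover have "fdiff \<tau> (2 * k + 2) (ramp_integral x y) 0 = fdiff \<tau> (2 * k + 2) (H 0) 0"
  proof (rule fdiff_cong)
    fix i assume i: "i \<le> 2 * k + 2"
    have "real i * \<tau> \<le> real (2 * k + 2) * \<tau>" using i \<tau>(1) by (intro mult_right_mono) auto
    moreover have "real i * \<tau> \<ge> 0" using \<tau>(1) by simp
    moreover have "\<bar>\<beta>\<bar> \<le> 2 * \<rho> * norm (x - y)" unfolding \<beta>_def by (rule abs_norm_sq_diff_le[OF x y])
    ultimately have "\<bar>real i * \<tau> + \<beta>\<bar> \<le> l" using \<tau>(2) by (simp add: l_def algebra_simps)
    from integral_ramp[OF R(1) l this]
    show "ramp_integral x y (0 + real i * \<tau>) = H 0 (0 + real i * \<tau>)"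
      unfolding ramp_integral_eq[OF n] H_def c_def l_def \<beta>_def by simp
  qed
  ultimately show ?thesis by simp
qed

lemma abs_ramp_integral_le:
  fixes x y :: "real ^ 'n"
  assumes "norm x \<le> 1" "norm y \<le> 1"
  shows "\<bar>ramp_integral x y b\<bar> \<le> sphere_area CARD('n) * (\<bar>b\<bar> + 4 * norm (x - y))"
proof -
  have "\<bar>max 0 (b + (norm (x - \<theta>))\<^sup>2 - (norm (y - \<theta>))\<^sup>2)\<bar> \<le> \<bar>b\<bar> + 4 * norm (x - y)" if "norm \<theta> = 1" for \<theta>
  proof -
    have "norm (x - \<theta>) \<le> 2" "norm (y - \<theta>) \<le> 2"
      using norm_triangle_ineq4[of x \<theta>] norm_triangle_ineq4[of y \<theta>] assms that by auto
    from abs_norm_sq_diff_le[OF this] have "\<bar>(norm (x - \<theta>))\<^sup>2 - (norm (y - \<theta>))\<^sup>2\<bar> \<le> 4 * norm (x - y)" by simp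
    then show ?thesis by (auto simp: max_def abs_real_def split: if_splits)
  qed
  moreover have "integrable sphere_measure (\<lambda>\<theta>. max 0 (b + (norm (x - \<theta>))\<^sup>2 - (norm (y - \<theta>))\<^sup>2))"
    by (intro sphere_integrable_continuous continuous_intros)
  ultimately show ?thesis
    using norm_sphere_integral_le[of "\<lambda>\<theta>. max 0 (b + (norm (x - \<theta>))\<^sup>2 - (norm (y - \<theta>))\<^sup>2)" "\<bar>b\<bar> + 4 * norm (x - y)"]
    by (simp add: ramp_integral_def)
qed

text \<open>Far from the diagonal, relative to the step, the exact value applies. Close to it, the
  ramp integral itself is O(\<tau>), and \<tau> = \<tau>^N \<tau>^(1-N) is traded for \<tau>^N |x -
  y|^(2-n) because N - 1 = n - 2. The bound is free of \<tau> after division by \<tau>^N.\<close>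

lemma fdiff_ramp_integral_bound:
  fixes x :: "real ^ 'n"
  assumes n: "CARD('n) = 2 * k + 3" and x: "norm x \<le> \<rho>" and \<rho>: "\<rho> < 1"
  obtains K where "K \<ge> 0" "\<And>y \<tau>. norm y \<le> \<rho> \<Longrightarrow> x \<noteq> y \<Longrightarrow> \<tau> > 0 \<Longrightarrow>
     \<bar>fdiff \<tau> (2 * k + 2) (ramp_integral x y) 0\<bar> \<le> \<tau> ^ (2 * k + 2) * (K * norm (x - y) powr (2 - real CARD('n)))"
proof -
  define N where "N = 2 * k + 2"
  \<comment> \<open>The threshold between the regimes: |x - y| >= \<kappa> \<tau> is exactly the
    step condition of \<open>fdiff_ramp_integral_exact\<close>.\<close>
  define \<kappa> where "\<kappa> = real N / (2 * (1 - \<rho>))"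
  have \<kappa>: "\<kappa> > 0" using \<rho> by (simp add: \<kappa>_def N_def)
  define K2 where "K2 = 2 ^ N * (sphere_area CARD('n) * (real N + 4 * \<kappa>)) * \<kappa> powr (real N - 1)"
  have K2: "K2 \<ge> 0" using \<kappa> sphere_area_pos[of "CARD('n)"] by (simp add: K2_def)
  have "\<bar>fdiff \<tau> N (ramp_integral x y) 0\<bar> \<le> \<tau> ^ N * ((\<bar>ramp_const k\<bar> + K2) * norm (x - y) powr (2 - real CARD('n)))"
    if y: "norm y \<le> \<rho>" "x \<noteq> y" "\<tau> > 0" for y \<tau>
  proof (cases "real N * \<tau> \<le> 2 * (1 - \<rho>) * norm (x - y)")
    case True
    then have "\<bar>fdiff \<tau> N (ramp_integral x y) 0\<bar> = \<tau> ^ N * (\<bar>ramp_const k\<bar> * norm (x - y) powr (2 - real CARD('n)))"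
      using fdiff_ramp_integral_exact[OF n x y(1) y(2), of \<tau>] y(3) by (simp add: N_def abs_mult del: fdiff.simps)
    also have "\<dots> \<le> \<tau> ^ N * ((\<bar>ramp_const k\<bar> + K2) * norm (x - y) powr (2 - real CARD('n)))"
      using K2 y(3) by (intro mult_left_mono mult_right_mono) auto
    finally show ?thesis .
  next
    case False
    then have d: "norm (x - y) < \<kappa> * \<tau>" using \<rho> by (simp add: \<kappa>_def field_simps)
    have "norm (ramp_integral x y (0 + real i * \<tau>)) \<le> sphere_area CARD('n) * ((real N + 4 * \<kappa>) * \<tau>)" if i: "i \<le> N" for i
    proof -
      have "\<bar>0 + real i * \<tau>\<bar> + 4 * norm (x - y) \<le> real N * \<tau> + 4 * (\<kappa> * \<tau>)"
        using i y(3) d by (intro add_mono) (auto intro!: mult_right_mono simp: abs_mult)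
      also have "\<dots> = (real N + 4 * \<kappa>) * \<tau>" by (simp add: algebra_simps)
      finally have "sphere_area CARD('n) * (\<bar>0 + real i * \<tau>\<bar> + 4 * norm (x - y)) \<le> sphere_area CARD('n) * ((real N + 4 * \<kappa>) * \<tau>)"
        using sphere_area_pos[of "CARD('n)"] by (intro mult_left_mono) auto
      moreover have "\<bar>ramp_integral x y (0 + real i * \<tau>)\<bar> \<le> sphere_area CARD('n) * (\<bar>0 + real i * \<tau>\<bar> + 4 * norm (x - y))"
        by (rule abs_ramp_integral_le) (use x y(1) \<rho> in auto)
      ultimately show ?thesis unfolding real_norm_def by (rule order_trans[rotated])
    qed
    then have "\<bar>fdiff \<tau> N (ramp_integral x y) 0\<bar> \<le> 2 ^ N * (sphere_area CARD('n) * ((real N + 4 * \<kappa>) * \<tau>))"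
      using norm_fdiff_le[of N "ramp_integral x y" 0 \<tau>] by simp
    also have "\<dots> \<le> \<tau> ^ N * (K2 * norm (x - y) powr (2 - real CARD('n)))"
    proof -
      have e: "2 - real CARD('n) = - (real N - 1)" by (simp add: n N_def)
      have "\<tau> powr (- (real N - 1)) \<le> (norm (x - y) / \<kappa>) powr (- (real N - 1))"
        using d \<kappa> y by (intro powr_mono2') (auto simp: N_def field_simps)
      also have "\<dots> = \<kappa> powr (real N - 1) * norm (x - y) powr (2 - real CARD('n))"
        unfolding e using \<kappa> y powr_minus_divide[of \<kappa> "real N - 1"] by (simp only: powr_divide) simp
      finally have "\<tau> ^ N * \<tau> powr (- (real N - 1)) \<le> \<tau> ^ N * (\<kappa> powr (real N - 1) * norm (x - y) powr (2 - real CARD('n)))"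
        using y(3) by (intro mult_left_mono) auto
      moreover have "\<tau> ^ N * \<tau> powr (- (real N - 1)) = \<tau>"
        using y(3) by (simp add: powr_realpow[symmetric] powr_add[symmetric])
      ultimately have "\<tau> \<le> \<tau> ^ N * (\<kappa> powr (real N - 1) * norm (x - y) powr (2 - real CARD('n)))" by simp
      then have "2 ^ N * (sphere_area CARD('n) * (real N + 4 * \<kappa>)) * \<tau> \<le> 2 ^ N * (sphere_area CARD('n) * (real N + 4 * \<kappa>)) * (\<tau> ^ N * (\<kappa> powr (real N - 1) * norm (x - y) powr (2 - real CARD('n))))"
        using \<kappa> sphere_area_pos[of "CARD('n)"] by (intro mult_left_mono) auto
      then show ?thesis by (simp add: K2_def mult_ac)
    qed
    also have "\<dots> \<le> \<tau> ^ N * ((\<bar>ramp_const k\<bar> + K2) * norm (x - y) powr (2 - real CARD('n)))"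
      using y(3) by (intro mult_left_mono mult_right_mono) auto
    finally show ?thesis .
  qed
  then show ?thesis using that[of "\<bar>ramp_const k\<bar> + K2"] K2 by (simp add: N_def del: fdiff.simps)
qed

definition ramp_mean :: "(real ^ 'n \<Rightarrow> complex) \<Rightarrow> real ^ 'n \<Rightarrow> real ^ 'n \<Rightarrow> real \<Rightarrow> complex" where
  "ramp_mean f x \<theta> b = (\<integral>y. f y * of_real (max 0 (b + (norm (x - \<theta>))\<^sup>2 - (norm (y - \<theta>))\<^sup>2)) \<partial>lborel)"

context
  fixes f :: "real ^ 'n \<Rightarrow> complex" and \<rho> :: real and k :: nat
  assumes f: "smooth f" and \<rho>: "\<And>x. \<rho> < norm x \<Longrightarrow> f x = 0" and \<rho>1: "\<rho> < 1"
begin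

text \<open>In s = |y - \<theta>|^2 the ramp is the kernel T - s of double integration, with
  Gamma(2) = 1. The factor 1/2 is due to \<open>sph_chain\<close> at index 0 being twice the polar
  weight times the mean.\<close>

lemma ramp_mean_eq_RL:
  assumes T: "b + (norm (x - \<theta>))\<^sup>2 > 0"
  shows "ramp_mean f x \<theta> b = RL 2 (sph_chain f \<theta> 0) (b + (norm (x - \<theta>))\<^sup>2) / 2"
proof -
  define T where "T = b + (norm (x - \<theta>))\<^sup>2"
  have cf: "continuous_on UNIV f" by (rule smooth_continuous[OF f])
  define G where "G z = f (\<theta> - z) * of_real (max 0 (T - (norm z)\<^sup>2))" for z
  have cG: "continuous_on UNIV G"
    unfolding G_def by (intro continuous_intros continuous_on_compose2[OF cf]) auto
  have iG: "integrable lborel G"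
  proof (rule integrable_continuous_bounded_support[OF cG, of "norm \<theta> + \<rho>"])
    fix z :: "real ^ 'n" assume "norm \<theta> + \<rho> < norm z"
    then have "\<rho> < norm (\<theta> - z)" using norm_triangle_ineq2[of z \<theta>] by (simp add: norm_minus_commute)
    then show "G z = 0" using \<rho> by (simp add: G_def)
  qed
  have "ramp_mean f x \<theta> b = (\<integral>y. f y * of_real (max 0 (T - (norm (y - \<theta>))\<^sup>2)) \<partial>lborel)"
    by (simp add: ramp_mean_def T_def)
  also have "\<dots> = (\<integral>y. f y * of_real (max 0 (T - (norm (y - \<theta>))\<^sup>2)) \<partial>distr lborel borel (\<lambda>z. \<theta> + (-1) *\<^sub>R z))"
    by (subst lborel_affine[of "-1" \<theta>]) (simp_all add: density_1 flip: one_ennreal_def)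
  also have "\<dots> = (\<integral>z. G z \<partial>lborel)"
    by (subst integral_distr) (auto simp: G_def[abs_def] intro!: borel_measurable_continuous_onI continuous_intros cf)
  also have "\<dots> = (\<integral>s. polar_weight CARD('n) s *\<^sub>R (\<integral>\<omega>. G (sqrt s *\<^sub>R \<omega>) \<partial>sphere_measure) \<partial>lborel)"
    by (rule integral_polar[OF iG])
  also have "\<dots> = (\<integral>s. (indicator {0<..<T} s *\<^sub>R (of_real (T - s) powr (2 - 1) * sph_chain f \<theta> 0 s)) / 2 \<partial>lborel)"
  proof (rule Bochner_Integration.integral_cong[OF refl])
    fix s
    show "polar_weight CARD('n) s *\<^sub>R (\<integral>\<omega>. G (sqrt s *\<^sub>R \<omega>) \<partial>sphere_measure) = (indicator {0<..<T} s *\<^sub>R (of_real (T - s) powr (2 - 1) * sph_chain f \<theta> 0 s)) / 2"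
    proof (cases "s > 0")
      case True
      have "(\<integral>\<omega>. G (sqrt s *\<^sub>R \<omega>) \<partial>sphere_measure) = (\<integral>\<omega>. f (\<theta> - sqrt s *\<^sub>R \<omega>) * of_real (max 0 (T - s)) \<partial>sphere_measure)"
        by (rule Bochner_Integration.integral_cong[OF refl]) (use True in \<open>simp add: G_def power_mult_distrib\<close>)
      also have "\<dots> = (\<integral>\<omega>. f (\<theta> - sqrt s *\<^sub>R \<omega>) \<partial>sphere_measure) * of_real (max 0 (T - s))"
        by (rule integral_mult_left_zero)
      finally show ?thesis
        using True by (auto simp: sph_chain_0 indicator_def max_def scaleR_conv_of_real simp del: of_real_diff)
    qed (simp add: polar_weight_def)
  qed
  also have "\<dots> = RL 2 (sph_chain f \<theta> 0) T / 2"
  proof -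
    have "rGamma (2 :: complex) = 1" using Gamma_fact[of 1, where 'a=complex] by (simp add: rGamma_inverse_Gamma)
    then show ?thesis unfolding RL_def set_lebesgue_integral_def by simp
  qed
  finally show ?thesis by (simp add: T_def)
qed

text \<open>As a function of b the ramp mean is half of a double primitive of the chain, so its (2k
  + 2)-nd derivative is half the (2k)-th member; the difference quotient approximates it with the
  modulus of continuity of that member.\<close>

lemma ramp_mean_fdiff_approx:
  assumes n: "CARD('n) = 2 * k + 3" and \<theta>: "norm \<theta> = 1" and x: "norm x < 1" and \<tau>: "\<tau> \<ge> 0"
    and \<epsilon>: "\<And>s. (norm (x - \<theta>))\<^sup>2 \<le> s \<Longrightarrow> s \<le> (norm (x - \<theta>))\<^sup>2 + real (2 * k + 2) * \<tau> \<Longrightarrow> norm (sph_chain f \<theta> (2 * k) s - c) \<le> \<epsilon>"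
  shows "norm (fdiff \<tau> (2 * k + 2) (ramp_mean f x \<theta>) 0 - \<tau> ^ (2 * k + 2) *\<^sub>R (c / 2)) \<le> \<epsilon> / 2 * \<tau> ^ (2 * k + 2)"
proof -
  define t where "t = (norm (x - \<theta>))\<^sup>2"
  have t: "t > 0" using x \<theta> by (auto simp: t_def)
  obtain h where h: "deriv_chain h" "\<And>j. h (2 + j) = sph_chain f \<theta> j"
    using deriv_chain_primitive[OF deriv_chain_sph_chain[OF f \<rho> \<rho>1 \<theta>]] by blast
  define H where "H j b = h j (b + t) / 2" for j b
  have der: "(H j has_vector_derivative H (Suc j) b) (at b)" for j b
  proof -
    have "((\<lambda>b. b + t) has_vector_derivative 1) (at b)" by (auto intro!: derivative_eq_intros)
    from vector_diff_chain_at[OF this, of "h j" "h (Suc j) (b + t)"] h(1)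
    have "((\<lambda>b. h j (b + t)) has_vector_derivative h (Suc j) (b + t)) (at b)"
      by (simp add: deriv_chain_def o_def)
    then show ?thesis unfolding H_def[abs_def] by (rule has_vector_derivative_divide)
  qed
  have "norm (fdiff \<tau> (2 * k + 2) (H 0) 0 - \<tau> ^ (2 * k + 2) *\<^sub>R (c / 2)) \<le> \<epsilon> / 2 * \<tau> ^ (2 * k + 2)"
  proof (rule fdiff_approx[where H=H, OF der \<tau>])
    fix s assume s: "0 \<le> s" "s \<le> 0 + real (2 * k + 2) * \<tau>"
    have "h (2 * k + 2) = sph_chain f \<theta> (2 * k)" using h(2)[of "2 * k"] by (simp add: add.commute)
    then have e: "H (2 * k + 2) s - c / 2 = (sph_chain f \<theta> (2 * k) (s + t) - c) / 2"
      by (simp add: H_def diff_divide_distrib)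
    show "norm (H (2 * k + 2) s - c / 2) \<le> \<epsilon> / 2"
      unfolding e using \<epsilon>[of "s + t"] s by (simp add: norm_divide t_def)
  qed
  moreover have "fdiff \<tau> (2 * k + 2) (ramp_mean f x \<theta>) 0 = fdiff \<tau> (2 * k + 2) (H 0) 0"
  proof (rule fdiff_cong)
    fix i
    have p: "0 + real i * \<tau> + t > 0" using \<tau> t by (simp add: add_nonneg_pos)
    have "RL 2 (sph_chain f \<theta> 0) (0 + real i * \<tau> + t) = h 0 (0 + real i * \<tau> + t)"
      using RL_deriv_chain[OF h(1) p, of 1] h(2)[of 0] by (simp add: numeral_2_eq_2)
    then show "ramp_mean f x \<theta> (0 + real i * \<tau>) = H 0 (0 + real i * \<tau>)"
      using ramp_mean_eq_RL[of "0 + real i * \<tau>" x \<theta>] p by (simp add: H_def t_def)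
  qed
  ultimately show ?thesis by (simp only:)
qed

lemma ramp_integrable:
  "integrable (lborel \<Otimes>\<^sub>M sphere_measure) (\<lambda>(y, \<theta>). f y * of_real (max 0 (b + (norm (x - \<theta>))\<^sup>2 - (norm (y - \<theta>))\<^sup>2)))"
proof -
  interpret P: pair_sigma_finite "lborel :: (real ^ 'n) measure" "sphere_measure :: (real ^ 'n) measure"
    by (intro pair_sigma_finite.intro sigma_finite_lborel sphere.sigma_finite_measure_axioms)
  have cf: "continuous_on UNIV f" by (rule smooth_continuous[OF f])
  have fi: "integrable lborel f" by (rule integrable_continuous_bounded_support[OF cf \<rho>])
  have [measurable]: "f \<in> borel_measurable borel" by (rule borel_measurable_continuous_onI[OF cf])
  define D where "D = \<bar>b\<bar> + (norm x + 1)\<^sup>2"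
  have D: "\<bar>max 0 (b + (norm (x - \<theta>))\<^sup>2 - (norm (y - \<theta>))\<^sup>2)\<bar> \<le> D" if "norm \<theta> = 1" for y \<theta>
  proof -
    have "norm (x - \<theta>) \<le> norm x + 1" using norm_triangle_ineq4[of x \<theta>] that by simp
    then have "(norm (x - \<theta>))\<^sup>2 \<le> (norm x + 1)\<^sup>2" by (intro power_mono) auto
    moreover have "(norm (y - \<theta>))\<^sup>2 \<ge> 0" by simp
    moreover have "\<bar>max 0 (b + A - B)\<bar> \<le> \<bar>b\<bar> + X" if "A \<le> X" "0 \<le> B" "0 \<le> X" for A B X :: real
      using that by (auto simp: max_def abs_real_def)
    ultimately show ?thesis unfolding D_def by simp
  qed
  have si: "integrable sphere_measure (\<lambda>\<theta>. f y * of_real (max 0 (b + (norm (x - \<theta>))\<^sup>2 - (norm (y - \<theta>))\<^sup>2)))" for y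
    by (intro sphere_integrable_continuous continuous_intros)
  have m: "(\<lambda>(y, \<theta>). f y * of_real (max 0 (b + (norm (x - \<theta>))\<^sup>2 - (norm (y - \<theta>))\<^sup>2))) \<in> borel_measurable (lborel \<Otimes>\<^sub>M (sphere_measure :: (real ^ 'n) measure))"
    unfolding case_prod_unfold by measurable
  show ?thesis
  proof (rule P.Fubini_integrable[OF m])
    show "integrable lborel (\<lambda>y. \<integral>\<theta>. norm (case (y, \<theta>) of (y, \<theta>) \<Rightarrow> f y * of_real (max 0 (b + (norm (x - \<theta>))\<^sup>2 - (norm (y - \<theta>))\<^sup>2))) \<partial>sphere_measure)"
    proof (rule Bochner_Integration.integrable_bound[OF integrable_mult_right[OF fi, of "of_real (sphere_area CARD('n) * D)"]])
      show "(\<lambda>y. \<integral>\<theta>. norm (case (y, \<theta>) of (y, \<theta>) \<Rightarrow> f y * of_real (max 0 (b + (norm (x - \<theta>))\<^sup>2 - (norm (y - \<theta>))\<^sup>2))) \<partial>sphere_measure) \<in> borel_measurable lborel"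
        by (rule sphere.borel_measurable_lebesgue_integral) (use m in \<open>simp add: case_prod_unfold\<close>)
      show "AE y in lborel. norm (\<integral>\<theta>. norm (case (y, \<theta>) of (y, \<theta>) \<Rightarrow> f y * of_real (max 0 (b + (norm (x - \<theta>))\<^sup>2 - (norm (y - \<theta>))\<^sup>2))) \<partial>sphere_measure) \<le> norm (of_real (sphere_area CARD('n) * D) * f y)"
      proof (rule AE_I2)
        fix y
        have "norm (\<integral>\<theta>. norm (f y * of_real (max 0 (b + (norm (x - \<theta>))\<^sup>2 - (norm (y - \<theta>))\<^sup>2))) \<partial>(sphere_measure :: (real ^ 'n) measure)) \<le> sphere_area CARD('n) * (norm (f y) * D)"
          by (rule norm_sphere_integral_le[OF _ integrable_norm[OF si]]) (use D in \<open>simp add: norm_mult mult_left_mono\<close>)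
        also have "\<dots> \<le> norm (of_real (sphere_area CARD('n) * D) * f y)"
        proof -
          have "D \<ge> 0" by (simp add: D_def)
          then show ?thesis using sphere_area_pos[of "CARD('n)"] by (simp add: norm_mult mult_ac)
        qed
        finally show "norm (\<integral>\<theta>. norm (case (y, \<theta>) of (y, \<theta>) \<Rightarrow> f y * of_real (max 0 (b + (norm (x - \<theta>))\<^sup>2 - (norm (y - \<theta>))\<^sup>2))) \<partial>sphere_measure) \<le> norm (of_real (sphere_area CARD('n) * D) * f y)"
          by simp
      qed
    qed
  qed (use si in simp)
qed

lemma ramp_mean_integrable: "integrable sphere_measure (\<lambda>\<theta>. ramp_mean f x \<theta> b)"
  and ramp_fubini: "(\<integral>\<theta>. ramp_mean f x \<theta> b \<partial>sphere_measure) = (\<integral>y. f y * of_real (ramp_integral x y b) \<partial>lborel)"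
  and ramp_integral_integrable: "integrable lborel (\<lambda>y. f y * of_real (ramp_integral x y b))"
proof -
  interpret P: pair_sigma_finite "lborel :: (real ^ 'n) measure" "sphere_measure :: (real ^ 'n) measure"
    by (intro pair_sigma_finite.intro sigma_finite_lborel sphere.sigma_finite_measure_axioms)
  have e: "(\<integral>\<theta>. f y * of_real (max 0 (b + (norm (x - \<theta>))\<^sup>2 - (norm (y - \<theta>))\<^sup>2)) \<partial>sphere_measure) = f y * of_real (ramp_integral x y b)" for y
    unfolding ramp_integral_def integral_mult_right_zero integral_complex_of_real ..
  show "integrable sphere_measure (\<lambda>\<theta>. ramp_mean f x \<theta> b)"
    unfolding ramp_mean_def using P.integrable_snd[OF ramp_integrable] .
  show "(\<integral>\<theta>. ramp_mean f x \<theta> b \<partial>sphere_measure) = (\<integral>y. f y * of_real (ramp_integral x y b) \<partial>lborel)"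
    unfolding ramp_mean_def e[symmetric] by (rule P.Fubini_integral[OF ramp_integrable])
  show "integrable lborel (\<lambda>y. f y * of_real (ramp_integral x y b))"
    unfolding e[symmetric] using P.integrable_fst[OF ramp_integrable] .
qed

text \<open>The rescaled differences of the ramp mean, integrated over \<theta>, have two limits:
  directly, half the integral of the chain; after Fubini, \<open>ramp_const k\<close> times the
  Newtonian potential.\<close>

lemma sphere_integral_sph_chain_eq_newton_potential:
  assumes n: "CARD('n) = 2 * k + 3" and x: "norm x < 1"
  shows "(\<integral>\<theta>. sph_chain f \<theta> (2 * k) ((norm (x - \<theta>))\<^sup>2) \<partial>sphere_measure) = of_real (2 * ramp_const k) * newton_potential f x"
proof -
  define N where "N = 2 * k + 2"
  \<comment> \<open>One radius below 1 for both x and the support of f, as the estimates on the ramp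
    integral require.\<close>
  define \<rho>' where "\<rho>' = max \<rho> (norm x)"
  have \<rho>': "\<rho>' < 1" "norm x \<le> \<rho>'" "\<And>y. \<rho>' < norm y \<Longrightarrow> f y = 0" using \<rho>1 x \<rho> by (auto simp: \<rho>'_def)
  define \<tau> where "\<tau> j = 1 / real (Suc j)" for j
  have \<tau>: "\<tau> j > 0" "\<tau> j \<le> 1" for j by (auto simp: \<tau>_def)
  have \<tau>0: "\<tau> \<longlonglongrightarrow> 0" unfolding \<tau>_def by real_asymp
  define A where "A j \<theta> = (1 / \<tau> j ^ N) *\<^sub>R fdiff (\<tau> j) N (ramp_mean f x \<theta>) 0" for j \<theta>
  have cf: "continuous_on UNIV f" by (rule smooth_continuous[OF f])
  \<comment> \<open>Convergence at each \<theta> is continuity of the chain at |x - \<theta>|^2.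
    Domination uses |x - \<theta>| <= 2 and steps at most 1, so all samples lie below 4 + N.\<close>
  have A_lim: "(\<lambda>j. \<integral>\<theta>. A j \<theta> \<partial>sphere_measure) \<longlonglongrightarrow> (\<integral>\<theta>. sph_chain f \<theta> (2 * k) ((norm (x - \<theta>))\<^sup>2) / 2 \<partial>sphere_measure)"
  proof -
    obtain C where C: "C \<ge> 0" "\<And>\<theta> s. norm \<theta> = 1 \<Longrightarrow> s \<le> 4 + real N \<Longrightarrow> norm (sph_chain f \<theta> (2 * k) s) \<le> C"
      using sph_chain_bounded[where f=f and \<rho>=\<rho> and R="4 + real N" and k="2 * k", OF f \<rho> \<rho>1] by metis
    have approx: "norm (A j \<theta> - c / 2) \<le> \<epsilon> / 2"
      if "norm \<theta> = 1" "\<And>s. (norm (x - \<theta>))\<^sup>2 \<le> s \<Longrightarrow> s \<le> (norm (x - \<theta>))\<^sup>2 + real N * \<tau> j \<Longrightarrow> norm (sph_chain f \<theta> (2 * k) s - c) \<le> \<epsilon>" for j \<theta> c \<epsilon>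
    proof -
      have "norm (fdiff (\<tau> j) N (ramp_mean f x \<theta>) 0 - \<tau> j ^ N *\<^sub>R (c / 2)) \<le> \<epsilon> / 2 * \<tau> j ^ N"
        unfolding N_def by (rule ramp_mean_fdiff_approx[OF n that(1) x less_imp_le[OF \<tau>(1)]]) (use that(2) in \<open>simp add: N_def\<close>)
      moreover have "A j \<theta> - c / 2 = (1 / \<tau> j ^ N) *\<^sub>R (fdiff (\<tau> j) N (ramp_mean f x \<theta>) 0 - \<tau> j ^ N *\<^sub>R (c / 2))"
        using \<tau>(1)[of j] by (simp add: A_def scaleR_diff_right)
      ultimately have "norm (A j \<theta> - c / 2) \<le> (1 / \<tau> j ^ N) * (\<epsilon> / 2 * \<tau> j ^ N)"
        using \<tau>(1)[of j] by (simp only: norm_scaleR) (intro mult_mono; simp)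
      then show ?thesis using \<tau>(1)[of j] by simp
    qed
    show ?thesis
    proof (rule integral_dominated_convergence[where w="\<lambda>_. C / 2"])
      show "(\<lambda>\<theta>. sph_chain f \<theta> (2 * k) ((norm (x - \<theta>))\<^sup>2) / 2) \<in> borel_measurable sphere_measure"
        by (intro borel_measurable_sphere_measureI borel_measurable_divide borel_measurable_const sph_chain_measurable[OF f \<rho> \<rho>1] continuous_intros)
      show "A j \<in> borel_measurable sphere_measure" for j
        unfolding A_def[abs_def] by (intro borel_measurable_scaleR borel_measurable_const borel_measurable_integrable fdiff_integral(1) ramp_mean_integrable)
      show "AE \<theta> in sphere_measure. (\<lambda>j. A j \<theta>) \<longlonglongrightarrow> sph_chain f \<theta> (2 * k) ((norm (x - \<theta>))\<^sup>2) / 2"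
      proof (rule AE_I2)
        fix \<theta> :: "real ^ 'n" assume "\<theta> \<in> space sphere_measure"
        then have \<theta>: "norm \<theta> = 1" by simp
        define t where "t = (norm (x - \<theta>))\<^sup>2"
        have c: "continuous_on UNIV (sph_chain f \<theta> (2 * k))"
          by (rule deriv_chain_continuous[OF deriv_chain_sph_chain[OF f \<rho> \<rho>1 \<theta>]])
        show "(\<lambda>j. A j \<theta>) \<longlonglongrightarrow> sph_chain f \<theta> (2 * k) ((norm (x - \<theta>))\<^sup>2) / 2"
        proof (rule LIMSEQ_I)
          fix r :: real assume r: "r > 0"
          obtain d where d: "d > 0" "\<And>s. dist s t < d \<Longrightarrow> dist (sph_chain f \<theta> (2 * k) s) (sph_chain f \<theta> (2 * k) t) < r"
            using c r unfolding continuous_on_iff by (metis UNIV_I)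
          have "(\<lambda>j. real N * \<tau> j) \<longlonglongrightarrow> real N * 0" by (intro tendsto_intros \<tau>0)
          then have "\<forall>\<^sub>F j in sequentially. real N * \<tau> j < d" using d(1) by (intro order_tendstoD(2)[of _ "real N * 0"]) auto
          then obtain M where M: "\<And>j. j \<ge> M \<Longrightarrow> real N * \<tau> j < d" by (auto simp: eventually_sequentially)
          have "norm (A j \<theta> - sph_chain f \<theta> (2 * k) t / 2) < r" if "j \<ge> M" for j
          proof -
            have "norm (A j \<theta> - sph_chain f \<theta> (2 * k) t / 2) \<le> r / 2"
            proof (rule approx[OF \<theta>])
              fix s assume "(norm (x - \<theta>))\<^sup>2 \<le> s" "s \<le> (norm (x - \<theta>))\<^sup>2 + real N * \<tau> j"
              then have "dist s t < d" using M[OF that] by (simp add: dist_real_def t_def)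
              then show "norm (sph_chain f \<theta> (2 * k) s - sph_chain f \<theta> (2 * k) t) \<le> r"
                using d(2)[of s] by (simp add: dist_norm)
            qed
            then show ?thesis using r by linarith
          qed
          then show "\<exists>M. \<forall>j\<ge>M. norm (A j \<theta> - sph_chain f \<theta> (2 * k) ((norm (x - \<theta>))\<^sup>2) / 2) < r"
            unfolding t_def by blast
        qed
      qed
      show "AE \<theta> in sphere_measure. norm (A j \<theta>) \<le> C / 2" for j
      proof (rule AE_I2)
        fix \<theta> :: "real ^ 'n" assume "\<theta> \<in> space sphere_measure"
        then have \<theta>: "norm \<theta> = 1" by simp
        have "norm (x - \<theta>) \<le> 2" using norm_triangle_ineq4[of x \<theta>] x \<theta> by simp
        then have x4: "(norm (x - \<theta>))\<^sup>2 \<le> 4" using power_mono[of "norm (x - \<theta>)" 2 2] by simp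
        have "norm (A j \<theta> - 0 / 2) \<le> C / 2"
        proof (rule approx[OF \<theta>])
          fix s assume "s \<le> (norm (x - \<theta>))\<^sup>2 + real N * \<tau> j"
          moreover have "real N * \<tau> j \<le> real N * 1" using \<tau>(2) by (intro mult_left_mono) auto
          ultimately show "norm (sph_chain f \<theta> (2 * k) s - 0) \<le> C" using C(2)[OF \<theta>, of s] x4 by simp
        qed
        then show "norm (A j \<theta>) \<le> C / 2" by simp
      qed
    qed simp
  qed
  \<comment> \<open>The integrand over y after Fubini has moved the differences onto the ramp
    integral.\<close>
  define B where "B j y = f y * of_real ((1 / \<tau> j ^ N) * fdiff (\<tau> j) N (ramp_integral x y) 0)" for j y
  have fd_mult: "fdiff t N (\<lambda>b. f y * of_real (ramp_integral x y b)) 0 = f y * of_real (fdiff t N (ramp_integral x y) 0)" for y t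
    by (rule fdiff_bounded_linear) (intro bounded_linear_const_mult bounded_linear_of_real)
  have AB: "(\<integral>\<theta>. A j \<theta> \<partial>sphere_measure) = (\<integral>y. B j y \<partial>lborel)" and Bm: "integrable lborel (B j)" for j
  proof -
    have "(\<integral>\<theta>. A j \<theta> \<partial>sphere_measure) = (1 / \<tau> j ^ N) *\<^sub>R (\<integral>\<theta>. fdiff (\<tau> j) N (ramp_mean f x \<theta>) 0 \<partial>sphere_measure)"
      unfolding A_def by simp
    also have "(\<integral>\<theta>. fdiff (\<tau> j) N (ramp_mean f x \<theta>) 0 \<partial>sphere_measure) = fdiff (\<tau> j) N (\<lambda>b. \<integral>y. f y * of_real (ramp_integral x y b) \<partial>lborel) 0"
      unfolding ramp_fubini[symmetric] by (rule fdiff_integral(2)[symmetric]) (rule ramp_mean_integrable)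
    also have "\<dots> = (\<integral>y. f y * of_real (fdiff (\<tau> j) N (ramp_integral x y) 0) \<partial>lborel)"
      unfolding fd_mult[symmetric] by (rule fdiff_integral(2)) (rule ramp_integral_integrable)
    also have "(1 / \<tau> j ^ N) *\<^sub>R \<dots> = (\<integral>y. B j y \<partial>lborel)"
      unfolding B_def by (simp add: scaleR_conv_of_real mult.left_commute flip: integral_mult_right_zero)
    finally show "(\<integral>\<theta>. A j \<theta> \<partial>sphere_measure) = (\<integral>y. B j y \<partial>lborel)" .
    have "integrable lborel (\<lambda>y. fdiff (\<tau> j) N (\<lambda>b. f y * of_real (ramp_integral x y b)) 0)"
      by (rule fdiff_integral(1)) (rule ramp_integral_integrable)
    then have "integrable lborel (\<lambda>y. (1 / \<tau> j ^ N) *\<^sub>R (f y * of_real (fdiff (\<tau> j) N (ramp_integral x y) 0)))"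
      unfolding fd_mult by simp
    then show "integrable lborel (B j)"
      unfolding B_def[abs_def] by (simp add: scaleR_conv_of_real mult.left_commute)
  qed
  define p where "p = 2 - real CARD('n)"
  have trans: "(\<integral>y. f y * of_real (c * norm (x - y) powr p) \<partial>lborel) = of_real c * newton_potential f x" for c
  proof -
    have "(\<integral>y. f y * of_real (c * norm (x - y) powr p) \<partial>lborel) = (\<integral>y. f y * of_real (c * norm (x - y) powr p) \<partial>distr lborel borel (\<lambda>z. x + (-1) *\<^sub>R z))"
      by (subst lborel_affine[of "-1" x]) (simp_all add: density_1 flip: one_ennreal_def)
    also have "\<dots> = (\<integral>z. f (x + (-1) *\<^sub>R z) * of_real (c * norm (x - (x + (-1) *\<^sub>R z)) powr p) \<partial>lborel)"
    proof (rule integral_distr)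
      have [measurable]: "f \<in> borel_measurable borel" by (rule borel_measurable_continuous_onI[OF cf])
      have "(\<lambda>y. norm (x - y) powr p) \<in> borel_measurable borel"
        by (intro powr_real_measurable borel_measurable_const borel_measurable_continuous_onI continuous_intros)
      then show "(\<lambda>y. f y * of_real (c * norm (x - y) powr p)) \<in> borel_measurable borel" by measurable
    qed simp
    also have "\<dots> = (\<integral>z. of_real c * (f (x - z) * of_real (norm z powr p)) \<partial>lborel)"
      by (simp add: mult.left_commute)
    finally show ?thesis by (simp add: newton_potential_def p_def)
  qed
  obtain K where K: "K \<ge> 0" "\<And>y \<tau>. norm y \<le> \<rho>' \<Longrightarrow> x \<noteq> y \<Longrightarrow> \<tau> > 0 \<Longrightarrow>
     \<bar>fdiff \<tau> (2 * k + 2) (ramp_integral x y) 0\<bar> \<le> \<tau> ^ (2 * k + 2) * (K * norm (x - y) powr (2 - real CARD('n)))"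
    using fdiff_ramp_integral_bound[OF n \<rho>'(2,1)] by blast
  \<comment> \<open>For each y other than x the sequence is eventually constant by exactness; the
    bound by K |x - y|^(2-n) is integrable against f, and the diagonal point is a null set.\<close>
  have B_lim: "(\<lambda>j. \<integral>y. B j y \<partial>lborel) \<longlonglongrightarrow> (\<integral>y. f y * of_real (ramp_const k * norm (x - y) powr p) \<partial>lborel)"
  proof (rule integral_dominated_convergence[where w="\<lambda>y. norm (f y * of_real (K * norm (x - y) powr p))"])
    have int: "integrable lborel (\<lambda>y. f y * of_real (c * norm (x - y) powr p))" for c
    proof -
      have "integrable lborel (\<lambda>z. f (x - z) * of_real (norm z powr p))"
        unfolding p_def by (rule newton_potential_integrable[OF cf \<rho>])
      then have i: "integrable lborel (\<lambda>z. of_real c * (f (x - z) * of_real (norm z powr p)))" by simp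
      have "integrable (density (distr lborel borel (\<lambda>z. x + (-1) *\<^sub>R z)) (\<lambda>_. ennreal (\<bar>-1\<bar> ^ DIM(real^'n)))) (\<lambda>y. of_real c * (f (x - (x - y)) * of_real (norm (x - y) powr p)))"
        unfolding abs_minus_cancel abs_one power_one ennreal_1 density_1
      proof (subst integrable_distr_eq)
        have [measurable]: "f \<in> borel_measurable borel" by (rule borel_measurable_continuous_onI[OF cf])
        have "(\<lambda>y. norm (x - y) powr p) \<in> borel_measurable borel"
          by (intro powr_real_measurable borel_measurable_const borel_measurable_continuous_onI continuous_intros)
        then show "(\<lambda>y. of_real c * (f (x - (x - y)) * of_real (norm (x - y) powr p))) \<in> borel_measurable borel" by simp
        show "(\<lambda>z. x + (-1) *\<^sub>R z) \<in> borel_measurable lborel" by simp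
        show "integrable lborel (\<lambda>z. of_real c * (f (x - (x - (x + (-1) *\<^sub>R z))) * of_real (norm (x - (x + (-1) *\<^sub>R z)) powr p)))"
          using i by simp
      qed
      then have "integrable lborel (\<lambda>y. of_real c * (f (x - (x - y)) * of_real (norm (x - y) powr p)))"
        using lborel_affine[of "-1" x] by simp
      then show ?thesis by (simp add: mult.left_commute)
    qed
    show "(\<lambda>y. f y * of_real (ramp_const k * norm (x - y) powr p)) \<in> borel_measurable lborel"
      by (rule borel_measurable_integrable[OF int])
    show "B j \<in> borel_measurable lborel" for j by (rule borel_measurable_integrable[OF Bm])
    show "integrable lborel (\<lambda>y. norm (f y * of_real (K * norm (x - y) powr p)))"
      by (rule integrable_norm[OF int])
    show "AE y in lborel. norm (B j y) \<le> norm (f y * of_real (K * norm (x - y) powr p))" for j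
      using AE_lborel_singleton[of x]
    proof eventually_elim
      fix y assume y: "y \<noteq> x"
      show "norm (B j y) \<le> norm (f y * of_real (K * norm (x - y) powr p))"
      proof (cases "norm y \<le> \<rho>'")
        case True
        have "\<bar>(1 / \<tau> j ^ N) * fdiff (\<tau> j) N (ramp_integral x y) 0\<bar> \<le> K * norm (x - y) powr p"
        proof -
          have "\<bar>fdiff (\<tau> j) N (ramp_integral x y) 0\<bar> \<le> \<tau> j ^ N * (K * norm (x - y) powr p)"
            unfolding N_def p_def by (rule K(2)[OF True y[symmetric] \<tau>(1)])
          then show ?thesis using \<tau>(1)[of j] by (simp add: abs_mult divide_simps mult_ac)
        qed
        also have "\<dots> \<le> \<bar>K * norm (x - y) powr p\<bar>" by simp
        finally show ?thesis unfolding B_def norm_mult norm_of_real by (rule mult_left_mono) simp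
      next
        case False
        then show ?thesis using \<rho>'(3)[of y] by (simp add: B_def)
      qed
    qed
    show "AE y in lborel. (\<lambda>j. B j y) \<longlonglongrightarrow> f y * of_real (ramp_const k * norm (x - y) powr p)"
      using AE_lborel_singleton[of x]
    proof eventually_elim
      fix y assume y: "y \<noteq> x"
      show "(\<lambda>j. B j y) \<longlonglongrightarrow> f y * of_real (ramp_const k * norm (x - y) powr p)"
      proof (cases "norm y \<le> \<rho>'")
        case True
        have pos: "0 < 2 * (1 - \<rho>') * norm (x - y)" using \<rho>'(1) y by simp
        have "(\<lambda>j. real N * \<tau> j) \<longlonglongrightarrow> real N * 0" by (intro tendsto_intros \<tau>0)
        then have "\<forall>\<^sub>F j in sequentially. real N * \<tau> j < 2 * (1 - \<rho>') * norm (x - y)"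
          using pos by (intro order_tendstoD(2)[of _ "real N * 0"]) auto
        then have "\<forall>\<^sub>F j in sequentially. f y * of_real (ramp_const k * norm (x - y) powr p) = B j y"
        proof eventually_elim
          fix j assume "real N * \<tau> j < 2 * (1 - \<rho>') * norm (x - y)"
          then have "fdiff (\<tau> j) N (ramp_integral x y) 0 = \<tau> j ^ N * (ramp_const k * norm (x - y) powr p)"
            unfolding N_def p_def
            by (intro fdiff_ramp_integral_exact[OF n \<rho>'(2) True y[symmetric] less_imp_le[OF \<tau>(1)]]) (simp add: N_def)
          then show "f y * of_real (ramp_const k * norm (x - y) powr p) = B j y"
            using \<tau>(1)[of j] by (simp add: B_def)
        qed
        then show ?thesis by (rule tendsto_eventually[OF eventually_mono]) simp
      next
        case False
        then show ?thesis using \<rho>'(3)[of y] by (simp add: B_def)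
      qed
    qed
  qed
  have "(\<integral>\<theta>. sph_chain f \<theta> (2 * k) ((norm (x - \<theta>))\<^sup>2) / 2 \<partial>sphere_measure) = of_real (ramp_const k) * newton_potential f x"
    using LIMSEQ_unique[OF A_lim[unfolded AB] B_lim] unfolding trans .
  then show ?thesis by simp
qed

end

section \<open>The trace of the solution as a fractional integral\<close>

lemma borel_measurable_RL_kernel [measurable]: "RL_kernel p c \<in> borel_measurable borel"
  unfolding RL_kernel_def by measurable

lemma RL_kernel_radial_integrable:
  fixes f :: "real ^ 'n \<Rightarrow> complex"
  assumes n: "CARD('n) \<ge> 2" and p: "Re p > 0" and t: "t > 0" and f: "continuous_on UNIV f" and fB: "\<And>x. norm (f x) \<le> B"
  shows "set_integrable lborel (ball 0 t) (\<lambda>y. RL_kernel p c (t\<^sup>2 - (norm y)\<^sup>2) * f (x - y))"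
proof -
  define T where "T = t\<^sup>2"
  have T: "T > 0" using t by (simp add: T_def)
  have B: "B \<ge> 0" using order_trans[OF norm_ge_zero fB] .
  have [measurable]: "f \<in> borel_measurable borel" by (rule borel_measurable_continuous_onI[OF f])
  define h where "h s = indicator {0<..<T} s * norm (RL_kernel p c (T - s))" for s
  have [measurable]: "h \<in> borel_measurable borel" unfolding h_def by measurable
  have "set_integrable lborel {0<..<T} (\<lambda>s. RL_kernel p c (T - s) * 1)"
    by (rule RL_kernel_integrable[OF p _ _ T, of _ 1]) auto
  then have "set_integrable lborel {0<..<T} (\<lambda>s. norm (RL_kernel p c (T - s)))"
    using set_integrable_norm by fastforce
  then have hi: "integrable lborel h" by (simp add: set_integrable_def h_def[abs_def])
  have "integrable lborel (\<lambda>s. polar_weight CARD('n) s * h s)"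
  proof (rule Bochner_Integration.integrable_bound[OF integrable_mult_right[OF hi, of "T powr (real CARD('n) / 2 - 1) / 2"]])
    show "AE s in lborel. norm (polar_weight CARD('n) s * h s) \<le> norm (T powr (real CARD('n) / 2 - 1) / 2 * h s)"
    proof (rule AE_I2)
      fix s
      show "norm (polar_weight CARD('n) s * h s) \<le> norm (T powr (real CARD('n) / 2 - 1) / 2 * h s)"
      proof (cases "s \<in> {0<..<T}")
        case True
        \<comment> \<open>For n >= 2 the polar weight is nondecreasing on (0,T), so integrability
          reduces to that of the kernel in s.\<close>
        then have "polar_weight CARD('n) s \<le> T powr (real CARD('n) / 2 - 1) / 2"
          using n by (auto simp: polar_weight_def intro!: powr_mono2 divide_right_mono)
        then have "\<bar>polar_weight CARD('n) s\<bar> * \<bar>h s\<bar> \<le> \<bar>T powr (real CARD('n) / 2 - 1) / 2\<bar> * \<bar>h s\<bar>"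
          by (intro mult_right_mono) simp_all
        then show ?thesis by (simp only: real_norm_def abs_mult)
      qed (simp add: h_def)
    qed
  qed measurable
  then have "(\<integral>\<^sup>+s. ennreal (polar_weight CARD('n) s * h s) \<partial>lborel) < \<infinity>"
    by (subst nn_integral_eq_integral) (auto simp: h_def)
  then have "(\<integral>\<^sup>+y. ennreal (h ((norm (y :: real ^ 'n))\<^sup>2)) \<partial>lborel) < \<infinity>"
    by (subst nn_integral_radial) (simp_all add: ennreal_mult_less_top)
  then have "integrable lborel (\<lambda>y :: real ^ 'n. h ((norm y)\<^sup>2))"
    by (intro integrableI_nonneg) (auto simp: h_def)
  then have i: "integrable lborel (\<lambda>y :: real ^ 'n. B * h ((norm y)\<^sup>2))" by simp
  show ?thesis
    unfolding set_integrable_def T_def[symmetric]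
  proof (rule Bochner_Integration.integrable_bound[OF i])
    show "(\<lambda>y. indicator (ball 0 t) y *\<^sub>R (RL_kernel p c (T - (norm y)\<^sup>2) * f (x - y))) \<in> borel_measurable lborel"
      by (intro borel_measurable_scaleR borel_measurable_indicator) simp_all
    show "AE y in lborel. norm (indicator (ball 0 t) y *\<^sub>R (RL_kernel p c (T - (norm y)\<^sup>2) * f (x - y))) \<le> norm (B * h ((norm y)\<^sup>2))"
      using AE_lborel_singleton[of 0]
    proof eventually_elim
      fix y :: "real ^ 'n" assume y: "y \<noteq> 0"
      show "norm (indicator (ball 0 t) y *\<^sub>R (RL_kernel p c (T - (norm y)\<^sup>2) * f (x - y))) \<le> norm (B * h ((norm y)\<^sup>2))"
      proof (cases "norm y < t")
        case True
        then have "(norm y)\<^sup>2 \<in> {0<..<T}" using y by (simp add: T_def power_strict_mono)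
        then show ?thesis using True fB[of "x - y"] B by (simp add: h_def norm_mult mult.commute mult_right_mono)
      qed simp
    qed
  qed
qed

text \<open>The kernel depends on |y| alone, so polar coordinates leave the spherical mean of f
  about \<theta>; again the 1/2 comes from \<open>sph_chain_0\<close>.\<close>

lemma integral_RL_kernel_radial:
  fixes f :: "real ^ 'n \<Rightarrow> complex"
  assumes n: "CARD('n) \<ge> 2" and p: "Re p > 0" and t: "t > 0"
    and f: "smooth f" and \<rho>: "\<And>x. \<rho> < norm x \<Longrightarrow> f x = 0" and \<rho>1: "\<rho> < 1" and \<theta>: "norm \<theta> = 1"
  shows "(LINT y:ball 0 t|lborel. RL_kernel p c (t\<^sup>2 - (norm y)\<^sup>2) * f (\<theta> - y)) = RL_exp p c (sph_chain f \<theta> 0) (t\<^sup>2) / 2"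
proof -
  define T where "T = t\<^sup>2"
  have T: "T > 0" using t by (simp add: T_def)
  have cf: "continuous_on UNIV f" by (rule smooth_continuous[OF f])
  obtain B where B: "B \<ge> 0" "\<And>x. norm (f x) \<le> B"
    using continuous_bounded_support_bounded[OF cf \<rho>] by blast
  define G where "G y = indicator (ball 0 t) y *\<^sub>R (RL_kernel p c (T - (norm y)\<^sup>2) * f (\<theta> - y))" for y
  have iG: "integrable lborel G"
    using RL_kernel_radial_integrable[OF n p t cf B(2), of c \<theta>] by (simp add: set_integrable_def G_def[abs_def] T_def)
  have "(LINT y:ball 0 t|lborel. RL_kernel p c (t\<^sup>2 - (norm y)\<^sup>2) * f (\<theta> - y)) = (\<integral>y. G y \<partial>lborel)"
    by (simp add: set_lebesgue_integral_def G_def T_def)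
  also have "\<dots> = (\<integral>s. polar_weight CARD('n) s *\<^sub>R (\<integral>\<omega>. G (sqrt s *\<^sub>R \<omega>) \<partial>sphere_measure) \<partial>lborel)"
    by (rule integral_polar[OF iG])
  also have "\<dots> = (\<integral>s. (indicator {0<..<T} s *\<^sub>R (RL_kernel p c (T - s) * sph_chain f \<theta> 0 s)) / 2 \<partial>lborel)"
  proof (rule Bochner_Integration.integral_cong[OF refl])
    fix s
    show "polar_weight CARD('n) s *\<^sub>R (\<integral>\<omega>. G (sqrt s *\<^sub>R \<omega>) \<partial>sphere_measure) = (indicator {0<..<T} s *\<^sub>R (RL_kernel p c (T - s) * sph_chain f \<theta> 0 s)) / 2"
    proof (cases "s > 0")
      case True
      have "sqrt T = t" using t by (simp add: T_def)
      then have lt: "sqrt s < t \<longleftrightarrow> s < T" using real_sqrt_less_iff[of s T] by simp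
      have "(\<integral>\<omega>. G (sqrt s *\<^sub>R \<omega>) \<partial>sphere_measure) = (\<integral>\<omega>. (indicator {..<T} s *\<^sub>R RL_kernel p c (T - s)) * f (\<theta> - sqrt s *\<^sub>R \<omega>) \<partial>sphere_measure)"
        by (rule Bochner_Integration.integral_cong[OF refl]) (use True lt in \<open>auto simp: G_def power_mult_distrib indicator_def\<close>)
      also have "\<dots> = (indicator {..<T} s *\<^sub>R RL_kernel p c (T - s)) * (\<integral>\<omega>. f (\<theta> - sqrt s *\<^sub>R \<omega>) \<partial>sphere_measure)"
        by (rule integral_mult_right_zero)
      finally show ?thesis
        using True by (auto simp: sph_chain_0 indicator_def scaleR_conv_of_real)
    qed (simp add: polar_weight_def)
  qed
  also have "\<dots> = (LINT s:{0<..<T}|lborel. RL_kernel p c (T - s) * sph_chain f \<theta> 0 s) / 2"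
    by (simp add: set_lebesgue_integral_def)
  also have "\<dots> = RL_exp p c (sph_chain f \<theta> 0) T / 2"
  proof -
    have ch: "deriv_chain (sph_chain f \<theta>)" by (rule deriv_chain_sph_chain[OF f \<rho> \<rho>1 \<theta>])
    obtain B' where B': "\<And>s. 0 < s \<Longrightarrow> s < T \<Longrightarrow> norm (sph_chain f \<theta> 0 s) \<le> B'" using deriv_chain_bounded[OF ch] by blast
    have "RL_exp p c (sph_chain f \<theta> 0) T = (LINT s:{0<..<T}|lborel. RL_kernel p c (T - s) * sph_chain f \<theta> 0 s)"
      by (rule RL_exp_eq_integral[OF p deriv_chain_measurable[OF ch] B' T])
    then show ?thesis by (simp only:)
  qed
  finally show ?thesis by (simp add: T_def)
qed

text \<open>Brings both branches of the definition to one form: the Bessel case by its power series,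
  the case \<open>lam = 0\<close> by rescaling the unit ball to radius t.\<close>

lemma solution_integral_eq_RL_kernel:
  fixes f :: "real ^ 'n \<Rightarrow> complex"
  assumes p: "Re p > 0" and t: "t > 0" and lam: "lam \<ge> 0" and f: "continuous_on UNIV f"
  shows "solution_integral p lam t f x = Gamma (p + of_nat CARD('n) / 2) / of_real (pi powr (real CARD('n) / 2)) *
     of_real t powr (2 - of_nat CARD('n) - 2 * p) * (LINT y:ball 0 t|lborel. RL_kernel p (- (lam\<^sup>2 / 4)) (t\<^sup>2 - (norm y)\<^sup>2) * f (x - y))"
proof (cases "lam = 0")
  case True
  have [measurable]: "f \<in> borel_measurable borel" by (rule borel_measurable_continuous_onI[OF f])
  define h where "h z = indicator (ball 0 t) z *\<^sub>R (of_real (t\<^sup>2 - (norm z)\<^sup>2) powr (p - 1) * f (x - z))" for z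
  have hm: "h \<in> borel_measurable borel"
    unfolding h_def[abs_def] by (intro borel_measurable_scaleR borel_measurable_indicator) simp_all
  have sc: "h (t *\<^sub>R y) = of_real (t\<^sup>2) powr (p - 1) * (indicator (ball 0 1) y *\<^sub>R (of_real (1 - (norm y)\<^sup>2) powr (p - 1) * f (x - t *\<^sub>R y)))" for y
  proof (cases "norm y < 1")
    case True
    have y2: "(norm y)\<^sup>2 < 1" using True by (simp add: abs_square_less_1)
    have "t\<^sup>2 - (norm (t *\<^sub>R y))\<^sup>2 = t\<^sup>2 * (1 - (norm y)\<^sup>2)" by (simp add: power_mult_distrib algebra_simps)
    moreover have "of_real (t\<^sup>2 * (1 - (norm y)\<^sup>2)) powr (p - 1) = of_real (t\<^sup>2) powr (p - 1) * (of_real (1 - (norm y)\<^sup>2) powr (p - 1) :: complex)"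
      unfolding of_real_mult by (rule powr_times_real) (use y2 in auto)
    ultimately have "of_real (t\<^sup>2 - (norm (t *\<^sub>R y))\<^sup>2) powr (p - 1) = of_real (t\<^sup>2) powr (p - 1) * (of_real (1 - (norm y)\<^sup>2) powr (p - 1) :: complex)"
      by (simp only:)
    then show ?thesis using True t by (simp add: h_def mult.assoc del: of_real_diff)
  next
    case False
    then show ?thesis using t by (simp add: h_def)
  qed
  have "(LINT y:ball 0 t|lborel. of_real (t\<^sup>2 - (norm y)\<^sup>2) powr (p - 1) * f (x - y)) = (\<integral>z. h z \<partial>lborel)"
    by (simp add: h_def set_lebesgue_integral_def)
  also have "\<dots> = (t ^ CARD('n)) *\<^sub>R (\<integral>y. h (t *\<^sub>R y) \<partial>lborel)"
    using lborel_integral_scaleR[OF hm t] by simp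
  also have "(\<integral>y. h (t *\<^sub>R y) \<partial>lborel) = of_real (t\<^sup>2) powr (p - 1) * (LINT y:ball 0 1|lborel. of_real (1 - (norm y)\<^sup>2) powr (p - 1) * f (x - t *\<^sub>R y))"
    unfolding sc set_lebesgue_integral_def by (rule integral_mult_right_zero)
  finally have I: "(LINT y:ball 0 t|lborel. of_real (t\<^sup>2 - (norm y)\<^sup>2) powr (p - 1) * f (x - y))
     = of_real (t ^ CARD('n)) * (of_real (t\<^sup>2) powr (p - 1) * (LINT y:ball 0 1|lborel. of_real (1 - (norm y)\<^sup>2) powr (p - 1) * f (x - t *\<^sub>R y)))"
    by (simp add: scaleR_conv_of_real)
  \<comment> \<open>The Jacobian t^n and the factor (t^2)^(p-1) from the kernel cancel the prefactor
    t^(2-n-2p).\<close>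
  have E: "of_real t powr (2 - of_nat CARD('n) - 2 * p) * (of_real (t ^ CARD('n)) * of_real (t\<^sup>2) powr (p - 1)) = (1 :: complex)"
  proof -
    have 1: "of_real (t ^ CARD('n)) = (of_real t powr of_nat CARD('n) :: complex)"
      using t by simp
    have 2: "of_real (t\<^sup>2) powr (p - 1) = (of_real t powr (2 * (p - 1)) :: complex)"
      using t by (subst (1 2) of_real_powr_pos) (simp_all add: ln_realpow algebra_simps)
    show ?thesis
      unfolding 1 2 powr_add[symmetric] using t by simp
  qed
  have arr: "A * B * (r * (c * (d * L))) = A * r * (B * (c * d)) * L" for A B r c d L :: complex
    by simp
  have "(LINT y:ball 0 t|lborel. RL_kernel p (- (lam\<^sup>2 / 4)) (t\<^sup>2 - (norm y)\<^sup>2) * f (x - y)) = (LINT y:ball 0 t|lborel. rGamma p * (of_real (t\<^sup>2 - (norm y)\<^sup>2) powr (p - 1) * f (x - y)))"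
    by (simp add: True RL_kernel_0 mult_ac)
  also have "\<dots> = rGamma p * (LINT y:ball 0 t|lborel. of_real (t\<^sup>2 - (norm y)\<^sup>2) powr (p - 1) * f (x - y))"
    by (simp add: set_lebesgue_integral_def flip: integral_mult_right_zero)
  finally have J: "(LINT y:ball 0 t|lborel. RL_kernel p (- (lam\<^sup>2 / 4)) (t\<^sup>2 - (norm y)\<^sup>2) * f (x - y)) = rGamma p *
     (of_real (t ^ CARD('n)) * (of_real (t\<^sup>2) powr (p - 1) * (LINT y:ball 0 1|lborel. of_real (1 - (norm y)\<^sup>2) powr (p - 1) * f (x - t *\<^sub>R y))))"
    unfolding I .
  have "Gamma (p + of_nat CARD('n) / 2) / of_real (pi powr (real CARD('n) / 2)) *
     of_real t powr (2 - of_nat CARD('n) - 2 * p) * (LINT y:ball 0 t|lborel. RL_kernel p (- (lam\<^sup>2 / 4)) (t\<^sup>2 - (norm y)\<^sup>2) * f (x - y))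
     = Gamma (p + of_nat CARD('n) / 2) / of_real (pi powr (real CARD('n) / 2)) * rGamma p *
       (of_real t powr (2 - of_nat CARD('n) - 2 * p) * (of_real (t ^ CARD('n)) * of_real (t\<^sup>2) powr (p - 1))) *
       (LINT y:ball 0 1|lborel. of_real (1 - (norm y)\<^sup>2) powr (p - 1) * f (x - t *\<^sub>R y))"
    unfolding J by (rule arr)
  moreover have "a / (b * Gamma p) * L = a / b * rGamma p * 1 * L" for a b L :: complex
    by (simp add: rGamma_inverse_Gamma divide_inverse mult.assoc)
  ultimately show ?thesis
    unfolding E solution_integral_def if_P[OF True] Let_def by (simp only:)
next
  case False
  then have l: "lam > 0" using lam by simp
  have "(LINT y:ball 0 t|lborel. RL_kernel p (- (lam\<^sup>2 / 4)) (t\<^sup>2 - (norm y)\<^sup>2) * f (x - y))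
     = (LINT y:ball 0 t|lborel. of_real (2 / lam) powr (p - 1) * (f (x - y) * of_real (t\<^sup>2 - (norm y)\<^sup>2) powr ((p - 1) / 2) *
           bessel_J (p - 1) (of_real (lam * sqrt (t\<^sup>2 - (norm y)\<^sup>2)))))"
  proof (rule set_lebesgue_integral_cong)
    show "\<forall>y. y \<in> ball 0 t \<longrightarrow> RL_kernel p (- (lam\<^sup>2 / 4)) (t\<^sup>2 - (norm y)\<^sup>2) * f (x - y)
       = of_real (2 / lam) powr (p - 1) * (f (x - y) * of_real (t\<^sup>2 - (norm y)\<^sup>2) powr ((p - 1) / 2) *
           bessel_J (p - 1) (of_real (lam * sqrt (t\<^sup>2 - (norm y)\<^sup>2))))"
    proof (intro allI impI)
      fix y :: "real ^ 'n" assume "y \<in> ball 0 t"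
      then have w: "t\<^sup>2 - (norm y)\<^sup>2 > 0" by (simp add: power_strict_mono)
      show "RL_kernel p (- (lam\<^sup>2 / 4)) (t\<^sup>2 - (norm y)\<^sup>2) * f (x - y)
       = of_real (2 / lam) powr (p - 1) * (f (x - y) * of_real (t\<^sup>2 - (norm y)\<^sup>2) powr ((p - 1) / 2) *
           bessel_J (p - 1) (of_real (lam * sqrt (t\<^sup>2 - (norm y)\<^sup>2))))"
        unfolding bessel_J_RL_kernel[OF l w, symmetric] by (simp only: mult_ac)
    qed
  qed simp
  also have "\<dots> = of_real (2 / lam) powr (p - 1) * (LINT y:ball 0 t|lborel. f (x - y) * of_real (t\<^sup>2 - (norm y)\<^sup>2) powr ((p - 1) / 2) *
           bessel_J (p - 1) (of_real (lam * sqrt (t\<^sup>2 - (norm y)\<^sup>2))))"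
    by (simp add: set_lebesgue_integral_def flip: integral_mult_right_zero)
  finally show ?thesis
    using False by (simp add: solution_integral_def Let_def)
qed

text \<open>For \<alpha> > 0 this is the integral formula with m integrations by parts; for other
  \<alpha> the same expression is the analytic continuation. Only points of the unit sphere are
  treated, since there the spherical means vanish for small radii.\<close>

lemma solution_operator_on_sphere:
  fixes f :: "real ^ 'n \<Rightarrow> complex"
  assumes n: "CARD('n) \<ge> 2" and t: "t > 0" and lam: "lam \<ge> 0"
    and f: "smooth f" and \<rho>: "\<And>x. \<rho> < norm x \<Longrightarrow> f x = 0" and \<rho>1: "\<rho> < 1" and \<theta>: "norm \<theta> = 1"
    and \<alpha>: "\<alpha> + real CARD('n) / 2 > 0" and m: "\<alpha> + real m > 0"
  shows "solution_operator (of_real \<alpha>) lam t f \<theta> = of_real (Gamma (\<alpha> + real CARD('n) / 2) / (2 * pi powr (real CARD('n) / 2))) *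
     of_real (t powr (2 - real CARD('n) - 2 * \<alpha>)) * RL_exp (of_real \<alpha> + of_nat m) (- (lam\<^sup>2 / 4)) (sph_chain f \<theta> m) (t\<^sup>2)"
proof -
  let ?c = "- (lam\<^sup>2 / 4)"
  let ?\<nu> = "of_nat CARD('n) / 2 :: complex"
  have ch: "deriv_chain (sph_chain f \<theta>)" by (rule deriv_chain_sph_chain[OF f \<rho> \<rho>1 \<theta>])
  have T: "t\<^sup>2 > 0" using t by simp
  define C where "C p = Gamma (p + ?\<nu>) / of_real (pi powr (real CARD('n) / 2)) * of_real t powr (2 - of_nat CARD('n) - 2 * p) / 2" for p :: complex
  have int: "solution_integral p lam t f \<theta> = C p * RL_exp p ?c (sph_chain f \<theta> 0) (t\<^sup>2)" if p: "Re p > 0" for p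
  proof -
    have e: "(LINT y:ball 0 t|lborel. RL_kernel p ?c (t\<^sup>2 - (norm y)\<^sup>2) * f (\<theta> - y)) = RL_exp p ?c (sph_chain f \<theta> 0) (t\<^sup>2) / 2"
      by (rule integral_RL_kernel_radial[OF n p t f \<rho> \<rho>1 \<theta>])
    show ?thesis
      unfolding solution_integral_eq_RL_kernel[OF p t lam smooth_continuous[OF f]] e by (simp add: C_def)
  qed
  have C\<alpha>: "C (of_real \<alpha>) = of_real (Gamma (\<alpha> + real CARD('n) / 2) / (2 * pi powr (real CARD('n) / 2))) * of_real (t powr (2 - real CARD('n) - 2 * \<alpha>))"
  proof -
    have "complex_of_real \<alpha> + ?\<nu> = of_real (\<alpha> + real CARD('n) / 2)" by simp
    then have 1: "Gamma (complex_of_real \<alpha> + ?\<nu>) = of_real (Gamma (\<alpha> + real CARD('n) / 2))"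
      by (simp only: Gamma_complex_of_real)
    have "2 - of_nat CARD('n) - 2 * complex_of_real \<alpha> = of_real (2 - real CARD('n) - 2 * \<alpha>)" by simp
    then have 2: "of_real t powr (2 - of_nat CARD('n) - 2 * complex_of_real \<alpha>) = complex_of_real (t powr (2 - real CARD('n) - 2 * \<alpha>))"
      using t by (simp only: powr_of_real less_imp_le)
    show ?thesis unfolding C_def 1 2 by simp
  qed
  show ?thesis
  proof (cases "\<alpha> > 0")
    case True
    then have "solution_operator (of_real \<alpha>) lam t f \<theta> = C (of_real \<alpha>) * RL_exp (of_real \<alpha>) ?c (sph_chain f \<theta> 0) (t\<^sup>2)"
      using int[of "of_real \<alpha>"] by (simp add: solution_operator_def)
    also have "RL_exp (of_real \<alpha>) ?c (sph_chain f \<theta> 0) (t\<^sup>2) = RL_exp (of_real \<alpha> + of_nat m) ?c (sph_chain f \<theta> (0 + m)) (t\<^sup>2)"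
      by (rule RL_exp_deriv_chain[OF ch _ T]) (use True in simp)
    finally show ?thesis unfolding C\<alpha> by simp
  next
    case False
    have "solution_operator (of_real \<alpha>) lam t f \<theta> = analytic_continuation {s. Re s > 0} {s. s + ?\<nu> \<notin> \<int>\<^sub>\<le>\<^sub>0} (\<lambda>s. solution_integral s lam t f \<theta>) (of_real \<alpha>)"
      using False by (simp add: solution_operator_def)
    also have "\<dots> = C (of_real \<alpha>) * RL_exp (of_real \<alpha> + of_nat m) ?c (sph_chain f \<theta> m) (t\<^sup>2)"
    proof (rule analytic_continuation_RL_exp[OF ch T _ _ int])
      show "C holomorphic_on {s. s + ?\<nu> \<notin> \<int>\<^sub>\<le>\<^sub>0}"
        unfolding C_def[abs_def] using t by (intro holomorphic_intros) auto
      \<comment> \<open>\<alpha> + n/2 > 0 keeps \<alpha> away from the poles of Gamma(\<alpha> +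
        n/2).\<close>
      show "of_real \<alpha> + ?\<nu> \<notin> \<int>\<^sub>\<le>\<^sub>0"
      proof
        assume "of_real \<alpha> + ?\<nu> \<in> \<int>\<^sub>\<le>\<^sub>0"
        then obtain i where i: "of_real \<alpha> + ?\<nu> = of_int i" "i \<le> 0" by (auto elim: nonpos_Ints_cases)
        then have "Re (of_real \<alpha> + ?\<nu>) \<le> 0" by simp
        then show False using \<alpha> by simp
      qed
    qed (use n m in auto)
    finally show ?thesis unfolding C\<alpha> .
  qed
qed

section \<open>Evaluation of the constant\<close>

text \<open>Here k + 3/2 is n/2. One factor Gamma(n/2) matches the inversion formula, the other the
  sphere area inside \<open>ramp_const\<close>; the induction starts from the value 2 at k =
  0.\<close>

lemma interval_moment_0_eq:
  "interval_moment k 0 * (Gamma (real k + 3 / 2))\<^sup>2 * 2 ^ (2 * k + 1) = pi * fact (2 * k + 1)"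
proof (induction k)
  case 0
  have "Gamma (1 / 2 + 1 :: real) = 1 / 2 * sqrt pi"
    by (subst Gamma_plus1) (auto simp: Gamma_one_half_real dest: nonpos_Ints_nonpos)
  then have "Gamma (3 / 2 :: real) = sqrt pi / 2" by simp
  then have "(Gamma (real 0 + 3 / 2))\<^sup>2 = pi / 4" by (simp only: of_nat_0 add_0 power_divide) simp
  then show ?case by (simp only:) (simp add: interval_moment_def)
next
  case (Suc k)
  have "interval_moment (Suc k) 0 = interval_moment k 0 - interval_moment k 2"
  proof -
    have i: "(\<lambda>v::real. v ^ j * (1 - v\<^sup>2) ^ k) integrable_on {-1..1}" for j
      by (intro integrable_continuous_real continuous_intros)
    have "(\<lambda>v::real. v ^ 0 * (1 - v\<^sup>2) ^ Suc k) = (\<lambda>v. v ^ 0 * (1 - v\<^sup>2) ^ k - v ^ 2 * (1 - v\<^sup>2) ^ k)"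
      by (simp add: algebra_simps)
    then show ?thesis
      unfolding interval_moment_def using Henstock_Kurzweil_Integration.integral_diff[OF i[of 0] i[of 2]] by simp
  qed
  then have "(2 * real k + 3) * interval_moment (Suc k) 0 = (2 * real k + 3) * interval_moment k 0 - (2 * real k + 3) * interval_moment k 2"
    by (simp only: right_diff_distrib)
  moreover have "(2 * real k + 3) * interval_moment k 2 = interval_moment k 0"
    using interval_moment_rec[of k 0] by (simp add: numeral_2_eq_2)
  \<comment> \<open>Combines W_(k+1) = W_k - (second moment) with the moment recursion at j =
    0.\<close>
  ultimately have W: "(2 * real k + 3) * interval_moment (Suc k) 0 = (2 * real k + 2) * interval_moment k 0"
    by (simp add: algebra_simps)
  have "real k + 3 / 2 \<notin> \<int>\<^sub>\<le>\<^sub>0" using nonpos_Ints_nonpos[of "real k + 3 / 2"] by auto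
  from Gamma_plus1[OF this] have G: "Gamma (real (Suc k) + 3 / 2) = (real k + 3 / 2) * Gamma (real k + 3 / 2)"
    by (simp add: add_ac)
  have F: "fact (2 * Suc k + 1) = (2 * real k + 3) * (2 * real k + 2) * fact (2 * k + 1)"
    by (simp add: algebra_simps)
  have "interval_moment (Suc k) 0 * (Gamma (real (Suc k) + 3 / 2))\<^sup>2 * 2 ^ (2 * Suc k + 1)
     = ((2 * real k + 3) * interval_moment (Suc k) 0) * (2 * real k + 3) * ((Gamma (real k + 3 / 2))\<^sup>2 * 2 ^ (2 * k + 1))"
    unfolding G by (simp add: power_mult_distrib power2_eq_square algebra_simps)
  also have "\<dots> = (2 * real k + 2) * (2 * real k + 3) * (interval_moment k 0 * (Gamma (real k + 3 / 2))\<^sup>2 * 2 ^ (2 * k + 1))"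
    unfolding W by (simp only: mult_ac)
  also have "\<dots> = pi * fact (2 * Suc k + 1)"
    unfolding Suc F by (simp only: mult_ac)
  finally show ?case .
qed

text \<open>Both G and the outer sphere areas cancel; n - 2 = 2k + 1 completes the factorial, and
  \<open>interval_moment_0_eq\<close> removes the rest.\<close>

lemma back_projection_constant:
  assumes n: "n = 2 * k + 3" and G: "G \<noteq> 0"
  shows "(- 1) ^ ((n - 1) div 2) * pi / (2 * Gamma (real n / 2) * G) *
     (G / (2 * pi powr (real n / 2)) * (2 * ramp_const k) / sphere_area n * (- ((real n - 2) * sphere_area n))) = 1"
proof -
  define g where "g = Gamma (real n / 2)"
  define P where "P = pi powr (real n / 2)"
  define W where "W = interval_moment k 0"
  have g: "g > 0" using n by (simp add: g_def Gamma_real_pos)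
  have P: "P > 0" by (simp add: P_def)
  have W: "W > 0" unfolding W_def by (rule interval_moment_0_pos)
  have nk: "(n - 1) div 2 = k + 1" using n by simp
  have n2: "real n / 2 = real k + 3 / 2" using n by simp
  have S: "sphere_area n = 2 * P / g" by (simp add: sphere_area_def P_def g_def)
  have rc: "ramp_const k = (2 * P / g) / W * ((- 1) ^ k * fact (2 * k)) / 2 ^ (2 * k + 1)"
    unfolding ramp_const_def W_def[symmetric] n[symmetric] S ..
  have WE: "W * g\<^sup>2 * 2 ^ (2 * k + 1) = pi * ((2 * real k + 1) * fact (2 * k))"
    using interval_moment_0_eq[of k] unfolding W_def g_def n2 by (simp add: algebra_simps)
  \<comment> \<open>The sign (-1)^(k+1) of the formula meets the (-1)^k of
    \<open>ramp_const\<close>; the product -1 offsets the minus sign of the Laplacian of the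
    potential.\<close>
  have sg: "(- 1) ^ (k + 1) * ((- 1) ^ k * x) = - (x :: real)" for x
    by (simp add: power_add[symmetric] mult.assoc[symmetric] mult_2[symmetric])
  have "(- 1) ^ (k + 1) * pi / (2 * g * G) * (G / (2 * P) * (2 * ((2 * P / g) / W * ((- 1) ^ k * fact (2 * k)) / 2 ^ (2 * k + 1))) / (2 * P / g) * (- ((real n - 2) * (2 * P / g))))
     = - ((- 1) ^ (k + 1) * ((- 1) ^ k * (pi * ((real n - 2) * fact (2 * k))))) / (W * g\<^sup>2 * 2 ^ (2 * k + 1))"
    using g P W G by (simp add: field_simps power2_eq_square)
  also have "\<dots> = 1"
    unfolding sg WE using n by simp
  finally show ?thesis
    unfolding rc S nk g_def[symmetric] P_def[symmetric] .
qed

section \<open>Assembling the inversion formula\<close>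

text \<open>The back-projection is identified only on the unit ball, so the Laplacian has to be
  compared locally.\<close>

lemma laplacian_cong_open:
  fixes g h :: "real ^ 'n \<Rightarrow> complex"
  assumes U: "open U" and x: "x \<in> U" and eq: "\<And>y. y \<in> U \<Longrightarrow> g y = h y"
  shows "laplacian g x = laplacian h x"
proof -
  have pd: "partial_deriv i g y = partial_deriv i h y" if eq: "\<And>y. y \<in> U \<Longrightarrow> g y = h y" and y: "y \<in> U" for g h :: "real ^ 'n \<Rightarrow> complex" and i y
  proof -
    have "open ((\<lambda>s. y + s *\<^sub>R axis i 1) -` U)"
      by (rule open_vimage[OF U]) (intro continuous_intros)
    then have "\<forall>\<^sub>F s in nhds 0. s \<in> (\<lambda>s. y + s *\<^sub>R axis i 1) -` U"
      by (rule eventually_nhds_in_open) (use y in simp)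
    then have "\<forall>\<^sub>F s in nhds 0. s \<in> UNIV \<longrightarrow> g (y + s *\<^sub>R axis i 1) = h (y + s *\<^sub>R axis i 1)"
      by eventually_elim (use eq in simp)
    then show ?thesis
      unfolding partial_deriv_def by (rule vector_derivative_cong_eq) simp_all
  qed
  show ?thesis
    unfolding laplacian_def by (intro sum.cong refl pd x pd[OF eq])
qed

text \<open>\<open>partial_deriv\<close> is a \<open>vector_derivative\<close>, so the factor is
  moved through by exhibiting the actual derivatives.\<close>

lemma laplacian_cmult_newton_potential:
  fixes f :: "real ^ 'n \<Rightarrow> complex"
  assumes f: "smooth f" and \<rho>: "\<And>x. \<rho> < norm x \<Longrightarrow> f x = 0"
  shows "laplacian (\<lambda>x. c * newton_potential f x) x = c * laplacian (newton_potential f) x"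
proof -
  have \<rho>': "dird v f x = 0" if "\<rho> < norm x" for x v
    using dird_funpow_outside[where k=1 and f=f and \<rho>=\<rho> and v=v and x=x, OF f \<rho> that] by simp
  have pd: "partial_deriv i (\<lambda>x. c * newton_potential g x) = (\<lambda>x. c * newton_potential (dird (axis i 1) g) x)"
    if "smooth g" "\<And>x. \<rho> < norm x \<Longrightarrow> g x = 0" for i and g :: "real ^ 'n \<Rightarrow> complex"
  proof (rule ext, rule partial_deriv_eq)
    fix x
    have "((\<lambda>s. newton_potential g (x + s *\<^sub>R axis i 1)) has_vector_derivative newton_potential (dird (axis i 1) g) (x + 0 *\<^sub>R axis i 1)) (at 0)"
      by (rule newton_potential_has_vector_derivative[OF that])
    from has_vector_derivative_mult_right[OF this, of c]
    show "((\<lambda>s. c * newton_potential g (x + s *\<^sub>R axis i 1)) has_vector_derivative c * newton_potential (dird (axis i 1) g) x) (at 0)" by simp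
  qed
  have "laplacian (newton_potential f) x = (\<Sum>i\<in>UNIV. newton_potential (dird (axis i 1) (dird (axis i 1) f)) x)"
    by (rule laplacian_newton_potential_eq[OF f \<rho>])
  moreover have "partial_deriv i (\<lambda>x. c * newton_potential f x) = (\<lambda>x. c * newton_potential (dird (axis i 1) f) x)" for i
    by (rule pd[OF f \<rho>])
  moreover have "partial_deriv i (\<lambda>x. c * newton_potential (dird (axis i 1) f) x) = (\<lambda>x. c * newton_potential (dird (axis i 1) (dird (axis i 1) f)) x)" for i
    by (rule pd[OF smooth_dird[OF f] \<rho>'])
  ultimately show ?thesis
    unfolding laplacian_def[of "\<lambda>x. c * newton_potential f x"] by (simp add: sum_distrib_left)
qed

text \<open>The weights are tuned so that all powers of t cancel: what is left after the
  Erdelyi-Kober inversion is the chain itself in t^2, on which \<open>D\<close> acts as a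
  shift.\<close>

lemma EK_trace_chain:
  fixes f :: "real ^ 'n \<Rightarrow> complex" and u :: "real ^ 'n \<Rightarrow> real \<Rightarrow> complex"
  assumes n: "CARD('n) \<ge> 3" and lam: "lam \<ge> 0"
    and f: "smooth f" and \<rho>: "\<And>x. \<rho> < norm x \<Longrightarrow> f x = 0" and \<rho>1: "\<rho> < 1" and \<theta>: "norm \<theta> = 1"
    and \<alpha>: "\<alpha> + real CARD('n) / 2 > 0" and \<eta>: "\<eta> = real CARD('n) / 2 - 1"
    and u: "\<And>t. t > 0 \<Longrightarrow> u \<theta> t = solution_operator (of_real \<alpha>) lam t f \<theta>"
    and t: "t > 0"
  shows "(D ^^ j) (\<lambda>t. of_real (t ^ (CARD('n) - 2)) * EK_weighted (- of_real \<alpha>) (of_real (\<eta> + \<alpha>)) lam (\<lambda>r. u \<theta> r) t) t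
     = of_real (Gamma (\<alpha> + real CARD('n) / 2) / (2 * pi powr (real CARD('n) / 2))) * sph_chain f \<theta> j (t\<^sup>2)"
proof -
  define C where "C = complex_of_real (Gamma (\<alpha> + real CARD('n) / 2) / (2 * pi powr (real CARD('n) / 2)))"
  have ch: "deriv_chain (sph_chain f \<theta>)" by (rule deriv_chain_sph_chain[OF f \<rho> \<rho>1 \<theta>])
  obtain m :: nat where "real m > - \<alpha>" using reals_Archimedean2 by blast
  then have m: "\<alpha> + real m > 0" by simp
  have \<psi>: "of_real r powr (2 * of_real (\<eta> + \<alpha>)) * u \<theta> r = C * RL_exp (of_real \<alpha> + of_nat m) (- (lam\<^sup>2 / 4)) (sph_chain f \<theta> m) (r\<^sup>2)" if r: "r > 0" for r
  proof -
    have "2 * complex_of_real (\<eta> + \<alpha>) = of_real (2 * (\<eta> + \<alpha>))" by simp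
    then have 1: "of_real r powr (2 * of_real (\<eta> + \<alpha>)) = complex_of_real (r powr (2 * (\<eta> + \<alpha>)))"
      using r by (simp only: powr_of_real less_imp_le)
    \<comment> \<open>Since 2\<eta> = n - 2, the inner weight cancels the prefactor
      r^(2-n-2\<alpha>) of the solution.\<close>
    have "r powr (2 * (\<eta> + \<alpha>)) * r powr (2 - real CARD('n) - 2 * \<alpha>) = 1"
      using r by (simp add: powr_add[symmetric] \<eta>)
    then have 2: "complex_of_real (r powr (2 * (\<eta> + \<alpha>))) * of_real (r powr (2 - real CARD('n) - 2 * \<alpha>)) = 1"
      by (metis of_real_1 of_real_mult)
    have 3: "a * (C * b * R) = (a * b) * (C * R)" for a b R :: complex by (simp only: mult_ac)
    have "u \<theta> r = C * of_real (r powr (2 - real CARD('n) - 2 * \<alpha>)) * RL_exp (of_real \<alpha> + of_nat m) (- (lam\<^sup>2 / 4)) (sph_chain f \<theta> m) (r\<^sup>2)"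
      unfolding u[OF r] C_def using n by (intro solution_operator_on_sphere[OF _ r lam f \<rho> \<rho>1 \<theta> \<alpha> m]) auto
    then show ?thesis unfolding 1 by (simp only: 2 3) simp
  qed
  have base: "of_real (s ^ (CARD('n) - 2)) * EK_weighted (- of_real \<alpha>) (of_real (\<eta> + \<alpha>)) lam (\<lambda>r. u \<theta> r) s = C * sph_chain f \<theta> 0 (s\<^sup>2)"
    if s: "s > 0" for s
  proof -
    have EK: "EK (- of_real \<alpha>) lam (\<lambda>r. of_real r powr (2 * of_real (\<eta> + \<alpha>)) * u \<theta> r) s = C * sph_chain f \<theta> 0 (s\<^sup>2)"
      by (rule EK_inversion[OF ch lam m s \<psi>])
    \<comment> \<open>The outer weight is t^(-2\<eta>) = t^(-(n-2)), which the factor t^(n-2)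
      removes.\<close>
    have "- 2 * (- complex_of_real \<alpha> + of_real (\<eta> + \<alpha>)) = of_real (- (real CARD('n) - 2))"
      by (simp add: \<eta> algebra_simps)
    then have "of_real s powr (- 2 * (- complex_of_real \<alpha> + of_real (\<eta> + \<alpha>))) = complex_of_real (s powr (- (real CARD('n) - 2)))"
      using s by (simp only: powr_of_real less_imp_le)
    moreover have "s ^ (CARD('n) - 2) * s powr (- (real CARD('n) - 2)) = 1"
    proof -
      have "s ^ (CARD('n) - 2) = s powr (real CARD('n) - 2)"
        using s n powr_realpow[of s "CARD('n) - 2"] by (simp add: of_nat_diff)
      then show ?thesis using s by (simp only: powr_add[symmetric]) simp
    qed
    then have "complex_of_real (s ^ (CARD('n) - 2)) * of_real (s powr (- (real CARD('n) - 2))) = 1"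
      by (metis of_real_1 of_real_mult)
    ultimately show ?thesis
      unfolding EK_weighted_def EK by (simp only: mult.assoc[symmetric]) simp
  qed
  have "(D ^^ j) (\<lambda>t. of_real (t ^ (CARD('n) - 2)) * EK_weighted (- of_real \<alpha>) (of_real (\<eta> + \<alpha>)) lam (\<lambda>r. u \<theta> r) t) t = C * sph_chain f \<theta> j (t\<^sup>2)"
    by (rule D_funpow_eq[where \<phi>="\<lambda>j t. C * sph_chain f \<theta> j (t\<^sup>2)"])
      (use deriv_chain_square_has_vector_derivative[OF ch] base t in auto)
  then show ?thesis by (simp only: C_def)
qed

text \<open>The norm attains its maximum on the compact support, and that maximum is below 1 because
  the ball is open.\<close>

lemma support_radius:
  fixes f :: "'a::euclidean_space \<Rightarrow> complex"
  assumes "closure {x. f x \<noteq> 0} \<subseteq> ball 0 1"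
  obtains \<rho> where "\<rho> < 1" "\<And>x. \<rho> < norm x \<Longrightarrow> f x = 0"
proof (cases "closure {x. f x \<noteq> 0} = {}")
  case True
  then have "f x = 0" for x using closure_subset[of "{x. f x \<noteq> 0}"] by blast
  then show ?thesis using that[of 0] by simp
next
  case False
  have "bounded (closure {x. f x \<noteq> 0})" using assms bounded_subset bounded_ball by blast
  then have "compact (closure {x. f x \<noteq> 0})" by (simp add: compact_eq_bounded_closed)
  then obtain z where z: "z \<in> closure {x. f x \<noteq> 0}" "\<forall>y\<in>closure {x. f x \<noteq> 0}. norm y \<le> norm z"
    using continuous_attains_sup[OF _ False, of norm] continuous_on_norm_id by blast
  have "f x = 0" if "norm z < norm x" for x
    using z(2) that closure_subset[of "{x. f x \<noteq> 0}"] by (metis (mono_tags) mem_Collect_eq not_le subsetD)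
  moreover have "norm z < 1" using z(1) assms by auto
  ultimately show ?thesis using that by blast
qed

theorem mainTheorem2:
  fixes f rhs :: "real ^ 'n \<Rightarrow> complex"
    and u :: "real ^ 'n \<Rightarrow> real \<Rightarrow> complex"
    and \<alpha> lam \<eta> :: real and n :: nat
  assumes n: "n = CARD('n)" "n \<ge> 3" "odd n"
    and alpha: "\<alpha> \<ge> (1 - real n) / 2"
    and lam: "lam \<ge> 0"
    and eta: "\<eta> = real n / 2 - 1"
    and f: "smooth f" "closure {x. f x \<noteq> 0} \<subseteq> ball 0 1"
    and u_init: "\<And>x. u x 0 = f x"
    and u: "\<And>x t. t > 0 \<Longrightarrow> u x t = solution_operator (of_real \<alpha>) lam t f x"
    and rhs: "\<And>x. rhs x =
      of_real ((- 1) ^ ((n - 1) div 2) * pi / (2 * Gamma (real n / 2) * Gamma (\<alpha> + real n / 2))) *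
      laplacian (back_projection (\<lambda>\<theta>. (D ^^ (n - 3)) (\<lambda>t. of_real (t ^ (n - 2)) *
        EK_weighted (- of_real \<alpha>) (of_real (\<eta> + \<alpha>)) lam (\<lambda>r. u \<theta> r) t))) x"
  shows "(\<forall>x\<in>ball 0 1. f x = rhs x) \<and>
    (\<forall>x. u x 0 = (if x \<in> ball 0 1 then rhs x else 0)) \<and>
    (\<forall>x. \<forall>t>0. u x t =
      solution_operator (of_real \<alpha>) lam t (\<lambda>y. if y \<in> ball 0 1 then rhs y else 0) x)"
proof -
  obtain \<rho> where \<rho>1: "\<rho> < 1" and \<rho>: "\<And>x. \<rho> < norm x \<Longrightarrow> f x = 0"
    using support_radius[OF f(2)] by blast
  define k where "k = (n - 3) div 2"
  have k: "n = 2 * k + 3" using n(2,3) unfolding k_def by presburger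
  then have nk: "CARD('n) = 2 * k + 3" and n3: "n - 3 = 2 * k" using n by simp_all
  have \<alpha>0: "\<alpha> + real n / 2 > 0" using alpha by (simp add: field_simps)
  define G where "G = Gamma (\<alpha> + real n / 2)"
  have G: "G > 0" unfolding G_def using \<alpha>0 by (rule Gamma_real_pos)
  define K where "K = G / (2 * pi powr (real n / 2)) * (2 * ramp_const k) / sphere_area n"
  let ?F = "\<lambda>\<theta>. (D ^^ (n - 3)) (\<lambda>t. of_real (t ^ (n - 2)) * EK_weighted (- of_real \<alpha>) (of_real (\<eta> + \<alpha>)) lam (\<lambda>r. u \<theta> r) t)"
  \<comment> \<open>For x in the open ball |x - \<theta>| is positive, so the trace formula, valid
    for t > 0, applies at every \<theta>.\<close>
  have bp: "back_projection ?F x = of_real K * newton_potential f x" if x: "x \<in> ball 0 1" for x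
  proof -
    have "(LINT \<theta>|sphere_measure. ?F \<theta> (norm (x - \<theta>))) = (LINT \<theta>|sphere_measure. of_real (G / (2 * pi powr (real n / 2))) * sph_chain f \<theta> (2 * k) ((norm (x - \<theta>))\<^sup>2))"
    proof (rule Bochner_Integration.integral_cong[OF refl])
      fix \<theta> :: "real ^ 'n" assume "\<theta> \<in> space sphere_measure"
      then have \<theta>: "norm \<theta> = 1" by simp
      then have "norm (x - \<theta>) > 0" using x by auto
      then show "?F \<theta> (norm (x - \<theta>)) = of_real (G / (2 * pi powr (real n / 2))) * sph_chain f \<theta> (2 * k) ((norm (x - \<theta>))\<^sup>2)"
        unfolding n3[symmetric] G_def n(1)
        by (intro EK_trace_chain[OF _ lam f(1) \<rho> \<rho>1 \<theta>]) (use n \<alpha>0 eta u in auto)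
    qed
    also have "\<dots> = of_real (G / (2 * pi powr (real n / 2))) * (of_real (2 * ramp_const k) * newton_potential f x)"
      using sphere_integral_sph_chain_eq_newton_potential[OF f(1) \<rho> \<rho>1 nk] x by simp
    finally show ?thesis
      unfolding back_projection_def K_def n(1) by simp
  qed
  have main: "f x = rhs x" if x: "x \<in> ball 0 1" for x
  proof -
    have "laplacian (back_projection ?F) x = laplacian (\<lambda>x. of_real K * newton_potential f x) x"
      by (rule laplacian_cong_open[OF open_ball x bp])
    also have "\<dots> = of_real K * laplacian (newton_potential f) x"
      by (rule laplacian_cmult_newton_potential[OF f(1) \<rho>])
    also have "laplacian (newton_potential f) x = - of_real ((real CARD('n) - 2) * sphere_area CARD('n)) * f x"
      by (rule laplacian_newton_potential[OF _ f(1) \<rho>]) (use n in auto)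
    finally have L: "laplacian (back_projection ?F) x = of_real K * (- of_real ((real n - 2) * sphere_area n) * f x)"
      unfolding n(1) .
    have arr: "of_real A * (of_real K * (- of_real S * y)) = of_real (A * (K * (- S))) * y" for A S :: real and y :: complex
      by simp
    have "rhs x = of_real ((- 1) ^ ((n - 1) div 2) * pi / (2 * Gamma (real n / 2) * G) * (K * (- ((real n - 2) * sphere_area n)))) * f x"
      unfolding rhs L G_def[symmetric] by (rule arr)
    also have "(- 1) ^ ((n - 1) div 2) * pi / (2 * Gamma (real n / 2) * G) * (K * (- ((real n - 2) * sphere_area n))) = 1"
      unfolding K_def by (rule back_projection_constant[OF k]) (use G in simp)
    finally show ?thesis by simp
  qed
  have f0: "f x = 0" if "x \<notin> ball 0 1" for x
    using f(2) closure_subset[of "{x. f x \<noteq> 0}"] that by blast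
  \<comment> \<open>The right side extended by 0 is f on the whole space, so the reconstruction of u
    is a rewriting.\<close>
  have "(\<lambda>y. if y \<in> ball 0 1 then rhs y else 0) = f"
    using main f0 by (intro ext) auto
  then show ?thesis using main f0 u u_init by auto
qed

end
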